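(* Let $1\le n<\infty$ and let $A$ be a cocomplete categorical symmetric operad. Let $\zeta:\mathbf h^n\to\mathbf H^\infty$ be the canonical morphism of categorical symmetric operads, and let $\zeta^{*}:IO^{sym}_\infty(A)\to IO^{sym}_n(A)$ be the restriction functor along $\zeta$ from internal symmetric operads in $A$ to internal $n$-operads in $A$. Then $\zeta^*$ has a left adjoint $sym_n$, and on an internal $n$-operad $a\in IO^{sym}_n(A)$ it is given by $$(sym_n(a))_k\;\simeq\;\operatorname{colim}_{\mathbf h^n_k}\tilde a_k ,\qquad k\ge 0,$$ where $\tilde a:\mathbf h^n\to A$, with components $\tilde a_k:\mathbf h^n_k\to A_k$, is the operadic functor representing $a$.
   Context: Symmetric operads. For $n\ge0$ let $[n]=\{1<\dots<n\}$; $\Omega^s$ is the category of the $[n]$ and all functions. For $\sigma:[n]\to[k]$ the fibre $\sigma^{-1}(i)$ with the induced order is identified with an ordinal $[n_i]$. There is a unique factorisation $\sigma=\nu(\sigma)\circ\pi(\sigma)$ with $\nu(\sigma)$ order preserving and $\pi(\sigma):[n]\to[n]$ a bijection that is order preserving on each fibre of $\sigma$. A (left) symmetric operad $A$ in a symmetric monoidal category has objects $A_k$ ($k\ge0$) with left $\Sigma_k$-actions, a unit $e:I\to A_1$ and multiplications $m:A_k\otimes A_{n_1}\otimes\dots\otimes A_{n_k}\to A_{n_1+\dots+n_k}$, associative, unital and equivariant in May's sense: writing $x\cdot\pi:=\pi^{-1}x$, $m(a\cdot\rho;b_{\rho(1)},\dots,b_{\rho(k)})=m(a;b_1,\dots,b_k)\cdot\bar\rho$,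 where $\bar\rho$ sends the $i$-th block (of size $n_{\rho(i)}$) order-preservingly onto the $\rho(i)$-th block, and $m(a;b_1\cdot\tau_1,\dots,b_k\cdot\tau_k)=m(a;b_1,\dots,b_k)\cdot(\tau_1\oplus\dots\oplus\tau_k)$. A categorical symmetric operad is one in $(Cat,\times)$; it is cocomplete if every $A_k$ is cocomplete and the multiplication preserves colimits in each variable. $\mathbf{SCO}$ is the 2-category of categorical symmetric operads, (strict) operadic functors and operadic natural transformations. Trees. An $n$-tree is a chain $T=([k_n]\xrightarrow{\rho_{n-1}}[k_{n-1}]\to\dots\xrightarrow{\rho_0}[k_0]=[1])$ of order preserving maps; elements of $[k_n]$ are tips, $|T|=k_n$; $U_n$ is the tree with all $[k_i]=[1]$. A morphism $\sigma:T\to S$ in the category $\Omega_n$ is a family of functions $\sigma_m$ between the $m$-th levels ($0\le m\le n$) commuting with the structure maps such that $\sigma_m$ is order preserving on each fibre $\rho_{m-1}^{-1}(j)$. The fibre $T_i$ of $\sigma$ over a tip $i$ of $S$ is the levelwise pullback of $\sigma$ along the map $U_n\to S$ picking out $i$. Put $\pi(\sigma)=\pi(\sigma_n)$. Internal operads. Let $A$ be a categorical symmetric operad. An internal $n$-operad in $A$ consists of objects $a_T\in A_{|T|}$ for all $n$-trees $T$, morphisms $\mu_\sigma:m(a_S;a_{T_1},\dots,a_{T_k})\to\pi(\sigma)a_T$ for each $\sigma:T\to S$ in $\Omega_n$ ($T_1,\dots,T_k$ the fibres over the tips of $S$ in order), and $\epsilon:e\to a_{U_n}$, subject to associativity (for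 $T\xrightarrow{\sigma}S\xrightarrow{\omega}R$, with fibres $S_i$ of $\omega$, $T'_i$ of $\omega\sigma$ and induced maps $\sigma_i:T'_i\to S_i$, after multiplying by the appropriate permutations, composing along $\mu_\omega$ then $\mu_\sigma$ equals composing along the $\mu_{\sigma_i}$ then $\mu_{\omega\sigma}$) and unit axioms (the composites $a_T=m(a_T;e,\dots,e)\to m(a_T;a_{U_n},\dots,a_{U_n})\to a_T$ via $\mu_{id_T}$ and $a_T=m(e;a_T)\to m(a_{U_n};a_T)\to a_T$ via $\mu_{T\to U_n}$ are identities). An internal symmetric operad in $A$ is the analogous structure with objects $a_k\in A_k$, morphisms $\mu_\sigma:m(a_k;a_{n_1},\dots,a_{n_k})\to\pi(\sigma)a_n$ for every function $\sigma:[n]\to[k]$, and $\epsilon:e\to a_1$. Morphisms are families of morphisms compatible with the structure. This gives categories $IO_n^{sym}(A)$ and $IO^{sym}_\infty(A)$, 2-functorial in $A\in\mathbf{SCO}$. Both 2-functors are representable: $\mathbf{SCO}(\mathbf h^n,A)\cong IO^{sym}_n(A)$ and $\mathbf{SCO}(\mathbf H^\infty,A)\cong IO^{sym}_\infty(A)$, and $\tilde a$ denotes the operadic functor corresponding to $a$. The internal desymmetrisation $\delta_n:IO^{sym}_\infty(A)\to IO^{sym}_n(A)$ sends $(a_k)$ to $a_T=a_{|T|}$, $\mu_\sigma=\mu_{\sigma_n}$. The morphism $\zeta:\mathbf h^n\to\mathbf H^\infty$ corresponds to $\delta_n$ of the universal internal symmetric operad of $\mathbf H^\infty$, so that $\zeta^*$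 is identified with $\delta_n$. *)

theory Defs
  imports "HOL-Library.FuncSet" "HOL-Combinatorics.Permutations"
begin

section \<open>Categories, functors, colimits, adjunctions\<close>

record ('o, 'm) category =
  Ob :: "'o set"
  Ar :: "'m set"
  Src :: "'m \<Rightarrow> 'o"
  Trg :: "'m \<Rightarrow> 'o"
  Idn :: "'o \<Rightarrow> 'm"
  Cmp :: "'m \<Rightarrow> 'm \<Rightarrow> 'm"  \<comment> \<open>\<open>Cmp C g f\<close> is \<open>f\<close> followed by \<open>g\<close>\<close>

definition Hom :: "('o, 'm) category \<Rightarrow> 'o \<Rightarrow> 'o \<Rightarrow> 'm set" where
  "Hom C x y = {f \<in> Ar C. Src C f = x \<and> Trg C f = y}"

definition is_category :: "('o, 'm) category \<Rightarrow> bool" where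
  "is_category C \<longleftrightarrow>
     (\<forall>f\<in>Ar C. Src C f \<in> Ob C \<and> Trg C f \<in> Ob C) \<and>
     (\<forall>x\<in>Ob C. Idn C x \<in> Hom C x x) \<and>
     (\<forall>f\<in>Ar C. \<forall>g\<in>Ar C. Trg C f = Src C g \<longrightarrow> Cmp C g f \<in> Hom C (Src C f) (Trg C g)) \<and>
     (\<forall>f\<in>Ar C. Cmp C f (Idn C (Src C f)) = f \<and> Cmp C (Idn C (Trg C f)) f = f) \<and>
     (\<forall>f\<in>Ar C. \<forall>g\<in>Ar C. \<forall>e\<in>Ar C. Trg C f = Src C g \<longrightarrow> Trg C g = Src C e \<longrightarrow>
        Cmp C e (Cmp C g f) = Cmp C (Cmp C e g) f)"

record ('o, 'm, 'p, 'q) cat_functor =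
  FOb :: "'o \<Rightarrow> 'p"
  FAr :: "'m \<Rightarrow> 'q"

definition is_functor ::
    "('o, 'm) category \<Rightarrow> ('p, 'q) category \<Rightarrow> ('o, 'm, 'p, 'q) cat_functor \<Rightarrow> bool" where
  "is_functor C D F \<longleftrightarrow> is_category C \<and> is_category D \<and>
     (\<forall>x\<in>Ob C. FOb F x \<in> Ob D) \<and>
     (\<forall>f\<in>Ar C. FAr F f \<in> Hom D (FOb F (Src C f)) (FOb F (Trg C f))) \<and>
     (\<forall>x\<in>Ob C. FAr F (Idn C x) = Idn D (FOb F x)) \<and>
     (\<forall>f\<in>Ar C. \<forall>g\<in>Ar C. Trg C f = Src C g \<longrightarrow>
        FAr F (Cmp C g f) = Cmp D (FAr F g) (FAr F f))"

definition functor_comp ::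
    "('p, 'q, 'r, 's) cat_functor \<Rightarrow> ('o, 'm, 'p, 'q) cat_functor \<Rightarrow> ('o, 'm, 'r, 's) cat_functor" where
  "functor_comp G F = \<lparr>FOb = FOb G \<circ> FOb F, FAr = FAr G \<circ> FAr F\<rparr>"

definition is_category_iso ::
    "('o, 'm) category \<Rightarrow> ('p, 'q) category \<Rightarrow> ('o, 'm, 'p, 'q) cat_functor \<Rightarrow> bool" where
  "is_category_iso C D F \<longleftrightarrow> is_functor C D F \<and>
     bij_betw (FOb F) (Ob C) (Ob D) \<and> bij_betw (FAr F) (Ar C) (Ar D)"

definition is_cocone ::
    "('j, 'i) category \<Rightarrow> ('o, 'm) category \<Rightarrow> ('j, 'i, 'o, 'm) cat_functor \<Rightarrow>
      'o \<Rightarrow> ('j \<Rightarrow> 'm) \<Rightarrow> bool" where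
  "is_cocone J C D c t \<longleftrightarrow> c \<in> Ob C \<and>
     (\<forall>j\<in>Ob J. t j \<in> Hom C (FOb D j) c) \<and>
     (\<forall>f\<in>Ar J. Cmp C (t (Trg J f)) (FAr D f) = t (Src J f))"

definition is_colimit ::
    "('j, 'i) category \<Rightarrow> ('o, 'm) category \<Rightarrow> ('j, 'i, 'o, 'm) cat_functor \<Rightarrow>
      'o \<Rightarrow> ('j \<Rightarrow> 'm) \<Rightarrow> bool" where
  "is_colimit J C D c t \<longleftrightarrow> is_functor J C D \<and> is_cocone J C D c t \<and>
     (\<forall>c' t'. is_cocone J C D c' t' \<longrightarrow>
        (\<exists>!f. f \<in> Hom C c c' \<and> (\<forall>j\<in>Ob J. Cmp C f (t j) = t' j)))"

text \<open>The type \<open>'v\<close> plays the role of the universe of small sets: a small category is one whose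
  objects and arrows form subsets of \<open>'v\<close>.\<close>

definition cocomplete :: "'v itself \<Rightarrow> ('o, 'm) category \<Rightarrow> bool" where
  "cocomplete _ C \<longleftrightarrow> is_category C \<and>
     (\<forall>(J :: ('v, 'v) category) D. is_functor J C D \<longrightarrow> (\<exists>c t. is_colimit J C D c t))"

definition preserves_colimits ::
    "'v itself \<Rightarrow> ('o, 'm) category \<Rightarrow> ('p, 'q) category \<Rightarrow> ('o, 'm, 'p, 'q) cat_functor \<Rightarrow> bool" where
  "preserves_colimits _ C E F \<longleftrightarrow>
     (\<forall>(J :: ('v, 'v) category) D c t. is_colimit J C D c t \<longrightarrow>
        is_colimit J E (functor_comp F D) (FOb F c) (FAr F \<circ> t))"

definition is_left_adjoint ::
    "('o, 'm) category \<Rightarrow> ('p, 'q) category \<Rightarrow>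
      ('o, 'm, 'p, 'q) cat_functor \<Rightarrow> ('p, 'q, 'o, 'm) cat_functor \<Rightarrow> bool" where
  "is_left_adjoint C D L R \<longleftrightarrow> is_functor C D L \<and> is_functor D C R \<and>
     (\<exists>\<Phi>. (\<forall>c\<in>Ob C. \<forall>d\<in>Ob D. bij_betw (\<Phi> c d) (Hom D (FOb L c) d) (Hom C c (FOb R d))) \<and>
        (\<forall>f\<in>Ar C. \<forall>d\<in>Ob D. \<forall>g\<in>Hom D (FOb L (Trg C f)) d.
           \<Phi> (Src C f) d (Cmp D g (FAr L f)) = Cmp C (\<Phi> (Trg C f) d g) f) \<and>
        (\<forall>c\<in>Ob C. \<forall>f\<in>Ar D. \<forall>g\<in>Hom D (FOb L c) (Src D f).
           \<Phi> c (Trg D f) (Cmp D f g) = Cmp C (FAr R f) (\<Phi> c (Src D f) g)))"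


section \<open>Finite ordinals and permutations\<close>

text \<open>The ordinal \<open>[n]\<close> is \<open>{..<n}\<close> (counting from 0), a function \<open>s\<close> from \<open>[n]\<close> to \<open>[k]\<close> is its
  list of values \<open>[s 0, \<dots>, s (n-1)]\<close>, and \<open>\<Sigma>\<^sub>k\<close> consists of the \<open>p\<close> with \<open>p permutes {..<k}\<close>, with
  \<open>p \<circ> q\<close> as product.\<close>

definition fin_maps :: "nat \<Rightarrow> nat \<Rightarrow> nat list set" where
  "fin_maps n k = {s. length s = n \<and> set s \<subseteq> {..<k}}"

definition fin_comp :: "nat list \<Rightarrow> nat list \<Rightarrow> nat list" where
  "fin_comp w s = map (\<lambda>x. w ! x) s"

definition fibre_elems :: "nat list \<Rightarrow> nat \<Rightarrow> nat list" where
  "fibre_elems s i = filter (\<lambda>x. s ! x = i) [0..<length s]"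

text \<open>Restricted to the set of entries of \<open>xs\<close>, \<open>rank xs\<close> is the order isomorphism of that set
  with an ordinal.\<close>

definition rank :: "nat list \<Rightarrow> nat \<Rightarrow> nat" where
  "rank xs y = card {z \<in> set xs. z < y}"

text \<open>The permutation \<open>\<pi>(s)\<close>; \<open>fibre_perm_unique\<close> below shows that it is the one from the
  factorisation of \<open>s\<close>.\<close>

definition fibre_perm :: "nat list \<Rightarrow> nat \<Rightarrow> nat" where
  "fibre_perm s x = (if x < length s
     then card {y. y < length s \<and> s ! y < s ! x} + card {y. y < x \<and> s ! y = s ! x} else x)"

definition is_factorisation :: "nat list \<Rightarrow> nat list \<Rightarrow> (nat \<Rightarrow> nat) \<Rightarrow> bool" where
  "is_factorisation s r p \<longleftrightarrow> length r = length s \<and> sorted r \<and> p permutes {..<length s} \<and>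
     (\<forall>x<length s. s ! x = r ! p x) \<and>
     (\<forall>x y. x \<le> y \<and> y < length s \<and> s ! x = s ! y \<longrightarrow> p x \<le> p y)"

lemma fibre_perm_unique: "(\<exists>r. is_factorisation s r p) \<longleftrightarrow> p = fibre_perm s"
proof -
  define n where "n = length s"
  define lx where "lx y x \<longleftrightarrow> s ! y < s ! x \<or> s ! y = s ! x \<and> y < x" for x y
  have fp: "fibre_perm s x = card {y. y < n \<and> lx y x}" if "x < n" for x
  proof -
    have "{y. y < n \<and> lx y x} = {y. y < length s \<and> s ! y < s ! x} \<union> {y. y < x \<and> s ! y = s ! x}"
      using that by (auto simp: lx_def n_def)
    moreover have "card ({y. y < length s \<and> s ! y < s ! x} \<union> {y. y < x \<and> s ! y = s ! x}) =
        card {y. y < length s \<and> s ! y < s ! x} + card {y. y < x \<and> s ! y = s ! x}"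
      by (rule card_Un_disjoint) auto
    ultimately show ?thesis using that by (simp add: fibre_perm_def n_def)
  qed
  have mono: "fibre_perm s y < fibre_perm s x" if "lx y x" "x < n" "y < n" for x y
  proof -
    have "{z. z < n \<and> lx z y} \<subset> {z. z < n \<and> lx z x}"
      using that by (auto simp: lx_def)
    then show ?thesis using that by (simp add: fp psubset_card_mono)
  qed
  have tot: "lx y x \<or> lx x y \<or> x = y" for x y
    by (auto simp: lx_def)
  have inj: "inj_on (fibre_perm s) {..<n}"
    by (rule inj_onI) (metis lessThan_iff less_irrefl mono tot)
  have bound: "fibre_perm s x < n" if "x < n" for x
  proof -
    have "{y. y < n \<and> lx y x} \<subset> {..<n}" using that by (auto simp: lx_def)
    then have "card {y. y < n \<and> lx y x} < card {..<n}" by (intro psubset_card_mono) auto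
    then show ?thesis using that by (simp add: fp)
  qed
  have bij: "bij_betw (fibre_perm s) {..<n} {..<n}"
    unfolding bij_betw_def using inj bound
    by (metis endo_inj_surj finite_lessThan image_subsetI lessThan_iff)
  have perm: "fibre_perm s permutes {..<n}"
    by (rule bij_imp_permutes[OF bij]) (simp add: fibre_perm_def n_def)
  show ?thesis
  proof
    assume "\<exists>r. is_factorisation s r p"
    then obtain r where r: "length r = n" "sorted r" "p permutes {..<n}"
      "\<And>x. x < n \<Longrightarrow> s ! x = r ! p x"
      "\<And>x y. x \<le> y \<Longrightarrow> y < n \<Longrightarrow> s ! x = s ! y \<Longrightarrow> p x \<le> p y"
      unfolding is_factorisation_def n_def by blast
    have pn: "p x < n \<longleftrightarrow> x < n" for x
      using permutes_in_image[OF r(3), of x] by simp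
    have pm: "p y < p x" if "lx y x" "x < n" "y < n" for x y
    proof (cases "s ! y < s ! x")
      case True
      show ?thesis
      proof (rule ccontr)
        assume "\<not> p y < p x"
        then have "r ! p x \<le> r ! p y"
          using r(1,2) pn that by (intro sorted_nth_mono) auto
        then show False using True that r(4) by simp
      qed
    next
      case False
      then have "p y \<le> p x" "y \<noteq> x" using that r(5) by (auto simp: lx_def)
      then show ?thesis using permutes_inj[OF r(3)] by (metis injD le_neq_implies_less)
    qed
    have "p x = fibre_perm s x" for x
    proof (cases "x < n")
      case True
      have "{z. z < p x} = p ` {y. y < n \<and> lx y x}"
      proof
        show "p ` {y. y < n \<and> lx y x} \<subseteq> {z. z < p x}" using True pm by auto
        show "{z. z < p x} \<subseteq> p ` {y. y < n \<and> lx y x}"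
        proof
          fix z assume z: "z \<in> {z. z < p x}"
          then have zn: "z < n" using pn[of x] True by simp
          obtain y where y: "p y = z" using permutes_surj[OF r(3)] by (metis surjD)
          then have "y < n" using pn zn by blast
          then have "lx y x" using tot[of y x] pm[of x y] True y z by fastforce
          then show "z \<in> p ` {y. y < n \<and> lx y x}" using y \<open>y < n\<close> by auto
        qed
      qed
      then have "card {z. z < p x} = card (p ` {y. y < n \<and> lx y x})" by simp
      also have "\<dots> = card {y. y < n \<and> lx y x}"
        by (rule card_image) (metis inj_on_subset permutes_inj[OF r(3)] subset_UNIV)
      finally show ?thesis using True by (simp add: fp)
    next
      case False
      then show ?thesis using permutes_not_in[OF r(3), of x] by (simp add: fibre_perm_def n_def)
    qed
    then show "p = fibre_perm s" by blast
  next
    assume p: "p = fibre_perm s"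
    define q where "q = inv p"
    have pq: "p (q z) = z" "q (p z) = z" for z
      using permutes_inverses[OF perm] by (simp_all add: p q_def)
    have qn: "q z < n \<longleftrightarrow> z < n" for z
      using permutes_in_image[OF permutes_inv[OF perm], of z] by (simp add: p q_def)
    define r where "r = map (\<lambda>z. s ! q z) [0..<n]"
    have rp: "s ! x = r ! p x" if "x < n" for x
      using that qn[of "p x"] by (simp add: r_def pq)
    have "sorted r"
    proof (rule sorted_iff_nth_mono[THEN iffD2], intro allI impI)
      fix i j assume "i \<le> j" "j < length r"
      then have ij: "i \<le> j" "j < n" by (auto simp: r_def)
      have "\<not> lx (q j) (q i)"
        using mono[of "q j" "q i"] ij qn[of i] qn[of j] pq(1) p by auto
      then show "r ! i \<le> r ! j" using ij by (auto simp: r_def lx_def)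
    qed
    moreover have "p x \<le> p y" if "x \<le> y" "y < n" "s ! x = s ! y" for x y
      using mono[of x y] that p by (cases "x = y") (auto simp: lx_def intro: less_imp_le)
    ultimately have "is_factorisation s r p"
      using perm rp by (auto simp: is_factorisation_def n_def r_def p)
    then show "\<exists>r. is_factorisation s r p" ..
  qed
qed

text \<open>\<open>perm_of_list\<close> turns a listing of \<open>[n]\<close> into a permutation. With \<open>ns = [n\<^sub>1, \<dots>, n\<^sub>k]\<close>,
  \<open>block_perm \<rho> ns\<close> is the permutation written \<open>\<rho>\<close> with a bar: it maps the \<open>i\<close>-th block, of size
  \<open>ns ! \<rho> i\<close>, onto the \<open>\<rho> i\<close>-th block of the decomposition given by \<open>ns\<close>.\<close>

definition perm_of_list :: "nat list \<Rightarrow> nat \<Rightarrow> nat" where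
  "perm_of_list xs x = (if x < length xs then xs ! x else x)"

definition offset :: "nat list \<Rightarrow> nat \<Rightarrow> nat" where
  "offset ns i = sum_list (take i ns)"

definition block_perm :: "(nat \<Rightarrow> nat) \<Rightarrow> nat list \<Rightarrow> nat \<Rightarrow> nat" where
  "block_perm \<rho> ns = perm_of_list
     (concat (map (\<lambda>i. map (\<lambda>j. offset ns (\<rho> i) + j) [0..<ns ! \<rho> i]) [0..<length ns]))"

definition sum_perm :: "nat list \<Rightarrow> (nat \<Rightarrow> nat) list \<Rightarrow> nat \<Rightarrow> nat" where
  "sum_perm ns ts = perm_of_list
     (concat (map (\<lambda>i. map (\<lambda>j. offset ns i + (ts ! i) j) [0..<ns ! i]) [0..<length ns]))"


section \<open>Categorical symmetric operads\<close>

text \<open>A left symmetric operad in sets, with components \<open>C k\<close>: \<open>mul ns x ys\<close> is \<open>m(x; y\<^sub>1, \<dots>, y\<^sub>k)\<close>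
  for \<open>x \<in> C k\<close> and \<open>y\<^sub>i \<in> C n\<^sub>i\<close>, where \<open>ns = [n\<^sub>1, \<dots>, n\<^sub>k]\<close>. The right action \<open>x \<cdot> p\<close> is
  \<open>act k (inv p) x\<close>.\<close>

definition is_set_operad ::
    "(nat \<Rightarrow> 'u set) \<Rightarrow> (nat \<Rightarrow> (nat \<Rightarrow> nat) \<Rightarrow> 'u \<Rightarrow> 'u) \<Rightarrow> 'u \<Rightarrow>
      (nat list \<Rightarrow> 'u \<Rightarrow> 'u list \<Rightarrow> 'u) \<Rightarrow> bool" where
  "is_set_operad C act e mul \<longleftrightarrow>
     (\<forall>k p x. p permutes {..<k} \<longrightarrow> x \<in> C k \<longrightarrow> act k p x \<in> C k) \<and>
     (\<forall>k x. x \<in> C k \<longrightarrow> act k id x = x) \<and>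
     (\<forall>k p q x. p permutes {..<k} \<longrightarrow> q permutes {..<k} \<longrightarrow> x \<in> C k \<longrightarrow>
        act k (p \<circ> q) x = act k p (act k q x)) \<and>
     e \<in> C 1 \<and>
     (\<forall>ns x ys. x \<in> C (length ns) \<longrightarrow> list_all2 (\<lambda>n y. y \<in> C n) ns ys \<longrightarrow>
        mul ns x ys \<in> C (sum_list ns)) \<and>
     \<comment> \<open>associativity\<close>
     (\<forall>nss x ys zss. x \<in> C (length nss) \<longrightarrow>
        list_all2 (\<lambda>ns y. y \<in> C (length ns)) nss ys \<longrightarrow>
        list_all2 (list_all2 (\<lambda>n z. z \<in> C n)) nss zss \<longrightarrow>
        mul (concat nss) (mul (map length nss) x ys) (concat zss) =
        mul (map sum_list nss) x
          (map (\<lambda>i. mul (nss ! i) (ys ! i) (zss ! i)) [0..<length nss])) \<and>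
     \<comment> \<open>unit laws\<close>
     (\<forall>k x. x \<in> C k \<longrightarrow> mul [k] e [x] = x) \<and>
     (\<forall>k x. x \<in> C k \<longrightarrow> mul (replicate k 1) x (replicate k e) = x) \<and>
     \<comment> \<open>equivariance\<close>
     (\<forall>ns x ys \<rho>. x \<in> C (length ns) \<longrightarrow> list_all2 (\<lambda>n y. y \<in> C n) ns ys \<longrightarrow>
        \<rho> permutes {..<length ns} \<longrightarrow>
        mul (permute_list \<rho> ns) (act (length ns) (inv \<rho>) x) (permute_list \<rho> ys) =
        act (sum_list ns) (inv (block_perm \<rho> ns)) (mul ns x ys)) \<and>
     (\<forall>ns x ys ts. x \<in> C (length ns) \<longrightarrow> list_all2 (\<lambda>n y. y \<in> C n) ns ys \<longrightarrow>
        list_all2 (\<lambda>n t. t permutes {..<n}) ns ts \<longrightarrow>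
        mul ns x (map (\<lambda>i. act (ns ! i) (inv (ts ! i)) (ys ! i)) [0..<length ns]) =
        act (sum_list ns) (inv (sum_perm ns ts)) (mul ns x ys))"

text \<open>The type \<open>'u\<close> is the universe in which the objects and arrows of all components live.\<close>

record 'u cat_operad =
  cat :: "nat \<Rightarrow> ('u, 'u) category"
  acto :: "nat \<Rightarrow> (nat \<Rightarrow> nat) \<Rightarrow> 'u \<Rightarrow> 'u"
  acta :: "nat \<Rightarrow> (nat \<Rightarrow> nat) \<Rightarrow> 'u \<Rightarrow> 'u"
  unt :: 'u
  mulo :: "nat list \<Rightarrow> 'u \<Rightarrow> 'u list \<Rightarrow> 'u"
  mula :: "nat list \<Rightarrow> 'u \<Rightarrow> 'u list \<Rightarrow> 'u"

text \<open>An operad in \<open>(Cat, \<times>)\<close>: actions and multiplications are functors, and the equations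
  between functors are required on objects and on arrows.\<close>

definition is_cat_operad :: "'u cat_operad \<Rightarrow> bool" where
  "is_cat_operad A \<longleftrightarrow>
     (\<forall>k. is_category (cat A k)) \<and>
     is_set_operad (\<lambda>k. Ob (cat A k)) (acto A) (unt A) (mulo A) \<and>
     is_set_operad (\<lambda>k. Ar (cat A k)) (acta A) (Idn (cat A 1) (unt A)) (mula A) \<and>
     (\<forall>k p. p permutes {..<k} \<longrightarrow>
        is_functor (cat A k) (cat A k) \<lparr>FOb = acto A k p, FAr = acta A k p\<rparr>) \<and>
     (\<forall>ns f gs. f \<in> Ar (cat A (length ns)) \<longrightarrow>
        list_all2 (\<lambda>n g. g \<in> Ar (cat A n)) ns gs \<longrightarrow>
        mula A ns f gs \<in> Hom (cat A (sum_list ns))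
          (mulo A ns (Src (cat A (length ns)) f) (map2 (\<lambda>n. Src (cat A n)) ns gs))
          (mulo A ns (Trg (cat A (length ns)) f) (map2 (\<lambda>n. Trg (cat A n)) ns gs))) \<and>
     (\<forall>ns x ys. x \<in> Ob (cat A (length ns)) \<longrightarrow>
        list_all2 (\<lambda>n y. y \<in> Ob (cat A n)) ns ys \<longrightarrow>
        mula A ns (Idn (cat A (length ns)) x) (map2 (\<lambda>n. Idn (cat A n)) ns ys) =
        Idn (cat A (sum_list ns)) (mulo A ns x ys)) \<and>
     (\<forall>ns f f' gs gs'. f \<in> Ar (cat A (length ns)) \<longrightarrow> f' \<in> Ar (cat A (length ns)) \<longrightarrow>
        Trg (cat A (length ns)) f = Src (cat A (length ns)) f' \<longrightarrow>
        list_all2 (\<lambda>n g. g \<in> Ar (cat A n)) ns gs \<longrightarrow>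
        list_all2 (\<lambda>n g. g \<in> Ar (cat A n)) ns gs' \<longrightarrow>
        (\<forall>i<length ns. Trg (cat A (ns ! i)) (gs ! i) = Src (cat A (ns ! i)) (gs' ! i)) \<longrightarrow>
        mula A ns (Cmp (cat A (length ns)) f' f)
          (map (\<lambda>i. Cmp (cat A (ns ! i)) (gs' ! i) (gs ! i)) [0..<length ns]) =
        Cmp (cat A (sum_list ns)) (mula A ns f' gs') (mula A ns f gs))"

definition mul_in_operation ::
    "'u cat_operad \<Rightarrow> nat list \<Rightarrow> 'u list \<Rightarrow> ('u, 'u, 'u, 'u) cat_functor" where
  "mul_in_operation A ns ys =
     \<lparr>FOb = (\<lambda>x. mulo A ns x ys),
      FAr = (\<lambda>f. mula A ns f (map2 (\<lambda>n. Idn (cat A n)) ns ys))\<rparr>"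

definition mul_in_input ::
    "'u cat_operad \<Rightarrow> nat list \<Rightarrow> 'u \<Rightarrow> 'u list \<Rightarrow> nat \<Rightarrow> ('u, 'u, 'u, 'u) cat_functor" where
  "mul_in_input A ns x ys i =
     \<lparr>FOb = (\<lambda>y. mulo A ns x (ys[i := y])),
      FAr = (\<lambda>g. mula A ns (Idn (cat A (length ns)) x)
                   ((map2 (\<lambda>n. Idn (cat A n)) ns ys)[i := g]))\<rparr>"

definition is_cocomplete_cat_operad :: "'v itself \<Rightarrow> 'u cat_operad \<Rightarrow> bool" where
  "is_cocomplete_cat_operad V A \<longleftrightarrow> is_cat_operad A \<and>
     (\<forall>k. cocomplete V (cat A k)) \<and>
     (\<forall>ns ys. list_all2 (\<lambda>n y. y \<in> Ob (cat A n)) ns ys \<longrightarrow>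
        preserves_colimits V (cat A (length ns)) (cat A (sum_list ns))
          (mul_in_operation A ns ys)) \<and>
     (\<forall>ns x ys i. x \<in> Ob (cat A (length ns)) \<longrightarrow>
        list_all2 (\<lambda>n y. y \<in> Ob (cat A n)) ns ys \<longrightarrow> i < length ns \<longrightarrow>
        preserves_colimits V (cat A (ns ! i)) (cat A (sum_list ns))
          (mul_in_input A ns x ys i))"


section \<open>The 2-category \<open>SCO\<close>\<close>

record 'u op_functor =
  oo :: "nat \<Rightarrow> 'u \<Rightarrow> 'u"
  oa :: "nat \<Rightarrow> 'u \<Rightarrow> 'u"

type_synonym 'u op_arrow = "'u op_functor \<times> (nat \<Rightarrow> 'u \<Rightarrow> 'u) \<times> 'u op_functor"

definition op_component :: "'u op_functor \<Rightarrow> nat \<Rightarrow> ('u, 'u, 'u, 'u) cat_functor" where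
  "op_component F k = \<lparr>FOb = oo F k, FAr = oa F k\<rparr>"

definition is_op_functor :: "'u cat_operad \<Rightarrow> 'u cat_operad \<Rightarrow> 'u op_functor \<Rightarrow> bool" where
  "is_op_functor A B F \<longleftrightarrow>
     (\<forall>k. oo F k \<in> extensional (Ob (cat A k)) \<and> oa F k \<in> extensional (Ar (cat A k))) \<and>
     (\<forall>k. is_functor (cat A k) (cat B k) (op_component F k)) \<and>
     (\<forall>k p. p permutes {..<k} \<longrightarrow>
        (\<forall>x\<in>Ob (cat A k). oo F k (acto A k p x) = acto B k p (oo F k x)) \<and>
        (\<forall>f\<in>Ar (cat A k). oa F k (acta A k p f) = acta B k p (oa F k f))) \<and>
     oo F 1 (unt A) = unt B \<and>
     (\<forall>ns x ys. x \<in> Ob (cat A (length ns)) \<longrightarrow>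
        list_all2 (\<lambda>n y. y \<in> Ob (cat A n)) ns ys \<longrightarrow>
        oo F (sum_list ns) (mulo A ns x ys) = mulo B ns (oo F (length ns) x) (map2 (oo F) ns ys)) \<and>
     (\<forall>ns f gs. f \<in> Ar (cat A (length ns)) \<longrightarrow>
        list_all2 (\<lambda>n g. g \<in> Ar (cat A n)) ns gs \<longrightarrow>
        oa F (sum_list ns) (mula A ns f gs) = mula B ns (oa F (length ns) f) (map2 (oa F) ns gs))"

definition is_op_transformation ::
    "'u cat_operad \<Rightarrow> 'u cat_operad \<Rightarrow> 'u op_functor \<Rightarrow> 'u op_functor \<Rightarrow>
      (nat \<Rightarrow> 'u \<Rightarrow> 'u) \<Rightarrow> bool" where
  "is_op_transformation A B F G t \<longleftrightarrow> is_op_functor A B F \<and> is_op_functor A B G \<and>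
     (\<forall>k. t k \<in> extensional (Ob (cat A k))) \<and>
     (\<forall>k. \<forall>x\<in>Ob (cat A k). t k x \<in> Hom (cat B k) (oo F k x) (oo G k x)) \<and>
     (\<forall>k. \<forall>f\<in>Ar (cat A k).
        Cmp (cat B k) (t k (Trg (cat A k) f)) (oa F k f) =
        Cmp (cat B k) (oa G k f) (t k (Src (cat A k) f))) \<and>
     (\<forall>k p. p permutes {..<k} \<longrightarrow>
        (\<forall>x\<in>Ob (cat A k). t k (acto A k p x) = acta B k p (t k x))) \<and>
     t 1 (unt A) = Idn (cat B 1) (unt B) \<and>
     (\<forall>ns x ys. x \<in> Ob (cat A (length ns)) \<longrightarrow>
        list_all2 (\<lambda>n y. y \<in> Ob (cat A n)) ns ys \<longrightarrow>
        t (sum_list ns) (mulo A ns x ys) = mula B ns (t (length ns) x) (map2 t ns ys))"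

definition SCO ::
    "'u cat_operad \<Rightarrow> 'u cat_operad \<Rightarrow>
      ('u op_functor, 'u op_arrow) category" where
  "SCO A B =
     \<lparr>Ob = {F. is_op_functor A B F},
      Ar = {(F, t, G). is_op_transformation A B F G t},
      Src = (\<lambda>(F, t, G). F),
      Trg = (\<lambda>(F, t, G). G),
      Idn = (\<lambda>F. (F, (\<lambda>k. \<lambda>x\<in>Ob (cat A k). Idn (cat B k) (oo F k x)), F)),
      Cmp = (\<lambda>(F', t', G') (F, t, G).
        (F, (\<lambda>k. \<lambda>x\<in>Ob (cat A k). Cmp (cat B k) (t' k x) (t k x)), G'))\<rparr>"

definition op_functor_comp ::
    "'u cat_operad \<Rightarrow> 'u op_functor \<Rightarrow> 'u op_functor \<Rightarrow> 'u op_functor" where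
  "op_functor_comp A G F =
     \<lparr>oo = (\<lambda>k. compose (Ob (cat A k)) (oo G k) (oo F k)),
      oa = (\<lambda>k. compose (Ar (cat A k)) (oa G k) (oa F k))\<rparr>"

text \<open>Precomposition with \<open>Z : A \<rightarrow> B\<close>, as a functor from \<open>SCO B C\<close> to \<open>SCO A C\<close>.\<close>

definition precomp ::
    "'u cat_operad \<Rightarrow> 'u op_functor \<Rightarrow>
      ('u op_functor, 'u op_arrow,
       'u op_functor, 'u op_arrow) cat_functor" where
  "precomp A Z =
     \<lparr>FOb = (\<lambda>F. op_functor_comp A F Z),
      FAr = (\<lambda>(F, t, G). (op_functor_comp A F Z,
               (\<lambda>k. compose (Ob (cat A k)) (t k) (oo Z k)), op_functor_comp A G Z))\<rparr>"


section \<open>The categories \<open>\<Omega>\<^sup>s\<close> and \<open>\<Omega>\<^sub>n\<close>\<close>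

text \<open>The data on \<open>\<Omega>\<^sup>s\<close> and \<open>\<Omega>\<^sub>n\<close> entering the definition of internal operads, which is then given
  once for both. \<open>Tips X T\<close> is \<open>|T|\<close> and \<open>tip_map X s\<close> is the underlying function \<open>[|T|] \<rightarrow> [|S|]\<close>
  of \<open>s : T \<rightarrow> S\<close>; \<open>Fib X T S s i\<close> is the fibre of \<open>s\<close> over the tip \<open>i\<close>; \<open>Ind X T S R s w i\<close> is
  the map induced by \<open>s : T \<rightarrow> S\<close> from the fibre of \<open>w \<circ> s\<close> to that of \<open>w : S \<rightarrow> R\<close>, over the tip
  \<open>i\<close> of \<open>R\<close>; \<open>UnitI\<close> is \<open>[1]\<close>, respectively \<open>U\<^sub>n\<close>.\<close>

record ('i, 'f) index_category =
  IOb :: "'i set"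
  IHom :: "'i \<Rightarrow> 'i \<Rightarrow> 'f set"
  IId :: "'i \<Rightarrow> 'f"
  IComp :: "'f \<Rightarrow> 'f \<Rightarrow> 'f"
  Tips :: "'i \<Rightarrow> nat"
  tip_map :: "'f \<Rightarrow> nat list"
  Fib :: "'i \<Rightarrow> 'i \<Rightarrow> 'f \<Rightarrow> nat \<Rightarrow> 'i"
  Ind :: "'i \<Rightarrow> 'i \<Rightarrow> 'i \<Rightarrow> 'f \<Rightarrow> 'f \<Rightarrow> nat \<Rightarrow> 'f"
  UnitI :: 'i

definition induced :: "nat list \<Rightarrow> nat list \<Rightarrow> nat \<Rightarrow> nat list" where
  "induced s w i =
     map (\<lambda>x. rank (fibre_elems w i) (s ! x)) (fibre_elems (fin_comp w s) i)"

definition Omega_sym :: "(nat, nat list) index_category" where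
  "Omega_sym =
     \<lparr>IOb = UNIV,
      IHom = fin_maps,
      IId = (\<lambda>n. [0..<n]),
      IComp = fin_comp,
      Tips = (\<lambda>n. n),
      tip_map = (\<lambda>s. s),
      Fib = (\<lambda>n k s i. length (fibre_elems s i)),
      Ind = (\<lambda>n k l s w i. induced s w i),
      UnitI = 1\<rparr>"

text \<open>An \<open>n\<close>-tree is the list \<open>[\<rho>\<^sub>0, \<dots>, \<rho>\<^sub>n\<^sub>-\<^sub>1]\<close> of its structure maps, \<open>\<rho>\<^sub>m : [k\<^sub>m\<^sub>+\<^sub>1] \<rightarrow> [k\<^sub>m]\<close>; this
  determines the \<open>k\<^sub>m\<close>. A map of trees is the list \<open>[\<sigma>\<^sub>0, \<dots>, \<sigma>\<^sub>n]\<close> of its components.\<close>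

type_synonym tree = "nat list list"
type_synonym tree_map = "nat list list"

definition level :: "tree \<Rightarrow> nat \<Rightarrow> nat" where
  "level T m = (case m of 0 \<Rightarrow> 1 | Suc l \<Rightarrow> length (T ! l))"

definition is_tree :: "nat \<Rightarrow> tree \<Rightarrow> bool" where
  "is_tree n T \<longleftrightarrow> length T = n \<and>
     (\<forall>m<n. T ! m \<in> fin_maps (level T (Suc m)) (level T m) \<and> sorted (T ! m))"

definition tree_maps :: "nat \<Rightarrow> tree \<Rightarrow> tree \<Rightarrow> tree_map set" where
  "tree_maps n T S = {s. length s = Suc n \<and>
     (\<forall>m\<le>n. s ! m \<in> fin_maps (level T m) (level S m)) \<and>
     (\<forall>m<n. fin_comp (s ! m) (T ! m) = fin_comp (S ! m) (s ! Suc m)) \<and>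
     (\<forall>m<n. \<forall>x y. x \<le> y \<and> y < level T (Suc m) \<and> T ! m ! x = T ! m ! y \<longrightarrow>
        s ! Suc m ! x \<le> s ! Suc m ! y)}"

definition unit_tree :: "nat \<Rightarrow> tree" where
  "unit_tree n = replicate n [0]"

text \<open>The element at level \<open>m\<close> below the tip \<open>i\<close>: the value at level \<open>m\<close> of the map from the unit
  tree that picks out \<open>i\<close>.\<close>

definition ancestor :: "tree \<Rightarrow> nat \<Rightarrow> nat \<Rightarrow> nat" where
  "ancestor S i m = foldr (\<lambda>r x. r ! x) (drop m S) i"

definition tree_fibre_elems :: "tree \<Rightarrow> tree_map \<Rightarrow> nat \<Rightarrow> nat \<Rightarrow> nat list" where
  "tree_fibre_elems S s i m = fibre_elems (s ! m) (ancestor S i m)"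

definition tree_fibre :: "nat \<Rightarrow> tree \<Rightarrow> tree \<Rightarrow> tree_map \<Rightarrow> nat \<Rightarrow> tree" where
  "tree_fibre n T S s i =
     map (\<lambda>m. map (\<lambda>x. rank (tree_fibre_elems S s i m) (T ! m ! x))
                   (tree_fibre_elems S s i (Suc m))) [0..<n]"

definition Omega :: "nat \<Rightarrow> (tree, tree_map) index_category" where
  "Omega n =
     \<lparr>IOb = {T. is_tree n T},
      IHom = tree_maps n,
      IId = (\<lambda>T. map (\<lambda>m. [0..<level T m]) [0..<Suc n]),
      IComp = map2 fin_comp,
      Tips = (\<lambda>T. level T n),
      tip_map = (\<lambda>s. s ! n),
      Fib = tree_fibre n,
      Ind = (\<lambda>T S R s w i. map (\<lambda>m. induced (s ! m) (w ! m) (ancestor R i m))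
                              [0..<Suc n]),
      UnitI = unit_tree n\<rparr>"


section \<open>Internal operads\<close>

record ('i, 'f, 'u) internal_operad =
  iob :: "'i \<Rightarrow> 'u"
  imu :: "'i \<times> 'i \<times> 'f \<Rightarrow> 'u"
  ieps :: 'u

type_synonym ('i, 'f, 'u) internal_arrow =
  "('i, 'f, 'u) internal_operad \<times> ('i \<Rightarrow> 'u) \<times> ('i, 'f, 'u) internal_operad"

definition index_arrows :: "('i, 'f) index_category \<Rightarrow> ('i \<times> 'i \<times> 'f) set" where
  "index_arrows X = {(T, S, s). T \<in> IOb X \<and> S \<in> IOb X \<and> s \<in> IHom X T S}"

definition fibs :: "('i, 'f) index_category \<Rightarrow> 'i \<Rightarrow> 'i \<Rightarrow> 'f \<Rightarrow> 'i list" where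
  "fibs X T S s = map (Fib X T S s) [0..<Tips X S]"

definition ipi :: "('i, 'f) index_category \<Rightarrow> 'f \<Rightarrow> nat \<Rightarrow> nat" where
  "ipi X s = fibre_perm (tip_map X s)"

text \<open>In the associativity axiom both sides are arrows of \<open>A\<^sub>|\<^sub>T\<^sub>|\<close> from the iterated product of
  \<open>a\<^sub>R\<close>, the \<open>a\<^sub>S\<^sub>i\<close> and the \<open>a\<close> of the fibres of the \<open>s\<^sub>i\<close> to a translate of \<open>a\<^sub>T\<close>. On the left,
  \<open>\<mu>\<^sub>w\<close> leads to \<open>m(\<pi>(w) a\<^sub>S; \<dots>)\<close> with the fibres of \<open>s\<close> listed by blocks; equivariance, with
  \<open>\<rho> = \<pi>(w)\<^sup>-\<^sup>1\<close>, identifies this with the \<open>block_perm\<close>-translate of the source of \<open>\<mu>\<^sub>s\<close>. On the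
  right, the \<open>\<mu>\<close> of the \<open>s\<^sub>i\<close> lead to the translate of the source of the \<open>\<mu>\<close> of \<open>w \<circ> s\<close> by the
  sum of the \<open>\<pi>(s\<^sub>i)\<close>.\<close>

definition internal_assoc ::
    "('i, 'f) index_category \<Rightarrow> 'u cat_operad \<Rightarrow> ('i, 'f, 'u) internal_operad \<Rightarrow>
      'i \<Rightarrow> 'i \<Rightarrow> 'i \<Rightarrow> 'f \<Rightarrow> 'f \<Rightarrow> bool" where
  "internal_assoc X A a T S R s w \<longleftrightarrow>
     (let ws = IComp X w s;
          Ti = Fib X T R ws;
          Si = Fib X S R w;
          si = Ind X T S R s w;
          Tij = concat (map (\<lambda>i. fibs X (Ti i) (Si i) (si i)) [0..<Tips X R]);
          idn = (\<lambda>T. Idn (cat A (Tips X T)) (iob a T))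
      in Cmp (cat A (Tips X T))
           (acta A (Tips X T) (inv (block_perm (inv (ipi X w)) (map (Tips X) (fibs X T S s))))
             (imu a (T, S, s)))
           (mula A (map (Tips X) Tij) (imu a (S, R, w)) (map idn Tij))
       = Cmp (cat A (Tips X T))
           (acta A (Tips X T)
             (sum_perm (map (Tips X) (fibs X T R ws)) (map (\<lambda>i. ipi X (si i)) [0..<Tips X R]))
             (imu a (T, R, ws)))
           (mula A (map (Tips X) (fibs X T R ws)) (idn R)
             (map (\<lambda>i. imu a (Ti i, Si i, si i)) [0..<Tips X R])))"

definition is_internal_operad ::
    "('i, 'f) index_category \<Rightarrow> 'u cat_operad \<Rightarrow> ('i, 'f, 'u) internal_operad \<Rightarrow> bool" where
  "is_internal_operad X A a \<longleftrightarrow>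
     iob a \<in> extensional (IOb X) \<and> imu a \<in> extensional (index_arrows X) \<and>
     (\<forall>T\<in>IOb X. iob a T \<in> Ob (cat A (Tips X T))) \<and>
     (\<forall>T\<in>IOb X. \<forall>S\<in>IOb X. \<forall>s\<in>IHom X T S.
        imu a (T, S, s) \<in> Hom (cat A (Tips X T))
          (mulo A (map (Tips X) (fibs X T S s)) (iob a S) (map (iob a) (fibs X T S s)))
          (acto A (Tips X T) (ipi X s) (iob a T))) \<and>
     ieps a \<in> Hom (cat A 1) (unt A) (iob a (UnitI X)) \<and>
     (\<forall>T\<in>IOb X. \<forall>S\<in>IOb X. \<forall>R\<in>IOb X. \<forall>s\<in>IHom X T S. \<forall>w\<in>IHom X S R.
        internal_assoc X A a T S R s w) \<and>
     (\<forall>T\<in>IOb X.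
        Cmp (cat A (Tips X T)) (imu a (T, T, IId X T))
          (mula A (replicate (Tips X T) 1) (Idn (cat A (Tips X T)) (iob a T))
            (replicate (Tips X T) (ieps a))) =
        Idn (cat A (Tips X T)) (iob a T)) \<and>
     (\<forall>T\<in>IOb X. \<forall>s\<in>IHom X T (UnitI X).
        Cmp (cat A (Tips X T)) (imu a (T, UnitI X, s))
          (mula A [Tips X T] (ieps a) [Idn (cat A (Tips X T)) (iob a T)]) =
        Idn (cat A (Tips X T)) (iob a T))"

definition is_internal_map ::
    "('i, 'f) index_category \<Rightarrow> 'u cat_operad \<Rightarrow> ('i, 'f, 'u) internal_operad \<Rightarrow>
      ('i, 'f, 'u) internal_operad \<Rightarrow> ('i \<Rightarrow> 'u) \<Rightarrow> bool" where
  "is_internal_map X A a b f \<longleftrightarrow> is_internal_operad X A a \<and> is_internal_operad X A b \<and>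
     f \<in> extensional (IOb X) \<and>
     (\<forall>T\<in>IOb X. f T \<in> Hom (cat A (Tips X T)) (iob a T) (iob b T)) \<and>
     (\<forall>T\<in>IOb X. \<forall>S\<in>IOb X. \<forall>s\<in>IHom X T S.
        Cmp (cat A (Tips X T)) (imu b (T, S, s))
          (mula A (map (Tips X) (fibs X T S s)) (f S) (map f (fibs X T S s))) =
        Cmp (cat A (Tips X T)) (acta A (Tips X T) (ipi X s) (f T)) (imu a (T, S, s))) \<and>
     Cmp (cat A 1) (f (UnitI X)) (ieps a) = ieps b"

text \<open>\<open>IO (Omega n) A\<close> and \<open>IO Omega_sym A\<close> are the categories of internal \<open>n\<close>-operads and of
  internal symmetric operads in \<open>A\<close>.\<close>

definition IO ::
    "('i, 'f) index_category \<Rightarrow> 'u cat_operad \<Rightarrow>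
      (('i, 'f, 'u) internal_operad,
       ('i, 'f, 'u) internal_arrow) category" where
  "IO X A =
     \<lparr>Ob = {a. is_internal_operad X A a},
      Ar = {(a, f, b). is_internal_map X A a b f},
      Src = (\<lambda>(a, f, b). a),
      Trg = (\<lambda>(a, f, b). b),
      Idn = (\<lambda>a. (a, (\<lambda>T\<in>IOb X. Idn (cat A (Tips X T)) (iob a T)), a)),
      Cmp = (\<lambda>(a', f', b') (a, f, b).
        (a, (\<lambda>T\<in>IOb X. Cmp (cat A (Tips X T)) (f' T) (f T)), b'))\<rparr>"

definition delta :: "nat \<Rightarrow> (nat, nat list, 'u) internal_operad \<Rightarrow>
    (tree, tree_map, 'u) internal_operad" where
  "delta n b =
     \<lparr>iob = (\<lambda>T\<in>IOb (Omega n). iob b (level T n)),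
      imu = (\<lambda>(T, S, s)\<in>index_arrows (Omega n). imu b (level T n, level S n, s ! n)),
      ieps = ieps b\<rparr>"


section \<open>Representing objects\<close>

definition image_operad ::
    "('i, 'f) index_category \<Rightarrow> ('i, 'f, 'u) internal_operad \<Rightarrow> 'u op_functor \<Rightarrow>
      ('i, 'f, 'u) internal_operad" where
  "image_operad X u F =
     \<lparr>iob = (\<lambda>T\<in>IOb X. oo F (Tips X T) (iob u T)),
      imu = (\<lambda>(T, S, s)\<in>index_arrows X. oa F (Tips X T) (imu u (T, S, s))),
      ieps = oa F 1 (ieps u)\<rparr>"

definition evaluation ::
    "('i, 'f) index_category \<Rightarrow> ('i, 'f, 'u) internal_operad \<Rightarrow>
      ('u op_functor, 'u op_arrow,
       ('i, 'f, 'u) internal_operad,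
       ('i, 'f, 'u) internal_arrow) cat_functor" where
  "evaluation X u =
     \<lparr>FOb = image_operad X u,
      FAr = (\<lambda>(F, t, G). (image_operad X u F, (\<lambda>T\<in>IOb X. t (Tips X T) (iob u T)),
                           image_operad X u G))\<rparr>"

text \<open>\<open>h\<close> represents the 2-functor \<open>IO X\<close> with universal internal operad \<open>u\<close>: every 2-natural
  isomorphism \<open>SCO(h, -) \<cong> IO X\<close> is evaluation at the element \<open>u\<close> corresponding to the identity
  of \<open>h\<close>.\<close>

definition represents ::
    "('i, 'f) index_category \<Rightarrow> 'u cat_operad \<Rightarrow> ('i, 'f, 'u) internal_operad \<Rightarrow> bool" where
  "represents X h u \<longleftrightarrow> is_cat_operad h \<and> is_internal_operad X h u \<and>
     (\<forall>B. is_cat_operad B \<longrightarrow> is_category_iso (SCO h B) (IO X B) (evaluation X u))"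

text \<open>The operadic functor \<open>h \<rightarrow> A\<close> corresponding to an internal operad in \<open>A\<close>, and likewise on
  arrows.\<close>

definition classify ::
    "('i, 'f) index_category \<Rightarrow> 'u cat_operad \<Rightarrow> ('i, 'f, 'u) internal_operad \<Rightarrow> 'u cat_operad \<Rightarrow>
      (('i, 'f, 'u) internal_operad,
       ('i, 'f, 'u) internal_arrow,
       'u op_functor, 'u op_arrow) cat_functor" where
  "classify X h u A =
     \<lparr>FOb = the_inv_into (Ob (SCO h A)) (FOb (evaluation X u)),
      FAr = the_inv_into (Ar (SCO h A)) (FAr (evaluation X u))\<rparr>"

definition zeta ::
    "nat \<Rightarrow> 'u cat_operad \<Rightarrow> (tree, tree_map, 'u) internal_operad \<Rightarrow>
      'u cat_operad \<Rightarrow> (nat, nat list, 'u) internal_operad \<Rightarrow> 'u op_functor" where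
  "zeta n h u H v = FOb (classify (Omega n) h u H) (delta n v)"

text \<open>Restriction along \<open>\<zeta>\<close>:
  \<open>IO Omega_sym A \<cong> SCO H A \<rightarrow> SCO h A \<cong> IO (Omega n) A\<close>.\<close>

definition zeta_star ::
    "nat \<Rightarrow> 'u cat_operad \<Rightarrow> (tree, tree_map, 'u) internal_operad \<Rightarrow>
      'u cat_operad \<Rightarrow> (nat, nat list, 'u) internal_operad \<Rightarrow> 'u cat_operad \<Rightarrow>
      ((nat, nat list, 'u) internal_operad,
       (nat, nat list, 'u) internal_arrow,
       (tree, tree_map, 'u) internal_operad,
       (tree, tree_map, 'u) internal_arrow) cat_functor" where
  "zeta_star n h u H v A =
     functor_comp (evaluation (Omega n) u)
       (functor_comp (precomp h (zeta n h u H v)) (classify Omega_sym H v A))"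

end

theory Submission
  imports Defs "HOL-Library.Countable_Set"
begin

text \<open>Restriction along \<open>\<zeta>\<close> is desymmetrisation (\<open>zeta_star_Ob\<close>, \<open>zeta_star_Ar\<close>). Let \<open>F : h \<rightarrow> A\<close>
  represent the internal operad \<open>a\<close>, and let \<open>b\<^sub>k\<close> be the colimit of \<open>F\<^sub>k\<close>, with legs
  \<open>i\<^sub>x : F x \<rightarrow> b\<^sub>k\<close>. It suffices to make \<open>b\<close> an internal symmetric operad and to find a universal
  arrow from \<open>a\<close> to its desymmetrisation (\<open>colimit_universal_arrow\<close>): these arrows assemble to a
  left adjoint, and the value of any other left adjoint at \<open>a\<close> is isomorphic to \<open>b\<close>, hence again
  levelwise a colimit.

  Since the multiplication of \<open>A\<close> preserves colimits in each variable, \<open>m(b\<^sub>k; b\<^sub>n\<^sub>1, \<dots>)\<close> is a colimit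
  of the objects \<open>m(F x; F y\<^sub>1, \<dots>) = F(m(x; y\<^sub>1, \<dots>))\<close>. For \<open>\<sigma> : [n] \<rightarrow> [k]\<close> the \<open>\<pi>(\<sigma>)\<close>-translates of
  the legs at \<open>m(x; y\<^sub>1, \<dots>)\<close> form a cocone on it, which defines \<open>\<mu>\<^sub>\<sigma>\<close> (\<open>mu_exists\<close>); the axioms can
  be tested on the legs, where they reduce to the operad laws of \<open>h\<close> and to identities between
  permutations (\<open>sym_operad_internal\<close>).

  For the universal property let \<open>c\<close> be an internal symmetric operad. The maps \<open>\<mu>\<close> of bijections
  compare \<open>c\<^sub>k\<close> with its translates, and all other \<open>\<mu>\<close> are obtained from these and from the \<open>\<mu>\<close> of
  order preserving maps (\<open>mu_factor\<close>). With them the categories \<open>A\<^sub>k / c\<^sub>k\<close> form an operad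
  (\<open>slice_operad\<close>), and a map from \<open>a\<close> to the desymmetrisation of \<open>c\<close> is an internal operad in it
  that lies over \<open>a\<close> (\<open>slice_internal\<close>). The functor from \<open>h\<close> to the slice that represents it
  consists of cocones \<open>F\<^sub>k \<Rightarrow> c\<^sub>k\<close> compatible with all operad structure (\<open>slice_cocone\<close>), so the induced
  arrows \<open>b\<^sub>k \<rightarrow> c\<^sub>k\<close> form a map of internal operads (\<open>map_exists\<close>). It is unique, because no proper
  suboperad of \<open>h\<close> contains the universal internal operad (\<open>represents_minimal\<close>, \<open>map_unique\<close>). By
  the same minimality \<open>h\<close> is countable (\<open>represents_countable\<close>), so its components are small enough
  for the colimits that a cocomplete operad provides in an arbitrary infinite universe.\<close>

section \<open>Categories, colimits and universal arrows\<close>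

lemma HomI: "f \<in> Ar C \<Longrightarrow> Src C f = x \<Longrightarrow> Trg C f = y \<Longrightarrow> f \<in> Hom C x y"
  by (simp add: Hom_def)

lemma HomD:
  assumes "f \<in> Hom C x y"
  shows "f \<in> Ar C" "Src C f = x" "Trg C f = y"
  using assms by (auto simp: Hom_def)

lemma Hom_Ob:
  assumes "is_category C" "f \<in> Hom C x y"
  shows "x \<in> Ob C" "y \<in> Ob C"
  using assms by (auto simp: Hom_def is_category_def)

lemma Idn_Hom: "is_category C \<Longrightarrow> x \<in> Ob C \<Longrightarrow> Idn C x \<in> Hom C x x"
  by (auto simp: is_category_def)

lemma Cmp_Hom: "is_category C \<Longrightarrow> f \<in> Hom C x y \<Longrightarrow> g \<in> Hom C y z \<Longrightarrow> Cmp C g f \<in> Hom C x z"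
  unfolding is_category_def by (metis HomD)

lemma Cmp_Idn:
  assumes "is_category C" "f \<in> Hom C x y"
  shows "Cmp C f (Idn C x) = f" "Cmp C (Idn C y) f = f"
  using assms by (auto simp: Hom_def is_category_def)

lemma Cmp_assoc:
  assumes "is_category C" "f \<in> Hom C x y" "g \<in> Hom C y z" "e \<in> Hom C z w"
  shows "Cmp C (Cmp C e g) f = Cmp C e (Cmp C g f)"
  using assms by (simp add: Hom_def is_category_def)

lemma functor_Hom:
  assumes "is_functor C D F" "f \<in> Hom C x y"
  shows "FAr F f \<in> Hom D (FOb F x) (FOb F y)"
  using assms by (auto simp: Hom_def is_functor_def)

lemma functor_Ob: "is_functor C D F \<Longrightarrow> x \<in> Ob C \<Longrightarrow> FOb F x \<in> Ob D"
  by (auto simp: is_functor_def)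

lemma functor_Idn: "is_functor C D F \<Longrightarrow> x \<in> Ob C \<Longrightarrow> FAr F (Idn C x) = Idn D (FOb F x)"
  by (auto simp: is_functor_def)

lemma functor_Cmp:
  assumes "is_functor C D F" "f \<in> Hom C x y" "g \<in> Hom C y z"
  shows "FAr F (Cmp C g f) = Cmp D (FAr F g) (FAr F f)"
  using assms by (auto simp: Hom_def is_functor_def)

lemma functor_category: "is_functor C D F \<Longrightarrow> is_category C" "is_functor C D F \<Longrightarrow> is_category D"
  by (auto simp: is_functor_def)

lemma is_functor_comp:
  assumes "is_functor C D F" "is_functor D E G"
  shows "is_functor C E (functor_comp G F)"
  using assms unfolding is_functor_def functor_comp_def
  by (simp add: Hom_def)

lemma cocone_Hom: "is_cocone J C D c t \<Longrightarrow> j \<in> Ob J \<Longrightarrow> t j \<in> Hom C (FOb D j) c"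
  by (simp add: is_cocone_def)

lemma cocone_natural:
  assumes "is_cocone J C D c t" "f \<in> Hom J i j"
  shows "Cmp C (t j) (FAr D f) = t i"
  using assms by (auto simp: is_cocone_def Hom_def)

lemma is_cocone_cong:
  assumes "is_category J" "\<And>j. j \<in> Ob J \<Longrightarrow> s j = s' j"
  shows "is_cocone J C D c s \<longleftrightarrow> is_cocone J C D c s'"
proof -
  have "\<And>f. f \<in> Ar J \<Longrightarrow> Src J f \<in> Ob J \<and> Trg J f \<in> Ob J"
    using assms(1) by (simp add: is_category_def)
  then show ?thesis using assms(2) unfolding is_cocone_def by simp
qed

lemma is_colimit_cong:
  assumes "is_category J" "\<And>j. j \<in> Ob J \<Longrightarrow> s j = s' j"
  shows "is_colimit J C D c s \<longleftrightarrow> is_colimit J C D c s'"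
proof -
  have "is_cocone J C D c s \<longleftrightarrow> is_cocone J C D c s'"
    by (rule is_cocone_cong) (use assms in auto)
  then show ?thesis using assms(2) unfolding is_colimit_def by simp
qed

lemma colimit_cocone: "is_colimit J C D c t \<Longrightarrow> is_cocone J C D c t"
  by (simp add: is_colimit_def)

lemma colimit_functor: "is_colimit J C D c t \<Longrightarrow> is_functor J C D"
  by (simp add: is_colimit_def)

lemma cocone_postcompose:
  assumes "is_cocone J C D c t" "is_functor J C D" "f \<in> Hom C c z"
  shows "is_cocone J C D z (\<lambda>j. Cmp C f (t j))"
proof -
  have C: "is_category C" and J: "is_category J" using functor_category[OF assms(2)] by auto
  show ?thesis unfolding is_cocone_def
  proof (intro conjI ballI)
    show "z \<in> Ob C" using Hom_Ob[OF C assms(3)] by simp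
    show "Cmp C f (t j) \<in> Hom C (FOb D j) z" if "j \<in> Ob J" for j
      using Cmp_Hom[OF C cocone_Hom[OF assms(1) that] assms(3)] .
    fix g assume g: "g \<in> Ar J"
    have gh: "g \<in> Hom J (Src J g) (Trg J g)" using g by (simp add: Hom_def)
    have "Cmp C (Cmp C f (t (Trg J g))) (FAr D g) = Cmp C f (Cmp C (t (Trg J g)) (FAr D g))"
      by (rule Cmp_assoc[OF C functor_Hom[OF assms(2) gh] cocone_Hom[OF assms(1)] assms(3)])
         (use Hom_Ob[OF J gh] in simp)
    then show "Cmp C (Cmp C f (t (Trg J g))) (FAr D g) = Cmp C f (t (Src J g))"
      using cocone_natural[OF assms(1) gh] by simp
  qed
qed

lemma colimit_unique:
  assumes "is_colimit J C D c t" "f \<in> Hom C c z" "g \<in> Hom C c z"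
    and "\<And>j. j \<in> Ob J \<Longrightarrow> Cmp C f (t j) = Cmp C g (t j)"
  shows "f = g"
proof -
  have "is_cocone J C D z (\<lambda>j. Cmp C f (t j))"
    by (rule cocone_postcompose[OF colimit_cocone[OF assms(1)] colimit_functor[OF assms(1)] assms(2)])
  then have "\<exists>!h. h \<in> Hom C c z \<and> (\<forall>j\<in>Ob J. Cmp C h (t j) = Cmp C f (t j))"
    using assms(1) by (simp add: is_colimit_def)
  then show ?thesis using assms by metis
qed

lemma colimit_factor:
  assumes "is_colimit J C D c t" "is_cocone J C D z t'"
  obtains f where "f \<in> Hom C c z" "\<And>j. j \<in> Ob J \<Longrightarrow> Cmp C f (t j) = t' j"
  using assms unfolding is_colimit_def by blast

lemma colimit_iso:
  assumes "is_colimit J C D c t" "i \<in> Hom C c c'" "i' \<in> Hom C c' c"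
    "Cmp C i' i = Idn C c" "Cmp C i i' = Idn C c'"
  shows "is_colimit J C D c' (\<lambda>j. Cmp C i (t j))"
proof -
  have F: "is_functor J C D" and cc: "is_cocone J C D c t" using assms(1) by (auto simp: is_colimit_def)
  have C: "is_category C" using functor_category[OF F] by auto
  have th: "t j \<in> Hom C (FOb D j) c" if "j \<in> Ob J" for j using cocone_Hom[OF cc that] .
  have "\<exists>!f. f \<in> Hom C c' d \<and> (\<forall>j\<in>Ob J. Cmp C f (Cmp C i (t j)) = s j)"
    if s: "is_cocone J C D d s" for d s
  proof -
    obtain f where f: "f \<in> Hom C c d" "\<And>j. j \<in> Ob J \<Longrightarrow> Cmp C f (t j) = s j"
      using colimit_factor[OF assms(1) s] by blast
    have fi: "Cmp C f i' \<in> Hom C c' d" using Cmp_Hom[OF C assms(3) f(1)] .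
    have "Cmp C (Cmp C f i') (Cmp C i (t j)) = s j" if j: "j \<in> Ob J" for j
    proof -
      have "Cmp C (Cmp C f i') (Cmp C i (t j)) = Cmp C f (Cmp C (Cmp C i' i) (t j))"
        using Cmp_assoc[OF C Cmp_Hom[OF C th[OF j] assms(2)] assms(3) f(1)]
          Cmp_assoc[OF C th[OF j] assms(2) assms(3)] by simp
      then show ?thesis using f(2) j assms(4) Cmp_Idn[OF C th[OF j]] by simp
    qed
    moreover have "g = Cmp C f i'"
      if g: "g \<in> Hom C c' d" "\<forall>j\<in>Ob J. Cmp C g (Cmp C i (t j)) = s j" for g
    proof -
      have "Cmp C g i = f"
        by (rule colimit_unique[OF assms(1) Cmp_Hom[OF C assms(2) g(1)] f(1)])
           (use Cmp_assoc[OF C th assms(2) g(1)] g(2) f(2) in auto)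
      then have "Cmp C f i' = Cmp C g (Cmp C i i')"
        using Cmp_assoc[OF C assms(3) assms(2) g(1)] by simp
      then show ?thesis using assms(5) Cmp_Idn[OF C g(1)] by simp
    qed
    ultimately show ?thesis using fi by blast
  qed
  then show ?thesis
    using F cocone_postcompose[OF cc F assms(2)] by (simp add: is_colimit_def)
qed

text \<open>A category is moved along injections of its objects and arrows into other types; cocones,
  and therefore colimits, do not notice. This makes a countable category small in the sense of any
  infinite universe.\<close>

definition transport_cat ::
    "('a \<Rightarrow> 'v) \<Rightarrow> ('b \<Rightarrow> 'w) \<Rightarrow> ('a, 'b) category \<Rightarrow> ('v, 'w) category" where
  "transport_cat e e' J =
     \<lparr>Ob = e ` Ob J, Ar = e' ` Ar J,
      Src = (\<lambda>f. e (Src J (inv_into (Ar J) e' f))),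
      Trg = (\<lambda>f. e (Trg J (inv_into (Ar J) e' f))),
      Idn = (\<lambda>x. e' (Idn J (inv_into (Ob J) e x))),
      Cmp = (\<lambda>g f. e' (Cmp J (inv_into (Ar J) e' g) (inv_into (Ar J) e' f)))\<rparr>"

definition transport_diagram ::
    "('a \<Rightarrow> 'v) \<Rightarrow> ('b \<Rightarrow> 'w) \<Rightarrow> ('a, 'b) category \<Rightarrow> ('a, 'b, 'o, 'm) cat_functor \<Rightarrow>
      ('v, 'w, 'o, 'm) cat_functor" where
  "transport_diagram e e' J D =
     \<lparr>FOb = FOb D \<circ> inv_into (Ob J) e, FAr = FAr D \<circ> inv_into (Ar J) e'\<rparr>"

lemma transport_functor:
  assumes F: "is_functor J C D" and e: "inj_on e (Ob J)" "inj_on e' (Ar J)"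
  shows "is_functor (transport_cat e e' J) C (transport_diagram e e' J D)"
proof -
  have J: "is_category J" using functor_category[OF F] by auto
  have [simp]: "inv_into (Ob J) e (e x) = x" if "x \<in> Ob J" for x using that e by simp
  have [simp]: "inv_into (Ar J) e' (e' x) = x" if "x \<in> Ar J" for x using that e by simp
  have [simp]: "Src J f \<in> Ob J" "Trg J f \<in> Ob J" if "f \<in> Ar J" for f
    using J that by (auto simp: is_category_def)
  have [simp]: "e x = e y \<longleftrightarrow> x = y" if "x \<in> Ob J" "y \<in> Ob J" for x y
    using that e by (auto dest: inj_onD)
  have "is_category (transport_cat e e' J)"
    using J unfolding is_category_def transport_cat_def by (simp add: Hom_def)
  then show ?thesis
    using F unfolding is_functor_def transport_diagram_def
    by (simp add: transport_cat_def is_category_def Hom_def)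
qed

lemma transport_cocone:
  assumes F: "is_functor J C D" and e: "inj_on e (Ob J)" "inj_on e' (Ar J)"
  shows "is_cocone (transport_cat e e' J) C (transport_diagram e e' J D) c t \<longleftrightarrow>
    is_cocone J C D c (t \<circ> e)"
proof -
  have J: "is_category J" using functor_category[OF F] by auto
  have [simp]: "inv_into (Ob J) e (e x) = x" if "x \<in> Ob J" for x using that e by simp
  have [simp]: "inv_into (Ar J) e' (e' x) = x" if "x \<in> Ar J" for x using that e by simp
  have [simp]: "Src J f \<in> Ob J" "Trg J f \<in> Ob J" if "f \<in> Ar J" for f
    using J that by (auto simp: is_category_def)
  show ?thesis unfolding is_cocone_def transport_cat_def transport_diagram_def by simp
qed

lemma transport_colimit:
  assumes F: "is_functor J C D" and e: "inj_on e (Ob J)" "inj_on e' (Ar J)"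
  shows "is_colimit (transport_cat e e' J) C (transport_diagram e e' J D) c t \<longleftrightarrow>
    is_colimit J C D c (t \<circ> e)"
proof -
  let ?J = "transport_cat e e' J" and ?D = "transport_diagram e e' J D"
  have ob: "Ob ?J = e ` Ob J" by (simp add: transport_cat_def)
  have cc: "is_cocone ?J C ?D c' t' \<longleftrightarrow> is_cocone J C D c' (t' \<circ> e)" for c' t'
    by (rule transport_cocone[OF assms])
  have cc': "is_cocone J C D c' t' \<Longrightarrow> is_cocone ?J C ?D c' (t' \<circ> inv_into (Ob J) e)" for c' t'
    unfolding cc using e
    by (subst is_cocone_cong[OF functor_category(1)[OF F], of _ t']) auto
  have eq: "(\<forall>j\<in>Ob ?J. Cmp C f (t j) = t' j) \<longleftrightarrow> (\<forall>j\<in>Ob J. Cmp C f ((t \<circ> e) j) = (t' \<circ> e) j)"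
    for f t' by (simp add: ob)
  have eq': "(\<forall>j\<in>Ob J. Cmp C f ((t \<circ> e) j) = t' j) \<longleftrightarrow>
      (\<forall>j\<in>Ob ?J. Cmp C f (t j) = (t' \<circ> inv_into (Ob J) e) j)" for f t'
    using e by (simp add: ob)
  show ?thesis
  proof
    assume L: "is_colimit ?J C ?D c t"
    have "\<exists>!f. f \<in> Hom C c c' \<and> (\<forall>j\<in>Ob J. Cmp C f ((t \<circ> e) j) = t' j)"
      if "is_cocone J C D c' t'" for c' t'
      using L cc'[OF that] unfolding is_colimit_def eq' by blast
    then show "is_colimit J C D c (t \<circ> e)" using L F cc unfolding is_colimit_def by blast
  next
    assume R: "is_colimit J C D c (t \<circ> e)"
    have "\<exists>!f. f \<in> Hom C c c' \<and> (\<forall>j\<in>Ob ?J. Cmp C f (t j) = t' j)"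
      if "is_cocone ?J C ?D c' t'" for c' t'
      using R that unfolding is_colimit_def eq cc by blast
    then show "is_colimit ?J C ?D c t"
      using R transport_functor[OF assms] cc unfolding is_colimit_def by blast
  qed
qed

lemma countable_inj_infinite:
  assumes "infinite (UNIV :: 'v set)" "countable X"
  obtains e :: "'a \<Rightarrow> 'v" where "inj_on e X"
proof -
  obtain f :: "nat \<Rightarrow> 'v" where f: "inj f" using infinite_countable_subset[OF assms(1)] by blast
  have "inj_on (f \<circ> to_nat_on X) X"
    using inj_on_to_nat_on[OF assms(2)] f by (meson comp_inj_on inj_on_subset subset_UNIV)
  then show thesis using that by blast
qed

lemma cocomplete_countable_colimit:
  assumes "cocomplete TYPE('v) C" "infinite (UNIV :: 'v set)"
    and "countable (Ob J)" "countable (Ar J)" "is_functor J C D"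
  obtains c t where "is_colimit J C D c t"
proof -
  obtain e :: "_ \<Rightarrow> 'v" where e: "inj_on e (Ob J)"
    using countable_inj_infinite[OF assms(2,3)] by blast
  obtain e' :: "_ \<Rightarrow> 'v" where e': "inj_on e' (Ar J)"
    using countable_inj_infinite[OF assms(2,4)] by blast
  obtain c t where "is_colimit (transport_cat e e' J) C (transport_diagram e e' J D) c t"
    using assms(1) transport_functor[OF assms(5) e e'] unfolding cocomplete_def by blast
  then show thesis using that transport_colimit[OF assms(5) e e'] by blast
qed

lemma preserves_countable_colimit:
  assumes "preserves_colimits TYPE('v) C E F" "infinite (UNIV :: 'v set)" "is_functor C E F"
    and "countable (Ob J)" "countable (Ar J)" "is_colimit J C D c t"
  shows "is_colimit J E (functor_comp F D) (FOb F c) (\<lambda>j. FAr F (t j))"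
proof -
  have F: "is_functor J C D" using assms(6) by (simp add: is_colimit_def)
  obtain e :: "_ \<Rightarrow> 'v" where e: "inj_on e (Ob J)"
    using countable_inj_infinite[OF assms(2,4)] by blast
  obtain e' :: "_ \<Rightarrow> 'v" where e': "inj_on e' (Ar J)"
    using countable_inj_infinite[OF assms(2,5)] by blast
  let ?t = "t \<circ> inv_into (Ob J) e"
  have te: "?t (e j) = t j" if "j \<in> Ob J" for j using that e by simp
  have "is_colimit J C D c (?t \<circ> e)"
    by (rule iffD2[OF is_colimit_cong assms(6)]) (use functor_category(1)[OF F] te in auto)
  then have "is_colimit (transport_cat e e' J) C (transport_diagram e e' J D) c ?t"
    using transport_colimit[OF F e e'] by blast
  then have "is_colimit (transport_cat e e' J) E
      (functor_comp F (transport_diagram e e' J D)) (FOb F c) (FAr F \<circ> ?t)"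
    using assms(1) unfolding preserves_colimits_def by blast
  moreover have "functor_comp F (transport_diagram e e' J D) =
      transport_diagram e e' J (functor_comp F D)"
    by (simp add: functor_comp_def transport_diagram_def comp_assoc)
  ultimately have "is_colimit J E (functor_comp F D) (FOb F c) (FAr F \<circ> ?t \<circ> e)"
    using transport_colimit[OF is_functor_comp[OF F assms(3)] e e'] by simp
  then show ?thesis
    by (rule iffD1[OF is_colimit_cong, rotated 2]) (use functor_category(1)[OF F] te in auto)
qed

definition universal_arrow ::
    "('o, 'm) category \<Rightarrow> ('p, 'q) category \<Rightarrow> ('p, 'q, 'o, 'm) cat_functor \<Rightarrow>
      'o \<Rightarrow> 'p \<Rightarrow> 'm \<Rightarrow> bool" where
  "universal_arrow C D R c b \<eta> \<longleftrightarrow> b \<in> Ob D \<and> \<eta> \<in> Hom C c (FOb R b) \<and>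
     (\<forall>d\<in>Ob D. \<forall>g\<in>Hom C c (FOb R d). \<exists>!f. f \<in> Hom D b d \<and> Cmp C (FAr R f) \<eta> = g)"

text \<open>Universal arrows can be chosen independently for every object; on an arrow \<open>f : c \<rightarrow> c'\<close> the left
  adjoint is then the factorisation of \<open>\<eta>\<^sub>c\<^sub>' f\<close> through \<open>\<eta>\<^sub>c\<close>, and uniqueness makes it a functor.\<close>

lemma left_adjoint_from_universal_arrows:
  assumes C: "is_category C" and R: "is_functor D C R"
    and ex: "\<And>c. c \<in> Ob C \<Longrightarrow> \<exists>b \<eta>. universal_arrow C D R c b \<eta>"
  shows "\<exists>L. is_left_adjoint C D L R"
proof -
  have D: "is_category D" using functor_category[OF R] by auto
  obtain b \<eta> where u: "\<And>c. c \<in> Ob C \<Longrightarrow> universal_arrow C D R c (b c) (\<eta> c)"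
    using ex by metis
  have b: "b c \<in> Ob D" and \<eta>: "\<eta> c \<in> Hom C c (FOb R (b c))" if "c \<in> Ob C" for c
    using u[OF that] by (auto simp: universal_arrow_def)
  have un: "\<exists>!f. f \<in> Hom D (b c) d \<and> Cmp C (FAr R f) (\<eta> c) = g"
    if "d \<in> Ob D" "g \<in> Hom C c (FOb R d)" "c \<in> Ob C" for c d g
    using u[OF that(3)] that by (auto simp: universal_arrow_def)
  have uneq: "f = f'" if "c \<in> Ob C" "f \<in> Hom D (b c) d" "f' \<in> Hom D (b c) d"
    "Cmp C (FAr R f) (\<eta> c) = Cmp C (FAr R f') (\<eta> c)" for c d f f'
    using un[OF _ Cmp_Hom[OF C \<eta>[OF that(1)] functor_Hom[OF R that(2)]] that(1)]
      Hom_Ob[OF D that(2)] that by metis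
  define l where "l f = (THE h. h \<in> Hom D (b (Src C f)) (b (Trg C f)) \<and>
     Cmp C (FAr R h) (\<eta> (Src C f)) = Cmp C (\<eta> (Trg C f)) f)" for f
  have l: "l f \<in> Hom D (b x) (b y) \<and> Cmp C (FAr R (l f)) (\<eta> x) = Cmp C (\<eta> y) f"
    if f: "f \<in> Hom C x y" for f x y
  proof -
    have xy: "x \<in> Ob C" "y \<in> Ob C" using Hom_Ob[OF C f] .
    show ?thesis
      using theI'[OF un[OF b[OF xy(2)] Cmp_Hom[OF C f \<eta>[OF xy(2)]] xy(1)]] HomD[OF f]
      by (simp add: l_def)
  qed
  define L where "L = \<lparr>FOb = b, FAr = l\<rparr>"
  have FL: "is_functor C D L" unfolding is_functor_def
  proof (intro conjI ballI impI)
    show "is_category C" "is_category D" by fact+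
    show "FOb L x \<in> Ob D" if "x \<in> Ob C" for x using b that by (simp add: L_def)
    show "FAr L f \<in> Hom D (FOb L (Src C f)) (FOb L (Trg C f))" if "f \<in> Ar C" for f
      using l[of f "Src C f" "Trg C f"] that by (simp add: L_def Hom_def)
    show "FAr L (Idn C x) = Idn D (FOb L x)" if x: "x \<in> Ob C" for x
    proof -
      have "Cmp C (FAr R (Idn D (b x))) (\<eta> x) = Cmp C (\<eta> x) (Idn C x)"
        using Cmp_Idn[OF C \<eta>[OF x]] functor_Idn[OF R b[OF x]] by simp
      then show ?thesis
        using uneq[OF x _ Idn_Hom[OF D b[OF x]]] l[OF Idn_Hom[OF C x]] by (simp add: L_def)
    qed
    fix f g assume fg: "f \<in> Ar C" "g \<in> Ar C" "Trg C f = Src C g"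
    define x y z where "x = Src C f" "y = Trg C f" "z = Trg C g"
    have f: "f \<in> Hom C x y" and g: "g \<in> Hom C y z" using fg by (auto simp: Hom_def x_y_z_def)
    have x: "x \<in> Ob C" and y: "y \<in> Ob C" and z: "z \<in> Ob C"
      using Hom_Ob[OF C f] Hom_Ob[OF C g] by auto
    have lf: "l f \<in> Hom D (b x) (b y)" and lg: "l g \<in> Hom D (b y) (b z)" using l f g by auto
    have "Cmp C (FAr R (Cmp D (l g) (l f))) (\<eta> x) = Cmp C (FAr R (l g)) (Cmp C (\<eta> y) f)"
      using functor_Cmp[OF R lf lg] Cmp_assoc[OF C \<eta>[OF x] functor_Hom[OF R lf] functor_Hom[OF R lg]]
        l[OF f] by simp
    also have "\<dots> = Cmp C (Cmp C (\<eta> z) g) f"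
      using Cmp_assoc[OF C f \<eta>[OF y] functor_Hom[OF R lg]] l[OF g] by simp
    also have "\<dots> = Cmp C (FAr R (l (Cmp C g f))) (\<eta> x)"
      using Cmp_assoc[OF C f g \<eta>[OF z]] l[OF Cmp_Hom[OF C f g]] by simp
    finally show "FAr L (Cmp C g f) = Cmp D (FAr L g) (FAr L f)"
      using uneq[OF x _ Cmp_Hom[OF D lf lg]] l[OF Cmp_Hom[OF C f g]] by (simp add: L_def)
  qed
  define \<Phi> where "\<Phi> c d g = Cmp C (FAr R g) (\<eta> c)" for c and d :: 'c and g
  have "bij_betw (\<Phi> c d) (Hom D (FOb L c) d) (Hom C c (FOb R d))"
    if c: "c \<in> Ob C" and d: "d \<in> Ob D" for c d
  proof (rule bij_betwI')
    fix f f' assume "f \<in> Hom D (FOb L c) d" "f' \<in> Hom D (FOb L c) d"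
    then show "\<Phi> c d f = \<Phi> c d f' \<longleftrightarrow> f = f'"
      using uneq[OF c] by (auto simp: \<Phi>_def L_def)
  next
    fix f assume "f \<in> Hom D (FOb L c) d"
    then show "\<Phi> c d f \<in> Hom C c (FOb R d)"
      using Cmp_Hom[OF C \<eta>[OF c]] functor_Hom[OF R] by (simp add: \<Phi>_def L_def)
  next
    fix g assume "g \<in> Hom C c (FOb R d)"
    then show "\<exists>f\<in>Hom D (FOb L c) d. g = \<Phi> c d f"
      using un[OF d _ c] unfolding \<Phi>_def L_def by (simp; blast)
  qed
  moreover have "\<Phi> (Src C f) d (Cmp D g (FAr L f)) = Cmp C (\<Phi> (Trg C f) d g) f"
    if "f \<in> Ar C" "d \<in> Ob D" "g \<in> Hom D (FOb L (Trg C f)) d" for f d g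
  proof -
    define x y where "x = Src C f" "y = Trg C f"
    have f: "f \<in> Hom C x y" using that by (auto simp: Hom_def x_y_def)
    have x: "x \<in> Ob C" and y: "y \<in> Ob C" using Hom_Ob[OF C f] by auto
    have g: "g \<in> Hom D (b y) d" using that by (simp add: x_y_def L_def)
    have "Cmp C (FAr R (Cmp D g (l f))) (\<eta> x) = Cmp C (FAr R g) (Cmp C (\<eta> y) f)"
      using functor_Cmp[OF R _ g] l[OF f]
        Cmp_assoc[OF C \<eta>[OF x] functor_Hom[OF R] functor_Hom[OF R g]] by metis
    also have "\<dots> = Cmp C (Cmp C (FAr R g) (\<eta> y)) f"
      using Cmp_assoc[OF C f \<eta>[OF y] functor_Hom[OF R g]] by simp
    finally show ?thesis by (simp add: \<Phi>_def L_def x_y_def)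
  qed
  moreover have "\<Phi> c (Trg D f) (Cmp D f g) = Cmp C (FAr R f) (\<Phi> c (Src D f) g)"
    if "c \<in> Ob C" "f \<in> Ar D" "g \<in> Hom D (FOb L c) (Src D f)" for c f g
  proof -
    have f: "f \<in> Hom D (Src D f) (Trg D f)" using that by (simp add: Hom_def)
    have g: "g \<in> Hom D (b c) (Src D f)" using that by (simp add: L_def)
    show ?thesis unfolding \<Phi>_def
      using functor_Cmp[OF R g f]
        Cmp_assoc[OF C \<eta>[OF that(1)] functor_Hom[OF R g] functor_Hom[OF R f]] by simp
  qed
  ultimately have "is_left_adjoint C D L R"
    using FL R unfolding is_left_adjoint_def by blast
  then show ?thesis ..
qed

lemma left_adjoint_universal_arrow:
  assumes "is_left_adjoint C D L R" "c \<in> Ob C"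
  shows "\<exists>\<eta>. universal_arrow C D R c (FOb L c) \<eta>"
proof -
  have L: "is_functor C D L" and R: "is_functor D C R" using assms by (auto simp: is_left_adjoint_def)
  have C: "is_category C" and D: "is_category D" using functor_category[OF R] by auto
  obtain \<Phi> where b: "\<And>d. d \<in> Ob D \<Longrightarrow> bij_betw (\<Phi> c d) (Hom D (FOb L c) d) (Hom C c (FOb R d))"
    and n: "\<And>f g. f \<in> Ar D \<Longrightarrow> g \<in> Hom D (FOb L c) (Src D f) \<Longrightarrow>
        \<Phi> c (Trg D f) (Cmp D f g) = Cmp C (FAr R f) (\<Phi> c (Src D f) g)"
    using assms unfolding is_left_adjoint_def by blast
  have Lc: "FOb L c \<in> Ob D" using functor_Ob[OF L assms(2)] .
  define \<eta> where "\<eta> = \<Phi> c (FOb L c) (Idn D (FOb L c))"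
  have eq: "Cmp C (FAr R f) \<eta> = \<Phi> c d f" if "f \<in> Hom D (FOb L c) d" for d f
    using n[of f "Idn D (FOb L c)"] Idn_Hom[OF D Lc] HomD[OF that] Cmp_Idn[OF D that]
    by (simp add: \<eta>_def)
  have "\<eta> \<in> Hom C c (FOb R (FOb L c))"
    using bij_betwE[OF b[OF Lc]] Idn_Hom[OF D Lc] by (simp add: \<eta>_def)
  moreover have "\<exists>!f. f \<in> Hom D (FOb L c) d \<and> Cmp C (FAr R f) \<eta> = g"
    if "d \<in> Ob D" "g \<in> Hom C c (FOb R d)" for d g
  proof -
    have "g \<in> \<Phi> c d ` Hom D (FOb L c) d"
      using bij_betw_imp_surj_on[OF b[OF that(1)]] that(2) by simp
    then have "\<exists>!f. f \<in> Hom D (FOb L c) d \<and> \<Phi> c d f = g"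
      using bij_betw_imp_inj_on[OF b[OF that(1)]] by (auto dest: inj_onD)
    then show ?thesis using eq by metis
  qed
  ultimately show ?thesis using Lc unfolding universal_arrow_def by blast
qed

lemma universal_arrow_unique:
  assumes R: "is_functor D C R"
    and u: "universal_arrow C D R c b \<eta>" and u': "universal_arrow C D R c b' \<eta>'"
  obtains i i' where "i \<in> Hom D b b'" "i' \<in> Hom D b' b"
    "Cmp D i' i = Idn D b" "Cmp D i i' = Idn D b'"
proof -
  have C: "is_category C" and D: "is_category D" using functor_category[OF R] by auto
  have b: "b \<in> Ob D" "b' \<in> Ob D" and \<eta>: "\<eta> \<in> Hom C c (FOb R b)" "\<eta>' \<in> Hom C c (FOb R b')"
    using u u' by (auto simp: universal_arrow_def)
  obtain i where i: "i \<in> Hom D b b'" "Cmp C (FAr R i) \<eta> = \<eta>'"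
    using u b \<eta> unfolding universal_arrow_def by metis
  obtain i' where i': "i' \<in> Hom D b' b" "Cmp C (FAr R i') \<eta>' = \<eta>"
    using u' b \<eta> unfolding universal_arrow_def by metis
  have inv: "Cmp D j' j = Idn D x"
    if x: "universal_arrow C D R c x e" and y: "e' \<in> Hom C c (FOb R y)"
      and j: "j \<in> Hom D x y" "Cmp C (FAr R j) e = e'" and j': "j' \<in> Hom D y x" "Cmp C (FAr R j') e' = e"
    for j j' x y e e'
  proof -
    have xo: "x \<in> Ob D" and e: "e \<in> Hom C c (FOb R x)" using x by (auto simp: universal_arrow_def)
    have "Cmp C (FAr R (Cmp D j' j)) e = e"
      using functor_Cmp[OF R j(1) j'(1)] Cmp_assoc[OF C e functor_Hom[OF R j(1)] functor_Hom[OF R j'(1)]]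
        j j' by simp
    moreover have "Cmp C (FAr R (Idn D x)) e = e"
      using functor_Idn[OF R xo] Cmp_Idn[OF C e] by simp
    ultimately show ?thesis
      using x xo e Cmp_Hom[OF D j(1) j'(1)] Idn_Hom[OF D xo] unfolding universal_arrow_def by metis
  qed
  show thesis
    using that[OF i(1) i'(1)] inv[OF u \<eta>(2) i i'] inv[OF u' \<eta>(1) i' i] by blast
qed

section \<open>Fibres, blocks and permutations\<close>

lemma offset_0 [simp]: "offset ns 0 = 0"
  by (simp add: offset_def)

lemma offset_Suc: "i < length ns \<Longrightarrow> offset ns (Suc i) = offset ns i + ns ! i"
  by (simp add: offset_def take_Suc_conv_app_nth)

lemma offset_Cons_Suc [simp]: "offset (n # ns) (Suc i) = n + offset ns i"
  by (simp add: offset_def)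

lemma offset_length: "offset ns (length ns) = sum_list ns"
  by (simp add: offset_def)

lemma offset_mono: "i \<le> i' \<Longrightarrow> offset ns i \<le> offset ns i'"
  by (induction ns arbitrary: i i') (auto simp: offset_def take_Cons split: nat.splits)

lemma offset_less:
  assumes "i < i'" "i < length ns" "j < ns ! i"
  shows "offset ns i + j < offset ns i'"
  using offset_mono[of "Suc i" i' ns] assms by (simp add: offset_Suc)

lemma offset_bound: "i < length ns \<Longrightarrow> j < ns ! i \<Longrightarrow> offset ns i + j < sum_list ns"
  using offset_less[of i "length ns" ns j] by (simp add: offset_length)

lemma offset_inj:
  assumes "offset ns i + j = offset ns i' + j'" "i < length ns" "j < ns ! i" "i' < length ns" "j' < ns ! i'"
  shows "i = i' \<and> j = j'"
  using offset_less[of i i' ns j] offset_less[of i' i ns j'] assms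
  by (metis add_left_cancel linorder_neqE_nat not_add_less1)

text \<open>Below, a position in a list of blocks is always given by its block \<open>i\<close> and its place \<open>j\<close> in the
  block; \<open>sum_perm\<close> and \<open>block_perm\<close> have simple formulas in these coordinates.\<close>

lemma offset_cases:
  assumes "p < sum_list ns"
  obtains i j where "i < length ns" "j < ns ! i" "p = offset ns i + j"
proof -
  have "\<exists>i j. i < length ns \<and> j < ns ! i \<and> p = offset ns i + j" using assms
  proof (induction ns arbitrary: p)
    case (Cons n ns)
    show ?case
    proof (cases "p < n")
      case True
      then have "0 < length (n # ns) \<and> p < (n # ns) ! 0 \<and> p = offset (n # ns) 0 + p" by simp
      then show ?thesis by blast
    next
      case False
      then have "p - n < sum_list ns" using Cons.prems by auto
      then obtain i j where "i < length ns" "j < ns ! i" "p - n = offset ns i + j"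
        using Cons.IH by blast
      then have "Suc i < length (n # ns) \<and> j < (n # ns) ! Suc i \<and> p = offset (n # ns) (Suc i) + j"
        using False by simp
      then show ?thesis by blast
    qed
  qed simp
  then show thesis using that by blast
qed

lemma concat_nth_offset:
  assumes "i < length xss" "j < length (xss ! i)"
  shows "concat xss ! (offset (map length xss) i + j) = xss ! i ! j"
  using assms
proof (induction xss arbitrary: i)
  case (Cons xs xss)
  then show ?case by (cases i) (auto simp: nth_append)
qed simp

lemma blocks_nth:
  assumes "\<And>i. i < length ns \<Longrightarrow> m i = ns ! i" "i < length ns" "j < ns ! i"
  shows "concat (map (\<lambda>i. map (f i) [0..<m i]) [0..<length ns]) ! (offset ns i + j) = f i j"
proof -
  let ?xss = "map (\<lambda>i. map (f i) [0..<m i]) [0..<length ns]"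
  have "map length ?xss = ns" by (rule nth_equalityI) (simp_all add: assms(1))
  then show ?thesis using concat_nth_offset[of i ?xss j] assms by simp
qed

lemma blocks_length:
  assumes "\<And>i. i < length ns \<Longrightarrow> m i = ns ! i"
  shows "length (concat (map (\<lambda>i. map (f i) [0..<m i]) [0..<length ns])) = sum_list ns"
proof -
  have "map (\<lambda>i. length (map (f i) [0..<m i])) [0..<length ns] = ns"
    by (rule nth_equalityI) (simp_all add: assms)
  then show ?thesis by (simp only: length_concat map_map comp_def)
qed

lemma permutes_lessThanI:
  assumes "\<And>x. x < n \<Longrightarrow> f x < n" "inj_on f {..<n}" "\<And>x. \<not> x < n \<Longrightarrow> f x = x"
  shows "f permutes {..<(n :: nat)}"
proof (rule bij_imp_permutes)
  have "f ` {..<n} \<subseteq> {..<n}" using assms(1) by auto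
  then show "bij_betw f {..<n} {..<n}"
    unfolding bij_betw_def using assms(2) endo_inj_surj[OF finite_lessThan] by blast
qed (use assms(3) in auto)

lemma sum_perm_apply:
  "i < length ns \<Longrightarrow> j < ns ! i \<Longrightarrow> sum_perm ns ts (offset ns i + j) = offset ns i + (ts ! i) j"
  using blocks_nth[of ns "\<lambda>i. ns ! i" i j "\<lambda>i j. offset ns i + (ts ! i) j"]
    blocks_length[of ns "\<lambda>i. ns ! i" "\<lambda>i j. offset ns i + (ts ! i) j"] offset_bound[of i ns j]
  by (simp add: sum_perm_def perm_of_list_def)

lemma sum_perm_outside: "\<not> x < sum_list ns \<Longrightarrow> sum_perm ns ts x = x"
  using blocks_length[of ns "\<lambda>i. ns ! i" "\<lambda>i j. offset ns i + (ts ! i) j"]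
  by (simp add: sum_perm_def perm_of_list_def)

lemma sum_perm_permutes:
  assumes "\<And>i. i < length ns \<Longrightarrow> ts ! i permutes {..<ns ! i}"
  shows "sum_perm ns ts permutes {..<sum_list ns}"
proof (rule permutes_lessThanI)
  have t: "(ts ! i) j < ns ! i" if "i < length ns" "j < ns ! i" for i j
    using permutes_in_image[OF assms[OF that(1)], of j] that by simp
  show "sum_perm ns ts x < sum_list ns" if "x < sum_list ns" for x
    using that by (elim offset_cases) (simp add: sum_perm_apply offset_bound t)
  show "inj_on (sum_perm ns ts) {..<sum_list ns}"
  proof (rule inj_onI)
    fix x y assume xy: "x \<in> {..<sum_list ns}" "y \<in> {..<sum_list ns}" "sum_perm ns ts x = sum_perm ns ts y"
    obtain i j where ij: "i < length ns" "j < ns ! i" "x = offset ns i + j"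
      using offset_cases xy by blast
    obtain i' j' where ij': "i' < length ns" "j' < ns ! i'" "y = offset ns i' + j'"
      using offset_cases xy by blast
    have "offset ns i + (ts ! i) j = offset ns i' + (ts ! i') j'"
      using xy ij ij' by (simp add: sum_perm_apply)
    then have "i = i' \<and> (ts ! i) j = (ts ! i') j'"
      by (rule offset_inj) (use ij ij' t in auto)
    then show "x = y" using ij ij' permutes_inj[OF assms[OF ij(1)]] by (auto dest: injD)
  qed
qed (rule sum_perm_outside)

lemma sum_perm_id: "sum_perm ns (map (\<lambda>i. id) [0..<length ns]) = id"
proof
  fix x show "sum_perm ns (map (\<lambda>i. id) [0..<length ns]) x = id x"
    by (cases "x < sum_list ns") (auto elim!: offset_cases simp: sum_perm_apply sum_perm_outside)
qed

lemma sum_perm_inv: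
  assumes "\<And>i. i < length ns \<Longrightarrow> ts ! i permutes {..<ns ! i}"
  shows "sum_perm ns (map (\<lambda>i. inv (ts ! i)) [0..<length ns]) = inv (sum_perm ns ts)"
proof -
  have "sum_perm ns (map (\<lambda>i. inv (ts ! i)) [0..<length ns]) x = inv (sum_perm ns ts) x" for x
  proof (rule sym, rule inv_f_eq)
    show "inj (sum_perm ns ts)" using permutes_inj[OF sum_perm_permutes[OF assms]] by simp
    show "sum_perm ns ts (sum_perm ns (map (\<lambda>i. inv (ts ! i)) [0..<length ns]) x) = x"
    proof (cases "x < sum_list ns")
      case True
      then obtain i j where ij: "i < length ns" "j < ns ! i" "x = offset ns i + j"
        using offset_cases by blast
      have "inv (ts ! i) j < ns ! i"
        using permutes_in_image[OF permutes_inv[OF assms[OF ij(1)]], of j] ij by simp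
      then show ?thesis using ij permutes_inverses[OF assms[OF ij(1)]] by (simp add: sum_perm_apply)
    next
      case False
      then show ?thesis by (simp add: sum_perm_outside)
    qed
  qed
  then show ?thesis by blast
qed

lemma sum_list_permute_list:
  "\<rho> permutes {..<length ns} \<Longrightarrow> sum_list (permute_list \<rho> ns) = sum_list (ns :: nat list)"
  by (metis mset_permute_list sum_mset_sum_list)

lemma block_perm_apply:
  assumes "\<rho> permutes {..<length ns}" "i < length ns" "j < ns ! \<rho> i"
  shows "block_perm \<rho> ns (offset (permute_list \<rho> ns) i + j) = offset ns (\<rho> i) + j"
proof -
  have nth: "permute_list \<rho> ns ! i = ns ! \<rho> i" if "i < length ns" for i
    using that assms(1) by (simp add: permute_list_nth)
  show ?thesis
    using blocks_nth[of "permute_list \<rho> ns" "\<lambda>i. ns ! \<rho> i" i j "\<lambda>i j. offset ns (\<rho> i) + j"]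
      blocks_length[of "permute_list \<rho> ns" "\<lambda>i. ns ! \<rho> i" "\<lambda>i j. offset ns (\<rho> i) + j"]
      offset_bound[of i "permute_list \<rho> ns" j] assms
    by (simp add: block_perm_def perm_of_list_def nth)
qed

lemma block_perm_outside:
  assumes "\<rho> permutes {..<length ns}" "\<not> x < sum_list ns"
  shows "block_perm \<rho> ns x = x"
proof -
  have nth: "permute_list \<rho> ns ! i = ns ! \<rho> i" if "i < length ns" for i
    using that assms(1) by (simp add: permute_list_nth)
  show ?thesis
    using blocks_length[of "permute_list \<rho> ns" "\<lambda>i. ns ! \<rho> i" "\<lambda>i j. offset ns (\<rho> i) + j"]
      assms sum_list_permute_list[OF assms(1)]
    by (simp add: block_perm_def perm_of_list_def nth)
qed

lemma block_perm_permutes: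
  assumes \<rho>: "\<rho> permutes {..<length ns}"
  shows "block_perm \<rho> ns permutes {..<sum_list ns}"
proof (rule permutes_lessThanI)
  have \<rho>l: "\<rho> i < length ns \<longleftrightarrow> i < length ns" for i using permutes_in_image[OF \<rho>, of i] by simp
  have nth: "permute_list \<rho> ns ! i = ns ! \<rho> i" if "i < length ns" for i
    using that \<rho> by (simp add: permute_list_nth)
  have sl: "sum_list (permute_list \<rho> ns) = sum_list ns" by (rule sum_list_permute_list[OF \<rho>])
  have ex: "\<exists>i j. i < length ns \<and> j < ns ! \<rho> i \<and> x = offset (permute_list \<rho> ns) i + j"
    if "x < sum_list ns" for x
    using offset_cases[of x "permute_list \<rho> ns"] that nth unfolding sl by (metis length_permute_list)
  show "block_perm \<rho> ns x < sum_list ns" if "x < sum_list ns" for x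
    using ex[OF that] by (auto simp: block_perm_apply[OF \<rho>] offset_bound \<rho>l)
  show "inj_on (block_perm \<rho> ns) {..<sum_list ns}"
  proof (rule inj_onI)
    fix x y assume xy: "x \<in> {..<sum_list ns}" "y \<in> {..<sum_list ns}" "block_perm \<rho> ns x = block_perm \<rho> ns y"
    obtain i j where ij: "i < length ns" "j < ns ! \<rho> i" "x = offset (permute_list \<rho> ns) i + j"
      using ex[of x] xy by auto
    obtain i' j' where ij': "i' < length ns" "j' < ns ! \<rho> i'" "y = offset (permute_list \<rho> ns) i' + j'"
      using ex[of y] xy by auto
    have "offset ns (\<rho> i) + j = offset ns (\<rho> i') + j'"
      using xy ij ij' by (simp add: block_perm_apply[OF \<rho>])
    then have "\<rho> i = \<rho> i' \<and> j = j'"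
      by (rule offset_inj) (use ij ij' \<rho>l in auto)
    then show "x = y" using ij ij' permutes_inj[OF \<rho>] by (auto dest: injD)
  qed
qed (rule block_perm_outside[OF \<rho>])

lemma block_perm_id: "block_perm id ns = id"
proof
  fix x show "block_perm id ns x = id x"
  proof (cases "x < sum_list ns")
    case True
    then obtain i j where "i < length ns" "j < ns ! i" "x = offset ns i + j" using offset_cases by blast
    then show ?thesis using block_perm_apply[of id ns i j] by (simp add: permutes_id)
  next
    case False
    then show ?thesis using block_perm_outside[of id ns x] by (simp add: permutes_id)
  qed
qed

lemma offset_replicate_1: "i \<le> k \<Longrightarrow> offset (replicate k 1) i = i"
  by (simp add: offset_def sum_list_replicate)

lemma block_perm_ones:
  assumes "\<rho> permutes {..<k}"
  shows "block_perm \<rho> (replicate k 1) = \<rho>"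
proof
  fix x show "block_perm \<rho> (replicate k 1) x = \<rho> x"
  proof (cases "x < k")
    case True
    then have \<rho>x: "\<rho> x < k" using permutes_in_image[OF assms, of x] by simp
    have "permute_list \<rho> (replicate k 1) = replicate k (1 :: nat)"
      using permutes_in_image[OF assms] by (auto simp: list_eq_iff_nth_eq permute_list_def)
    then show ?thesis
      using block_perm_apply[of \<rho> "replicate k 1" x 0] assms True \<rho>x
      by (simp add: offset_replicate_1[simplified])
  next
    case False
    then show ?thesis
      using block_perm_outside[of \<rho> "replicate k 1" x] assms permutes_not_in[OF assms, of x]
      by (simp add: sum_list_replicate)
  qed
qed

definition fibre_sizes :: "nat list \<Rightarrow> nat \<Rightarrow> nat list" where
  "fibre_sizes s k = map (\<lambda>i. length (fibre_elems s i)) [0..<k]"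

lemma length_fibre_sizes [simp]: "length (fibre_sizes s k) = k"
  by (simp add: fibre_sizes_def)

lemma fibre_sizes_nth [simp]: "i < k \<Longrightarrow> fibre_sizes s k ! i = length (fibre_elems s i)"
  by (simp add: fibre_sizes_def)

lemma fin_maps_nth: "s \<in> fin_maps n k \<Longrightarrow> x < n \<Longrightarrow> s ! x < k"
  unfolding fin_maps_def using nth_mem[of x s] by blast

lemma fin_maps_length: "s \<in> fin_maps n k \<Longrightarrow> length s = n"
  by (auto simp: fin_maps_def)

lemma fin_mapsI: "length s = n \<Longrightarrow> (\<And>x. x < n \<Longrightarrow> s ! x < k) \<Longrightarrow> s \<in> fin_maps n k"
  by (auto simp: fin_maps_def in_set_conv_nth)

lemma fin_comp_fin_maps: "s \<in> fin_maps n k \<Longrightarrow> w \<in> fin_maps k l \<Longrightarrow> fin_comp w s \<in> fin_maps n l"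
  by (rule fin_mapsI) (auto simp: fin_comp_def fin_maps_length fin_maps_nth)

lemma fin_comp_nth: "s \<in> fin_maps n k \<Longrightarrow> x < n \<Longrightarrow> fin_comp w s ! x = w ! (s ! x)"
  by (simp add: fin_comp_def fin_maps_length)

lemma set_fibre_elems: "set (fibre_elems s i) = {x. x < length s \<and> s ! x = i}"
  by (auto simp: fibre_elems_def)

lemma sorted_fibre_elems: "sorted_wrt (<) (fibre_elems s i)"
  by (simp add: fibre_elems_def sorted_wrt_filter)

lemma distinct_fibre_elems: "distinct (fibre_elems s i)"
  by (simp add: fibre_elems_def)

lemma length_fibre_elems: "length (fibre_elems s i) = card {x. x < length s \<and> s ! x = i}"
  using distinct_card[OF distinct_fibre_elems, of s i] by (simp add: set_fibre_elems)

lemma rank_nth: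
  assumes "sorted_wrt (<) xs" "i < length xs"
  shows "rank xs (xs ! i) = i"
proof -
  have "{z \<in> set xs. z < xs ! i} = set (take i xs)"
  proof (intro equalityI subsetI)
    fix z assume "z \<in> {z \<in> set xs. z < xs ! i}"
    then obtain j where j: "j < length xs" "z = xs ! j" "xs ! j < xs ! i" by (auto simp: in_set_conv_nth)
    then have "\<not> i < j" "j \<noteq> i" using sorted_wrt_nth_less[OF assms(1), of i j] by auto
    then have "take i xs ! j = z" "j < length (take i xs)" using j assms(2) by auto
    then show "z \<in> set (take i xs)" using nth_mem by metis
  next
    fix z assume "z \<in> set (take i xs)"
    then obtain j where "j < i" "z = xs ! j" using assms(2) by (auto simp: in_set_conv_nth)
    then show "z \<in> {z \<in> set xs. z < xs ! i}" using sorted_wrt_nth_less[OF assms(1), of j i] assms(2) by auto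
  qed
  then have "rank xs (xs ! i) = card (set (take i xs))" by (simp add: rank_def)
  then show ?thesis
    using assms by (simp add: distinct_card strict_sorted_iff)
qed

lemma nth_rank:
  assumes "sorted_wrt (<) xs" "x \<in> set xs"
  shows "rank xs x < length xs" "xs ! rank xs x = x"
  using assms rank_nth by (auto simp: in_set_conv_nth)

lemma rank_less: "x \<in> set xs \<Longrightarrow> x < y \<Longrightarrow> rank xs x < rank xs y"
  unfolding rank_def by (rule psubset_card_mono) auto

lemma rank_mono: "x \<le> y \<Longrightarrow> rank xs x \<le> rank xs y"
  unfolding rank_def by (rule card_mono) auto

lemma rank_fibre_elems:
  assumes "x < length s" "s ! x = i"
  shows "rank (fibre_elems s i) x = card {y. y < x \<and> s ! y = i}"
  unfolding rank_def set_fibre_elems using assms by (intro arg_cong[of _ _ card]) auto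

lemma offset_fibre_sizes:
  assumes "i \<le> k"
  shows "offset (fibre_sizes s k) i = card {y. y < length s \<and> s ! y < i}"
  using assms
proof (induction i)
  case (Suc i)
  have "{y. y < length s \<and> s ! y < Suc i} =
      {y. y < length s \<and> s ! y < i} \<union> {y. y < length s \<and> s ! y = i}" by auto
  moreover have "card ({y. y < length s \<and> s ! y < i} \<union> {y. y < length s \<and> s ! y = i}) =
      card {y. y < length s \<and> s ! y < i} + card {y. y < length s \<and> s ! y = i}"
    by (rule card_Un_disjoint) auto
  ultimately show ?case using Suc by (simp add: offset_Suc length_fibre_elems)
qed simp

lemma sum_fibre_sizes:
  assumes "s \<in> fin_maps n k"
  shows "sum_list (fibre_sizes s k) = n"
proof -
  have "{y. y < length s \<and> s ! y < k} = {..<n}"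
    using assms by (auto simp: fin_maps_length fin_maps_nth)
  then show ?thesis
    using offset_fibre_sizes[of k k s] offset_length[of "fibre_sizes s k"] by simp
qed

text \<open>\<open>\<pi>(s)\<close> lists the fibres of \<open>s\<close> one after the other: \<open>x\<close> goes to the block of \<open>s x\<close>, at the place
  given by its rank in the fibre.\<close>

lemma fibre_perm_offset:
  assumes "s \<in> fin_maps n k" "x < n"
  shows "fibre_perm s x = offset (fibre_sizes s k) (s ! x) + rank (fibre_elems s (s ! x)) x"
    and "rank (fibre_elems s (s ! x)) x < fibre_sizes s k ! (s ! x)"
proof -
  have l: "length s = n" and k: "s ! x < k" using assms by (auto simp: fin_maps_length fin_maps_nth)
  show "fibre_perm s x = offset (fibre_sizes s k) (s ! x) + rank (fibre_elems s (s ! x)) x"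
    using k l assms(2) by (simp add: fibre_perm_def offset_fibre_sizes rank_fibre_elems)
  show "rank (fibre_elems s (s ! x)) x < fibre_sizes s k ! (s ! x)"
    using k l assms(2) nth_rank(1)[OF sorted_fibre_elems, of x s "s ! x"] by (simp add: set_fibre_elems)
qed

lemma fibre_perm_factorisation: "\<exists>r. is_factorisation s r (fibre_perm s)"
  using fibre_perm_unique by blast

lemma fibre_perm_permutes: "length s = n \<Longrightarrow> fibre_perm s permutes {..<n}"
  using fibre_perm_factorisation[of s] by (auto simp: is_factorisation_def)

lemma fin_maps_perm: "s \<in> fin_maps n k \<Longrightarrow> fibre_perm s permutes {..<n}"
  by (rule fibre_perm_permutes[OF fin_maps_length])

lemma fibre_perm_sorted: "sorted s \<Longrightarrow> fibre_perm s = id"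
proof -
  assume "sorted s"
  then have "is_factorisation s s id" by (simp add: is_factorisation_def permutes_id)
  then show ?thesis using fibre_perm_unique by metis
qed

lemma fibre_perm_of_perm:
  assumes "p permutes {..<n}"
  shows "fibre_perm (map p [0..<n]) = p"
proof -
  have pn: "p x < n \<longleftrightarrow> x < n" for x using permutes_in_image[OF assms, of x] by simp
  have "is_factorisation (map p [0..<n]) [0..<n] p"
    unfolding is_factorisation_def
  proof (intro conjI allI impI)
    show "p x \<le> p y" if "x \<le> y \<and> y < length (map p [0..<n]) \<and> map p [0..<n] ! x = map p [0..<n] ! y" for x y
      using that by auto
  qed (use assms pn in simp_all)
  then show ?thesis using fibre_perm_unique by metis
qed

lemma fibre_perm_less:
  assumes "s \<in> fin_maps n k" "x < n" "y < n" "s ! y < s ! x \<or> s ! y = s ! x \<and> y < x"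
  shows "fibre_perm s y < fibre_perm s x"
proof -
  have k: "s ! x < k" "s ! y < k" using assms by (auto simp: fin_maps_nth)
  show ?thesis
  proof (cases "s ! y < s ! x")
    case True
    then show ?thesis
      using fibre_perm_offset[OF assms(1,2)] fibre_perm_offset[OF assms(1,3)] k
        offset_less[OF True, of "fibre_sizes s k" "rank (fibre_elems s (s ! y)) y"]
      by simp
  next
    case False
    then have "rank (fibre_elems s (s ! x)) y < rank (fibre_elems s (s ! x)) x"
      using assms by (intro rank_less) (auto simp: set_fibre_elems fin_maps_length)
    then show ?thesis
      using fibre_perm_offset[OF assms(1,2)] fibre_perm_offset[OF assms(1,3)] assms False by simp
  qed
qed

text \<open>A permutation that sorts \<open>[n]\<close> along \<open>R\<close> sends \<open>x\<close> to the number of its predecessors.\<close>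

lemma permutes_eq_if_monotone:
  assumes p: "p permutes {..<(n::nat)}" and q: "q permutes {..<n}"
    and pm: "\<And>x y. x < n \<Longrightarrow> y < n \<Longrightarrow> R y x \<Longrightarrow> p y < p x"
    and qm: "\<And>x y. x < n \<Longrightarrow> y < n \<Longrightarrow> R y x \<Longrightarrow> q y < q x"
    and tot: "\<And>x y. x < n \<Longrightarrow> y < n \<Longrightarrow> R x y \<or> x = y \<or> R y x"
  shows "p = q"
proof -
  have c: "f x = card {y. y < n \<and> R y x}"
    if f: "f permutes {..<n}" and m: "\<And>x y. x < n \<Longrightarrow> y < n \<Longrightarrow> R y x \<Longrightarrow> f y < f x" and x: "x < n" for f x
  proof -
    have fn: "f y < n \<longleftrightarrow> y < n" for y using permutes_in_image[OF f, of y] by simp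
    have "{z. z < f x} = f ` {y. y < n \<and> R y x}"
    proof
      show "f ` {y. y < n \<and> R y x} \<subseteq> {z. z < f x}" using m x by auto
      show "{z. z < f x} \<subseteq> f ` {y. y < n \<and> R y x}"
      proof
        fix z assume z: "z \<in> {z. z < f x}"
        obtain y where y: "f y = z" using permutes_surj[OF f] by (metis surjD)
        have yn: "y < n" using fn[of x] fn[of y] x y z by simp
        then have "R y x" using tot[OF x yn] m[OF yn x] y z by auto
        then show "z \<in> f ` {y. y < n \<and> R y x}" using y yn by auto
      qed
    qed
    then have "card {z. z < f x} = card (f ` {y. y < n \<and> R y x})" by simp
    also have "\<dots> = card {y. y < n \<and> R y x}"
      by (rule card_image) (metis inj_on_subset permutes_inj[OF f] subset_UNIV)
    finally show ?thesis by simp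
  qed
  show ?thesis
  proof
    fix x show "p x = q x"
      using c[OF p pm] c[OF q qm] permutes_not_in[OF p, of x] permutes_not_in[OF q, of x]
      by (cases "x < n") auto
  qed
qed

subsection \<open>Composable pairs of maps\<close>

lemma length_induced: "length (induced s w i) = length (fibre_elems (fin_comp w s) i)"
  by (simp add: induced_def)

lemma induced_fin_maps:
  assumes "s \<in> fin_maps n k" "w \<in> fin_maps k l"
  shows "induced s w i \<in> fin_maps (length (fibre_elems (fin_comp w s) i)) (length (fibre_elems w i))"
proof (rule fin_mapsI)
  fix x assume "x < length (fibre_elems (fin_comp w s) i)"
  then have "fibre_elems (fin_comp w s) i ! x \<in> {x. x < n \<and> w ! (s ! x) = i}" (is "?x \<in> _")
    using nth_mem[of x "fibre_elems (fin_comp w s) i"] assms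
    unfolding set_fibre_elems by (auto simp: fin_comp_nth fin_maps_length[OF fin_comp_fin_maps])
  then have "s ! ?x \<in> set (fibre_elems w i)"
    using assms by (auto simp: set_fibre_elems fin_maps_nth fin_maps_length)
  then show "induced s w i ! x < length (fibre_elems w i)"
    using nth_rank(1)[OF sorted_fibre_elems] \<open>x < _\<close> by (simp add: induced_def)
qed (simp add: length_induced)

lemma induced_rank:
  assumes "s \<in> fin_maps n k" "w \<in> fin_maps k l" "x < n" "w ! (s ! x) = i"
  shows "induced s w i ! rank (fibre_elems (fin_comp w s) i) x = rank (fibre_elems w i) (s ! x)"
    and "rank (fibre_elems (fin_comp w s) i) x < length (fibre_elems (fin_comp w s) i)"
proof -
  have x: "x \<in> set (fibre_elems (fin_comp w s) i)"
    using assms by (simp add: set_fibre_elems fin_comp_nth fin_maps_length[OF fin_comp_fin_maps])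
  show "rank (fibre_elems (fin_comp w s) i) x < length (fibre_elems (fin_comp w s) i)"
    using nth_rank(1)[OF sorted_fibre_elems x] .
  then show "induced s w i ! rank (fibre_elems (fin_comp w s) i) x = rank (fibre_elems w i) (s ! x)"
    using nth_rank(2)[OF sorted_fibre_elems x] by (simp add: induced_def)
qed

lemma length_fibre_induced:
  assumes "s \<in> fin_maps n k" "w \<in> fin_maps k l" "x < k" "w ! x = i"
  shows "length (fibre_elems (induced s w i) (rank (fibre_elems w i) x)) = length (fibre_elems s x)"
proof -
  let ?F = "fibre_elems (fin_comp w s) i" and ?r = "rank (fibre_elems w i)"
  have xw: "x \<in> set (fibre_elems w i)" using assms by (simp add: set_fibre_elems fin_maps_length)
  have "length (fibre_elems (induced s w i) (?r x)) =
      length (filter (\<lambda>y. ?r (s ! (?F ! y)) = ?r x) [0..<length ?F])"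
    unfolding fibre_elems_def[of "induced s w i"] length_induced
    by (intro arg_cong[of _ _ length] filter_cong) (auto simp: induced_def)
  also have "\<dots> = length (filter (\<lambda>z. ?r (s ! z) = ?r x) (map ((!) ?F) [0..<length ?F]))"
    by (simp add: filter_map comp_def)
  also have "\<dots> = length (filter (\<lambda>z. ?r (s ! z) = ?r x) ?F)"
    by (simp only: map_nth)
  also have "filter (\<lambda>z. ?r (s ! z) = ?r x) ?F = filter (\<lambda>z. s ! z = x) ?F"
  proof (rule filter_cong)
    fix z assume "z \<in> set ?F"
    then have "s ! z \<in> set (fibre_elems w i)"
      using assms by (auto simp: set_fibre_elems fin_comp_nth fin_maps_nth fin_maps_length
          fin_maps_length[OF fin_comp_fin_maps])
    then show "?r (s ! z) = ?r x \<longleftrightarrow> s ! z = x"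
      using nth_rank(2)[OF sorted_fibre_elems xw] nth_rank(2)[OF sorted_fibre_elems] by metis
  qed simp
  also have "\<dots> = fibre_elems s x"
    unfolding fibre_elems_def filter_filter using assms
    by (auto simp: fin_maps_length[OF fin_comp_fin_maps] fin_maps_length fin_comp_nth intro!: filter_cong)
  finally show ?thesis .
qed

text \<open>When \<open>[k]\<close> is listed along the fibres of \<open>w\<close>, the element at place \<open>p\<close> is \<open>\<pi>(w)\<inverse> p\<close>, and at this
  place the induced maps have the fibre of \<open>s\<close> over that element.\<close>

lemma concat_induced_sizes:
  assumes s: "s \<in> fin_maps n k" and w: "w \<in> fin_maps k l"
  shows "concat (map (\<lambda>i. fibre_sizes (induced s w i) (length (fibre_elems w i))) [0..<l]) =
    permute_list (inv (fibre_perm w)) (fibre_sizes s k)"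
proof (rule nth_equalityI)
  let ?xss = "map (\<lambda>i. fibre_sizes (induced s w i) (length (fibre_elems w i))) [0..<l]"
  have ml: "map length ?xss = fibre_sizes w l" by (simp add: list_eq_iff_nth_eq)
  have wp: "fibre_perm w permutes {..<k}" using fin_maps_perm[OF w] .
  show len: "length (concat ?xss) = length (permute_list (inv (fibre_perm w)) (fibre_sizes s k))"
    using sum_fibre_sizes[OF w] ml unfolding length_concat by simp
  fix p assume "p < length (concat ?xss)"
  then have pk: "p < k" using len by simp
  let ?x = "inv (fibre_perm w) p"
  have xk: "?x < k" using permutes_in_image[OF permutes_inv[OF wp], of p] pk by simp
  have xp: "fibre_perm w ?x = p" using permutes_inverses[OF wp] by simp
  let ?i = "w ! ?x" and ?j = "rank (fibre_elems w (w ! ?x)) ?x"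
  have il: "?i < l" using fin_maps_nth[OF w xk] .
  have "p = offset (map length ?xss) ?i + ?j" "?j < length (?xss ! ?i)"
    using fibre_perm_offset[OF w xk] il unfolding xp ml by simp_all
  then have "concat ?xss ! p = ?xss ! ?i ! ?j" using concat_nth_offset[of ?i ?xss ?j] il by simp
  also have "\<dots> = length (fibre_elems (induced s w ?i) ?j)"
    using il fibre_perm_offset(2)[OF w xk] by simp
  also have "\<dots> = length (fibre_elems s ?x)" using length_fibre_induced[OF s w xk] by simp
  also have "\<dots> = permute_list (inv (fibre_perm w)) (fibre_sizes s k) ! p"
    using pk xk permutes_inv[OF wp] by (simp add: permute_list_nth)
  finally show "concat ?xss ! p = permute_list (inv (fibre_perm w)) (fibre_sizes s k) ! p" .
qed

lemma sum_induced_sizes: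
  assumes "s \<in> fin_maps n k" "w \<in> fin_maps k l"
  shows "sum_list (fibre_sizes (induced s w i) (length (fibre_elems w i))) =
    length (fibre_elems (fin_comp w s) i)"
  using sum_fibre_sizes[OF induced_fin_maps[OF assms]] .

text \<open>Both permutations below sort \<open>[n]\<close> by the triple \<open>(w (s x), s x, x)\<close>: the left-hand one sorts
  by \<open>(s x, x)\<close> and then rearranges whole blocks, the right-hand one sorts by \<open>(w (s x), x)\<close> and
  then rearranges inside the blocks. This identity is what makes the associativity law of internal
  operads well typed.\<close>

lemma fibre_perm_comp:
  assumes s: "s \<in> fin_maps n k" and w: "w \<in> fin_maps k l"
  shows "inv (block_perm (inv (fibre_perm w)) (fibre_sizes s k)) \<circ> fibre_perm s =
    sum_perm (fibre_sizes (fin_comp w s) l) (map (\<lambda>i. fibre_perm (induced s w i)) [0..<l]) \<circ>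
      fibre_perm (fin_comp w s)"
    (is "inv ?b \<circ> _ = ?c \<circ> _")
proof (rule permutes_eq_if_monotone)
  let ?ws = "fin_comp w s"
  let ?R = "\<lambda>y x. w ! (s ! y) < w ! (s ! x) \<or>
    w ! (s ! y) = w ! (s ! x) \<and> (s ! y < s ! x \<or> s ! y = s ! x \<and> y < x)"
  have ws: "?ws \<in> fin_maps n l" using fin_comp_fin_maps[OF s w] .
  have wp: "fibre_perm w permutes {..<k}" using fin_maps_perm[OF w] .
  have wpi: "inv (fibre_perm w) permutes {..<length (fibre_sizes s k)}" using permutes_inv[OF wp] by simp
  have b: "?b permutes {..<n}"
    using block_perm_permutes[OF wpi] by (simp add: sum_fibre_sizes[OF s])
  show "inv ?b \<circ> fibre_perm s permutes {..<n}"
    using permutes_compose[OF fibre_perm_permutes permutes_inv[OF b]] s by (simp add: fin_maps_length)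
  have "map (\<lambda>i. fibre_perm (induced s w i)) [0..<l] ! i permutes {..<fibre_sizes ?ws l ! i}"
    if "i < l" for i
    using that fin_maps_perm[OF induced_fin_maps[OF s w]] by simp
  then have "?c permutes {..<n}"
    using sum_perm_permutes[of "fibre_sizes ?ws l"] by (simp add: sum_fibre_sizes[OF ws])
  then show "?c \<circ> fibre_perm ?ws permutes {..<n}"
    using permutes_compose[OF fibre_perm_permutes] ws by (simp add: fin_maps_length)
  fix x y assume xy: "x < n" "y < n"
  show "?R x y \<or> x = y \<or> ?R y x" by auto
  assume R: "?R y x"
  let ?P = "permute_list (inv (fibre_perm w)) (fibre_sizes s k)"
  have L: "(inv ?b \<circ> fibre_perm s) x =
      offset ?P (fibre_perm w (s ! x)) + rank (fibre_elems s (s ! x)) x" (is ?L1)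
    "rank (fibre_elems s (s ! x)) x < ?P ! fibre_perm w (s ! x)" (is ?L2)
    "fibre_perm w (s ! x) < k" (is ?L3)
    if x: "x < n" for x
  proof -
    have sx: "s ! x < k" using fin_maps_nth[OF s x] .
    then show 3: ?L3 using permutes_in_image[OF wp, of "s ! x"] by simp
    have i: "inv (fibre_perm w) (fibre_perm w (s ! x)) = s ! x" using permutes_inverses[OF wp] by simp
    show ?L2 using fibre_perm_offset(2)[OF s x] 3 wpi by (simp add: permute_list_nth i)
    have "?b (offset ?P (fibre_perm w (s ! x)) + rank (fibre_elems s (s ! x)) x) = fibre_perm s x"
      using block_perm_apply[OF wpi, of "fibre_perm w (s ! x)" "rank (fibre_elems s (s ! x)) x"]
        fibre_perm_offset[OF s x] 3 unfolding i by simp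
    then show ?L1 using permutes_inverses[OF b] by (metis comp_apply)
  qed
  show "(inv ?b \<circ> fibre_perm s) y < (inv ?b \<circ> fibre_perm s) x"
  proof (cases "s ! y = s ! x")
    case True
    then have "rank (fibre_elems s (s ! x)) y < rank (fibre_elems s (s ! x)) x"
      using R xy s by (intro rank_less) (auto simp: set_fibre_elems fin_maps_length)
    then show ?thesis using L(1)[OF xy(1)] L(1)[OF xy(2)] True by simp
  next
    case False
    then have "fibre_perm w (s ! y) < fibre_perm w (s ! x)"
      using R xy fin_maps_nth[OF s] by (intro fibre_perm_less[OF w]) auto
    then show ?thesis
      using L[OF xy(1)] L[OF xy(2)]
        offset_less[of "fibre_perm w (s ! y)" "fibre_perm w (s ! x)" ?P "rank (fibre_elems s (s ! y)) y"]
      by simp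
  qed
  have M: "(?c \<circ> fibre_perm ?ws) x = offset (fibre_sizes ?ws l) (w ! (s ! x)) +
      fibre_perm (induced s w (w ! (s ! x))) (rank (fibre_elems ?ws (w ! (s ! x))) x)" (is ?M1)
    "fibre_perm (induced s w (w ! (s ! x))) (rank (fibre_elems ?ws (w ! (s ! x))) x) <
      fibre_sizes ?ws l ! (w ! (s ! x))" (is ?M2)
    "w ! (s ! x) < l" (is ?M3)
    if x: "x < n" for x
  proof -
    let ?i = "w ! (s ! x)"
    show 3: ?M3 using fin_maps_nth[OF w fin_maps_nth[OF s x]] .
    have wsx: "?ws ! x = ?i" using fin_comp_nth[OF s x] .
    have r: "rank (fibre_elems ?ws ?i) x < fibre_sizes ?ws l ! ?i"
      using fibre_perm_offset(2)[OF ws x] unfolding wsx .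
    show ?M1
      using fibre_perm_offset(1)[OF ws x] sum_perm_apply[of ?i "fibre_sizes ?ws l"] r 3
      unfolding wsx by simp
    have "fibre_perm (induced s w ?i) permutes {..<fibre_sizes ?ws l ! ?i}"
      using fin_maps_perm[OF induced_fin_maps[OF s w]] 3 by simp
    then show ?M2 using permutes_in_image r by fastforce
  qed
  show "(?c \<circ> fibre_perm ?ws) y < (?c \<circ> fibre_perm ?ws) x"
  proof (cases "w ! (s ! y) = w ! (s ! x)")
    case True
    let ?i = "w ! (s ! x)"
    note ix = induced_rank[OF s w xy(1) refl] and iy = induced_rank[OF s w xy(2) True]
    have y': "y \<in> set (fibre_elems ?ws ?i)"
      using xy True s by (simp add: set_fibre_elems fin_comp_nth fin_maps_length[OF ws])
    have sy': "s ! y \<in> set (fibre_elems w ?i)"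
      using xy True s w by (simp add: set_fibre_elems fin_maps_nth fin_maps_length[OF w])
    have "s ! y < s ! x \<or> s ! y = s ! x \<and> y < x" using R True by auto
    then have "fibre_perm (induced s w ?i) (rank (fibre_elems ?ws ?i) y) <
        fibre_perm (induced s w ?i) (rank (fibre_elems ?ws ?i) x)"
      using rank_less[OF sy', of "s ! x"] rank_less[OF y', of x] ix iy
      by (intro fibre_perm_less[OF induced_fin_maps[OF s w]]) auto
    then show ?thesis using M(1)[OF xy(1)] M(1)[OF xy(2)] True by simp
  next
    case False
    then have "w ! (s ! y) < w ! (s ! x)" using R by auto
    then show ?thesis
      using M[OF xy(1)] M[OF xy(2)] offset_less[of "w ! (s ! y)" "w ! (s ! x)" "fibre_sizes ?ws l"]
      by (metis length_fibre_sizes trans_less_add1)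
  qed
qed

subsection \<open>Order preserving maps and bijections\<close>

text \<open>The order preserving map \<open>[n\<^sub>1 + \<dots> + n\<^sub>k] \<rightarrow> [k]\<close> with fibres of sizes \<open>n\<^sub>1, \<dots>, n\<^sub>k\<close>.\<close>

definition monotone_map :: "nat list \<Rightarrow> nat list" where
  "monotone_map ns = concat (map (\<lambda>i. map (\<lambda>j. i) [0..<ns ! i]) [0..<length ns])"

lemma length_monotone_map: "length (monotone_map ns) = sum_list ns"
  unfolding monotone_map_def by (rule blocks_length) simp

lemma monotone_map_nth: "i < length ns \<Longrightarrow> j < ns ! i \<Longrightarrow> monotone_map ns ! (offset ns i + j) = i"
  unfolding monotone_map_def by (rule blocks_nth) simp_all

lemma monotone_map_fin_maps: "monotone_map ns \<in> fin_maps (sum_list ns) (length ns)"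
  by (rule fin_mapsI) (auto simp: length_monotone_map monotone_map_nth elim!: offset_cases)

lemma sorted_monotone_map: "sorted (monotone_map ns)"
proof (rule sorted_iff_nth_mono[THEN iffD2], intro allI impI)
  fix p q assume "p \<le> q" "q < length (monotone_map ns)"
  then have pq: "p \<le> q" "p < sum_list ns" "q < sum_list ns" by (auto simp: length_monotone_map)
  obtain i j where p: "i < length ns" "j < ns ! i" "p = offset ns i + j" using offset_cases pq by blast
  obtain i' j' where q: "i' < length ns" "j' < ns ! i'" "q = offset ns i' + j'" using offset_cases pq by blast
  have "\<not> i' < i" using offset_less[of i' i ns j'] p q pq by auto
  then show "monotone_map ns ! p \<le> monotone_map ns ! q" using p q by (simp add: monotone_map_nth)
qed

lemma sorted_eq_monotone_map:
  assumes "s \<in> fin_maps n k" "sorted s"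
  shows "s = monotone_map (fibre_sizes s k)"
proof (rule nth_equalityI)
  show l: "length s = length (monotone_map (fibre_sizes s k))"
    using assms by (simp add: length_monotone_map sum_fibre_sizes fin_maps_length)
  fix x assume "x < length s"
  then have x: "x < n" using assms by (simp add: fin_maps_length)
  have "x = offset (fibre_sizes s k) (s ! x) + rank (fibre_elems s (s ! x)) x"
    using fibre_perm_offset(1)[OF assms(1) x] fibre_perm_sorted[OF assms(2)] by simp
  then show "s ! x = monotone_map (fibre_sizes s k) ! x"
    using monotone_map_nth[of "s ! x" "fibre_sizes s k"] fibre_perm_offset(2)[OF assms(1) x]
      fin_maps_nth[OF assms(1) x] by (metis length_fibre_sizes)
qed

lemma fibre_sizes_monotone_map: "fibre_sizes (monotone_map ns) (length ns) = ns"
proof (rule nth_equalityI)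
  fix i assume "i < length (fibre_sizes (monotone_map ns) (length ns))"
  then have i: "i < length ns" by simp
  have "{x. x < length (monotone_map ns) \<and> monotone_map ns ! x = i} = (+) (offset ns i) ` {..<ns ! i}"
    using i by (auto simp: length_monotone_map offset_bound monotone_map_nth elim!: offset_cases)
  moreover have "card ((+) (offset ns i) ` {..<ns ! i}) = ns ! i" by (simp add: card_image)
  ultimately show "fibre_sizes (monotone_map ns) (length ns) ! i = ns ! i"
    using i by (simp add: length_fibre_elems)
qed simp

lemma perm_list_fin_maps:
  assumes "p permutes {..<n}"
  shows "map p [0..<n] \<in> fin_maps n n"
  using permutes_in_image[OF assms] by (intro fin_mapsI) auto

lemma fibre_sizes_perm_list:
  assumes "p permutes {..<n}"
  shows "fibre_sizes (map p [0..<n]) n = replicate n 1"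
proof (rule nth_equalityI)
  fix i assume "i < length (fibre_sizes (map p [0..<n]) n)"
  then have i: "i < n" by simp
  have "{x. x < n \<and> map p [0..<n] ! x = i} = {inv p i}"
    using i permutes_inverses[OF assms] permutes_in_image[OF permutes_inv[OF assms], of i] by auto
  then show "fibre_sizes (map p [0..<n]) n ! i = replicate n 1 ! i"
    using i by (simp add: length_fibre_elems)
qed simp

lemma perm_list_of_fibre_sizes:
  assumes "s \<in> fin_maps n n" "fibre_sizes s n = replicate n 1"
  shows "s = map (fibre_perm s) [0..<n]"
proof (rule nth_equalityI)
  fix x assume "x < length s"
  then have x: "x < n" using assms by (simp add: fin_maps_length)
  then show "s ! x = map (fibre_perm s) [0..<n] ! x"
    using fibre_perm_offset[OF assms(1) x] fin_maps_nth[OF assms(1) x] assms(2)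
    by (simp add: offset_replicate_1[simplified])
qed (use assms in \<open>simp add: fin_maps_length\<close>)

lemma fin_maps_1: "s \<in> fin_maps n 1 \<longleftrightarrow> s = replicate n 0"
proof
  assume s: "s \<in> fin_maps n 1"
  show "s = replicate n 0"
    by (rule nth_equalityI) (use fin_maps_nth[OF s] in \<open>simp_all add: fin_maps_length[OF s]\<close>)
qed (auto simp: fin_maps_def)

lemma fibre_sizes_fin_maps_1: "s \<in> fin_maps n 1 \<Longrightarrow> fibre_sizes s 1 = [n]"
  using sum_fibre_sizes[of s n 1] by (simp add: fibre_sizes_def)

section \<open>Functors of several variables and colimits in each variable\<close>

text \<open>Variables are the elements of a finite set \<open>V\<close> of numbers, and a tuple of arguments is a
  function of which only the values on \<open>V\<close> matter; replacing one argument is then a function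
  update.\<close>

locale multifunctor =
  fixes V :: "nat set" and C :: "nat \<Rightarrow> ('o, 'm) category" and E :: "('p, 'q) category"
    and Mo :: "(nat \<Rightarrow> 'o) \<Rightarrow> 'p" and Ma :: "(nat \<Rightarrow> 'm) \<Rightarrow> 'q"
  assumes finite_V: "finite V"
    and C: "\<And>i. i \<in> V \<Longrightarrow> is_category (C i)" and E: "is_category E"
    and Mo_cong: "\<And>x y. (\<And>i. i \<in> V \<Longrightarrow> x i = y i) \<Longrightarrow> Mo x = Mo y"
    and Ma_cong: "\<And>f g. (\<And>i. i \<in> V \<Longrightarrow> f i = g i) \<Longrightarrow> Ma f = Ma g"
    and Ma_Hom: "\<And>f x y. (\<And>i. i \<in> V \<Longrightarrow> f i \<in> Hom (C i) (x i) (y i)) \<Longrightarrow> Ma f \<in> Hom E (Mo x) (Mo y)"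
    and Ma_Idn: "\<And>x. (\<And>i. i \<in> V \<Longrightarrow> x i \<in> Ob (C i)) \<Longrightarrow> Ma (\<lambda>i. Idn (C i) (x i)) = Idn E (Mo x)"
    and Ma_Cmp: "\<And>f g x y z. (\<And>i. i \<in> V \<Longrightarrow> f i \<in> Hom (C i) (x i) (y i)) \<Longrightarrow>
       (\<And>i. i \<in> V \<Longrightarrow> g i \<in> Hom (C i) (y i) (z i)) \<Longrightarrow>
       Cmp E (Ma g) (Ma f) = Ma (\<lambda>i. Cmp (C i) (g i) (f i))"
begin

definition slot :: "nat \<Rightarrow> (nat \<Rightarrow> 'o) \<Rightarrow> ('o, 'm, 'p, 'q) cat_functor" where
  "slot i x = \<lparr>FOb = (\<lambda>z. Mo (x(i := z))), FAr = (\<lambda>f. Ma ((\<lambda>l. Idn (C l) (x l))(i := f)))\<rparr>"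

lemma slot_functor:
  assumes i: "i \<in> V" and x: "\<And>l. l \<in> V \<Longrightarrow> x l \<in> Ob (C l)"
  shows "is_functor (C i) E (slot i x)"
proof -
  have H: "((\<lambda>l. Idn (C l) (x l))(i := f)) l \<in> Hom (C l) ((x(i := y)) l) ((x(i := z)) l)"
    if "f \<in> Hom (C i) y z" "l \<in> V" for f y z l
    using that Idn_Hom[OF C x] by simp
  show ?thesis unfolding is_functor_def
  proof (intro conjI ballI impI)
    show "is_category (C i)" "is_category E" using C[OF i] E .
    show Ar: "FAr (slot i x) f \<in> Hom E (FOb (slot i x) (Src (C i) f)) (FOb (slot i x) (Trg (C i) f))"
      if f: "f \<in> Ar (C i)" for f
    proof -
      have "Ma ((\<lambda>l. Idn (C l) (x l))(i := f)) \<in> Hom E (Mo (x(i := Src (C i) f))) (Mo (x(i := Trg (C i) f)))"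
        by (rule Ma_Hom) (rule H[OF HomI[OF f refl refl]])
      then show ?thesis by (simp only: slot_def cat_functor.simps)
    qed
    show "FAr (slot i x) (Idn (C i) y) = Idn E (FOb (slot i x) y)" if y: "y \<in> Ob (C i)" for y
    proof -
      have "Ma ((\<lambda>l. Idn (C l) (x l))(i := Idn (C i) y)) = Ma (\<lambda>l. Idn (C l) ((x(i := y)) l))"
        by (rule Ma_cong) simp
      then show ?thesis using Ma_Idn[of "x(i := y)"] y x by (simp add: slot_def)
    qed
    show "FOb (slot i x) y \<in> Ob E" if y: "y \<in> Ob (C i)" for y
      using Hom_Ob(1)[OF E Ar[OF HomD(1)[OF Idn_Hom[OF C[OF i] y]]]] HomD(2)[OF Idn_Hom[OF C[OF i] y]]
      by simp
    fix f g assume fg: "f \<in> Ar (C i)" "g \<in> Ar (C i)" "Trg (C i) f = Src (C i) g"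
    have f: "f \<in> Hom (C i) (Src (C i) f) (Trg (C i) f)" and g: "g \<in> Hom (C i) (Trg (C i) f) (Trg (C i) g)"
      using fg by (auto simp: Hom_def)
    have "Cmp E (FAr (slot i x) g) (FAr (slot i x) f) =
       Ma (\<lambda>l. Cmp (C l) (((\<lambda>l. Idn (C l) (x l))(i := g)) l) (((\<lambda>l. Idn (C l) (x l))(i := f)) l))"
      unfolding slot_def cat_functor.simps by (rule Ma_Cmp) (erule H[OF f], erule H[OF g])
    also have "\<dots> = Ma ((\<lambda>l. Idn (C l) (x l))(i := Cmp (C i) g f))"
      by (rule Ma_cong) (use Cmp_Idn[OF C Idn_Hom[OF C x]] in simp)
    finally show "FAr (slot i x) (Cmp (C i) g f) = Cmp E (FAr (slot i x) g) (FAr (slot i x) f)"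
      by (simp add: slot_def)
  qed
qed

text \<open>Both lemmas concern one colimit \<open>c\<^sub>i\<close>, with legs \<open>t\<^sub>i\<close>, in each of several variables, when every
  colimit is preserved in its own variable: together the tuples of legs then behave like the legs of
  a colimit of \<open>m(D\<^sub>1 j\<^sub>1, D\<^sub>2 j\<^sub>2, \<dots>)\<close>.\<close>

context
  fixes J :: "nat \<Rightarrow> ('j, 'i) category" and D :: "nat \<Rightarrow> ('j, 'i, 'o, 'm) cat_functor"
    and c :: "nat \<Rightarrow> 'o" and t :: "nat \<Rightarrow> 'j \<Rightarrow> 'm"
begin

text \<open>By induction on \<open>S\<close>: precomposing with the leg \<open>t\<^sub>s p\<close> in one variable \<open>s\<close> turns that variable into
  the parameter \<open>D\<^sub>s p\<close>, for the legs in the remaining ones. Variables outside \<open>S\<close> are parameters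
  from the start.\<close>

lemma jointly_epic:
  assumes "finite S" "S \<subseteq> V"
    and col: "\<And>i. i \<in> S \<Longrightarrow> is_colimit (J i) (C i) (D i) (c i) (t i)"
    and pres: "\<And>i x. i \<in> S \<Longrightarrow> (\<And>l. l \<in> V \<Longrightarrow> x l \<in> Ob (C l)) \<Longrightarrow>
      is_colimit (J i) E (functor_comp (slot i x) (D i)) (FOb (slot i x) (c i))
        (\<lambda>j. FAr (slot i x) (t i j))"
    and x: "\<And>l. l \<in> V \<Longrightarrow> x l \<in> Ob (C l)" "\<And>i. i \<in> S \<Longrightarrow> x i = c i"
    and f: "f \<in> Hom E (Mo x) z" and g: "g \<in> Hom E (Mo x) z"
    and eq: "\<And>j. (\<And>i. i \<in> S \<Longrightarrow> j i \<in> Ob (J i)) \<Longrightarrow>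
      Cmp E f (Ma (\<lambda>l. if l \<in> S then t l (j l) else Idn (C l) (x l))) =
      Cmp E g (Ma (\<lambda>l. if l \<in> S then t l (j l) else Idn (C l) (x l)))"
  shows "f = g"
  using assms
proof (induction S arbitrary: x f g rule: finite_induct)
  case empty
  have "Ma (\<lambda>l. Idn (C l) (x l)) = Idn E (Mo x)" by (rule Ma_Idn) (use empty in auto)
  then show ?case using empty.prems(8)[of undefined] Cmp_Idn[OF E empty.prems(6)]
      Cmp_Idn[OF E empty.prems(7)] by simp
next
  case (insert s S)
  have sV: "s \<in> V" and SV: "S \<subseteq> V" using insert.prems by auto
  have xo: "\<And>l. l \<in> V \<Longrightarrow> x l \<in> Ob (C l)" by fact
  have cx: "FOb (slot s x) (c s) = Mo x" using insert.prems(5)[of s] by (simp add: slot_def fun_upd_idem)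
  have ts: "t s p \<in> Hom (C s) (FOb (D s) p) (c s)" if "p \<in> Ob (J s)" for p
    using cocone_Hom[OF colimit_cocone[OF insert.prems(2)]] that by simp
  show ?case
  proof (rule colimit_unique[OF insert.prems(3)[of s x]])
    show "f \<in> Hom E (FOb (slot s x) (c s)) z" "g \<in> Hom E (FOb (slot s x) (c s)) z"
      using insert.prems cx by auto
    fix p assume p: "p \<in> Ob (J s)"
    let ?x = "x(s := FOb (D s) p)" and ?m = "(\<lambda>l. Idn (C l) (x l))(s := t s p)"
    have xo': "?x l \<in> Ob (C l)" if "l \<in> V" for l
      using that xo Hom_Ob(1)[OF C[OF sV] ts[OF p]] by simp
    have m: "?m l \<in> Hom (C l) (?x l) (x l)" if "l \<in> V" for l
      using that ts[OF p] insert.prems(5)[of s] Idn_Hom[OF C xo] by simp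
    have cmp: "Cmp E f' (Ma (\<lambda>l. if l \<in> insert s S then t l ((j(s := p)) l) else Idn (C l) (x l))) =
      Cmp E (Cmp E f' (Ma ?m)) (Ma (\<lambda>l. if l \<in> S then t l (j l) else Idn (C l) (?x l)))"
      if f': "f' \<in> Hom E (Mo x) z" and j: "\<forall>i\<in>S. j i \<in> Ob (J i)" for f' j
    proof -
      let ?y = "\<lambda>l. if l \<in> S then FOb (D l) (j l) else ?x l"
      have q: "(if l \<in> S then t l (j l) else Idn (C l) (?x l)) \<in> Hom (C l) (?y l) (?x l)" if "l \<in> V" for l
        using cocone_Hom[OF colimit_cocone[OF insert.prems(2)], of l "j l"] insert.prems(5)[of l]
          j insert.hyps(2) Idn_Hom[OF C[OF that] xo'[OF that]] by auto
      have "Cmp E (Cmp E f' (Ma ?m)) (Ma (\<lambda>l. if l \<in> S then t l (j l) else Idn (C l) (?x l))) =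
        Cmp E f' (Cmp E (Ma ?m) (Ma (\<lambda>l. if l \<in> S then t l (j l) else Idn (C l) (?x l))))"
        by (rule Cmp_assoc[OF E Ma_Hom[OF q] Ma_Hom[OF m] f'])
      also have "Cmp E (Ma ?m) (Ma (\<lambda>l. if l \<in> S then t l (j l) else Idn (C l) (?x l))) =
        Ma (\<lambda>l. Cmp (C l) (?m l) (if l \<in> S then t l (j l) else Idn (C l) (?x l)))"
        by (rule Ma_Cmp[OF q m])
      also have "\<dots> = Ma (\<lambda>l. if l \<in> insert s S then t l ((j(s := p)) l) else Idn (C l) (x l))"
      proof (rule Ma_cong)
        fix l assume l: "l \<in> V"
        consider "l = s" | "l \<noteq> s" "l \<in> S" | "l \<noteq> s" "l \<notin> S" by blast
        then show "Cmp (C l) (?m l) (if l \<in> S then t l (j l) else Idn (C l) (?x l)) =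
          (if l \<in> insert s S then t l ((j(s := p)) l) else Idn (C l) (x l))"
        proof cases
          case 1
          then show ?thesis using insert.hyps(2) Cmp_Idn[OF C[OF sV] ts[OF p]] by simp
        next
          case 2
          then show ?thesis using Cmp_Idn(2)[OF C[OF l] q[OF l]] by simp
        next
          case 3
          then show ?thesis using Cmp_Idn[OF C[OF l] Idn_Hom[OF C[OF l] xo[OF l]]] by simp
        qed
      qed
      finally show ?thesis by (rule sym)
    qed
    have "Cmp E f (Ma ?m) = Cmp E g (Ma ?m)"
    proof (rule insert.IH[OF SV])
      show "Cmp E f (Ma ?m) \<in> Hom E (Mo ?x) z" "Cmp E g (Ma ?m) \<in> Hom E (Mo ?x) z"
        using Cmp_Hom[OF E Ma_Hom[OF m]] insert.prems by blast+
      show "?x i = c i" if "i \<in> S" for i using that insert.hyps insert.prems by auto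
      show "Cmp E (Cmp E f (Ma ?m)) (Ma (\<lambda>l. if l \<in> S then t l (j l) else Idn (C l) (?x l))) =
        Cmp E (Cmp E g (Ma ?m)) (Ma (\<lambda>l. if l \<in> S then t l (j l) else Idn (C l) (?x l)))"
        if j: "\<And>i. i \<in> S \<Longrightarrow> j i \<in> Ob (J i)" for j
      proof -
        have "Cmp E f (Ma (\<lambda>l. if l \<in> insert s S then t l ((j(s := p)) l) else Idn (C l) (x l))) =
          Cmp E g (Ma (\<lambda>l. if l \<in> insert s S then t l ((j(s := p)) l) else Idn (C l) (x l)))"
          by (rule insert.prems(8)) (use j p in auto)
        moreover have "\<forall>i\<in>S. j i \<in> Ob (J i)" using j by blast
        note cmp[OF insert.prems(6) this] cmp[OF insert.prems(7) this]
        ultimately show ?thesis by simp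
      qed
      show "is_colimit (J i) (C i) (D i) (c i) (t i)" if "i \<in> S" for i
        by (rule insert.prems(2)) (use that in simp)
      show "is_colimit (J i) E (functor_comp (slot i y) (D i)) (FOb (slot i y) (c i))
          (\<lambda>j. FAr (slot i y) (t i j))"
        if "i \<in> S" "\<And>l. l \<in> V \<Longrightarrow> y l \<in> Ob (C l)" for i y
        by (rule insert.prems(3)) (use that in simp_all)
    qed (rule xo')
    then show "Cmp E f (FAr (slot s x) (t s p)) = Cmp E g (FAr (slot s x) (t s p))"
      by (simp add: slot_def)
  qed (use xo in simp_all)
qed

text \<open>The variables are replaced by their colimits one at a time. If the family factors through the
  value where the variables in \<open>T\<close> are colimits, then these factorisations form a cocone in a further
  variable \<open>s\<close> (as \<open>jointly_epic\<close> for \<open>T\<close> shows) and therefore factor through its colimit.\<close>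

lemma joint_factor:
  assumes col: "\<And>i. i \<in> V \<Longrightarrow> is_colimit (J i) (C i) (D i) (c i) (t i)"
    and pres: "\<And>i x. i \<in> V \<Longrightarrow> (\<And>l. l \<in> V \<Longrightarrow> x l \<in> Ob (C l)) \<Longrightarrow>
      is_colimit (J i) E (functor_comp (slot i x) (D i)) (FOb (slot i x) (c i))
        (\<lambda>j. FAr (slot i x) (t i j))"
    and z: "z \<in> Ob E"
    and cong: "\<And>j j'. (\<And>i. i \<in> V \<Longrightarrow> j i = j' i) \<Longrightarrow> \<phi> j = \<phi> j'"
    and hom: "\<And>j. (\<And>i. i \<in> V \<Longrightarrow> j i \<in> Ob (J i)) \<Longrightarrow> \<phi> j \<in> Hom E (Mo (\<lambda>i. FOb (D i) (j i))) z"
    and nat: "\<And>j i p q a. (\<And>i. i \<in> V \<Longrightarrow> j i \<in> Ob (J i)) \<Longrightarrow> i \<in> V \<Longrightarrow> a \<in> Hom (J i) p q \<Longrightarrow>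
      Cmp E (\<phi> (j(i := q))) (Ma ((\<lambda>l. Idn (C l) (FOb (D l) (j l)))(i := FAr (D i) a))) = \<phi> (j(i := p))"
  obtains \<psi> where "\<psi> \<in> Hom E (Mo c) z"
    "\<And>j. (\<And>i. i \<in> V \<Longrightarrow> j i \<in> Ob (J i)) \<Longrightarrow> Cmp E \<psi> (Ma (\<lambda>i. t i (j i))) = \<phi> j"
proof -
  \<comment> \<open>\<open>X T j\<close> is the tuple with colimits at \<open>T\<close> and the objects \<open>D\<^sub>l (j l)\<close> elsewhere; \<open>m T j\<close> leads to
    it from \<open>X {} j\<close>.\<close>
  define X where "X T j = (\<lambda>l. if l \<in> T then c l else FOb (D l) (j l))" for T :: "nat set" and j
  define m where "m T j = (\<lambda>l. if l \<in> T then t l (j l) else Idn (C l) (FOb (D l) (j l)))"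
    for T :: "nat set" and j
  define ok where "ok j \<longleftrightarrow> (\<forall>i\<in>V. j i \<in> Ob (J i))" for j
  have t: "t i p \<in> Hom (C i) (FOb (D i) p) (c i)" if "i \<in> V" "p \<in> Ob (J i)" for i p
    using cocone_Hom[OF colimit_cocone[OF col]] that by simp
  have Do: "FOb (D i) (j i) \<in> Ob (C i)" if "i \<in> V" "ok j" for i j
    using functor_Ob[OF colimit_functor[OF col]] that by (simp add: ok_def)
  have co: "c i \<in> Ob (C i)" if "i \<in> V" for i
    using colimit_cocone[OF col[OF that]] by (simp add: is_cocone_def)
  have Xo: "X T j l \<in> Ob (C l)" if "l \<in> V" "ok j" for T j l using that Do co by (simp add: X_def)
  have mH: "m T j l \<in> Hom (C l) (FOb (D l) (j l)) (X T j l)" if "l \<in> V" "ok j" for T j l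
    using that t Idn_Hom[OF C Do] by (simp add: m_def X_def ok_def)
  have "\<forall>j. ok j \<longrightarrow> (\<exists>\<psi>\<in>Hom E (Mo (X T j)) z.
      \<forall>j'. ok j' \<and> (\<forall>l\<in>V - T. j' l = j l) \<longrightarrow> Cmp E \<psi> (Ma (m T j')) = \<phi> j')"
    if "finite T" "T \<subseteq> V" for T
    using that
  proof (induction T rule: finite_induct)
    case empty
    have "Cmp E (\<phi> j) (Ma (m {} j')) = \<phi> j'" if j: "ok j" "\<forall>l\<in>V - {}. j' l = j l" for j j'
    proof -
      have "Ma (m {} j') = Ma (\<lambda>l. Idn (C l) (FOb (D l) (j l)))"
        by (rule Ma_cong) (use j in \<open>simp add: m_def\<close>)
      also have "\<dots> = Idn E (Mo (\<lambda>l. FOb (D l) (j l)))" by (rule Ma_Idn) (use j Do in auto)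
      finally show ?thesis
        using Cmp_Idn(1)[OF E hom[of j]] cong[of j j'] j by (simp add: ok_def)
    qed
    moreover have "\<phi> j \<in> Hom E (Mo (X {} j)) z" if "ok j" for j
      using hom[of j] that by (simp add: X_def ok_def)
    ultimately show ?case by blast
  next
    case (insert s T)
    have sV: "s \<in> V" and TV: "T \<subseteq> V" using insert.prems by auto
    define good where "good \<psi> j \<longleftrightarrow> \<psi> \<in> Hom E (Mo (X T j)) z \<and>
      (\<forall>j'. ok j' \<and> (\<forall>l\<in>V - T. j' l = j l) \<longrightarrow> Cmp E \<psi> (Ma (m T j')) = \<phi> j')" for \<psi> j
    have "\<exists>\<psi>. good \<psi> j" if "ok j" for j
      using insert.IH[OF TV] that unfolding good_def by blast
    then obtain \<Psi> where g: "\<And>j. ok j \<Longrightarrow> good (\<Psi> j) j" by metis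
    have \<Psi>: "\<Psi> j \<in> Hom E (Mo (X T j)) z" if "ok j" for j
      using g[OF that] by (simp add: good_def)
    have \<Psi>': "Cmp E (\<Psi> j) (Ma (m T j')) = \<phi> j'" if "ok j" "ok j'" "\<forall>l\<in>V - T. j' l = j l" for j j'
      using g[OF that(1)] that by (simp add: good_def)
    show ?case
    proof (intro allI impI)
      fix j assume j: "ok j"
      let ?X = "X T j"
      have okp: "ok (j(s := p))" if "p \<in> Ob (J s)" for p using that j by (simp add: ok_def)
      have Xp: "X T (j(s := p)) = ?X(s := FOb (D s) p)" for p
        using insert.hyps by (auto simp: X_def)
      let ?i = "\<lambda>f. (\<lambda>l. Idn (C l) (?X l))(s := f)"
      have iH: "?i f l \<in> Hom (C l) ((?X(s := y)) l) ((?X(s := y')) l)"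
        if "f \<in> Hom (C s) y y'" "l \<in> V" for f y y' l
        using that Idn_Hom[OF C Xo[OF _ j]] by simp
      have Mi: "Ma (?i f) \<in> Hom E (Mo (?X(s := y))) (Mo (?X(s := y')))"
        if "f \<in> Hom (C s) y y'" for f y y' by (rule Ma_Hom) (erule iH[OF that])
      have "is_cocone (J s) E (functor_comp (slot s ?X) (D s)) z (\<lambda>p. \<Psi> (j(s := p)))"
        unfolding is_cocone_def
      proof (intro conjI ballI)
        show "z \<in> Ob E" using Hom_Ob[OF E \<Psi>[OF j]] by simp
        show "\<Psi> (j(s := p)) \<in> Hom E (FOb (functor_comp (slot s ?X) (D s)) p) z" if "p \<in> Ob (J s)" for p
          using \<Psi>[OF okp[OF that]] by (simp add: Xp functor_comp_def slot_def)
        fix a assume a: "a \<in> Ar (J s)"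
        define p q where "p = Src (J s) a" "q = Trg (J s) a"
        have a': "a \<in> Hom (J s) p q" using a by (simp add: Hom_def p_q_def)
        have Js: "is_category (J s)" using functor_category(1)[OF colimit_functor[OF col[OF sV]]] .
        have p: "p \<in> Ob (J s)" and q: "q \<in> Ob (J s)" using Hom_Ob[OF Js a'] .
        have Da: "FAr (D s) a \<in> Hom (C s) (FOb (D s) p) (FOb (D s) q)"
          using functor_Hom[OF colimit_functor[OF col[OF sV]] a'] .
        have \<Psi>q: "\<Psi> (j(s := q)) \<in> Hom E (Mo (?X(s := FOb (D s) q))) z"
          using \<Psi>[OF okp[OF q]] by (simp add: Xp)
        have "Cmp E (\<Psi> (j(s := q))) (Ma (?i (FAr (D s) a))) = \<Psi> (j(s := p))"
        proof (rule jointly_epic[where S = T and x = "?X(s := FOb (D s) p)"])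
          show "finite T" "T \<subseteq> V" using insert.hyps TV by auto
          show "(?X(s := FOb (D s) p)) l \<in> Ob (C l)" if "l \<in> V" for l
            using Xo[OF that okp[OF p], of T] unfolding Xp .
          show "(?X(s := FOb (D s) p)) i = c i" if "i \<in> T" for i using that insert.hyps by (auto simp: X_def)
          show "\<Psi> (j(s := p)) \<in> Hom E (Mo (?X(s := FOb (D s) p))) z"
            using \<Psi>[OF okp[OF p]] by (simp add: Xp)
          show "Cmp E (\<Psi> (j(s := q))) (Ma (?i (FAr (D s) a))) \<in> Hom E (Mo (?X(s := FOb (D s) p))) z"
            using Cmp_Hom[OF E Mi[OF Da] \<Psi>q] .
          show "is_colimit (J i) (C i) (D i) (c i) (t i)" if "i \<in> T" for i
            by (rule col) (use that TV in blast)
          show "is_colimit (J i) E (functor_comp (slot i y) (D i)) (FOb (slot i y) (c i))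
              (\<lambda>j. FAr (slot i y) (t i j))"
            if "i \<in> T" "\<And>l. l \<in> V \<Longrightarrow> y l \<in> Ob (C l)" for i y
            by (rule pres) (use that TV in blast)+
          fix j0 :: "nat \<Rightarrow> 'j" assume j0: "\<And>i. i \<in> T \<Longrightarrow> j0 i \<in> Ob (J i)"
          define j1 where "j1 = (\<lambda>l. if l \<in> T then j0 l else j l)"
          have j1: "ok j1" using j0 j by (simp add: ok_def j1_def)
          have okr: "ok (j1(s := r))" if "r \<in> Ob (J s)" for r using that j1 by (simp add: ok_def)
          let ?m = "\<lambda>l. if l \<in> T then t l (j0 l) else Idn (C l) ((?X(s := FOb (D s) p)) l)"
          have m: "Ma ?m = Ma (m T (j1(s := p)))"
            by (rule Ma_cong) (use insert.hyps in \<open>auto simp: m_def j1_def X_def\<close>)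
          have Xr: "X T (j1(s := r)) = ?X(s := FOb (D s) r)" for r
            using insert.hyps by (auto simp: X_def j1_def)
          have mp: "m T (j1(s := r)) l \<in> Hom (C l) (FOb (D l) ((j1(s := r)) l)) ((?X(s := FOb (D s) r)) l)"
            if "l \<in> V" "r \<in> Ob (J s)" for l r
            using mH[OF that(1) okr[OF that(2)], of T] unfolding Xr .
          have Mm: "Ma (m T (j1(s := r))) \<in> Hom E (Mo (\<lambda>l. FOb (D l) ((j1(s := r)) l))) (Mo (?X(s := FOb (D s) r)))"
            if "r \<in> Ob (J s)" for r by (rule Ma_Hom) (erule mp[OF _ that])
          let ?d = "(\<lambda>l. Idn (C l) (FOb (D l) (j1 l)))(s := FAr (D s) a)"
          have dH: "?d l \<in> Hom (C l) (FOb (D l) ((j1(s := p)) l)) (FOb (D l) ((j1(s := q)) l))"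
            if "l \<in> V" for l using that Da Idn_Hom[OF C Do[OF that j1]] by simp
          have Md: "Ma ?d \<in> Hom E (Mo (\<lambda>l. FOb (D l) ((j1(s := p)) l))) (Mo (\<lambda>l. FOb (D l) ((j1(s := q)) l)))"
            by (rule Ma_Hom) (erule dH)
          have "Cmp E (Cmp E (\<Psi> (j(s := q))) (Ma (?i (FAr (D s) a)))) (Ma (m T (j1(s := p)))) =
            Cmp E (\<Psi> (j(s := q))) (Ma (\<lambda>l. Cmp (C l) (?i (FAr (D s) a) l) (m T (j1(s := p)) l)))"
            unfolding Cmp_assoc[OF E Mm[OF p] Mi[OF Da] \<Psi>q]
            by (rule arg_cong[where f = "Cmp E (\<Psi> (j(s := q)))"], rule Ma_Cmp) (erule mp[OF _ p], erule iH[OF Da])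
          also have "Ma (\<lambda>l. Cmp (C l) (?i (FAr (D s) a) l) (m T (j1(s := p)) l)) =
            Ma (\<lambda>l. Cmp (C l) (m T (j1(s := q)) l) (?d l))"
          proof (rule Ma_cong)
            fix l assume l: "l \<in> V"
            show "Cmp (C l) (?i (FAr (D s) a) l) (m T (j1(s := p)) l) =
              Cmp (C l) (m T (j1(s := q)) l) (?d l)"
            proof (cases "l = s")
              case True
              then show ?thesis using insert.hyps Cmp_Idn[OF C[OF sV] Da] by (simp add: m_def)
            next
              case False
              then show ?thesis
                using Cmp_Idn(1)[OF C[OF l] mp[OF l q]] Cmp_Idn(2)[OF C[OF l] mp[OF l p]]
                by (simp add: m_def)
            qed
          qed
          also have "Cmp E (\<Psi> (j(s := q))) (Ma (\<lambda>l. Cmp (C l) (m T (j1(s := q)) l) (?d l))) =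
            Cmp E (Cmp E (\<Psi> (j(s := q))) (Ma (m T (j1(s := q))))) (Ma ?d)"
            unfolding Cmp_assoc[OF E Md Mm[OF q] \<Psi>q]
            by (rule arg_cong[where f = "Cmp E (\<Psi> (j(s := q)))"], rule Ma_Cmp[symmetric])
              (erule dH, erule mp[OF _ q])
          also have "Cmp E (\<Psi> (j(s := q))) (Ma (m T (j1(s := q)))) = \<phi> (j1(s := q))"
            by (rule \<Psi>'[OF okp[OF q] okr[OF q]]) (simp add: j1_def)
          also have "Cmp E (\<phi> (j1(s := q))) (Ma ?d) = \<phi> (j1(s := p))"
            by (rule nat) (use j1 sV a' in \<open>auto simp: ok_def\<close>)
          also have "\<dots> = Cmp E (\<Psi> (j(s := p))) (Ma (m T (j1(s := p))))"
            by (rule \<Psi>'[OF okp[OF p] okr[OF p], symmetric]) (simp add: j1_def)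
          finally show "Cmp E (Cmp E (\<Psi> (j(s := q))) (Ma (?i (FAr (D s) a)))) (Ma ?m) =
            Cmp E (\<Psi> (j(s := p))) (Ma ?m)" unfolding m .
        qed
        then show "Cmp E (\<Psi> (j(s := Trg (J s) a))) (FAr (functor_comp (slot s ?X) (D s)) a) =
          \<Psi> (j(s := Src (J s) a))"
          by (simp add: functor_comp_def slot_def p_q_def)
      qed
      moreover have pX: "is_colimit (J s) E (functor_comp (slot s ?X) (D s)) (FOb (slot s ?X) (c s))
          (\<lambda>p. FAr (slot s ?X) (t s p))"
        by (rule pres[OF sV]) (rule Xo[OF _ j])
      ultimately obtain \<psi> where \<psi>: "\<psi> \<in> Hom E (FOb (slot s ?X) (c s)) z"
        "\<And>p. p \<in> Ob (J s) \<Longrightarrow> Cmp E \<psi> (FAr (slot s ?X) (t s p)) = \<Psi> (j(s := p))"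
        using colimit_factor[OF pX] by blast
      have Xs: "X (insert s T) j = ?X(s := c s)" by (auto simp: X_def)
      have \<psi>H: "\<psi> \<in> Hom E (Mo (?X(s := c s))) z" using \<psi>(1) by (simp add: slot_def)
      have "Cmp E \<psi> (Ma (m (insert s T) j')) = \<phi> j'"
        if j': "ok j'" "\<forall>l\<in>V - insert s T. j' l = j l" for j'
      proof -
        have p: "j' s \<in> Ob (J s)" using j' sV by (simp add: ok_def)
        have j'X: "X T j' l = (?X(s := FOb (D s) (j' s))) l" if "l \<in> V" for l
          using j' that insert.hyps by (auto simp: X_def)
        have mj: "m T j' l \<in> Hom (C l) (FOb (D l) (j' l)) ((?X(s := FOb (D s) (j' s))) l)"
          if "l \<in> V" for l using mH[OF that j'(1), of T] j'X[OF that] by simp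
        have "Ma (m (insert s T) j') = Ma (\<lambda>l. Cmp (C l) (?i (t s (j' s)) l) (m T j' l))"
        proof (rule Ma_cong)
          fix l assume l: "l \<in> V"
          show "m (insert s T) j' l = Cmp (C l) (?i (t s (j' s)) l) (m T j' l)"
          proof (cases "l = s")
            case True
            then show ?thesis using insert.hyps Cmp_Idn[OF C[OF sV] t[OF sV p]] by (simp add: m_def)
          next
            case False
            then show ?thesis using Cmp_Idn(2)[OF C[OF l] mj[OF l]] by (simp add: m_def)
          qed
        qed
        also have "\<dots> = Cmp E (Ma (?i (t s (j' s)))) (Ma (m T j'))"
          by (rule Ma_Cmp[symmetric]) (erule mj, erule iH[OF t[OF sV p]])
        finally have "Cmp E \<psi> (Ma (m (insert s T) j')) = Cmp E (\<Psi> (j(s := j' s))) (Ma (m T j'))"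
          using Cmp_assoc[OF E Ma_Hom[OF mj] Mi[OF t[OF sV p]] \<psi>H] \<psi>(2)[OF p]
          by (simp add: slot_def)
        also have "\<dots> = \<phi> j'"
          by (rule \<Psi>'[OF okp[OF p] j'(1)]) (use j' in auto)
        finally show ?thesis .
      qed
      then show "\<exists>\<psi>\<in>Hom E (Mo (X (insert s T) j)) z. \<forall>j'. ok j' \<and>
          (\<forall>l\<in>V - insert s T. j' l = j l) \<longrightarrow> Cmp E \<psi> (Ma (m (insert s T) j')) = \<phi> j'"
        using \<psi>H unfolding Xs by blast
    qed
  qed
  note all = this[OF finite_V subset_refl]
  have MoX: "Mo (X V j) = Mo c" for j by (rule Mo_cong) (simp add: X_def)
  have mV: "Ma (m V j) = Ma (\<lambda>i. t i (j i))" for j by (rule Ma_cong) (simp add: m_def)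
  show thesis
  proof (cases "\<exists>j. ok j")
    case True
    then obtain j \<psi> where "\<psi> \<in> Hom E (Mo (X V j)) z" "\<forall>j'. ok j' \<longrightarrow> Cmp E \<psi> (Ma (m V j')) = \<phi> j'"
      using all by auto
    then show thesis using that unfolding MoX mV ok_def by blast
  next
    case False
    \<comment> \<open>With an empty index category in some variable there is no condition on \<open>\<psi>\<close>; an arrow exists
      because \<open>m(c\<^sub>1, c\<^sub>2, \<dots>)\<close> is a colimit of the empty diagram.\<close>
    have "\<exists>i\<in>V. Ob (J i) = {}"
    proof (rule ccontr)
      assume "\<not> (\<exists>i\<in>V. Ob (J i) = {})"
      then have "\<forall>i\<in>V. \<exists>p. p \<in> Ob (J i)" by auto
      then have "\<exists>j. \<forall>i\<in>V. j i \<in> Ob (J i)" by (rule bchoice)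
      then show False using False unfolding ok_def by blast
    qed
    then obtain i where i: "i \<in> V" "Ob (J i) = {}" by blast
    have Ji: "is_category (J i)" using functor_category(1)[OF colimit_functor[OF col[OF i(1)]]] .
    have "is_cocone (J i) E (functor_comp (slot i c) (D i)) z undefined"
      using i(2) z Ji unfolding is_cocone_def is_category_def by auto
    then obtain \<psi> where "\<psi> \<in> Hom E (FOb (slot i c) (c i)) z"
      using colimit_factor[OF pres[OF i(1) co]] by blast
    then have "\<psi> \<in> Hom E (Mo c) z" by (simp add: slot_def)
    then show thesis using that False unfolding ok_def by blast
  qed
qed

end

end

section \<open>Categorical symmetric operads\<close>

abbreviation each :: "('n \<Rightarrow> 'b set) \<Rightarrow> 'n list \<Rightarrow> 'b list \<Rightarrow> bool" where
  "each C \<equiv> list_all2 (\<lambda>n y. y \<in> C n)"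

abbreviation hom :: "'u cat_operad \<Rightarrow> nat \<Rightarrow> 'u \<Rightarrow> 'u \<Rightarrow> 'u set" where "hom A k \<equiv> Hom (cat A k)"
abbreviation obj :: "'u cat_operad \<Rightarrow> nat \<Rightarrow> 'u set" where "obj A k \<equiv> Ob (cat A k)"
abbreviation arr :: "'u cat_operad \<Rightarrow> nat \<Rightarrow> 'u set" where "arr A k \<equiv> Ar (cat A k)"
abbreviation src :: "'u cat_operad \<Rightarrow> nat \<Rightarrow> 'u \<Rightarrow> 'u" where "src A k \<equiv> Src (cat A k)"
abbreviation trg :: "'u cat_operad \<Rightarrow> nat \<Rightarrow> 'u \<Rightarrow> 'u" where "trg A k \<equiv> Trg (cat A k)"
abbreviation idt :: "'u cat_operad \<Rightarrow> nat \<Rightarrow> 'u \<Rightarrow> 'u" where "idt A k \<equiv> Idn (cat A k)"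
abbreviation cmp :: "'u cat_operad \<Rightarrow> nat \<Rightarrow> 'u \<Rightarrow> 'u \<Rightarrow> 'u" where "cmp A k \<equiv> Cmp (cat A k)"

definition homs :: "'u cat_operad \<Rightarrow> nat list \<Rightarrow> 'u list \<Rightarrow> 'u list \<Rightarrow> 'u list \<Rightarrow> bool" where
  "homs A ns gs xs ys \<longleftrightarrow> length gs = length ns \<and> length xs = length ns \<and> length ys = length ns \<and>
     (\<forall>i<length ns. gs ! i \<in> hom A (ns ! i) (xs ! i) (ys ! i))"

abbreviation obs :: "'u cat_operad \<Rightarrow> nat list \<Rightarrow> 'u list \<Rightarrow> bool" where
  "obs A \<equiv> list_all2 (\<lambda>n y. y \<in> obj A n)"

abbreviation ars :: "'u cat_operad \<Rightarrow> nat list \<Rightarrow> 'u list \<Rightarrow> bool" where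
  "ars A \<equiv> list_all2 (\<lambda>n y. y \<in> arr A n)"

abbreviation idns :: "'u cat_operad \<Rightarrow> nat list \<Rightarrow> 'u list \<Rightarrow> 'u list" where
  "idns A \<equiv> map2 (\<lambda>n. idt A n)"

definition cmps :: "'u cat_operad \<Rightarrow> nat list \<Rightarrow> 'u list \<Rightarrow> 'u list \<Rightarrow> 'u list" where
  "cmps A ns gs' gs = map (\<lambda>i. cmp A (ns ! i) (gs' ! i) (gs ! i)) [0..<length ns]"

lemma homs_nth: "homs A ns gs xs ys \<Longrightarrow> i < length ns \<Longrightarrow> gs ! i \<in> hom A (ns ! i) (xs ! i) (ys ! i)"
  by (simp add: homs_def)

lemma homs_map:
  assumes "\<And>i. i < length ns \<Longrightarrow> g i \<in> hom A (ns ! i) (x i) (y i)" "k = length ns"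
  shows "homs A ns (map g [0..<k]) (map x [0..<k]) (map y [0..<k])"
  using assms by (simp add: homs_def)

lemma obs_map:
  assumes "\<And>i. i < length ns \<Longrightarrow> x i \<in> obj A (ns ! i)" "k = length ns"
  shows "obs A ns (map x [0..<k])"
  using assms by (simp add: list_all2_conv_all_nth)

lemma idns_map: "idns A ns (map x [0..<length ns]) = map (\<lambda>i. idt A (ns ! i) (x i)) [0..<length ns]"
  by (rule nth_equalityI) auto

context
  fixes C :: "nat \<Rightarrow> 'u set" and act e mul
  assumes S: "is_set_operad C act e mul"
begin

lemma set_operad_id: "x \<in> C k \<Longrightarrow> act k id x = x"
  using S by (simp add: is_set_operad_def)

lemma set_operad_comp: "p permutes {..<k} \<Longrightarrow> q permutes {..<k} \<Longrightarrow> x \<in> C k \<Longrightarrow> act k p (act k q x) = act k (p \<circ> q) x"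
  using S by (simp add: is_set_operad_def)

lemma set_operad_mul: "x \<in> C (length ns) \<Longrightarrow> each C ns ys \<Longrightarrow> mul ns x ys \<in> C (sum_list ns)"
  using S by (simp add: is_set_operad_def)

lemma set_operad_assoc:
  assumes "x \<in> C (length nss)" "list_all2 (\<lambda>ns y. y \<in> C (length ns)) nss ys"
    "list_all2 (each C) nss zss"
  shows "mul (concat nss) (mul (map length nss) x ys) (concat zss) =
    mul (map sum_list nss) x (map (\<lambda>i. mul (nss ! i) (ys ! i) (zss ! i)) [0..<length nss])"
  using S assms unfolding is_set_operad_def by blast

lemma set_operad_unit:
  assumes "x \<in> C k"
  shows "mul [k] e [x] = x" "mul (replicate k 1) x (replicate k e) = x"
  using S assms unfolding is_set_operad_def by blast+

lemma set_operad_equivariant_operation: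
  assumes "x \<in> C (length ns)" "each C ns ys" "\<rho> permutes {..<length ns}"
  shows "mul (permute_list \<rho> ns) (act (length ns) (inv \<rho>) x) (permute_list \<rho> ys) =
    act (sum_list ns) (inv (block_perm \<rho> ns)) (mul ns x ys)"
  using S assms unfolding is_set_operad_def by blast

lemma set_operad_equivariant_inputs:
  assumes "x \<in> C (length ns)" "each C ns ys" "list_all2 (\<lambda>n t. t permutes {..<n}) ns ts"
  shows "mul ns x (map (\<lambda>i. act (ns ! i) (inv (ts ! i)) (ys ! i)) [0..<length ns]) =
    act (sum_list ns) (inv (sum_perm ns ts)) (mul ns x ys)"
  using S assms unfolding is_set_operad_def by blast

text \<open>Equivariance in the inputs for the left action: the right translate by \<open>\<tau>\<close> is the left translate by
  its inverse.\<close>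

lemma set_operad_inputs:
  assumes x: "x \<in> C (length ns)" and ys: "each C ns ys"
    and ts: "\<And>i. i < length ns \<Longrightarrow> ts ! i permutes {..<ns ! i}" and l: "length zs = length ns"
    and zs: "\<And>i. i < length ns \<Longrightarrow> zs ! i = act (ns ! i) (ts ! i) (ys ! i)"
  shows "mul ns x zs = act (sum_list ns) (sum_perm ns ts) (mul ns x ys)"
proof -
  let ?ti = "map (\<lambda>i. inv (ts ! i)) [0..<length ns]"
  have ti: "list_all2 (\<lambda>n t. t permutes {..<n}) ns ?ti"
    using permutes_inv[OF ts] by (simp add: list_all2_conv_all_nth)
  have "map (\<lambda>i. act (ns ! i) (inv (?ti ! i)) (ys ! i)) [0..<length ns] = zs"
    by (rule nth_equalityI) (simp_all add: l zs permutes_inv_inv[OF ts])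
  then show ?thesis
    using set_operad_equivariant_inputs[OF x ys ti] sum_perm_inv[of ns ts] ts
      permutes_inv_inv[OF sum_perm_permutes[OF ts]] by simp
qed

end

locale cat_operad =
  fixes A :: "'u cat_operad"
  assumes operad: "is_cat_operad A"
begin

lemma category: "is_category (cat A k)"
  using operad by (simp add: is_cat_operad_def)

lemmas idt_hom = Idn_Hom[OF category] and hom_obj = Hom_Ob[OF category] and cmp_hom = Cmp_Hom[OF category]
  and cmp_idt = Cmp_Idn[OF category] and cmp_assoc = Cmp_assoc[OF category]

lemma object_operad: "is_set_operad (\<lambda>k. obj A k) (acto A) (unt A) (mulo A)"
  using operad by (simp add: is_cat_operad_def)

lemma arrow_operad: "is_set_operad (\<lambda>k. arr A k) (acta A) (idt A 1 (unt A)) (mula A)"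
  using operad by (simp add: is_cat_operad_def)

lemma act_functor: "p permutes {..<k} \<Longrightarrow> is_functor (cat A k) (cat A k) \<lparr>FOb = acto A k p, FAr = acta A k p\<rparr>"
  using operad by (simp add: is_cat_operad_def)

lemma acto_Ob: "p permutes {..<k} \<Longrightarrow> x \<in> obj A k \<Longrightarrow> acto A k p x \<in> obj A k"
  using functor_Ob[OF act_functor] by fastforce

lemma acta_Hom: "p permutes {..<k} \<Longrightarrow> f \<in> hom A k x y \<Longrightarrow>
    acta A k p f \<in> hom A k (acto A k p x) (acto A k p y)"
  using functor_Hom[OF act_functor] by fastforce

lemma acta_Idn: "p permutes {..<k} \<Longrightarrow> x \<in> obj A k \<Longrightarrow>
    acta A k p (idt A k x) = idt A k (acto A k p x)"
  using functor_Idn[OF act_functor] by fastforce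

lemma acta_Cmp: "p permutes {..<k} \<Longrightarrow> f \<in> hom A k x y \<Longrightarrow> g \<in> hom A k y z \<Longrightarrow>
    acta A k p (cmp A k g f) = cmp A k (acta A k p g) (acta A k p f)"
  using functor_Cmp[OF act_functor] by fastforce

lemmas acto_id = set_operad_id[OF object_operad] and acta_id = set_operad_id[OF arrow_operad]
  and acto_comp = set_operad_comp[OF object_operad] and acta_comp = set_operad_comp[OF arrow_operad]
  and mulo_Ob = set_operad_mul[OF object_operad]
  and mulo_assoc = set_operad_assoc[OF object_operad] and mula_assoc = set_operad_assoc[OF arrow_operad]
  and mulo_unit = set_operad_unit[OF object_operad] and mula_unit = set_operad_unit[OF arrow_operad]
  and mulo_equivariant_operation = set_operad_equivariant_operation[OF object_operad]
  and mula_equivariant_operation = set_operad_equivariant_operation[OF arrow_operad]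
  and mulo_equivariant_inputs = set_operad_equivariant_inputs[OF object_operad]
  and mula_equivariant_inputs = set_operad_equivariant_inputs[OF arrow_operad]
  and mulo_inputs = set_operad_inputs[OF object_operad] and mula_inputs = set_operad_inputs[OF arrow_operad]

lemma acto_inv:
  assumes "p permutes {..<k}" "x \<in> obj A k"
  shows "acto A k p (acto A k (inv p) x) = x" "acto A k (inv p) (acto A k p x) = x"
  using assms acto_comp[OF assms(1) permutes_inv[OF assms(1)]] acto_comp[OF permutes_inv[OF assms(1)] assms(1)]
  by (simp_all add: permutes_inv_o acto_id)

lemma acta_inv:
  assumes "p permutes {..<k}" "x \<in> arr A k"
  shows "acta A k p (acta A k (inv p) x) = x" "acta A k (inv p) (acta A k p x) = x"
  using assms acta_comp[OF assms(1) permutes_inv[OF assms(1)]] acta_comp[OF permutes_inv[OF assms(1)] assms(1)]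
  by (simp_all add: permutes_inv_o acta_id)

lemma unt_Ob: "unt A \<in> obj A 1"
  using object_operad by (simp add: is_set_operad_def)

lemma homs_ars: "homs A ns gs xs ys \<Longrightarrow> ars A ns gs"
  by (auto simp: homs_def list_all2_conv_all_nth Hom_def)

lemma homs_obs:
  assumes "homs A ns gs xs ys"
  shows "obs A ns xs" "obs A ns ys"
  using assms hom_obj by (auto simp: homs_def list_all2_conv_all_nth)

lemma homs_idns: "obs A ns xs \<Longrightarrow> homs A ns (idns A ns xs) xs xs"
  using idt_hom by (auto simp: homs_def list_all2_conv_all_nth)

lemma cmps_idns:
  assumes "homs A ns gs xs ys"
  shows "cmps A ns gs (idns A ns xs) = gs" "cmps A ns (idns A ns ys) gs = gs"
  using assms cmp_idt by (auto simp: homs_def cmps_def intro!: nth_equalityI)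

lemma mula_Hom:
  assumes "f \<in> hom A (length ns) x y" "homs A ns gs xs ys"
  shows "mula A ns f gs \<in> hom A (sum_list ns) (mulo A ns x xs) (mulo A ns y ys)"
proof -
  have "map2 (\<lambda>n. src A n) ns gs = xs" "map2 (\<lambda>n. trg A n) ns gs = ys"
    using assms(2) by (auto simp: homs_def Hom_def intro!: nth_equalityI)
  moreover have "mula A ns f gs \<in> hom A (sum_list ns)
      (mulo A ns (src A (length ns) f) (map2 (\<lambda>n. src A n) ns gs))
      (mulo A ns (trg A (length ns) f) (map2 (\<lambda>n. trg A n) ns gs))"
    using operad HomD(1)[OF assms(1)] homs_ars[OF assms(2)] unfolding is_cat_operad_def by blast
  ultimately show ?thesis using HomD[OF assms(1)] by simp
qed

lemma mula_Idn: "x \<in> obj A (length ns) \<Longrightarrow> obs A ns ys \<Longrightarrow>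
    mula A ns (idt A (length ns) x) (idns A ns ys) = idt A (sum_list ns) (mulo A ns x ys)"
  using operad unfolding is_cat_operad_def by blast

lemma mula_Cmp:
  assumes "f \<in> hom A (length ns) x y" "homs A ns gs xs ys"
    and "f' \<in> hom A (length ns) y z" "homs A ns gs' ys zs"
  shows "cmp A (sum_list ns) (mula A ns f' gs') (mula A ns f gs) =
    mula A ns (cmp A (length ns) f' f) (cmps A ns gs' gs)"
proof -
  have "\<forall>i<length ns. trg A (ns ! i) (gs ! i) = src A (ns ! i) (gs' ! i)"
    using homs_nth[OF assms(2)] homs_nth[OF assms(4)] by (simp add: Hom_def)
  moreover have "trg A (length ns) f = src A (length ns) f'"
    using assms by (simp add: Hom_def)
  ultimately show ?thesis
    unfolding cmps_def
    by (intro operad[unfolded is_cat_operad_def, THEN conjunct2, THEN conjunct2, THEN conjunct2,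
          THEN conjunct2, THEN conjunct2, THEN conjunct2, rule_format, symmetric]
        HomD(1)[OF assms(1)] HomD(1)[OF assms(3)] homs_ars[OF assms(2)] homs_ars[OF assms(4)]) auto
qed

lemma mula_split:
  assumes "f \<in> hom A (length ns) x y" "homs A ns gs xs ys"
  shows "mula A ns f gs = cmp A (sum_list ns) (mula A ns f (idns A ns ys)) (mula A ns (idt A (length ns) x) gs)"
    and "mula A ns f gs = cmp A (sum_list ns) (mula A ns (idt A (length ns) y) gs) (mula A ns f (idns A ns xs))"
proof -
  have x: "x \<in> obj A (length ns)" and y: "y \<in> obj A (length ns)"
    using hom_obj[OF assms(1)] by auto
  show "mula A ns f gs = cmp A (sum_list ns) (mula A ns f (idns A ns ys)) (mula A ns (idt A (length ns) x) gs)"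
    using mula_Cmp[OF idt_hom[OF x] assms(2) assms(1) homs_idns[OF homs_obs(2)[OF assms(2)]]]
      cmp_idt[OF assms(1)] cmps_idns[OF assms(2)] by simp
  show "mula A ns f gs = cmp A (sum_list ns) (mula A ns (idt A (length ns) y) gs) (mula A ns f (idns A ns xs))"
    using mula_Cmp[OF assms(1) homs_idns[OF homs_obs(1)[OF assms(2)]] idt_hom[OF y] assms(2)]
      cmp_idt[OF assms(1)] cmps_idns[OF assms(2)] by simp
qed

end

section \<open>Colimits and operadic multiplication\<close>

context cat_operad
begin

text \<open>Variable \<open>0\<close> of the multiplication is the operation, variable \<open>i + 1\<close> its \<open>i\<close>-th input.\<close>

definition arg_cat :: "nat list \<Rightarrow> nat \<Rightarrow> ('u, 'u) category" where
  "arg_cat ns i = (case i of 0 \<Rightarrow> cat A (length ns) | Suc i \<Rightarrow> cat A (ns ! i))"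

definition arg_list :: "nat list \<Rightarrow> (nat \<Rightarrow> 'a) \<Rightarrow> 'a list" where
  "arg_list ns x = map (\<lambda>i. x (Suc i)) [0..<length ns]"

lemma arg_cat_simps [simp]: "arg_cat ns 0 = cat A (length ns)" "arg_cat ns (Suc i) = cat A (ns ! i)"
  by (simp_all add: arg_cat_def)

lemma mul_multifunctor:
  "multifunctor {..length ns} (arg_cat ns) (cat A (sum_list ns))
     (\<lambda>x. mulo A ns (x 0) (arg_list ns x)) (\<lambda>f. mula A ns (f 0) (arg_list ns f))"
proof
  show "finite {..length ns}" by simp
  show "is_category (arg_cat ns i)" for i using category by (simp add: arg_cat_def split: nat.split)
  show "is_category (cat A (sum_list ns))" by (rule category)
  have al: "arg_list ns x = arg_list ns y" if "\<And>i. i \<in> {..length ns} \<Longrightarrow> x i = y i" for x y :: "nat \<Rightarrow> 'u"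
    using that by (auto simp: arg_list_def)
  show "mulo A ns (x 0) (arg_list ns x) = mulo A ns (y 0) (arg_list ns y)"
    if "\<And>i. i \<in> {..length ns} \<Longrightarrow> x i = y i" for x y
    using al[OF that] that[of 0] by simp
  show "mula A ns (x 0) (arg_list ns x) = mula A ns (y 0) (arg_list ns y)"
    if "\<And>i. i \<in> {..length ns} \<Longrightarrow> x i = y i" for x y
    using al[OF that] that[of 0] by simp
  have hs: "homs A ns (arg_list ns f) (arg_list ns x) (arg_list ns y)"
    if "\<And>i. i \<in> {..length ns} \<Longrightarrow> f i \<in> Hom (arg_cat ns i) (x i) (y i)" for f x y
  proof -
    have "f (Suc i) \<in> hom A (ns ! i) (x (Suc i)) (y (Suc i))" if "i < length ns" for i
      using \<open>\<And>i. i \<in> {..length ns} \<Longrightarrow> f i \<in> Hom (arg_cat ns i) (x i) (y i)\<close>[of "Suc i"] that by simp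
    then show ?thesis unfolding arg_list_def by (intro homs_map) auto
  qed
  show "mula A ns (f 0) (arg_list ns f) \<in>
      hom A (sum_list ns) (mulo A ns (x 0) (arg_list ns x)) (mulo A ns (y 0) (arg_list ns y))"
    if "\<And>i. i \<in> {..length ns} \<Longrightarrow> f i \<in> Hom (arg_cat ns i) (x i) (y i)" for f x y
    using mula_Hom[OF _ hs[OF that]] that[of 0] by simp
  show "mula A ns (Idn (arg_cat ns 0) (x 0)) (arg_list ns (\<lambda>i. Idn (arg_cat ns i) (x i))) =
      idt A (sum_list ns) (mulo A ns (x 0) (arg_list ns x))"
    if "\<And>i. i \<in> {..length ns} \<Longrightarrow> x i \<in> Ob (arg_cat ns i)" for x
  proof -
    have "x (Suc i) \<in> obj A (ns ! i)" if "i < length ns" for i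
      using \<open>\<And>i. i \<in> {..length ns} \<Longrightarrow> x i \<in> Ob (arg_cat ns i)\<close>[of "Suc i"] that by simp
    then have "obs A ns (arg_list ns x)" unfolding arg_list_def by (rule obs_map) simp_all
    then show ?thesis
      using mula_Idn[of "x 0" ns "arg_list ns x"] that[of 0] by (simp add: arg_list_def idns_map)
  qed
  show "cmp A (sum_list ns) (mula A ns (g 0) (arg_list ns g)) (mula A ns (f 0) (arg_list ns f)) =
      mula A ns (Cmp (arg_cat ns 0) (g 0) (f 0)) (arg_list ns (\<lambda>i. Cmp (arg_cat ns i) (g i) (f i)))"
    if "\<And>i. i \<in> {..length ns} \<Longrightarrow> f i \<in> Hom (arg_cat ns i) (x i) (y i)"
      "\<And>i. i \<in> {..length ns} \<Longrightarrow> g i \<in> Hom (arg_cat ns i) (y i) (z i)" for f g x y z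
  proof -
    have "cmps A ns (arg_list ns g) (arg_list ns f) = arg_list ns (\<lambda>i. Cmp (arg_cat ns i) (g i) (f i))"
      by (simp add: cmps_def arg_list_def)
    then show ?thesis
      using mula_Cmp[OF _ hs[OF that(1)] _ hs[OF that(2)]] that(1)[of 0] that(2)[of 0] by simp
  qed
qed

end

locale cocomplete_operad = cat_operad A for A :: "'u cat_operad" +
  fixes V :: "'v itself"
  assumes cocomplete_operad: "is_cocomplete_cat_operad TYPE('v) A"
    and infinite_universe: "infinite (UNIV :: 'v set)"
begin

lemma colimit_exists:
  assumes "countable (Ob J)" "countable (Ar J)" "is_functor J (cat A k) D"
  obtains c t where "is_colimit J (cat A k) D c t"
  using cocomplete_countable_colimit[OF _ infinite_universe assms] cocomplete_operad
  unfolding is_cocomplete_cat_operad_def by blast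

lemma slot_preserves:
  fixes ns :: "nat list"
  defines "slot \<equiv> multifunctor.slot (arg_cat ns)
     (\<lambda>x. mulo A ns (x 0) (arg_list ns x)) (\<lambda>f. mula A ns (f 0) (arg_list ns f))"
  assumes i: "i \<in> {..length ns}" and x: "\<And>l. l \<in> {..length ns} \<Longrightarrow> x l \<in> Ob (arg_cat ns l)"
    and J: "countable (Ob J)" "countable (Ar J)" and col: "is_colimit J (arg_cat ns i) D c t"
  shows "is_colimit J (cat A (sum_list ns)) (functor_comp (slot i x) D) (FOb (slot i x) c)
     (\<lambda>j. FAr (slot i x) (t j))"
proof (rule preserves_countable_colimit[OF _ infinite_universe _ J col])
  interpret m: multifunctor "{..length ns}" "arg_cat ns" "cat A (sum_list ns)"
    "\<lambda>x. mulo A ns (x 0) (arg_list ns x)" "\<lambda>f. mula A ns (f 0) (arg_list ns f)"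
    by (rule mul_multifunctor)
  show "is_functor (arg_cat ns i) (cat A (sum_list ns)) (slot i x)"
    unfolding slot_def using m.slot_functor[OF i x] by blast
  have xo: "x 0 \<in> obj A (length ns)" using x[of 0] by simp
  have "x (Suc l) \<in> obj A (ns ! l)" if "l < length ns" for l using x[of "Suc l"] that by simp
  then have xs: "obs A ns (arg_list ns x)" unfolding arg_list_def by (rule obs_map) simp_all
  show "preserves_colimits TYPE('v) (arg_cat ns i) (cat A (sum_list ns)) (slot i x)"
  proof (cases i)
    case 0
    have "slot i x = mul_in_operation A ns (arg_list ns x)"
      unfolding slot_def m.slot_def mul_in_operation_def 0 by (simp add: arg_list_def idns_map)
    then show ?thesis
      using cocomplete_operad xs 0 unfolding is_cocomplete_cat_operad_def by simp
  next
    case (Suc l)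
    then have l: "l < length ns" using i by simp
    have u: "arg_list ns (y(Suc l := z)) = (arg_list ns y)[l := z]" for y and z :: 'u
      using l by (auto simp: arg_list_def intro!: nth_equalityI simp: nth_list_update)
    have "slot i x = mul_in_input A ns (x 0) (arg_list ns x) l"
      unfolding slot_def m.slot_def mul_in_input_def Suc u by (simp add: arg_list_def idns_map)
    then show ?thesis
      using cocomplete_operad xs xo l Suc unfolding is_cocomplete_cat_operad_def by simp
  qed
qed

lemma operation_colimit:
  assumes J: "countable (Ob J)" "countable (Ar J)" and col: "is_colimit J (cat A (length ns)) D c t"
    and ys: "obs A ns ys"
  obtains D' where "is_colimit J (cat A (sum_list ns)) D' (mulo A ns c ys) (\<lambda>j. mula A ns (t j) (idns A ns ys))"
proof -
  interpret m: multifunctor "{..length ns}" "arg_cat ns" "cat A (sum_list ns)"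
    "\<lambda>x. mulo A ns (x 0) (arg_list ns x)" "\<lambda>f. mula A ns (f 0) (arg_list ns f)"
    by (rule mul_multifunctor)
  define x where "x i = (case i of 0 \<Rightarrow> c | Suc l \<Rightarrow> ys ! l)" for i
  have yl: "length ys = length ns" using list_all2_lengthD[OF ys] by simp
  have xys: "arg_list ns (x(0 := z)) = ys" for z
    by (rule nth_equalityI) (simp_all add: arg_list_def x_def yl)
  have xid: "arg_list ns ((\<lambda>l. Idn (arg_cat ns l) (x l))(0 := z)) = idns A ns ys" for z
    by (rule nth_equalityI) (simp_all add: arg_list_def x_def yl)
  have c: "c \<in> obj A (length ns)" using colimit_cocone[OF col] by (simp add: is_cocone_def)
  have xo: "x l \<in> Ob (arg_cat ns l)" if "l \<in> {..length ns}" for l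
    using that c ys by (cases l) (auto simp: x_def list_all2_conv_all_nth)
  have "is_colimit J (cat A (sum_list ns)) (functor_comp (m.slot 0 x) D) (FOb (m.slot 0 x) c)
     (\<lambda>j. FAr (m.slot 0 x) (t j))"
    by (rule slot_preserves[OF _ xo J]) (use col in simp_all)
  then have "is_colimit J (cat A (sum_list ns)) (functor_comp (m.slot 0 x) D) (mulo A ns c ys)
     (\<lambda>j. mula A ns (t j) (idns A ns ys))"
    by (simp add: m.slot_def xys xid del: fun_upd_apply) (simp add: fun_upd_same)
  then show thesis by (rule that)
qed

lemma epic_in_operation:
  assumes J: "countable (Ob J)" "countable (Ar J)" and col: "is_colimit J (cat A (length ns)) D c t"
    and ys: "obs A ns ys"
    and f: "f \<in> hom A (sum_list ns) (mulo A ns c ys) z"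
    and g: "g \<in> hom A (sum_list ns) (mulo A ns c ys) z"
    and eq: "\<And>j. j \<in> Ob J \<Longrightarrow> cmp A (sum_list ns) f (mula A ns (t j) (idns A ns ys)) =
      cmp A (sum_list ns) g (mula A ns (t j) (idns A ns ys))"
  shows "f = g"
proof -
  obtain D' where "is_colimit J (cat A (sum_list ns)) D' (mulo A ns c ys) (\<lambda>j. mula A ns (t j) (idns A ns ys))"
    using operation_colimit[OF J col ys] by blast
  then show ?thesis by (rule colimit_unique[OF _ f g eq])
qed

context
  fixes ns :: "nat list" and J :: "nat \<Rightarrow> ('j, 'i) category"
    and D :: "nat \<Rightarrow> ('j, 'i, 'u, 'u) cat_functor" and c :: "nat \<Rightarrow> 'u" and t :: "nat \<Rightarrow> 'j \<Rightarrow> 'u"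
  assumes J: "\<And>i. i < length ns \<Longrightarrow> countable (Ob (J i))" "\<And>i. i < length ns \<Longrightarrow> countable (Ar (J i))"
    and col: "\<And>i. i < length ns \<Longrightarrow> is_colimit (J i) (cat A (ns ! i)) (D i) (c i) (t i)"
begin

lemma cocone_arrows:
  assumes "\<And>i. i < length ns \<Longrightarrow> j i \<in> Ob (J i)"
  shows "homs A ns (map (\<lambda>i. t i (j i)) [0..<length ns]) (map (\<lambda>i. FOb (D i) (j i)) [0..<length ns])
    (map c [0..<length ns])"
  using assms cocone_Hom[OF colimit_cocone[OF col]] by (intro homs_map) auto

lemma colimit_obs: "obs A ns (map c [0..<length ns])"
  using colimit_cocone[OF col] by (intro obs_map) (auto simp: is_cocone_def)

lemma epic_in_inputs:
  assumes x: "x \<in> obj A (length ns)"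
    and f: "f \<in> hom A (sum_list ns) (mulo A ns x (map c [0..<length ns])) z"
    and g: "g \<in> hom A (sum_list ns) (mulo A ns x (map c [0..<length ns])) z"
    and eq: "\<And>j. (\<And>i. i < length ns \<Longrightarrow> j i \<in> Ob (J i)) \<Longrightarrow>
      cmp A (sum_list ns) f
        (mula A ns (idt A (length ns) x) (map (\<lambda>i. t i (j i)) [0..<length ns])) =
      cmp A (sum_list ns) g
        (mula A ns (idt A (length ns) x) (map (\<lambda>i. t i (j i)) [0..<length ns]))"
  shows "f = g"
proof -
  interpret m: multifunctor "{..length ns}" "arg_cat ns" "cat A (sum_list ns)"
    "\<lambda>x. mulo A ns (x 0) (arg_list ns x)" "\<lambda>f. mula A ns (f 0) (arg_list ns f)"
    by (rule mul_multifunctor)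
  define X where "X i = (case i of 0 \<Rightarrow> x | Suc l \<Rightarrow> c l)" for i
  have Xc: "arg_list ns X = map c [0..<length ns]" by (simp add: arg_list_def X_def)
  have X0: "X 0 = x" by (simp add: X_def)
  let ?S = "Suc ` {..<length ns}"
  have cl: "c l \<in> obj A (ns ! l)" if "l < length ns" for l
    using colimit_cocone[OF col[OF that]] by (simp add: is_cocone_def)
  have Xo: "X l \<in> Ob (arg_cat ns l)" if "l \<in> {..length ns}" for l
    using that x cl by (cases l) (auto simp: X_def)
  have colS: "is_colimit (J (i - 1)) (arg_cat ns i) (D (i - 1)) (c (i - 1)) (t (i - 1))" if "i \<in> ?S" for i
    using that col by auto
  show ?thesis
  proof (rule m.jointly_epic[where S = ?S and J = "\<lambda>i. J (i - 1)" and D = "\<lambda>i. D (i - 1)"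
        and c = "\<lambda>i. c (i - 1)" and t = "\<lambda>i. t (i - 1)" and x = X and f = f and g = g and z = z])
    show "finite ?S" "?S \<subseteq> {..length ns}" by auto
    show "is_colimit (J (i - 1)) (arg_cat ns i) (D (i - 1)) (c (i - 1)) (t (i - 1))" if "i \<in> ?S" for i
      using colS[OF that] .
    show "is_colimit (J (i - 1)) (cat A (sum_list ns)) (functor_comp (m.slot i y) (D (i - 1)))
        (FOb (m.slot i y) (c (i - 1))) (\<lambda>j. FAr (m.slot i y) (t (i - 1) j))"
      if i: "i \<in> ?S" and y: "\<And>l. l \<in> {..length ns} \<Longrightarrow> y l \<in> Ob (arg_cat ns l)" for i y
      by (rule slot_preserves[OF _ y _ _ colS[OF i]]) (use i J in auto)
    show "X l \<in> Ob (arg_cat ns l)" if "l \<in> {..length ns}" for l using Xo[OF that] .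
    show "X i = c (i - 1)" if "i \<in> ?S" for i using that by (auto simp: X_def)
    show "f \<in> hom A (sum_list ns) (mulo A ns (X 0) (arg_list ns X)) z"
      "g \<in> hom A (sum_list ns) (mulo A ns (X 0) (arg_list ns X)) z"
      using f g by (simp_all add: Xc X0)
    fix j assume j: "\<And>i. i \<in> ?S \<Longrightarrow> j i \<in> Ob (J (i - 1))"
    have "arg_list ns (\<lambda>l. if l \<in> ?S then t (l - 1) (j l) else Idn (arg_cat ns l) (X l)) =
        map (\<lambda>i. t i (j (Suc i))) [0..<length ns]"
      by (auto simp: arg_list_def)
    moreover have "(\<lambda>l. if l \<in> ?S then t (l - 1) (j l) else Idn (arg_cat ns l) (X l)) 0 =
        idt A (length ns) x" by (simp add: X0)
    moreover have "j (Suc i) \<in> Ob (J i)" if "i < length ns" for i using j[of "Suc i"] that by simp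
    ultimately show "cmp A (sum_list ns) f
        (mula A ns ((\<lambda>l. if l \<in> ?S then t (l - 1) (j l) else Idn (arg_cat ns l) (X l)) 0)
          (arg_list ns (\<lambda>l. if l \<in> ?S then t (l - 1) (j l) else Idn (arg_cat ns l) (X l)))) =
      cmp A (sum_list ns) g
        (mula A ns ((\<lambda>l. if l \<in> ?S then t (l - 1) (j l) else Idn (arg_cat ns l) (X l)) 0)
          (arg_list ns (\<lambda>l. if l \<in> ?S then t (l - 1) (j l) else Idn (arg_cat ns l) (X l))))"
      using eq[of "\<lambda>i. j (Suc i)"] by simp
  qed
qed

context
  fixes J0 :: "('j, 'i) category" and D0 :: "('j, 'i, 'u, 'u) cat_functor" and c0 :: 'u and t0 :: "'j \<Rightarrow> 'u"
  assumes J0: "countable (Ob J0)" "countable (Ar J0)"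
    and col0: "is_colimit J0 (cat A (length ns)) D0 c0 t0"
begin

lemma epic_jointly:
  assumes f: "f \<in> hom A (sum_list ns) (mulo A ns c0 (map c [0..<length ns])) z"
    and g: "g \<in> hom A (sum_list ns) (mulo A ns c0 (map c [0..<length ns])) z"
    and eq: "\<And>p j. p \<in> Ob J0 \<Longrightarrow> (\<And>i. i < length ns \<Longrightarrow> j i \<in> Ob (J i)) \<Longrightarrow>
      cmp A (sum_list ns) f (mula A ns (t0 p) (map (\<lambda>i. t i (j i)) [0..<length ns])) =
      cmp A (sum_list ns) g (mula A ns (t0 p) (map (\<lambda>i. t i (j i)) [0..<length ns]))"
  shows "f = g"
proof (rule epic_in_operation[OF J0 col0 colimit_obs f g])
  fix p assume p: "p \<in> Ob J0"
  let ?E = "cat A (sum_list ns)" and ?cs = "map c [0..<length ns]"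
  have t0: "t0 p \<in> hom A (length ns) (FOb D0 p) c0"
    using cocone_Hom[OF colimit_cocone[OF col0] p] .
  have tH: "mula A ns (t0 p) (idns A ns ?cs) \<in> Hom ?E (mulo A ns (FOb D0 p) ?cs) (mulo A ns c0 ?cs)"
    using mula_Hom[OF t0 homs_idns[OF colimit_obs]] .
  show "Cmp ?E f (mula A ns (t0 p) (idns A ns ?cs)) = Cmp ?E g (mula A ns (t0 p) (idns A ns ?cs))"
  proof (rule epic_in_inputs[OF _ cmp_hom[OF tH f] cmp_hom[OF tH g]])
    show "FOb D0 p \<in> obj A (length ns)" using hom_obj[OF t0] by simp
    fix j assume j: "\<And>i. i < length ns \<Longrightarrow> j i \<in> Ob (J i)"
    let ?m = "mula A ns (idt A (length ns) (FOb D0 p)) (map (\<lambda>i. t i (j i)) [0..<length ns])"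
    have ts: "homs A ns (map (\<lambda>i. t i (j i)) [0..<length ns]) (map (\<lambda>i. FOb (D i) (j i)) [0..<length ns]) ?cs"
      using j by (rule cocone_arrows)
    have m: "?m \<in> Hom ?E (mulo A ns (FOb D0 p) (map (\<lambda>i. FOb (D i) (j i)) [0..<length ns]))
        (mulo A ns (FOb D0 p) ?cs)"
      using mula_Hom[OF idt_hom[OF hom_obj(1)[OF t0]] ts] .
    show "Cmp ?E (Cmp ?E f (mula A ns (t0 p) (idns A ns ?cs))) ?m =
        Cmp ?E (Cmp ?E g (mula A ns (t0 p) (idns A ns ?cs))) ?m"
      using cmp_assoc[OF m tH f] cmp_assoc[OF m tH g] mula_split(1)[OF t0 ts]
        eq[OF p j] by simp
  qed
qed

lemma factor_jointly:
  assumes z: "z \<in> obj A (sum_list ns)"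
    and hom: "\<And>p qs. p \<in> Ob J0 \<Longrightarrow> length qs = length ns \<Longrightarrow>
      (\<And>i. i < length ns \<Longrightarrow> qs ! i \<in> Ob (J i)) \<Longrightarrow>
      \<phi> p qs \<in> hom A (sum_list ns)
        (mulo A ns (FOb D0 p) (map (\<lambda>i. FOb (D i) (qs ! i)) [0..<length ns])) z"
    and nat: "\<And>a p p' bs qs qs'. a \<in> Hom J0 p p' \<Longrightarrow> length bs = length ns \<Longrightarrow>
      length qs = length ns \<Longrightarrow> length qs' = length ns \<Longrightarrow>
      (\<And>i. i < length ns \<Longrightarrow> bs ! i \<in> Hom (J i) (qs ! i) (qs' ! i)) \<Longrightarrow>
      cmp A (sum_list ns) (\<phi> p' qs')
        (mula A ns (FAr D0 a) (map (\<lambda>i. FAr (D i) (bs ! i)) [0..<length ns])) = \<phi> p qs"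
  obtains \<psi> where "\<psi> \<in> hom A (sum_list ns) (mulo A ns c0 (map c [0..<length ns])) z"
    "\<And>p j. p \<in> Ob J0 \<Longrightarrow> (\<And>i. i < length ns \<Longrightarrow> j i \<in> Ob (J i)) \<Longrightarrow>
      cmp A (sum_list ns) \<psi> (mula A ns (t0 p) (map (\<lambda>i. t i (j i)) [0..<length ns])) =
      \<phi> p (map j [0..<length ns])"
proof -
  interpret m: multifunctor "{..length ns}" "arg_cat ns" "cat A (sum_list ns)"
    "\<lambda>x. mulo A ns (x 0) (arg_list ns x)" "\<lambda>f. mula A ns (f 0) (arg_list ns f)"
    by (rule mul_multifunctor)
  define J' where "J' i = (case i of 0 \<Rightarrow> J0 | Suc l \<Rightarrow> J l)" for i
  define D' where "D' i = (case i of 0 \<Rightarrow> D0 | Suc l \<Rightarrow> D l)" for i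
  define c' where "c' i = (case i of 0 \<Rightarrow> c0 | Suc l \<Rightarrow> c l)" for i
  define t' where "t' i = (case i of 0 \<Rightarrow> t0 | Suc l \<Rightarrow> t l)" for i
  note defs = J'_def D'_def c'_def t'_def
  have col': "is_colimit (J' i) (arg_cat ns i) (D' i) (c' i) (t' i)" if "i \<in> {..length ns}" for i
    using that col col0 by (cases i) (auto simp: defs)
  have cnt: "countable (Ob (J' i))" "countable (Ar (J' i))" if "i \<in> {..length ns}" for i
    using that J J0 by (cases i; auto simp: defs)+
  define \<Phi> where "\<Phi> j = \<phi> (j 0) (arg_list ns j)" for j
  have okS: "j 0 \<in> Ob J0" "\<And>i. i < length ns \<Longrightarrow> j (Suc i) \<in> Ob (J i)"
    if "\<And>i. i \<in> {..length ns} \<Longrightarrow> j i \<in> Ob (J' i)" for j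
    using that[of 0] that[of "Suc _"] by (auto simp: defs)
  show thesis
  proof (rule m.joint_factor[where J = J' and D = D' and c = c' and t = t' and \<phi> = \<Phi> and z = z])
    show "is_colimit (J' i) (arg_cat ns i) (D' i) (c' i) (t' i)" if "i \<in> {..length ns}" for i
      using col'[OF that] .
    show "is_colimit (J' i) (cat A (sum_list ns)) (functor_comp (m.slot i y) (D' i))
        (FOb (m.slot i y) (c' i)) (\<lambda>j. FAr (m.slot i y) (t' i j))"
      if i: "i \<in> {..length ns}" and y: "\<And>l. l \<in> {..length ns} \<Longrightarrow> y l \<in> Ob (arg_cat ns l)" for i y
      by (rule slot_preserves[OF i y cnt[OF i] col'[OF i]])
    show "z \<in> obj A (sum_list ns)" by (rule z)
    show "\<Phi> j = \<Phi> j'" if "\<And>i. i \<in> {..length ns} \<Longrightarrow> j i = j' i" for j j'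
    proof -
      have "arg_list ns j = arg_list ns j'" using that by (simp add: arg_list_def)
      then show ?thesis using that[of 0] by (simp add: \<Phi>_def)
    qed
    have D'l: "arg_list ns (\<lambda>i. FOb (D' i) (j i)) = map (\<lambda>i. FOb (D i) (arg_list ns j ! i)) [0..<length ns]" for j
      by (simp add: arg_list_def defs)
    show "\<Phi> j \<in> hom A (sum_list ns) (mulo A ns (FOb (D' 0) (j 0)) (arg_list ns (\<lambda>i. FOb (D' i) (j i)))) z"
      if j: "\<And>i. i \<in> {..length ns} \<Longrightarrow> j i \<in> Ob (J' i)" for j
      unfolding \<Phi>_def D'l using hom[of "j 0" "arg_list ns j"] okS[OF j] by (simp add: arg_list_def defs)
    show "cmp A (sum_list ns) (\<Phi> (j(i := q)))
        (mula A ns (((\<lambda>l. Idn (arg_cat ns l) (FOb (D' l) (j l)))(i := FAr (D' i) a)) 0)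
          (arg_list ns ((\<lambda>l. Idn (arg_cat ns l) (FOb (D' l) (j l)))(i := FAr (D' i) a)))) = \<Phi> (j(i := p))"
      if j: "\<And>i. i \<in> {..length ns} \<Longrightarrow> j i \<in> Ob (J' i)" and i: "i \<in> {..length ns}"
        and a: "a \<in> Hom (J' i) p q" for j i p q a
    proof -
      define b where "b l = (if l = i then a else Idn (J' l) (j l))" for l
      have J'c: "is_category (J' l)" if "l \<in> {..length ns}" for l
        using functor_category(1)[OF colimit_functor[OF col'[OF that]]] .
      have b: "b l \<in> Hom (J' l) ((j(i := p)) l) ((j(i := q)) l)" if "l \<in> {..length ns}" for l
        using a Idn_Hom[OF J'c[OF that] j[OF that]] by (simp add: b_def)
      have D'b: "((\<lambda>l. Idn (arg_cat ns l) (FOb (D' l) (j l)))(i := FAr (D' i) a)) l = FAr (D' l) (b l)"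
        if "l \<in> {..length ns}" for l
        using functor_Idn[OF colimit_functor[OF col'[OF that]] j[OF that]] by (simp add: b_def)
      have "arg_list ns ((\<lambda>l. Idn (arg_cat ns l) (FOb (D' l) (j l)))(i := FAr (D' i) a)) =
          map (\<lambda>i. FAr (D i) (arg_list ns b ! i)) [0..<length ns]"
        using D'b[of "Suc _"] unfolding arg_list_def by (auto simp: defs)
      moreover have "((\<lambda>l. Idn (arg_cat ns l) (FOb (D' l) (j l)))(i := FAr (D' i) a)) 0 = FAr D0 (b 0)"
        using D'b[of 0] by (simp add: defs)
      moreover have "cmp A (sum_list ns) (\<Phi> (j(i := q)))
        (mula A ns (FAr D0 (b 0)) (map (\<lambda>i. FAr (D i) (arg_list ns b ! i)) [0..<length ns])) = \<Phi> (j(i := p))"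
        unfolding \<Phi>_def
      proof (rule nat)
        show "b 0 \<in> Hom J0 ((j(i := p)) 0) ((j(i := q)) 0)" using b[of 0] by (simp add: defs)
        show "arg_list ns b ! l \<in> Hom (J l) (arg_list ns (j(i := p)) ! l) (arg_list ns (j(i := q)) ! l)"
          if "l < length ns" for l
          using b[of "Suc l"] that by (cases "Suc l = i") (auto simp: arg_list_def defs)
      qed (simp_all add: arg_list_def)
      ultimately show ?thesis by simp
    qed
    fix \<psi> assume \<psi>: "\<psi> \<in> hom A (sum_list ns) (mulo A ns (c' 0) (arg_list ns c')) z"
      "\<And>j. (\<And>i. i \<in> {..length ns} \<Longrightarrow> j i \<in> Ob (J' i)) \<Longrightarrow>
         cmp A (sum_list ns) \<psi> (mula A ns (t' 0 (j 0)) (arg_list ns (\<lambda>i. t' i (j i)))) = \<Phi> j"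
    show thesis
    proof (rule that)
      show "\<psi> \<in> hom A (sum_list ns) (mulo A ns c0 (map c [0..<length ns])) z"
        using \<psi>(1) by (simp add: arg_list_def defs)
      fix p j assume pj: "p \<in> Ob J0" "\<And>i. i < length ns \<Longrightarrow> j i \<in> Ob (J i)"
      define j' where "j' i = (case i of 0 \<Rightarrow> p | Suc l \<Rightarrow> j l)" for i
      have "cmp A (sum_list ns) \<psi> (mula A ns (t' 0 (j' 0)) (arg_list ns (\<lambda>i. t' i (j' i)))) = \<Phi> j'"
      proof (rule \<psi>(2))
        show "j' i \<in> Ob (J' i)" if "i \<in> {..length ns}" for i
          using that pj by (cases i) (auto simp: j'_def defs)
      qed
      then show "cmp A (sum_list ns) \<psi> (mula A ns (t0 p) (map (\<lambda>i. t i (j i)) [0..<length ns])) =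
          \<phi> p (map j [0..<length ns])"
        by (simp add: arg_list_def defs j'_def \<Phi>_def)
    qed
  qed
qed

end

end

end

section \<open>Representing operads are minimal and countable\<close>

lemma represents_operad:
  assumes "represents X h u"
  shows "is_cat_operad h" "is_internal_operad X h u"
  using assms by (auto simp: represents_def)

lemma represents_iso:
  "represents X h u \<Longrightarrow> is_cat_operad B \<Longrightarrow> is_category_iso (SCO h B) (IO X B) (evaluation X u)"
  by (simp add: represents_def)

lemma represents_IO_category:
  fixes h B :: "'u cat_operad"
  shows "represents X h u \<Longrightarrow> is_cat_operad B \<Longrightarrow> is_category (IO X B)"
  using represents_iso[of X h u B] functor_category(2)[of "SCO h B" "IO X B" "evaluation X u"]
  by (simp add: is_category_iso_def)

lemma represents_functor:
  assumes "represents X h u" "is_cat_operad B" "is_internal_operad X B a"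
  obtains F where "is_op_functor h B F" "image_operad X u F = a"
proof -
  have "bij_betw (image_operad X u) {F. is_op_functor h B F} {a. is_internal_operad X B a}"
    using represents_iso[OF assms(1,2)] by (simp add: is_category_iso_def evaluation_def SCO_def IO_def)
  then have "a \<in> image_operad X u ` {F. is_op_functor h B F}"
    using assms(3) bij_betw_imp_surj_on by blast
  then show thesis using that by blast
qed

lemma represents_functor_unique:
  assumes "represents X h u" "is_cat_operad B" "is_op_functor h B F" "is_op_functor h B G"
    and "image_operad X u F = image_operad X u G"
  shows "F = G"
proof -
  have "inj_on (image_operad X u) {F. is_op_functor h B F}"
    using represents_iso[OF assms(1,2)]
    by (simp add: is_category_iso_def evaluation_def SCO_def IO_def bij_betw_def)
  then show ?thesis using assms by (auto dest: inj_onD)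
qed

lemma image_operad_internal:
  assumes "represents X h u" "is_cat_operad B" "is_op_functor h B F"
  shows "is_internal_operad X B (image_operad X u F)"
proof -
  have "bij_betw (image_operad X u) {F. is_op_functor h B F} {a. is_internal_operad X B a}"
    using represents_iso[OF assms(1,2)] by (simp add: is_category_iso_def evaluation_def SCO_def IO_def)
  then show ?thesis using assms(3) by (auto simp: bij_betw_def)
qed

definition suboperad ::
    "'u cat_operad \<Rightarrow> (nat \<Rightarrow> 'u set) \<Rightarrow> (nat \<Rightarrow> 'u set) \<Rightarrow> 'u cat_operad" where
  "suboperad A P M = A\<lparr>cat := \<lambda>k. (cat A k)\<lparr>Ob := P k, Ar := M k\<rparr>\<rparr>"

definition operad_closed ::
    "'u cat_operad \<Rightarrow> (nat \<Rightarrow> 'u set) \<Rightarrow> (nat \<Rightarrow> 'u set) \<Rightarrow> bool" where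
  "operad_closed A P M \<longleftrightarrow>
     (\<forall>k. P k \<subseteq> obj A k \<and> M k \<subseteq> arr A k) \<and>
     (\<forall>k. \<forall>f\<in>M k. src A k f \<in> P k \<and> trg A k f \<in> P k) \<and>
     (\<forall>k. \<forall>x\<in>P k. idt A k x \<in> M k) \<and>
     (\<forall>k. \<forall>f\<in>M k. \<forall>g\<in>M k. trg A k f = src A k g \<longrightarrow> cmp A k g f \<in> M k) \<and>
     (\<forall>k p. p permutes {..<k} \<longrightarrow> (\<forall>x\<in>P k. acto A k p x \<in> P k) \<and> (\<forall>f\<in>M k. acta A k p f \<in> M k)) \<and>
     unt A \<in> P 1 \<and>
     (\<forall>ns x ys. x \<in> P (length ns) \<longrightarrow> each P ns ys \<longrightarrow> mulo A ns x ys \<in> P (sum_list ns)) \<and>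
     (\<forall>ns x ys. x \<in> M (length ns) \<longrightarrow> each M ns ys \<longrightarrow> mula A ns x ys \<in> M (sum_list ns))"

lemma suboperad_simps [simp]:
  "Ob (cat (suboperad A P M) k) = P k" "Ar (cat (suboperad A P M) k) = M k"
  "Src (cat (suboperad A P M) k) = src A k" "Trg (cat (suboperad A P M) k) = trg A k"
  "Idn (cat (suboperad A P M) k) = idt A k" "Cmp (cat (suboperad A P M) k) = cmp A k"
  "acto (suboperad A P M) = acto A" "acta (suboperad A P M) = acta A" "unt (suboperad A P M) = unt A"
  "mulo (suboperad A P M) = mulo A" "mula (suboperad A P M) = mula A"
  by (simp_all add: suboperad_def)

lemma is_set_operad_subset:
  assumes S: "is_set_operad C act e mul" and sub: "\<And>k. C' k \<subseteq> C k"
    and act: "\<And>k p x. p permutes {..<k} \<Longrightarrow> x \<in> C' k \<Longrightarrow> act k p x \<in> C' k" and e: "e \<in> C' 1"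
    and mul: "\<And>ns x ys. x \<in> C' (length ns) \<Longrightarrow> each C' ns ys \<Longrightarrow> mul ns x ys \<in> C' (sum_list ns)"
  shows "is_set_operad C' act e mul"
proof -
  have s: "x \<in> C' k \<Longrightarrow> x \<in> C k" for k x using sub by blast
  have l: "each C' ns ys \<Longrightarrow> each C ns ys" for ns ys
    by (erule list_all2_mono) (rule s)
  have l': "list_all2 (\<lambda>ns y. y \<in> C' (length ns)) nss ys \<Longrightarrow> list_all2 (\<lambda>ns y. y \<in> C (length ns)) nss ys"
    for nss :: "nat list list" and ys by (erule list_all2_mono) (rule s)
  have ll: "list_all2 (each C') nss yss \<Longrightarrow> list_all2 (each C) nss yss"
    for nss yss by (erule list_all2_mono) (rule l)
  show ?thesis
    unfolding is_set_operad_def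
    by (intro conjI allI impI set_operad_id[OF S] set_operad_comp[OF S, symmetric] set_operad_assoc[OF S]
        set_operad_unit[OF S] set_operad_equivariant_operation[OF S] set_operad_equivariant_inputs[OF S]
        act mul e; (rule l l' ll s)?; assumption)
qed

lemma suboperad_operad:
  assumes A: "is_cat_operad A" and cl: "operad_closed A P M"
  shows "is_cat_operad (suboperad A P M)"
proof -
  interpret cat_operad A by standard (rule A)
  let ?S = "suboperad A P M"
  have P: "x \<in> P k \<Longrightarrow> x \<in> obj A k" and M: "f \<in> M k \<Longrightarrow> f \<in> arr A k" for x f k
    using cl by (auto simp: operad_closed_def)
  have st: "src A k f \<in> P k" "trg A k f \<in> P k" if "f \<in> M k" for f k
    using cl that by (auto simp: operad_closed_def)
  have i: "idt A k x \<in> M k" if "x \<in> P k" for x k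
    using cl that by (auto simp: operad_closed_def)
  have c: "cmp A k g f \<in> M k" if "f \<in> M k" "g \<in> M k" "trg A k f = src A k g" for f g k
    using cl that by (auto simp: operad_closed_def)
  have ao: "acto A k p x \<in> P k" if "p permutes {..<k}" "x \<in> P k" for p x k
    using cl that by (auto simp: operad_closed_def)
  have aa: "acta A k p x \<in> M k" if "p permutes {..<k}" "x \<in> M k" for p x k
    using cl that by (auto simp: operad_closed_def)
  have u: "unt A \<in> P 1" using cl by (simp add: operad_closed_def)
  have mo: "mulo A ns x ys \<in> P (sum_list ns)"
    if "x \<in> P (length ns)" "each P ns ys" for ns x ys
    using cl that unfolding operad_closed_def by blast
  have ma: "mula A ns x ys \<in> M (sum_list ns)"
    if "x \<in> M (length ns)" "each M ns ys" for ns x ys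
    using cl that unfolding operad_closed_def by blast
  have lo: "obs A ns ys" if "each P ns ys" for ns ys
    using that by (rule list_all2_mono) (rule P)
  have la: "ars A ns ys" if "each M ns ys" for ns ys
    using that by (rule list_all2_mono) (rule M)
  have H: "f \<in> hom ?S k x y \<longleftrightarrow> f \<in> M k \<and> f \<in> hom A k x y" for f k x y
    using M by (auto simp: Hom_def)
  have cat: "is_category (cat ?S k)" for k
    using category[of k] P M st i c unfolding is_category_def by (auto simp: Hom_def)
  show ?thesis
    unfolding is_cat_operad_def
  proof (intro conjI allI impI)
    show "is_category (cat ?S k)" for k by (rule cat)
    show "is_set_operad (\<lambda>k. obj ?S k) (acto ?S) (unt ?S) (mulo ?S)"
      using is_set_operad_subset[OF object_operad, of P] P ao u mo by (simp add: subset_iff)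
    show "is_set_operad (\<lambda>k. arr ?S k) (acta ?S) (idt ?S 1 (unt ?S)) (mula ?S)"
      using is_set_operad_subset[OF arrow_operad, of M] M aa i[OF u] ma by (simp add: subset_iff)
    show "is_functor (cat ?S k) (cat ?S k) \<lparr>FOb = acto ?S k p, FAr = acta ?S k p\<rparr>" if "p permutes {..<k}" for k p
      using act_functor[OF that] cat[of k] ao[OF that] aa[OF that] P M
      unfolding is_functor_def H by simp
    show "mula ?S ns f gs \<in> hom ?S (sum_list ns)
          (mulo ?S ns (src ?S (length ns) f) (map2 (\<lambda>n. src ?S n) ns gs))
          (mulo ?S ns (trg ?S (length ns) f) (map2 (\<lambda>n. trg ?S n) ns gs))"
      if "f \<in> arr ?S (length ns)" "ars ?S ns gs" for ns f gs
      using that ma M la operad unfolding H is_cat_operad_def by simp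
    show "mula ?S ns (idt ?S (length ns) x) (idns ?S ns ys) = idt ?S (sum_list ns) (mulo ?S ns x ys)"
      if "x \<in> obj ?S (length ns)" "obs ?S ns ys" for ns x ys
      using mula_Idn[OF P lo] that by simp
    fix ns f f' gs gs' assume a: "f \<in> arr ?S (length ns)" "f' \<in> arr ?S (length ns)"
      "trg ?S (length ns) f = src ?S (length ns) f'" "ars ?S ns gs" "ars ?S ns gs'"
      "\<forall>i<length ns. trg ?S (ns ! i) (gs ! i) = src ?S (ns ! i) (gs' ! i)"
    have f: "f \<in> hom A (length ns) (src A (length ns) f) (trg A (length ns) f)"
      "f' \<in> hom A (length ns) (trg A (length ns) f) (trg A (length ns) f')"
      using a M by (auto simp: Hom_def)
    have g: "homs A ns gs (map2 (\<lambda>n. src A n) ns gs) (map2 (\<lambda>n. trg A n) ns gs)"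
      "homs A ns gs' (map2 (\<lambda>n. trg A n) ns gs) (map2 (\<lambda>n. trg A n) ns gs')"
      using a M by (auto simp: homs_def list_all2_conv_all_nth Hom_def)
    show "mula ?S ns (cmp ?S (length ns) f' f)
        (map (\<lambda>i. cmp ?S (ns ! i) (gs' ! i) (gs ! i)) [0..<length ns]) =
      cmp ?S (sum_list ns) (mula ?S ns f' gs') (mula ?S ns f gs)"
      using mula_Cmp[OF f(1) g(1) f(2) g(2)] by (simp add: cmps_def)
  qed
qed

text \<open>The identity of the representing operad factors through every suboperad that contains the
  universal internal operad: the operadic functor into the suboperad that classifies \<open>u\<close> is, seen
  in \<open>h\<close>, another functor that sends \<open>u\<close> to \<open>u\<close>.\<close>

lemma represents_minimal:
  fixes h :: "'u cat_operad"
  assumes rep: "represents X h u" and cl: "operad_closed h P M"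
    and u: "\<And>T. T \<in> IOb X \<Longrightarrow> iob u T \<in> P (Tips X T)"
      "\<And>T S s. T \<in> IOb X \<Longrightarrow> S \<in> IOb X \<Longrightarrow> s \<in> IHom X T S \<Longrightarrow> imu u (T, S, s) \<in> M (Tips X T)"
      "ieps u \<in> M 1"
  shows "P k = obj h k" "M k = arr h k"
proof -
  let ?S = "suboperad h P M"
  have h: "is_cat_operad h" and uh: "is_internal_operad X h u" using represents_operad[OF rep] .
  have S: "is_cat_operad ?S" using suboperad_operad[OF h cl] .
  have sub: "P k \<subseteq> obj h k" "M k \<subseteq> arr h k" for k using cl by (auto simp: operad_closed_def)
  have H: "f \<in> hom ?S k x y \<longleftrightarrow> f \<in> M k \<and> f \<in> hom h k x y" for f k x y
    using sub by (auto simp: Hom_def)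
  have "is_internal_operad X ?S u"
    using uh u unfolding is_internal_operad_def internal_assoc_def H by simp
  then obtain F where F: "is_op_functor h ?S F" "image_operad X u F = u"
    using represents_functor[OF rep S] by blast
  have F': "is_op_functor h h F"
    using F(1) h sub unfolding is_op_functor_def is_functor_def H op_component_def is_cat_operad_def
    by (auto simp: subset_iff)
  define I where "I = \<lparr>oo = (\<lambda>k. \<lambda>x\<in>obj h k. x), oa = (\<lambda>k. \<lambda>f\<in>arr h k. f)\<rparr>"
  interpret h: cat_operad h by standard (rule h)
  have m2: "map2 (\<lambda>k. \<lambda>x\<in>C k. x) ns ys = ys" if "each C ns ys" for C :: "nat \<Rightarrow> 'u set" and ns ys
    using that by (auto simp: list_all2_conv_all_nth intro!: nth_equalityI)
  have I: "is_op_functor h h I"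
    unfolding is_op_functor_def
  proof (intro conjI allI impI ballI)
    show "is_functor (cat h k) (cat h k) (op_component I k)" for k
      using h.category[of k] unfolding is_functor_def op_component_def I_def is_category_def
      by (auto simp: Hom_def)
    show "oo I (sum_list ns) (mulo h ns x ys) = mulo h ns (oo I (length ns) x) (map2 (oo I) ns ys)"
      if "x \<in> obj h (length ns)" "obs h ns ys" for ns x ys
      using that h.mulo_Ob m2[OF that(2)] unfolding I_def op_functor.simps by (simp only: restrict_apply')
    show "oa I (sum_list ns) (mula h ns x ys) = mula h ns (oa I (length ns) x) (map2 (oa I) ns ys)"
      if "x \<in> arr h (length ns)" "ars h ns ys" for ns x ys
    proof -
      have "mula h ns x ys \<in> arr h (sum_list ns)"
        using h.arrow_operad that unfolding is_set_operad_def by blast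
      then show ?thesis
        using that m2[OF that(2)] unfolding I_def op_functor.simps by (simp only: restrict_apply')
    qed
  qed (use h.acto_Ob h.unt_Ob in
      \<open>auto simp: I_def Hom_def h.arrow_operad[unfolded is_set_operad_def]\<close>)
  have "image_operad X u I = u"
  proof -
    have "iob u T \<in> obj h (Tips X T)" if "T \<in> IOb X" for T
      using uh that by (simp add: is_internal_operad_def)
    moreover have "imu u (T, S, s) \<in> arr h (Tips X T)" if "(T, S, s) \<in> index_arrows X" for T S s
      using uh that by (simp add: is_internal_operad_def index_arrows_def Hom_def)
    moreover have "ieps u \<in> arr h 1" "iob u \<in> extensional (IOb X)" "imu u \<in> extensional (index_arrows X)"
      using uh by (auto simp: is_internal_operad_def Hom_def)
    ultimately show ?thesis
      by (intro internal_operad.equality)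
        (auto simp: image_operad_def I_def fun_eq_iff restrict_def extensional_def)
  qed
  then have "F = I" using represents_functor_unique[OF rep h F' I] F(2) by simp
  have "x \<in> P k" if "x \<in> obj h k" for x
    using F(1) that \<open>F = I\<close> unfolding is_op_functor_def is_functor_def op_component_def I_def by auto
  moreover have "f \<in> M k" if "f \<in> arr h k" for f
    using F(1) that \<open>F = I\<close> unfolding is_op_functor_def is_functor_def H op_component_def I_def by auto
  ultimately show "P k = obj h k" "M k = arr h k" using sub[of k] by auto
qed

text \<open>The operations take lists, so that operations of all arities can be treated at once.\<close>

lemma countable_closure:
  assumes "countable (ops :: ('a list \<Rightarrow> 'a) set)"
  obtains R where "countable R" "\<And>f xs. f \<in> ops \<Longrightarrow> set xs \<subseteq> R \<Longrightarrow> f xs \<in> R"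
proof -
  define S where "S = rec_nat {} (\<lambda>_ B. B \<union> (\<Union>f\<in>ops. f ` lists B))"
  have S_Suc: "S (Suc n) = S n \<union> (\<Union>f\<in>ops. f ` lists (S n))" for n by (simp add: S_def)
  have "countable (S n)" for n
  proof (induction n)
    case (Suc n)
    then show ?case unfolding S_Suc using assms by (intro countable_Un countable_UN countable_image countable_lists)
  qed (simp add: S_def)
  then have "countable (\<Union>n. S n)" by (intro countable_UN) auto
  moreover have "f xs \<in> (\<Union>n. S n)" if f: "f \<in> ops" and xs: "set xs \<subseteq> (\<Union>n. S n)" for f xs
  proof -
    have mono: "mono S" by (rule mono_iff_le_Suc[THEN iffD2]) (simp add: S_Suc)
    have "\<exists>n. set xs \<subseteq> S n" using xs
    proof (induction xs)
      case (Cons x xs)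
      then obtain n m where "set xs \<subseteq> S n" "x \<in> S m" by auto
      then have "set (x # xs) \<subseteq> S (max n m)"
        using monoD[OF mono, of n "max n m"] monoD[OF mono, of m "max n m"] by auto
      then show ?case by blast
    qed simp
    then obtain n where "set xs \<subseteq> S n" by blast
    then have "f xs \<in> S (Suc n)" using f by (auto simp: S_Suc)
    then show ?thesis by blast
  qed
  ultimately show thesis using that by blast
qed

text \<open>Closing the data of \<open>u\<close> under the countably many operations of \<open>h\<close> gives a countable suboperad,
  which by minimality is all of \<open>h\<close>.\<close>

lemma represents_countable:
  fixes X :: "('i :: countable, 'f :: countable) index_category"
  assumes rep: "represents X h u"
  shows "countable (obj h k)" "countable (arr h k)"
proof -
  interpret h: cat_operad h by standard (rule represents_operad(1)[OF rep])
  have uh: "is_internal_operad X h u" using represents_operad(2)[OF rep] .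
  define ops where "ops =
    range (\<lambda>k xs. src h k (hd xs)) \<union> range (\<lambda>k xs. trg h k (hd xs)) \<union>
    range (\<lambda>k xs. idt h k (hd xs)) \<union> range (\<lambda>k xs. cmp h k (xs ! 0) (xs ! 1)) \<union>
    range (\<lambda>(k, l) xs. acto h k (perm_of_list l) (hd xs)) \<union>
    range (\<lambda>(k, l) xs. acta h k (perm_of_list l) (hd xs)) \<union>
    range (\<lambda>ns xs. mulo h ns (hd xs) (tl xs)) \<union> range (\<lambda>ns xs. mula h ns (hd xs) (tl xs)) \<union>
    range (\<lambda>T xs. iob u T) \<union> range (\<lambda>p xs. imu u p) \<union> {\<lambda>xs. unt h, \<lambda>xs. ieps u}"
  have "countable ops" unfolding ops_def
    by (intro countable_Un countable_image countableI_type countable_insert countable_empty)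
  then obtain R where R: "countable R" "\<And>f xs. f \<in> ops \<Longrightarrow> set xs \<subseteq> R \<Longrightarrow> f xs \<in> R"
    using countable_closure by blast
  have pl: "p = perm_of_list (map p [0..<k])" if "p permutes {..<k}" for p k
    using permutes_not_in[OF that] by (auto simp: perm_of_list_def fun_eq_iff)
  have sub: "set ys \<subseteq> R" if "list_all2 (\<lambda>n y. y \<in> C n \<inter> R) ns ys" for C ns ys
    using that by (auto simp: list_all2_conv_all_nth in_set_conv_nth)
  have ac: "acto h k p x \<in> R" "acta h k p x \<in> R" if p: "p permutes {..<k}" and x: "x \<in> R" for k p x
  proof -
    have "(\<lambda>xs. acto h k (perm_of_list (map p [0..<k])) (hd xs)) \<in> ops"
      "(\<lambda>xs. acta h k (perm_of_list (map p [0..<k])) (hd xs)) \<in> ops"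
      unfolding ops_def by auto
    from this(1)[THEN R(2), of "[x]"] this(2)[THEN R(2), of "[x]"] x
    show "acto h k p x \<in> R" "acta h k p x \<in> R" unfolding pl[OF p, symmetric] by auto
  qed
  have s: "src h k f \<in> R" "trg h k f \<in> R" "idt h k f \<in> R" if "f \<in> R" for k f
    using R(2)[of "\<lambda>xs. src h k (hd xs)" "[f]"] R(2)[of "\<lambda>xs. trg h k (hd xs)" "[f]"]
      R(2)[of "\<lambda>xs. idt h k (hd xs)" "[f]"] that by (auto simp: ops_def)
  have c: "cmp h k g f \<in> R" if "f \<in> R" "g \<in> R" for k f g
    using R(2)[of "\<lambda>xs. cmp h k (xs ! 0) (xs ! 1)" "[g, f]"] that by (auto simp: ops_def)
  have m: "mulo h ns x ys \<in> R" "mula h ns x ys \<in> R" if "x \<in> R" "set ys \<subseteq> R" for ns x ys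
    using R(2)[of "\<lambda>xs. mulo h ns (hd xs) (tl xs)" "x # ys"]
      R(2)[of "\<lambda>xs. mula h ns (hd xs) (tl xs)" "x # ys"] that by (auto simp: ops_def)
  have uR: "iob u T \<in> R" "imu u p \<in> R" "unt h \<in> R" "ieps u \<in> R" for T p
    using R(2)[of "\<lambda>xs. iob u T" "[]"] R(2)[of "\<lambda>xs. imu u p" "[]"] R(2)[of "\<lambda>xs. unt h" "[]"]
      R(2)[of "\<lambda>xs. ieps u" "[]"] by (auto simp: ops_def)
  have cl: "operad_closed h (\<lambda>k. obj h k \<inter> R) (\<lambda>k. arr h k \<inter> R)"
    unfolding operad_closed_def
  proof (intro conjI allI impI ballI)
    fix ns x ys assume a: "x \<in> obj h (length ns) \<inter> R" "list_all2 (\<lambda>n y. y \<in> obj h n \<inter> R) ns ys"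
    have "obs h ns ys" using a(2) by (rule list_all2_mono) simp
    then show "mulo h ns x ys \<in> obj h (sum_list ns) \<inter> R"
      using h.mulo_Ob m a(1) sub[OF a(2)] by blast
  next
    fix ns x ys assume a: "x \<in> arr h (length ns) \<inter> R" "list_all2 (\<lambda>n y. y \<in> arr h n \<inter> R) ns ys"
    have "ars h ns ys" using a(2) by (rule list_all2_mono) simp
    then have "mula h ns x ys \<in> arr h (sum_list ns)"
      using h.arrow_operad a(1) unfolding is_set_operad_def by blast
    then show "mula h ns x ys \<in> arr h (sum_list ns) \<inter> R"
      using m a(1) sub[OF a(2)] by blast
  qed (use s c ac uR h.acto_Ob h.unt_Ob h.category h.arrow_operad in
      \<open>auto simp: is_category_def is_set_operad_def Hom_def\<close>)
  have "obj h k \<inter> R = obj h k" "arr h k \<inter> R = arr h k"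
    by (rule represents_minimal[OF rep cl]; use uR uh in \<open>auto simp: is_internal_operad_def Hom_def\<close>)+
  then show "countable (obj h k)" "countable (arr h k)"
    using R(1) by (metis countable_Int2)+
qed

section \<open>Trees and desymmetrisation\<close>

text \<open>What the constructions below use of \<open>\<Omega>\<^sup>s\<close> and \<open>\<Omega>\<^sub>n\<close>: passing to tips is compatible with
  composition, fibres and induced maps.\<close>

locale operadic_index =
  fixes X :: "('i, 'f) index_category"
  assumes tip_map: "\<And>T S s. T \<in> IOb X \<Longrightarrow> S \<in> IOb X \<Longrightarrow> s \<in> IHom X T S \<Longrightarrow>
      tip_map X s \<in> fin_maps (Tips X T) (Tips X S)"
    and Fib_IOb: "\<And>T S s i. T \<in> IOb X \<Longrightarrow> S \<in> IOb X \<Longrightarrow> s \<in> IHom X T S \<Longrightarrow> i < Tips X S \<Longrightarrow>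
      Fib X T S s i \<in> IOb X"
    and Tips_Fib: "\<And>T S s i. T \<in> IOb X \<Longrightarrow> S \<in> IOb X \<Longrightarrow> s \<in> IHom X T S \<Longrightarrow> i < Tips X S \<Longrightarrow>
      Tips X (Fib X T S s i) = length (fibre_elems (tip_map X s) i)"
    and IComp_IHom: "\<And>T S R s w. T \<in> IOb X \<Longrightarrow> S \<in> IOb X \<Longrightarrow> R \<in> IOb X \<Longrightarrow>
      s \<in> IHom X T S \<Longrightarrow> w \<in> IHom X S R \<Longrightarrow> IComp X w s \<in> IHom X T R"
    and tip_map_IComp: "\<And>T S R s w. T \<in> IOb X \<Longrightarrow> S \<in> IOb X \<Longrightarrow> R \<in> IOb X \<Longrightarrow>
      s \<in> IHom X T S \<Longrightarrow> w \<in> IHom X S R \<Longrightarrow> tip_map X (IComp X w s) = fin_comp (tip_map X w) (tip_map X s)"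
    and Ind_IHom: "\<And>T S R s w i. T \<in> IOb X \<Longrightarrow> S \<in> IOb X \<Longrightarrow> R \<in> IOb X \<Longrightarrow>
      s \<in> IHom X T S \<Longrightarrow> w \<in> IHom X S R \<Longrightarrow> i < Tips X R \<Longrightarrow>
      Ind X T S R s w i \<in> IHom X (Fib X T R (IComp X w s) i) (Fib X S R w i)"
    and tip_map_Ind: "\<And>T S R s w i. T \<in> IOb X \<Longrightarrow> S \<in> IOb X \<Longrightarrow> R \<in> IOb X \<Longrightarrow>
      s \<in> IHom X T S \<Longrightarrow> w \<in> IHom X S R \<Longrightarrow> i < Tips X R \<Longrightarrow>
      tip_map X (Ind X T S R s w i) = induced (tip_map X s) (tip_map X w) i"
    and IId_IHom: "\<And>T. T \<in> IOb X \<Longrightarrow> IId X T \<in> IHom X T T"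
    and tip_map_IId: "\<And>T. T \<in> IOb X \<Longrightarrow> tip_map X (IId X T) = [0..<Tips X T]"
    and UnitI_IOb: "UnitI X \<in> IOb X" and Tips_UnitI: "Tips X (UnitI X) = 1"
begin

lemma Tips_fibs:
  assumes "T \<in> IOb X" "S \<in> IOb X" "s \<in> IHom X T S"
  shows "map (Tips X) (fibs X T S s) = fibre_sizes (tip_map X s) (Tips X S)"
  using assms by (auto simp: fibs_def fibre_sizes_def Tips_Fib)

lemma fibs_IOb:
  assumes "T \<in> IOb X" "S \<in> IOb X" "s \<in> IHom X T S"
  shows "set (fibs X T S s) \<subseteq> IOb X"
  using assms by (auto simp: fibs_def Fib_IOb)

end

lemma Omega_sym_simps [simp]:
  "IOb Omega_sym = UNIV" "IHom Omega_sym = fin_maps" "IId Omega_sym = (\<lambda>n. [0..<n])"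
  "IComp Omega_sym = fin_comp" "Tips Omega_sym = (\<lambda>n. n)" "tip_map Omega_sym = (\<lambda>s. s)"
  "Fib Omega_sym = (\<lambda>n k s i. length (fibre_elems s i))"
  "Ind Omega_sym = (\<lambda>n k l s w i. induced s w i)" "UnitI Omega_sym = 1"
  by (simp_all add: Omega_sym_def)

lemma ipi_Omega_sym [simp]: "ipi Omega_sym s = fibre_perm s"
  by (simp add: ipi_def)

lemma fibs_Omega_sym: "fibs Omega_sym n k s = fibre_sizes s k"
  by (simp add: fibs_def fibre_sizes_def)

lemma upt_fin_maps: "[0..<n] \<in> fin_maps n n"
  by (rule fin_mapsI) auto

interpretation sym: operadic_index Omega_sym
  by standard (simp_all add: fin_comp_fin_maps induced_fin_maps upt_fin_maps)

lemma Omega_simps [simp]: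
  "IOb (Omega n) = {T. is_tree n T}" "IHom (Omega n) = tree_maps n"
  "IId (Omega n) = (\<lambda>T. map (\<lambda>m. [0..<level T m]) [0..<Suc n])"
  "IComp (Omega n) = map2 fin_comp" "Tips (Omega n) = (\<lambda>T. level T n)"
  "tip_map (Omega n) = (\<lambda>s. s ! n)" "Fib (Omega n) = tree_fibre n"
  "Ind (Omega n) = (\<lambda>T S R s w i. map (\<lambda>m. induced (s ! m) (w ! m) (ancestor R i m)) [0..<Suc n])"
  "UnitI (Omega n) = unit_tree n"
  by (simp_all add: Omega_def del: upt_Suc)

lemma level_simps [simp]: "level T 0 = 1" "level T (Suc m) = length (T ! m)"
  by (simp_all add: level_def)

lemma is_treeD:
  assumes "is_tree n T"
  shows "length T = n" "\<And>m. m < n \<Longrightarrow> T ! m \<in> fin_maps (level T (Suc m)) (level T m)"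
    "\<And>m. m < n \<Longrightarrow> sorted (T ! m)"
  using assms by (auto simp: is_tree_def)

lemma tree_mapsD:
  assumes "s \<in> tree_maps n T S"
  shows "length s = Suc n" "\<And>m. m \<le> n \<Longrightarrow> s ! m \<in> fin_maps (level T m) (level S m)"
    "\<And>m. m < n \<Longrightarrow> fin_comp (s ! m) (T ! m) = fin_comp (S ! m) (s ! Suc m)"
    "\<And>m x y. m < n \<Longrightarrow> x \<le> y \<Longrightarrow> y < level T (Suc m) \<Longrightarrow> T ! m ! x = T ! m ! y \<Longrightarrow>
       s ! Suc m ! x \<le> s ! Suc m ! y"
  using assms by (auto simp: tree_maps_def)

lemma tree_maps_commute:
  assumes "is_tree n T" "s \<in> tree_maps n T S" "m < n" "x < level T (Suc m)"
  shows "s ! m ! (T ! m ! x) = S ! m ! (s ! Suc m ! x)"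
proof -
  have "fin_comp (s ! m) (T ! m) ! x = s ! m ! (T ! m ! x)"
    using fin_comp_nth[OF is_treeD(2)[OF assms(1,3)] assms(4)] .
  moreover have "fin_comp (S ! m) (s ! Suc m) ! x = S ! m ! (s ! Suc m ! x)"
    using fin_comp_nth[OF tree_mapsD(2)[OF assms(2), of "Suc m"] assms(4)] assms(3) by simp
  ultimately show ?thesis using tree_mapsD(3)[OF assms(2,3)] by simp
qed

lemma ancestor_top: "length S = n \<Longrightarrow> ancestor S i n = i"
  by (simp add: ancestor_def)

lemma ancestor_step: "is_tree n S \<Longrightarrow> m < n \<Longrightarrow> ancestor S i m = S ! m ! ancestor S i (Suc m)"
  using is_treeD(1) by (simp add: ancestor_def Cons_nth_drop_Suc[symmetric])

lemma ancestor_level: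
  assumes S: "is_tree n S" and "i < level S n" "m \<le> n"
  shows "ancestor S i m < level S m"
  using assms(3)
proof (induction m rule: inc_induct)
  case base
  then show ?case using ancestor_top[OF is_treeD(1)[OF S]] assms(2) by simp
next
  case (step m)
  then show ?case using fin_maps_nth[OF is_treeD(2)[OF S step(2)]] ancestor_step[OF S step(2)] by simp
qed

context
  fixes n :: nat and T S :: tree and s :: tree_map and i :: nat
  assumes T: "is_tree n T" and S: "is_tree n S" and s: "s \<in> tree_maps n T S" and i: "i < level S n"
begin

lemma tree_fibre_elems_step:
  assumes "m < n" "x \<in> set (tree_fibre_elems S s i (Suc m))"
  shows "T ! m ! x \<in> set (tree_fibre_elems S s i m)" "x < level T (Suc m)"
proof -
  have x: "x < level T (Suc m)" "s ! Suc m ! x = ancestor S i (Suc m)"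
    using assms fin_maps_length[OF tree_mapsD(2)[OF s, of "Suc m"]]
    by (auto simp: tree_fibre_elems_def set_fibre_elems)
  then show "x < level T (Suc m)" by simp
  have "s ! m ! (T ! m ! x) = ancestor S i m"
    using tree_maps_commute[OF T s assms(1) x(1)] x(2) ancestor_step[OF S assms(1)] by simp
  then show "T ! m ! x \<in> set (tree_fibre_elems S s i m)"
    using fin_maps_nth[OF is_treeD(2)[OF T assms(1)] x(1)] fin_maps_length[OF tree_mapsD(2)[OF s, of m]]
      assms(1) by (simp add: tree_fibre_elems_def set_fibre_elems)
qed

lemma level_tree_fibre:
  assumes "m \<le> n"
  shows "level (tree_fibre n T S s i) m = length (tree_fibre_elems S s i m)"
proof (cases m)
  case 0
  have "s ! 0 \<in> fin_maps 1 1" using tree_mapsD(2)[OF s, of 0] by simp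
  then have "s ! 0 = replicate 1 0" by (rule fin_maps_1[THEN iffD1])
  moreover have "ancestor S i 0 = 0" using ancestor_level[OF S i, of 0] by simp
  ultimately show ?thesis using 0 by (simp add: tree_fibre_elems_def fibre_elems_def)
next
  case (Suc l)
  then show ?thesis using assms by (simp add: tree_fibre_def)
qed

lemma tree_fibre_nth:
  assumes "m < n" "j < length (tree_fibre_elems S s i (Suc m))"
  shows "tree_fibre n T S s i ! m ! j =
    rank (tree_fibre_elems S s i m) (T ! m ! (tree_fibre_elems S s i (Suc m) ! j))"
  using assms by (simp add: tree_fibre_def)

lemma is_tree_tree_fibre: "is_tree n (tree_fibre n T S s i)"
  unfolding is_tree_def
proof (intro conjI allI impI)
  show "length (tree_fibre n T S s i) = n" by (simp add: tree_fibre_def)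
  fix m assume m: "m < n"
  let ?F = "tree_fibre n T S s i" and ?E = "tree_fibre_elems S s i"
  have l: "length (?F ! m) = length (?E (Suc m))" using m by (simp add: tree_fibre_def)
  show "?F ! m \<in> fin_maps (level ?F (Suc m)) (level ?F m)"
  proof (rule fin_mapsI)
    fix x assume "x < level ?F (Suc m)"
    then have x: "x < length (?E (Suc m))" using l by simp
    show "?F ! m ! x < level ?F m"
      using tree_fibre_nth[OF m x] level_tree_fibre[of m] m tree_fibre_elems_step(1)[OF m nth_mem[OF x]]
        nth_rank(1)[of "?E m"] sorted_fibre_elems by (simp add: tree_fibre_elems_def)
  qed simp
  show "sorted (?F ! m)"
  proof (rule sorted_iff_nth_mono[THEN iffD2], intro allI impI)
    fix x y assume "x \<le> y" "y < length (?F ! m)"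
    then have xy: "x \<le> y" "x < length (?E (Suc m))" "y < length (?E (Suc m))" using l by auto
    have "?E (Suc m) ! x \<le> ?E (Suc m) ! y"
      using xy sorted_nth_mono[OF strict_sorted_imp_sorted[OF sorted_fibre_elems]]
      by (simp add: tree_fibre_elems_def)
    then have "T ! m ! (?E (Suc m) ! x) \<le> T ! m ! (?E (Suc m) ! y)"
      using sorted_nth_mono[OF is_treeD(3)[OF T m]] tree_fibre_elems_step(2)[OF m nth_mem[OF xy(3)]] by simp
    then show "?F ! m ! x \<le> ?F ! m ! y"
      using xy by (simp add: tree_fibre_nth[OF m] rank_mono)
  qed
qed

end

lemma length_fin_comp: "length (fin_comp w s) = length s"
  by (simp add: fin_comp_def)

lemma nth_fin_comp: "j < length s \<Longrightarrow> fin_comp w s ! j = w ! (s ! j)"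
  by (simp add: fin_comp_def)

lemma tree_maps_comp:
  assumes T: "is_tree n T" and S: "is_tree n S" and s: "s \<in> tree_maps n T S" and w: "w \<in> tree_maps n S R"
  shows "map2 fin_comp w s \<in> tree_maps n T R"
proof -
  note l = tree_mapsD(1)[OF s] tree_mapsD(1)[OF w]
  have n: "map2 fin_comp w s ! m = fin_comp (w ! m) (s ! m)" if "m \<le> n" for m using that l by simp
  have sm: "s ! Suc m ! x < level S (Suc m)" if "m < n" "x < level T (Suc m)" for m x
    using fin_maps_nth[OF tree_mapsD(2)[OF s, of "Suc m"]] that by simp
  show ?thesis
    unfolding tree_maps_def
  proof (intro CollectI conjI allI impI)
    show "length (map2 fin_comp w s) = Suc n" using l by simp
    show "map2 fin_comp w s ! m \<in> fin_maps (level T m) (level R m)" if "m \<le> n" for m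
      using fin_comp_fin_maps[OF tree_mapsD(2)[OF s that] tree_mapsD(2)[OF w that]] n[OF that] by simp
    show "fin_comp (map2 fin_comp w s ! m) (T ! m) = fin_comp (R ! m) (map2 fin_comp w s ! Suc m)"
      if m: "m < n" for m
    proof (rule nth_equalityI)
      have sl: "length (s ! Suc m) = level T (Suc m)"
        using fin_maps_length[OF tree_mapsD(2)[OF s, of "Suc m"]] m by simp
      show "length (fin_comp (map2 fin_comp w s ! m) (T ! m)) = length (fin_comp (R ! m) (map2 fin_comp w s ! Suc m))"
        using m sl n[of "Suc m"] by (simp add: fin_comp_def)
      fix x assume "x < length (fin_comp (map2 fin_comp w s ! m) (T ! m))"
      then have x: "x < level T (Suc m)" by (simp add: fin_comp_def)
      have Tx: "T ! m ! x < level T m" using fin_maps_nth[OF is_treeD(2)[OF T m] x] .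
      show "fin_comp (map2 fin_comp w s ! m) (T ! m) ! x = fin_comp (R ! m) (map2 fin_comp w s ! Suc m) ! x"
        using fin_comp_nth[OF is_treeD(2)[OF T m] x] n[of m] n[of "Suc m"] m
          fin_comp_nth[OF tree_mapsD(2)[OF s, of m] Tx]
          fin_comp_nth[OF fin_comp_fin_maps[OF tree_mapsD(2)[OF s, of "Suc m"] tree_mapsD(2)[OF w, of "Suc m"]] x]
          fin_comp_nth[OF tree_mapsD(2)[OF s, of "Suc m"] x]
          tree_maps_commute[OF T s m x] tree_maps_commute[OF S w m sm[OF m x]]
        by simp
    qed
    fix m x y assume m: "m < n" and xy: "x \<le> y \<and> y < level T (Suc m) \<and> T ! m ! x = T ! m ! y"
    then have x: "x < level T (Suc m)" and y: "y < level T (Suc m)" by auto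
    have "S ! m ! (s ! Suc m ! x) = S ! m ! (s ! Suc m ! y)"
      using tree_maps_commute[OF T s m x] tree_maps_commute[OF T s m y] xy by simp
    then have "w ! Suc m ! (s ! Suc m ! x) \<le> w ! Suc m ! (s ! Suc m ! y)"
      using tree_mapsD(4)[OF w m _ sm[OF m y]] tree_mapsD(4)[OF s m] xy by blast
    then show "map2 fin_comp w s ! Suc m ! x \<le> map2 fin_comp w s ! Suc m ! y"
      using n[of "Suc m"] m fin_comp_nth[OF tree_mapsD(2)[OF s, of "Suc m"] x]
        fin_comp_nth[OF tree_mapsD(2)[OF s, of "Suc m"] y] by simp
  qed
qed

lemma tree_maps_induced:
  assumes T: "is_tree n T" and S: "is_tree n S" and R: "is_tree n R"
    and s: "s \<in> tree_maps n T S" and w: "w \<in> tree_maps n S R" and i: "i < level R n"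
  shows "map (\<lambda>m. induced (s ! m) (w ! m) (ancestor R i m)) [0..<Suc n] \<in>
    tree_maps n (tree_fibre n T R (map2 fin_comp w s) i) (tree_fibre n S R w i)"
    (is "?f \<in> tree_maps n ?FT ?FS")
proof -
  let ?ws = "map2 fin_comp w s"
  note l = tree_mapsD(1)[OF s] tree_mapsD(1)[OF w]
  have ws: "?ws \<in> tree_maps n T R" by (rule tree_maps_comp[OF T S s w])
  have wsm: "?ws ! m = fin_comp (w ! m) (s ! m)" if "m \<le> n" for m using that l by simp
  let ?ET = "tree_fibre_elems R ?ws i" and ?ES = "tree_fibre_elems R w i"
  have ET: "?ET m = fibre_elems (fin_comp (w ! m) (s ! m)) (ancestor R i m)" if "m \<le> n" for m
    using wsm[OF that] by (simp add: tree_fibre_elems_def)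
  have ES: "?ES m = fibre_elems (w ! m) (ancestor R i m)" for m by (simp add: tree_fibre_elems_def)
  note lT = level_tree_fibre[OF T R ws i] and lS = level_tree_fibre[OF S R w i]
  have f: "?f ! m = induced (s ! m) (w ! m) (ancestor R i m)" if "m \<le> n" for m
    using that by (simp del: upt_Suc)
  have ex: "x < level T m \<and> w ! m ! (s ! m ! x) = ancestor R i m"
    if "m \<le> n" "x \<in> set (?ET m)" for m x
  proof -
    have "x < length (fin_comp (w ! m) (s ! m))" "fin_comp (w ! m) (s ! m) ! x = ancestor R i m"
      using that by (auto simp: ET set_fibre_elems)
    then show ?thesis
      using fin_comp_nth[OF tree_mapsD(2)[OF s that(1)]] fin_maps_length[OF tree_mapsD(2)[OF s that(1)]]
      by (simp add: fin_comp_def)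
  qed
  have fr: "?f ! m ! rank (?ET m) x = rank (?ES m) (s ! m ! x)"
    if "m \<le> n" "x \<in> set (?ET m)" for m x
    unfolding f[OF that(1)] ES ET[OF that(1)]
    using induced_rank(1)[OF tree_mapsD(2)[OF s that(1)] tree_mapsD(2)[OF w that(1)]] ex[OF that] by blast
  have rn: "rank (?ET m) (?ET m ! j) = j" if "j < length (?ET m)" for m j
    using rank_nth[OF sorted_fibre_elems] that by (simp add: tree_fibre_elems_def)
  have fj: "?f ! m ! j = rank (?ES m) (s ! m ! (?ET m ! j))" if "m \<le> n" "j < length (?ET m)" for m j
    using fr[OF that(1) nth_mem[OF that(2)]] rn[OF that(2)] by simp
  have sx: "s ! m ! x \<in> set (?ES m)" if "m \<le> n" "x \<in> set (?ET m)" for m x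
    using ex[OF that] fin_maps_nth[OF tree_mapsD(2)[OF s that(1)]] fin_maps_length[OF tree_mapsD(2)[OF w that(1)]]
    by (simp add: ES set_fibre_elems)
  have rS: "rank (?ES m) x < length (?ES m)" "?ES m ! rank (?ES m) x = x" if "x \<in> set (?ES m)" for m x
    using nth_rank[OF sorted_fibre_elems] that unfolding ES by auto
  have ffm: "?f ! m \<in> fin_maps (level ?FT m) (level ?FS m)" if m: "m \<le> n" for m
    unfolding f[OF m] lT[OF m] lS[OF m] ES ET[OF m]
    by (rule induced_fin_maps[OF tree_mapsD(2)[OF s m] tree_mapsD(2)[OF w m]])
  show ?thesis
    unfolding tree_maps_def
  proof (intro CollectI conjI allI impI)
    show "length ?f = Suc n" by simp
    show "?f ! m \<in> fin_maps (level ?FT m) (level ?FS m)" if "m \<le> n" for m by (rule ffm[OF that])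
    note FTn = tree_fibre_nth[where T = T and S = R and s = ?ws and i = i and n = n]
      and FSn = tree_fibre_nth[where T = S and S = R and s = w and i = i and n = n]
    show "fin_comp (?f ! m) (?FT ! m) = fin_comp (?FS ! m) (?f ! Suc m)" if m: "m < n" for m
    proof (rule nth_equalityI)
      have lf: "length (?f ! Suc m) = length (?ET (Suc m))"
        using fin_maps_length[OF ffm[of "Suc m"]] lT[of "Suc m"] m by simp
      have lF: "length (?FT ! m) = length (?ET (Suc m))" using lT[of "Suc m"] m by simp
      show "length (fin_comp (?f ! m) (?FT ! m)) = length (fin_comp (?FS ! m) (?f ! Suc m))"
        by (simp only: length_fin_comp lf lF)
      fix j assume "j < length (fin_comp (?f ! m) (?FT ! m))"
      then have j: "j < length (?ET (Suc m))" by (simp only: length_fin_comp lF)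
      let ?x = "?ET (Suc m) ! j"
      have x: "?x \<in> set (?ET (Suc m))" using nth_mem[OF j] .
      have m': "Suc m \<le> n" "m \<le> n" using m by auto
      have Tx: "T ! m ! ?x \<in> set (?ET m)" using tree_fibre_elems_step(1)[OF T R ws i m x] .
      have "fin_comp (?f ! m) (?FT ! m) ! j = ?f ! m ! (?FT ! m ! j)"
        by (simp only: nth_fin_comp lF j)
      also have "\<dots> = rank (?ES m) (s ! m ! (T ! m ! ?x))"
        using FTn[OF T R ws i m j] fr[OF m'(2) Tx] by simp
      also have "\<dots> = rank (?ES m) (S ! m ! (s ! Suc m ! ?x))"
        using tree_maps_commute[OF T s m] ex[OF m'(1) x] by simp
      also have "\<dots> = ?FS ! m ! rank (?ES (Suc m)) (s ! Suc m ! ?x)"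
        using FSn[OF S R w i m] rS[OF sx[OF m'(1) x]] by simp
      also have "\<dots> = fin_comp (?FS ! m) (?f ! Suc m) ! j"
        by (simp only: nth_fin_comp lf j fj[OF m'(1) j])
      finally show "fin_comp (?f ! m) (?FT ! m) ! j = fin_comp (?FS ! m) (?f ! Suc m) ! j" .
    qed
    fix m x y assume m: "m < n" and xy: "x \<le> y \<and> y < level ?FT (Suc m) \<and> ?FT ! m ! x = ?FT ! m ! y"
    have m': "Suc m \<le> n" "m \<le> n" using m by auto
    have x: "x < length (?ET (Suc m))" and y: "y < length (?ET (Suc m))"
      using xy lT[OF m'(1)] by auto
    let ?x = "?ET (Suc m) ! x" and ?y = "?ET (Suc m) ! y"
    have le: "?x \<le> ?y"
      using xy y sorted_nth_mono[OF strict_sorted_imp_sorted[OF sorted_fibre_elems]]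
      by (simp add: tree_fibre_elems_def)
    have "rank (?ET m) (T ! m ! ?x) = rank (?ET m) (T ! m ! ?y)"
      using FTn[OF T R ws i m x] FTn[OF T R ws i m y] xy by simp
    then have "T ! m ! ?x = T ! m ! ?y"
      using nth_rank(2)[OF sorted_fibre_elems] tree_fibre_elems_step(1)[OF T R ws i m nth_mem[OF x]]
        tree_fibre_elems_step(1)[OF T R ws i m nth_mem[OF y]] unfolding ET[OF m'(2)] by metis
    then have "s ! Suc m ! ?x \<le> s ! Suc m ! ?y"
      using tree_mapsD(4)[OF s m le] ex[OF m'(1) nth_mem[OF y]] by simp
    then show "?f ! Suc m ! x \<le> ?f ! Suc m ! y"
      using fj[OF m'(1) x] fj[OF m'(1) y] by (simp add: rank_mono)
  qed
qed

lemma operadic_index_Omega: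
  assumes "1 \<le> n"
  shows "operadic_index (Omega n)"
proof
  fix T S R s w i
  assume "T \<in> IOb (Omega n)" "S \<in> IOb (Omega n)" "R \<in> IOb (Omega n)"
  then have T: "is_tree n T" and S: "is_tree n S" and R: "is_tree n R" by simp_all
  { assume "s \<in> IHom (Omega n) T S"
    then have s: "s \<in> tree_maps n T S" by simp
    { assume "i < Tips (Omega n) S"
      then have i: "i < level S n" by simp
      show "Fib (Omega n) T S s i \<in> IOb (Omega n)" using is_tree_tree_fibre[OF T S s i] by simp
      show "Tips (Omega n) (Fib (Omega n) T S s i) = length (fibre_elems (tip_map (Omega n) s) i)"
        using level_tree_fibre[OF T S s i order_refl] ancestor_top[OF is_treeD(1)[OF S]]
        by (simp add: tree_fibre_elems_def) }
    assume "w \<in> IHom (Omega n) S R"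
    then have w: "w \<in> tree_maps n S R" by simp
    show "IComp (Omega n) w s \<in> IHom (Omega n) T R" using tree_maps_comp[OF T S s w] by simp
    show "tip_map (Omega n) (IComp (Omega n) w s) = fin_comp (tip_map (Omega n) w) (tip_map (Omega n) s)"
      using tree_mapsD(1)[OF s] tree_mapsD(1)[OF w] by simp
    assume "i < Tips (Omega n) R"
    then have i: "i < level R n" by simp
    show "Ind (Omega n) T S R s w i \<in> IHom (Omega n) (Fib (Omega n) T R (IComp (Omega n) w s) i) (Fib (Omega n) S R w i)"
      using tree_maps_induced[OF T S R s w i] by (simp del: upt_Suc)
    show "tip_map (Omega n) (Ind (Omega n) T S R s w i) = induced (tip_map (Omega n) s) (tip_map (Omega n) w) i"
      using ancestor_top[OF is_treeD(1)[OF R]] by (simp del: upt_Suc) }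
next
  fix T S s assume "s \<in> IHom (Omega n) T S"
  then show "tip_map (Omega n) s \<in> fin_maps (Tips (Omega n) T) (Tips (Omega n) S)"
    using tree_mapsD(2)[of s n T S n] by simp
next
  fix T assume "T \<in> IOb (Omega n)"
  then have T: "is_tree n T" by simp
  let ?i = "map (\<lambda>m. [0..<level T m]) [0..<Suc n]"
  have i: "?i ! m = [0..<level T m]" if "m \<le> n" for m using that by (simp del: upt_Suc)
  show "tip_map (Omega n) (IId (Omega n) T) = [0..<Tips (Omega n) T]" by (simp add: i del: upt_Suc)
  have "?i \<in> tree_maps n T T"
    unfolding tree_maps_def
  proof (intro CollectI conjI allI impI)
    fix m assume m: "m < n"
    have "fin_comp [0..<level T m] (T ! m) = T ! m"
      unfolding fin_comp_def by (rule map_idI) (use is_treeD(2)[OF T m] in \<open>auto simp: fin_maps_def\<close>)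
    moreover have "fin_comp (T ! m) [0..<level T (Suc m)] = T ! m"
      by (simp add: fin_comp_def map_nth)
    ultimately show "fin_comp (?i ! m) (T ! m) = fin_comp (T ! m) (?i ! Suc m)"
      using m i[of m] i[of "Suc m"] by simp
    show "?i ! Suc m ! x \<le> ?i ! Suc m ! y"
      if "x \<le> y \<and> y < level T (Suc m) \<and> T ! m ! x = T ! m ! y" for x y
      using that m i[of "Suc m"] by simp
  qed (use i upt_fin_maps in \<open>simp_all del: upt_Suc\<close>)
  then show "IId (Omega n) T \<in> IHom (Omega n) T T" by simp
next
  have l: "level (unit_tree n) m = 1" if "m \<le> n" for m
    using that by (cases m) (auto simp: unit_tree_def)
  then show "Tips (Omega n) (UnitI (Omega n)) = 1" by simp
  show "UnitI (Omega n) \<in> IOb (Omega n)"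
    using l by (auto simp: is_tree_def unit_tree_def fin_maps_def)
qed

lemma internal_ob: "is_internal_operad X A a \<Longrightarrow> T \<in> IOb X \<Longrightarrow> iob a T \<in> obj A (Tips X T)"
  by (simp add: is_internal_operad_def)

lemma internal_mu: "is_internal_operad X A a \<Longrightarrow> T \<in> IOb X \<Longrightarrow> S \<in> IOb X \<Longrightarrow> s \<in> IHom X T S \<Longrightarrow>
    imu a (T, S, s) \<in> hom A (Tips X T)
      (mulo A (map (Tips X) (fibs X T S s)) (iob a S) (map (iob a) (fibs X T S s)))
      (acto A (Tips X T) (ipi X s) (iob a T))"
  by (simp add: is_internal_operad_def)

lemma internal_eps: "is_internal_operad X A a \<Longrightarrow> ieps a \<in> hom A 1 (unt A) (iob a (UnitI X))"
  by (simp add: is_internal_operad_def)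

lemma internal_associative: "is_internal_operad X A a \<Longrightarrow> T \<in> IOb X \<Longrightarrow> S \<in> IOb X \<Longrightarrow> R \<in> IOb X \<Longrightarrow>
    s \<in> IHom X T S \<Longrightarrow> w \<in> IHom X S R \<Longrightarrow> internal_assoc X A a T S R s w"
  by (simp add: is_internal_operad_def)

lemma internal_unit_right: "is_internal_operad X A a \<Longrightarrow> T \<in> IOb X \<Longrightarrow>
    cmp A (Tips X T) (imu a (T, T, IId X T))
      (mula A (replicate (Tips X T) 1) (idt A (Tips X T) (iob a T)) (replicate (Tips X T) (ieps a))) =
    idt A (Tips X T) (iob a T)"
  by (simp add: is_internal_operad_def)

lemma internal_unit_left: "is_internal_operad X A a \<Longrightarrow> T \<in> IOb X \<Longrightarrow> s \<in> IHom X T (UnitI X) \<Longrightarrow>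
    cmp A (Tips X T) (imu a (T, UnitI X, s))
      (mula A [Tips X T] (ieps a) [idt A (Tips X T) (iob a T)]) =
    idt A (Tips X T) (iob a T)"
  by (simp add: is_internal_operad_def)

definition desymmetrise ::
    "('i, 'f) index_category \<Rightarrow> (nat, nat list, 'u) internal_operad \<Rightarrow> ('i, 'f, 'u) internal_operad" where
  "desymmetrise X b =
     \<lparr>iob = (\<lambda>T\<in>IOb X. iob b (Tips X T)),
      imu = (\<lambda>(T, S, s)\<in>index_arrows X. imu b (Tips X T, Tips X S, tip_map X s)),
      ieps = ieps b\<rparr>"

lemma delta_desymmetrise: "delta n b = desymmetrise (Omega n) b"
  by (simp add: delta_def desymmetrise_def)

lemma desymmetrise_simps [simp]:
  "T \<in> IOb X \<Longrightarrow> iob (desymmetrise X b) T = iob b (Tips X T)"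
  "T \<in> IOb X \<Longrightarrow> S \<in> IOb X \<Longrightarrow> s \<in> IHom X T S \<Longrightarrow>
     imu (desymmetrise X b) (T, S, s) = imu b (Tips X T, Tips X S, tip_map X s)"
  "ieps (desymmetrise X b) = ieps b"
  by (simp_all add: desymmetrise_def index_arrows_def)

context operadic_index
begin

lemma map_Tips:
  "set Ts \<subseteq> IOb X \<Longrightarrow> (\<And>T. T \<in> IOb X \<Longrightarrow> f T = g (Tips X T)) \<Longrightarrow> map f Ts = map g (map (Tips X) Ts)"
  by auto

text \<open>The fibres whose objects are the innermost inputs in the associativity law.\<close>

definition double_fibs :: "'i \<Rightarrow> 'i \<Rightarrow> 'i \<Rightarrow> 'f \<Rightarrow> 'f \<Rightarrow> 'i list" where
  "double_fibs T S R s w = concat (map (\<lambda>i. fibs X (Fib X T R (IComp X w s) i) (Fib X S R w i)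
     (Ind X T S R s w i)) [0..<Tips X R])"

context
  fixes T S R s w
  assumes T: "T \<in> IOb X" and S: "S \<in> IOb X" and R: "R \<in> IOb X"
    and s: "s \<in> IHom X T S" and w: "w \<in> IHom X S R"
begin

lemma double_fibs_IOb: "set (double_fibs T S R s w) \<subseteq> IOb X"
proof -
  have "set (fibs X (Fib X T R (IComp X w s) i) (Fib X S R w i) (Ind X T S R s w i)) \<subseteq> IOb X"
    if "i < Tips X R" for i
    by (rule fibs_IOb[OF Fib_IOb[OF T R IComp_IHom[OF T S R s w] that] Fib_IOb[OF S R w that]
          Ind_IHom[OF T S R s w that]])
  then show ?thesis unfolding double_fibs_def by (simp add: UN_subset_iff)
qed

lemma Tips_inner_fibs:
  assumes "i < Tips X R"
  shows "map (Tips X) (fibs X (Fib X T R (IComp X w s) i) (Fib X S R w i) (Ind X T S R s w i)) =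
    fibre_sizes (induced (tip_map X s) (tip_map X w) i) (length (fibre_elems (tip_map X w) i))"
  using Tips_fibs[OF Fib_IOb[OF T R IComp_IHom[OF T S R s w] assms] Fib_IOb[OF S R w assms]
      Ind_IHom[OF T S R s w assms]]
  by (simp add: tip_map_Ind[OF T S R s w assms] Tips_Fib[OF S R w assms])

lemma Tips_double_fibs:
  "map (Tips X) (double_fibs T S R s w) =
     concat (map (\<lambda>i. fibre_sizes (induced (tip_map X s) (tip_map X w) i)
       (length (fibre_elems (tip_map X w) i))) [0..<Tips X R])"
  unfolding double_fibs_def map_concat map_map
  by (rule arg_cong[where f = concat]) (auto simp: Tips_inner_fibs)

end

text \<open>For a desymmetrised operad all terms of the associativity law depend on trees and their maps only
  through tips, so that the law is an instance of the one over \<open>\<Omega>\<^sup>s\<close>.\<close>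

lemma internal_assoc_desymmetrise:
  assumes b: "internal_assoc Omega_sym A b (Tips X T) (Tips X S) (Tips X R) (tip_map X s) (tip_map X w)"
    and T: "T \<in> IOb X" and S: "S \<in> IOb X" and R: "R \<in> IOb X"
    and s: "s \<in> IHom X T S" and w: "w \<in> IHom X S R"
  shows "internal_assoc X A (desymmetrise X b) T S R s w"
proof -
  let ?idn = "\<lambda>n. idt A n (iob b n)"
  note ws = IComp_IHom[OF T S R s w]
  have d: "concat (map (\<lambda>i. fibs X (Fib X T R (IComp X w s) i) (Fib X S R w i) (Ind X T S R s w i))
      [0..<Tips X R]) = double_fibs T S R s w" by (simp add: double_fibs_def)
  have idn: "map (\<lambda>T. idt A (Tips X T) (iob (desymmetrise X b) T)) (double_fibs T S R s w) =
      map ?idn (map (Tips X) (double_fibs T S R s w))"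
    by (rule map_Tips[OF double_fibs_IOb[OF T S R s w]]) simp
  have sp: "map (\<lambda>i. ipi X (Ind X T S R s w i)) [0..<Tips X R] =
      map (\<lambda>i. fibre_perm (induced (tip_map X s) (tip_map X w) i)) [0..<Tips X R]"
    by (auto simp: ipi_def tip_map_Ind[OF T S R s w])
  have mu: "map (\<lambda>i. imu (desymmetrise X b) (Fib X T R (IComp X w s) i, Fib X S R w i, Ind X T S R s w i)) [0..<Tips X R] =
      map (\<lambda>i. imu b (length (fibre_elems (fin_comp (tip_map X w) (tip_map X s)) i),
        length (fibre_elems (tip_map X w) i), induced (tip_map X s) (tip_map X w) i)) [0..<Tips X R]"
    using Fib_IOb[OF T R ws] Fib_IOb[OF S R w] Ind_IHom[OF T S R s w]
    by (auto simp: tip_map_Ind[OF T S R s w] Tips_Fib[OF T R ws] Tips_Fib[OF S R w]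
        tip_map_IComp[OF T S R s w])
  show ?thesis
    using b T S R s w ws unfolding internal_assoc_def Let_def d idn sp mu Tips_double_fibs[OF T S R s w]
    by (simp add: fibs_Omega_sym Tips_fibs tip_map_IComp[OF T S R s w] ipi_def)
qed

lemma desymmetrise_internal:
  assumes b: "is_internal_operad Omega_sym A b"
  shows "is_internal_operad X A (desymmetrise X b)"
  unfolding is_internal_operad_def
proof (intro conjI ballI)
  show "iob (desymmetrise X b) \<in> extensional (IOb X)" "imu (desymmetrise X b) \<in> extensional (index_arrows X)"
    by (simp_all add: desymmetrise_def)
  show "iob (desymmetrise X b) T \<in> obj A (Tips X T)" if "T \<in> IOb X" for T
    using b that by (simp add: is_internal_operad_def)
  show "ieps (desymmetrise X b) \<in> hom A 1 (unt A) (iob (desymmetrise X b) (UnitI X))"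
    using b by (simp add: is_internal_operad_def UnitI_IOb Tips_UnitI)
  show "imu (desymmetrise X b) (T, S, s) \<in> hom A (Tips X T)
      (mulo A (map (Tips X) (fibs X T S s)) (iob (desymmetrise X b) S)
        (map (iob (desymmetrise X b)) (fibs X T S s)))
      (acto A (Tips X T) (ipi X s) (iob (desymmetrise X b) T))"
    if T: "T \<in> IOb X" and S: "S \<in> IOb X" and s: "s \<in> IHom X T S" for T S s
  proof -
    have "map (iob (desymmetrise X b)) (fibs X T S s) = map (iob b) (map (Tips X) (fibs X T S s))"
      by (rule map_Tips[OF fibs_IOb[OF T S s]]) simp
    moreover have "imu b (Tips X T, Tips X S, tip_map X s) \<in> hom A (Tips X T)
        (mulo A (fibre_sizes (tip_map X s) (Tips X S)) (iob b (Tips X S))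
          (map (iob b) (fibre_sizes (tip_map X s) (Tips X S))))
        (acto A (Tips X T) (fibre_perm (tip_map X s)) (iob b (Tips X T)))"
      using b tip_map[OF T S s] by (simp add: is_internal_operad_def fibs_Omega_sym)
    ultimately show ?thesis using T S s by (simp add: Tips_fibs ipi_def)
  qed
  show "internal_assoc X A (desymmetrise X b) T S R s w"
    if "T \<in> IOb X" "S \<in> IOb X" "R \<in> IOb X" "s \<in> IHom X T S" "w \<in> IHom X S R" for T S R s w
    using b that tip_map by (intro internal_assoc_desymmetrise) (simp_all add: is_internal_operad_def)
  show "cmp A (Tips X T) (imu (desymmetrise X b) (T, T, IId X T))
      (mula A (replicate (Tips X T) 1) (idt A (Tips X T) (iob (desymmetrise X b) T))
        (replicate (Tips X T) (ieps (desymmetrise X b)))) =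
      idt A (Tips X T) (iob (desymmetrise X b) T)" if "T \<in> IOb X" for T
    using b that by (simp add: is_internal_operad_def IId_IHom tip_map_IId)
  show "cmp A (Tips X T) (imu (desymmetrise X b) (T, UnitI X, s))
      (mula A [Tips X T] (ieps (desymmetrise X b)) [idt A (Tips X T) (iob (desymmetrise X b) T)]) =
      idt A (Tips X T) (iob (desymmetrise X b) T)"
    if "T \<in> IOb X" "s \<in> IHom X T (UnitI X)" for T s
    using b that tip_map[OF that(1) UnitI_IOb that(2)]
    by (simp add: is_internal_operad_def UnitI_IOb Tips_UnitI)
qed

lemma desymmetrise_map:
  assumes f: "is_internal_map Omega_sym A b c f"
  shows "is_internal_map X A (desymmetrise X b) (desymmetrise X c) (\<lambda>T\<in>IOb X. f (Tips X T))"
  unfolding is_internal_map_def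
proof (intro conjI ballI)
  show "is_internal_operad X A (desymmetrise X b)" "is_internal_operad X A (desymmetrise X c)"
    using f desymmetrise_internal by (auto simp: is_internal_map_def)
  let ?f = "\<lambda>T\<in>IOb X. f (Tips X T)"
  show "?f T \<in> hom A (Tips X T) (iob (desymmetrise X b) T) (iob (desymmetrise X c) T)"
    if "T \<in> IOb X" for T using f that by (simp add: is_internal_map_def)
  show "cmp A 1 (?f (UnitI X)) (ieps (desymmetrise X b)) = ieps (desymmetrise X c)"
    using f by (simp add: is_internal_map_def UnitI_IOb Tips_UnitI)
  show "cmp A (Tips X T) (imu (desymmetrise X c) (T, S, s))
      (mula A (map (Tips X) (fibs X T S s)) (?f S) (map ?f (fibs X T S s))) =
    cmp A (Tips X T) (acta A (Tips X T) (ipi X s) (?f T)) (imu (desymmetrise X b) (T, S, s))"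
    if T: "T \<in> IOb X" and S: "S \<in> IOb X" and s: "s \<in> IHom X T S" for T S s
  proof -
    have "map ?f (fibs X T S s) = map f (map (Tips X) (fibs X T S s))"
      by (rule map_Tips[OF fibs_IOb[OF T S s]]) simp
    moreover have "cmp A (Tips X T) (imu c (Tips X T, Tips X S, tip_map X s))
        (mula A (fibre_sizes (tip_map X s) (Tips X S)) (f (Tips X S))
          (map f (fibre_sizes (tip_map X s) (Tips X S)))) =
      cmp A (Tips X T) (acta A (Tips X T) (fibre_perm (tip_map X s)) (f (Tips X T)))
        (imu b (Tips X T, Tips X S, tip_map X s))"
      using f tip_map[OF T S s] by (simp add: is_internal_map_def fibs_Omega_sym)
    ultimately show ?thesis using T S s by (simp add: Tips_fibs ipi_def)
  qed
qed simp

end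

section \<open>Restriction along \<open>\<zeta>\<close> is desymmetrisation\<close>

lemma classify_functor:
  assumes rep: "represents X h u" and A: "is_cat_operad A" and a: "is_internal_operad X A a"
  shows "is_op_functor h A (FOb (classify X h u A) a)"
    "image_operad X u (FOb (classify X h u A) a) = a"
proof -
  have B: "bij_betw (image_operad X u) {F. is_op_functor h A F} {a. is_internal_operad X A a}"
    using represents_iso[OF rep A] by (simp add: is_category_iso_def evaluation_def SCO_def IO_def)
  have "the_inv_into {F. is_op_functor h A F} (image_operad X u) a \<in> {F. is_op_functor h A F}"
    "image_operad X u (the_inv_into {F. is_op_functor h A F} (image_operad X u) a) = a"
    using bij_betwE[OF bij_betw_the_inv_into[OF B]] f_the_inv_into_f_bij_betw[OF B, of a] a by auto
  then show "is_op_functor h A (FOb (classify X h u A) a)" "image_operad X u (FOb (classify X h u A) a) = a"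
    by (simp_all add: classify_def evaluation_def SCO_def)
qed

lemma classify_arrow:
  assumes rep: "represents X h u" and A: "is_cat_operad A" and f: "is_internal_map X A a b f"
  obtains F t G where "FAr (classify X h u A) (a, f, b) = (F, t, G)" "is_op_transformation h A F G t"
    "image_operad X u F = a" "image_operad X u G = b" "\<And>T. T \<in> IOb X \<Longrightarrow> t (Tips X T) (iob u T) = f T"
proof -
  let ?e = "FAr (evaluation X u)"
  have bij: "bij_betw ?e (Ar (SCO h A)) (Ar (IO X A))"
    using represents_iso[OF rep A] by (simp add: is_category_iso_def)
  have f': "(a, f, b) \<in> Ar (IO X A)" using f by (simp add: IO_def)
  obtain F t G where c: "FAr (classify X h u A) (a, f, b) = (F, t, G)" by (cases "FAr (classify X h u A) (a, f, b)")
  have "FAr (classify X h u A) (a, f, b) \<in> Ar (SCO h A)"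
    using bij_betwE[OF bij_betw_the_inv_into[OF bij]] f' by (simp add: classify_def)
  then have 1: "is_op_transformation h A F G t" unfolding c by (simp add: SCO_def)
  have "?e (F, t, G) = (a, f, b)"
    using f_the_inv_into_f_bij_betw[OF bij] f' unfolding c[symmetric] by (simp add: classify_def)
  then have 2: "image_operad X u F = a" "image_operad X u G = b"
    "(\<lambda>T\<in>IOb X. t (Tips X T) (iob u T)) = f" by (auto simp: evaluation_def)
  then show thesis using that[OF c 1] by auto
qed

lemma image_operad_simps:
  "T \<in> IOb X \<Longrightarrow> iob (image_operad X u F) T = oo F (Tips X T) (iob u T)"
  "T \<in> IOb X \<Longrightarrow> S \<in> IOb X \<Longrightarrow> s \<in> IHom X T S \<Longrightarrow>
     imu (image_operad X u F) (T, S, s) = oa F (Tips X T) (imu u (T, S, s))"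
  "ieps (image_operad X u F) = oa F 1 (ieps u)"
  by (simp_all add: image_operad_def index_arrows_def)

context
  fixes n :: nat and A h H :: "'u cat_operad" and u :: "(tree, tree_map, 'u) internal_operad"
    and v :: "(nat, nat list, 'u) internal_operad"
  assumes n: "1 \<le> n" and A: "is_cat_operad A" and h: "represents (Omega n) h u"
    and H: "represents Omega_sym H v"
begin

interpretation Om: operadic_index "Omega n"
  by (rule operadic_index_Omega[OF n])

lemma delta_internal: "is_internal_operad Omega_sym B b \<Longrightarrow> is_internal_operad (Omega n) B (delta n b)"
  unfolding delta_desymmetrise by (rule Om.desymmetrise_internal)

lemma zeta_functor:
  "is_op_functor h H (zeta n h u H v)" "image_operad (Omega n) u (zeta n h u H v) = delta n v"
  unfolding zeta_def
  using classify_functor[OF h represents_operad(1)[OF H] delta_internal[OF represents_operad(2)[OF H]]]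
  by auto

text \<open>\<open>\<zeta>\<close> takes \<open>u\<close> to the desymmetrisation of \<open>v\<close>, and operadic functors commute with
  desymmetrisation.\<close>

lemma zeta_image:
  assumes F: "image_operad Omega_sym v F = c" and c: "is_internal_operad Omega_sym A c"
  shows "image_operad (Omega n) u (op_functor_comp h F (zeta n h u H v)) = delta n c"
proof -
  let ?Z = "zeta n h u H v" and ?FZ = "op_functor_comp h F (zeta n h u H v)"
  have uh: "is_internal_operad (Omega n) h u" using represents_operad(2)[OF h] .
  have ob: "oo ?FZ (Tips (Omega n) T) (iob u T) = iob c (Tips (Omega n) T)" if T: "T \<in> IOb (Omega n)" for T
  proof -
    have "iob u T \<in> obj h (Tips (Omega n) T)"
      using internal_ob[OF uh T] .
    then have "oo ?FZ (Tips (Omega n) T) (iob u T) = oo F (Tips (Omega n) T) (iob (delta n v) T)"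
      unfolding zeta_functor(2)[symmetric] image_operad_simps(1)[OF T] by (simp add: op_functor_comp_def compose_def)
    then show ?thesis
      using T image_operad_simps(1)[of "level T n" Omega_sym v F] by (simp add: delta_desymmetrise F)
  qed
  have ar: "oa ?FZ (Tips (Omega n) T) (imu u (T, S, s)) = imu c (Tips (Omega n) T, Tips (Omega n) S, tip_map (Omega n) s)"
    if p: "T \<in> IOb (Omega n)" "S \<in> IOb (Omega n)" "s \<in> IHom (Omega n) T S" for T S s
  proof -
    have "imu u (T, S, s) \<in> arr h (Tips (Omega n) T)"
      using HomD(1)[OF internal_mu[OF uh p]] .
    then have "oa ?FZ (Tips (Omega n) T) (imu u (T, S, s)) = oa F (Tips (Omega n) T) (imu (delta n v) (T, S, s))"
      unfolding zeta_functor(2)[symmetric] image_operad_simps(2)[OF p] by (simp add: op_functor_comp_def compose_def)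
    then show ?thesis
      using image_operad_simps(2)[of "Tips (Omega n) T" Omega_sym "Tips (Omega n) S" "tip_map (Omega n) s" v F]
        Om.tip_map[OF p] unfolding delta_desymmetrise desymmetrise_simps(2)[OF p]
      by (simp add: F)
  qed
  have "ieps u \<in> arr h 1" using HomD(1)[OF internal_eps[OF uh]] .
  then have "oa ?FZ 1 (ieps u) = oa F 1 (ieps (delta n v))"
    unfolding zeta_functor(2)[symmetric] image_operad_simps(3) by (simp add: op_functor_comp_def compose_def)
  then have e: "oa ?FZ 1 (ieps u) = ieps c"
    using image_operad_simps(3)[of Omega_sym v F] by (simp add: delta_desymmetrise F)
  show ?thesis
    unfolding delta_desymmetrise desymmetrise_def
    by (rule internal_operad.equality)
       (use ob ar e in \<open>auto simp: image_operad_def index_arrows_def simp del: Omega_simps intro!: restrict_ext\<close>)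
qed

lemma zeta_star_Ob:
  assumes c: "is_internal_operad Omega_sym A c"
  shows "FOb (zeta_star n h u H v A) c = delta n c"
  using zeta_image[OF classify_functor(2)[OF H A c] c]
  by (simp add: zeta_star_def functor_comp_def evaluation_def precomp_def)

lemma zeta_star_Ar:
  assumes f: "is_internal_map Omega_sym A b c f"
  shows "FAr (zeta_star n h u H v A) (b, f, c) = (delta n b, \<lambda>T\<in>IOb (Omega n). f (level T n), delta n c)"
proof -
  let ?Z = "zeta n h u H v"
  obtain F t G where cl: "FAr (classify Omega_sym H v A) (b, f, c) = (F, t, G)"
    "is_op_transformation H A F G t" "image_operad Omega_sym v F = b" "image_operad Omega_sym v G = c"
    "\<And>k. k \<in> IOb Omega_sym \<Longrightarrow> t (Tips Omega_sym k) (iob v k) = f k"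
    by (rule classify_arrow[OF H A f]) (rule that)
  have bc: "is_internal_operad Omega_sym A b" "is_internal_operad Omega_sym A c"
    using f by (auto simp: is_internal_map_def)
  have "compose (obj h (level T n)) (t (level T n)) (oo ?Z (level T n)) (iob u T) = f (level T n)"
    if T: "T \<in> IOb (Omega n)" for T
  proof -
    have "iob u T \<in> obj h (Tips (Omega n) T)"
      using internal_ob[OF represents_operad(2)[OF h] T] .
    moreover have "oo ?Z (Tips (Omega n) T) (iob u T) = iob v (Tips (Omega n) T)"
      unfolding image_operad_simps(1)[OF T, symmetric] zeta_functor(2) using T by (simp add: delta_desymmetrise)
    ultimately show ?thesis using cl(5) by (simp add: compose_def)
  qed
  then show ?thesis
    using zeta_image[OF cl(3) bc(1)] zeta_image[OF cl(4) bc(2)]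
    by (auto simp: zeta_star_def functor_comp_def evaluation_def precomp_def cl(1) intro!: restrict_ext)
qed

lemma zeta_star_is_functor:
  "is_functor (IO Omega_sym A) (IO (Omega n) A) (zeta_star n h u H v A)"
proof -
  have dm: "is_internal_map (Omega n) A (delta n b) (delta n c) (\<lambda>T\<in>IOb (Omega n). f (level T n))"
    if "is_internal_map Omega_sym A b c f" for b c f
    using Om.desymmetrise_map[OF that] by (simp add: delta_desymmetrise)
  have comp: "is_internal_map Omega_sym A b d (\<lambda>k\<in>UNIV. cmp A k (g k) (f k))"
    if "is_internal_map Omega_sym A b c f" "is_internal_map Omega_sym A c d g" for b c d f g
  proof -
    have "Cmp (IO Omega_sym A) (c, g, d) (b, f, c) \<in> Hom (IO Omega_sym A) b d"
      by (rule Cmp_Hom[OF represents_IO_category[OF H A]]) (use that in \<open>auto simp: IO_def Hom_def\<close>)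
    then show ?thesis by (simp add: IO_def Hom_def)
  qed
  have idm: "is_internal_map Omega_sym A b b (\<lambda>k\<in>UNIV. idt A k (iob b k))"
    if "is_internal_operad Omega_sym A b" for b
  proof -
    have "Idn (IO Omega_sym A) b \<in> Hom (IO Omega_sym A) b b"
      by (rule Idn_Hom[OF represents_IO_category[OF H A]]) (use that in \<open>simp add: IO_def\<close>)
    then show ?thesis by (simp add: IO_def Hom_def)
  qed
  show ?thesis
    unfolding is_functor_def
  proof (intro conjI ballI impI)
    show "is_category (IO Omega_sym A)" "is_category (IO (Omega n) A)"
      using represents_IO_category[OF H A] represents_IO_category[OF h A] by auto
    show "FOb (zeta_star n h u H v A) c \<in> Ob (IO (Omega n) A)" if "c \<in> Ob (IO Omega_sym A)" for c
      using that delta_internal by (simp add: zeta_star_Ob IO_def)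
    show "FAr (zeta_star n h u H v A) f \<in> Hom (IO (Omega n) A)
        (FOb (zeta_star n h u H v A) (Src (IO Omega_sym A) f)) (FOb (zeta_star n h u H v A) (Trg (IO Omega_sym A) f))"
      if "f \<in> Ar (IO Omega_sym A)" for f
    proof -
      obtain b f' c where f: "f = (b, f', c)" by (cases f)
      then have f': "is_internal_map Omega_sym A b c f'" using that by (simp add: IO_def)
      then have "is_internal_operad Omega_sym A b" "is_internal_operad Omega_sym A c"
        by (auto simp: is_internal_map_def)
      then show ?thesis unfolding f zeta_star_Ar[OF f']
        using dm[OF f'] by (simp add: IO_def Hom_def zeta_star_Ob)
    qed
    show "FAr (zeta_star n h u H v A) (Idn (IO Omega_sym A) b) =
        Idn (IO (Omega n) A) (FOb (zeta_star n h u H v A) b)" if b: "b \<in> Ob (IO Omega_sym A)" for b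
    proof -
      have b': "is_internal_operad Omega_sym A b" using b by (simp add: IO_def)
      show ?thesis
        using zeta_star_Ar[OF idm[OF b']] zeta_star_Ob[OF b']
        by (auto simp: IO_def delta_desymmetrise intro!: restrict_ext)
    qed
    fix f g assume fg: "f \<in> Ar (IO Omega_sym A)" "g \<in> Ar (IO Omega_sym A)"
      "Trg (IO Omega_sym A) f = Src (IO Omega_sym A) g"
    obtain b f' c where f: "f = (b, f', c)" by (cases f)
    obtain d g' where g: "g = (c, g', d)" using fg(3) f by (cases g) (simp add: IO_def)
    have f': "is_internal_map Omega_sym A b c f'" and g': "is_internal_map Omega_sym A c d g'"
      using fg f g by (auto simp: IO_def)
    show "FAr (zeta_star n h u H v A) (Cmp (IO Omega_sym A) g f) =
        Cmp (IO (Omega n) A) (FAr (zeta_star n h u H v A) g) (FAr (zeta_star n h u H v A) f)"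
      using zeta_star_Ar[OF f'] zeta_star_Ar[OF g'] zeta_star_Ar[OF comp[OF f' g']]
      unfolding f g by (auto simp: IO_def intro!: restrict_ext)
  qed
qed

end

section \<open>Coherence in an internal symmetric operad\<close>

lemma concat_eq_blocks:
  assumes "concat xss = concat yss" "map length xss = map length yss"
  shows "xss = yss"
proof (rule concat_injective[OF assms(1)])
  show "length xss = length yss" using assms(2) by (metis length_map)
  show "\<forall>(x, y)\<in>set (zip xss yss). length x = length y"
    using assms(2) by (auto simp: set_zip list_eq_iff_nth_eq)
qed

lemma concat_map_replicate: "concat (map (\<lambda>m. replicate m x) ns) = replicate (sum_list ns) x"
  by (induction ns) (simp_all add: replicate_add)

lemma concat_map_singleton: "concat (map (\<lambda>x. [f x]) xs) = map f xs"
  by (induction xs) simp_all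

lemma permute_list_replicate: "\<rho> permutes {..<k} \<Longrightarrow> permute_list \<rho> (replicate k x) = replicate k x"
  using permutes_in_image[of \<rho> "{..<k}"] by (auto simp: permute_list_def list_eq_iff_nth_eq)

lemma monotone_map_ones: "monotone_map (replicate k 1) = [0..<k]"
proof (rule nth_equalityI)
  fix i assume "i < length (monotone_map (replicate k 1))"
  then have i: "i < k" by (simp add: length_monotone_map sum_list_replicate)
  then show "monotone_map (replicate k 1) ! i = [0..<k] ! i"
    using monotone_map_nth[of i "replicate k 1" 0] by (simp add: offset_replicate_1[simplified])
qed (simp add: length_monotone_map sum_list_replicate)

text \<open>Here \<open>fibre_perm_comp\<close> factors a bijection \<open>\<pi>\<close>: since \<open>\<pi>(N)\<close> is the identity, \<open>\<pi>\<close> is \<open>\<pi>(N P)\<close>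
  followed by the permutations that \<open>P\<close> induces on the blocks.\<close>

lemma monotone_after_perm:
  fixes ns :: "nat list" and \<pi> :: "nat \<Rightarrow> nat"
  defines "P \<equiv> map \<pi> [0..<sum_list ns]" and "N \<equiv> monotone_map ns"
  assumes \<pi>: "\<pi> permutes {..<sum_list ns}"
  shows "fibre_sizes (fin_comp N P) (length ns) = ns"
    and "\<And>i. i < length ns \<Longrightarrow> induced P N i = map (fibre_perm (induced P N i)) [0..<ns ! i]"
    and "\<And>i. i < length ns \<Longrightarrow> fibre_perm (induced P N i) permutes {..<ns ! i}"
    and "\<pi> = sum_perm ns (map (\<lambda>i. fibre_perm (induced P N i)) [0..<length ns]) \<circ> fibre_perm (fin_comp N P)"
proof -
  let ?k = "length ns" and ?n = "sum_list ns"
  have P: "P \<in> fin_maps ?n ?n" unfolding P_def by (rule perm_list_fin_maps[OF \<pi>])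
  have N: "N \<in> fin_maps ?n ?k" unfolding N_def by (rule monotone_map_fin_maps)
  have Ni: "fibre_perm N = id" unfolding N_def by (rule fibre_perm_sorted[OF sorted_monotone_map])
  have Nf: "length (fibre_elems N i) = ns ! i" if "i < ?k" for i
    using fibre_sizes_monotone_map[of ns] fibre_sizes_nth[OF that, of N] unfolding N_def by simp
  have FP: "fibre_sizes P ?n = replicate ?n 1" unfolding P_def by (rule fibre_sizes_perm_list[OF \<pi>])
  have m: "map (\<lambda>i. fibre_sizes (induced P N i) (length (fibre_elems N i))) [0..<?k] =
      map (\<lambda>m. replicate m 1) ns"
  proof (rule concat_eq_blocks)
    show "concat (map (\<lambda>i. fibre_sizes (induced P N i) (length (fibre_elems N i))) [0..<?k]) =
        concat (map (\<lambda>m. replicate m 1) ns)"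
      using concat_induced_sizes[OF P N] unfolding Ni FP by (simp add: concat_map_replicate)
    show "map length (map (\<lambda>i. fibre_sizes (induced P N i) (length (fibre_elems N i))) [0..<?k]) =
        map length (map (\<lambda>m. replicate m (1::nat)) ns)"
      by (rule nth_equalityI) (simp_all add: Nf)
  qed
  have I: "fibre_sizes (induced P N i) (ns ! i) = replicate (ns ! i) 1" if "i < ?k" for i
    using arg_cong[OF m, of "\<lambda>z. z ! i"] that by (simp add: Nf)
  have L: "length (fibre_elems (fin_comp N P) i) = ns ! i" if "i < ?k" for i
    using sum_induced_sizes[OF P N, of i] by (simp add: Nf[OF that] I[OF that] sum_list_replicate)
  then show F: "fibre_sizes (fin_comp N P) ?k = ns" by (simp add: list_eq_iff_nth_eq)
  have ind: "induced P N i \<in> fin_maps (ns ! i) (ns ! i)" if "i < ?k" for i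
    using induced_fin_maps[OF P N, of i] by (simp add: Nf[OF that] L[OF that])
  show "induced P N i = map (fibre_perm (induced P N i)) [0..<ns ! i]" if "i < ?k" for i
    by (rule perm_list_of_fibre_sizes[OF ind[OF that] I[OF that]])
  show "fibre_perm (induced P N i) permutes {..<ns ! i}" if "i < ?k" for i
    by (rule fin_maps_perm[OF ind[OF that]])
  show "\<pi> = sum_perm ns (map (\<lambda>i. fibre_perm (induced P N i)) [0..<?k]) \<circ> fibre_perm (fin_comp N P)"
    using fibre_perm_comp[OF P N] unfolding Ni F
    by (simp add: block_perm_id fibre_perm_of_perm[OF \<pi>] P_def)
qed

text \<open>In the other order the fibres of \<open>P\<close> are points, the induced maps have target \<open>[1]\<close>, and \<open>\<pi>(P s)\<close>
  differs from \<open>\<pi>(s)\<close> by a permutation of whole blocks.\<close>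

lemma perm_after_map:
  assumes s: "s \<in> fin_maps n k" and p: "p permutes {..<k}"
  defines "P \<equiv> map p [0..<k]"
  shows "fibre_sizes (fin_comp P s) k = permute_list (inv p) (fibre_sizes s k)"
    and "\<And>i. i < k \<Longrightarrow> length (fibre_elems P i) = 1"
    and "\<And>i. i < k \<Longrightarrow> induced s P i \<in> fin_maps (length (fibre_elems (fin_comp P s) i)) 1"
    and "\<And>i. i < k \<Longrightarrow> fibre_perm (induced s P i) = id"
    and "fibre_perm (fin_comp P s) = inv (block_perm (inv p) (fibre_sizes s k)) \<circ> fibre_perm s"
proof -
  have P: "P \<in> fin_maps k k" unfolding P_def by (rule perm_list_fin_maps[OF p])
  have Pp: "fibre_perm P = p" unfolding P_def by (rule fibre_perm_of_perm[OF p])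
  show Pf: "length (fibre_elems P i) = 1" if "i < k" for i
    using fibre_sizes_perm_list[OF p] fibre_sizes_nth[OF that, of P] that unfolding P_def by simp
  show I: "induced s P i \<in> fin_maps (length (fibre_elems (fin_comp P s) i)) 1" if "i < k" for i
    using induced_fin_maps[OF s P, of i] unfolding Pf[OF that] .
  show J: "fibre_perm (induced s P i) = id" if "i < k" for i
    using fin_maps_1[THEN iffD1, OF I[OF that]] by (simp add: fibre_perm_sorted)
  have m: "map (\<lambda>i. fibre_sizes (induced s P i) (length (fibre_elems P i))) [0..<k] =
      map (\<lambda>i. [length (fibre_elems (fin_comp P s) i)]) [0..<k]"
    using Pf fibre_sizes_fin_maps_1[OF I] by simp
  show F: "fibre_sizes (fin_comp P s) k = permute_list (inv p) (fibre_sizes s k)"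
    using concat_induced_sizes[OF s P, unfolded m Pp concat_map_singleton]
    by (simp only: fibre_sizes_def)
  have "map (\<lambda>i. fibre_perm (induced s P i)) [0..<k] = map (\<lambda>i. id) [0..<length (fibre_sizes (fin_comp P s) k)]"
    using J by simp
  then show "fibre_perm (fin_comp P s) = inv (block_perm (inv p) (fibre_sizes s k)) \<circ> fibre_perm s"
    using fibre_perm_comp[OF s P] unfolding Pp by (simp only: sum_perm_id id_o)
qed

locale internal_symmetric = cat_operad A for A :: "'u cat_operad" +
  fixes c :: "(nat, nat list, 'u) internal_operad"
  assumes internal: "is_internal_operad Omega_sym A c"
begin

abbreviation idn :: "nat \<Rightarrow> 'u" where
  "idn k \<equiv> idt A k (iob c k)"

abbreviation ones :: "nat \<Rightarrow> nat list" where
  "ones k \<equiv> replicate k 1"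

lemma ob_Ob: "iob c k \<in> obj A k"
  using internal_ob[OF internal, of k] by simp

lemma idn_Hom: "idn k \<in> hom A k (iob c k) (iob c k)"
  by (rule idt_hom[OF ob_Ob])

lemma eps_Hom: "ieps c \<in> hom A 1 (unt A) (iob c 1)"
  using internal_eps[OF internal] by simp

lemma mu_Hom: "s \<in> fin_maps n k \<Longrightarrow> imu c (n, k, s) \<in> hom A n
    (mulo A (fibre_sizes s k) (iob c k) (map (iob c) (fibre_sizes s k)))
    (acto A n (fibre_perm s) (iob c n))"
  using internal_mu[OF internal, of n k s] by (simp add: fibs_Omega_sym)

lemma obs_ob: "obs A ns (map (iob c) ns)"
  using ob_Ob by (simp add: list_all2_conv_all_nth)

lemma idns_ob: "idns A ns (map (iob c) ns) = map idn ns"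
  by (rule nth_equalityI) simp_all

lemma homs_idn: "homs A ns (map idn ns) (map (iob c) ns) (map (iob c) ns)"
  using homs_idns[OF obs_ob] unfolding idns_ob .

lemma homs_replicate: "f \<in> hom A n x y \<Longrightarrow> homs A (replicate k n) (replicate k f) (replicate k x) (replicate k y)"
  by (simp add: homs_def)

lemma mu_associative:
  assumes s: "s \<in> fin_maps n k" and w: "w \<in> fin_maps k l"
  shows "cmp A n
      (acta A n (inv (block_perm (inv (fibre_perm w)) (fibre_sizes s k))) (imu c (n, k, s)))
      (mula A (permute_list (inv (fibre_perm w)) (fibre_sizes s k)) (imu c (k, l, w))
        (map idn (permute_list (inv (fibre_perm w)) (fibre_sizes s k)))) =
    cmp A n
      (acta A n (sum_perm (fibre_sizes (fin_comp w s) l) (map (\<lambda>i. fibre_perm (induced s w i)) [0..<l]))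
        (imu c (n, l, fin_comp w s)))
      (mula A (fibre_sizes (fin_comp w s) l) (idn l)
        (map (\<lambda>i. imu c (length (fibre_elems (fin_comp w s) i), length (fibre_elems w i), induced s w i)) [0..<l]))"
  using internal_associative[OF internal, of n k l s w] s w concat_induced_sizes[OF s w]
  by (simp add: internal_assoc_def fibs_Omega_sym Let_def)

lemma mu_unit_right: "cmp A k (imu c (k, k, [0..<k])) (mula A (ones k) (idn k) (replicate k (ieps c))) = idn k"
  using internal_unit_right[OF internal, of k] by simp

lemma mu_unit_left: "s \<in> fin_maps k 1 \<Longrightarrow> cmp A k (imu c (k, 1, s)) (mula A [k] (ieps c) [idn k]) = idn k"
  using internal_unit_left[OF internal, of k s] by simp

text \<open>\<open>pad\<close> inserts the unit into every input of an object; with it the maps \<open>\<mu>\<close> of bijections become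
  the comparison of \<open>c\<^sub>k\<close> with its translates.\<close>

definition pad :: "nat \<Rightarrow> 'u \<Rightarrow> 'u" where
  "pad k y = mula A (ones k) (idt A k y) (replicate k (ieps c))"

definition perm_arrow :: "nat \<Rightarrow> (nat \<Rightarrow> nat) \<Rightarrow> 'u" where
  "perm_arrow k p = cmp A k (imu c (k, k, map p [0..<k])) (pad k (iob c k))"

definition mult :: "nat list \<Rightarrow> 'u" where
  "mult ns = imu c (sum_list ns, length ns, monotone_map ns)"

lemma sum_ones [simp]: "sum_list (replicate k (Suc 0)) = k"
  by (simp add: sum_list_replicate)

lemma pad_Hom:
  assumes "y \<in> obj A k"
  shows "pad k y \<in> hom A k y (mulo A (ones k) y (replicate k (iob c 1)))"
proof -
  have "idt A k y \<in> hom A (length (ones k)) y y" using idt_hom[OF assms] by simp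
  from mula_Hom[OF this homs_replicate[OF eps_Hom, of k]] show ?thesis
    using mulo_unit(2)[OF assms] by (simp add: pad_def)
qed

lemma pad_natural:
  assumes f: "f \<in> hom A k x y"
  shows "mula A (ones k) f (replicate k (ieps c)) = cmp A k (pad k y) f"
    and "mula A (ones k) f (replicate k (ieps c)) =
      cmp A k (mula A (ones k) f (map idn (ones k))) (pad k x)"
proof -
  have f': "f \<in> hom A (length (ones k)) x y" using f by simp
  note e = homs_replicate[OF eps_Hom, of k]
  have u: "idns A (ones k) (replicate k (unt A)) = replicate k (idt A 1 (unt A))"
    by (rule nth_equalityI) simp_all
  have i: "idns A (ones k) (replicate k (iob c 1)) = map idn (ones k)"
    by (rule nth_equalityI) simp_all
  show "mula A (ones k) f (replicate k (ieps c)) = cmp A k (pad k y) f"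
    using mula_split(2)[OF f' e] mula_unit(2)[OF HomD(1)[OF f]] unfolding u pad_def by simp
  show "mula A (ones k) f (replicate k (ieps c)) =
      cmp A k (mula A (ones k) f (map idn (ones k))) (pad k x)"
    using mula_split(1)[OF f' e] unfolding i pad_def by simp
qed

lemma perm_mu_Hom:
  assumes "p permutes {..<k}"
  shows "imu c (k, k, map p [0..<k]) \<in>
    hom A k (mulo A (ones k) (iob c k) (replicate k (iob c 1))) (acto A k p (iob c k))"
  using mu_Hom[OF perm_list_fin_maps[OF assms]]
  by (simp add: fibre_sizes_perm_list[OF assms] fibre_perm_of_perm[OF assms] map_replicate_const[symmetric])

lemma perm_arrow_Hom:
  "p permutes {..<k} \<Longrightarrow> perm_arrow k p \<in> hom A k (iob c k) (acto A k p (iob c k))"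
  unfolding perm_arrow_def by (rule cmp_hom[OF pad_Hom[OF ob_Ob] perm_mu_Hom])

lemma perm_arrow_id: "perm_arrow k id = idn k"
  using mu_unit_right[of k] by (simp add: perm_arrow_def pad_def)

lemma mult_Hom:
  "mult ns \<in> hom A (sum_list ns) (mulo A ns (iob c (length ns)) (map (iob c) ns)) (iob c (sum_list ns))"
  using mu_Hom[OF monotone_map_fin_maps[of ns]]
  by (simp add: mult_def fibre_sizes_monotone_map fibre_perm_sorted[OF sorted_monotone_map] acto_id[OF ob_Ob])

text \<open>The associativity law for two order preserving maps. All permutations in it are identities.\<close>

lemma mult_associative:
  "cmp A (sum_list (concat nss)) (mult (concat nss)) (mula A (concat nss) (mult (map length nss)) (map idn (concat nss))) =
   cmp A (sum_list (concat nss)) (mult (map sum_list nss)) (mula A (map sum_list nss) (idn (length nss)) (map mult nss))"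
proof -
  let ?n = "sum_list (concat nss)" and ?k = "length (concat nss)" and ?l = "length nss"
  let ?N = "monotone_map (concat nss)" and ?W = "monotone_map (map length nss)"
  have k: "sum_list (map length nss) = ?k" by (simp add: length_concat)
  have N: "?N \<in> fin_maps ?n ?k" by (rule monotone_map_fin_maps)
  have W: "?W \<in> fin_maps ?k ?l" using monotone_map_fin_maps[of "map length nss"] k by simp
  have Ni: "fibre_perm ?N = id" "fibre_perm ?W = id" by (rule fibre_perm_sorted[OF sorted_monotone_map])+
  have FN: "fibre_sizes ?N ?k = concat nss" by (rule fibre_sizes_monotone_map)
  have FW: "fibre_sizes ?W ?l = map length nss" using fibre_sizes_monotone_map[of "map length nss"] by simp
  have Wi: "length (fibre_elems ?W i) = length (nss ! i)" if "i < ?l" for i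
    using FW that fibre_sizes_nth[OF that, of ?W] by simp
  have m: "map (\<lambda>i. fibre_sizes (induced ?N ?W i) (length (fibre_elems ?W i))) [0..<?l] = nss"
  proof (rule concat_eq_blocks)
    show "concat (map (\<lambda>i. fibre_sizes (induced ?N ?W i) (length (fibre_elems ?W i))) [0..<?l]) = concat nss"
      using concat_induced_sizes[OF N W] unfolding Ni FN by simp
    show "map length (map (\<lambda>i. fibre_sizes (induced ?N ?W i) (length (fibre_elems ?W i))) [0..<?l]) = map length nss"
      by (rule nth_equalityI) (simp_all add: Wi)
  qed
  have I: "fibre_sizes (induced ?N ?W i) (length (nss ! i)) = nss ! i" if "i < ?l" for i
    using arg_cong[OF m, of "\<lambda>z. z ! i"] that by (simp add: Wi)
  have L: "length (fibre_elems (fin_comp ?W ?N) i) = sum_list (nss ! i)" if "i < ?l" for i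
    using sum_induced_sizes[OF N W, of i] by (simp add: Wi[OF that] I[OF that])
  have F: "fibre_sizes (fin_comp ?W ?N) ?l = map sum_list nss"
    by (rule nth_equalityI) (simp_all add: L)
  have sWN: "sorted (fin_comp ?W ?N)"
  proof (rule sorted_iff_nth_mono[THEN iffD2], intro allI impI)
    fix x y assume xy: "x \<le> y" "y < length (fin_comp ?W ?N)"
    then have y: "y < ?n" using fin_maps_length[OF N] by (simp add: length_fin_comp)
    have "?N ! x \<le> ?N ! y" using sorted_nth_mono[OF sorted_monotone_map xy(1)] y fin_maps_length[OF N] by simp
    then have "?W ! (?N ! x) \<le> ?W ! (?N ! y)"
      using sorted_nth_mono[OF sorted_monotone_map] fin_maps_nth[OF N y] fin_maps_length[OF W] by simp
    then show "fin_comp ?W ?N ! x \<le> fin_comp ?W ?N ! y"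
      using fin_comp_nth[OF N] xy(1) y by simp
  qed
  have WN: "fin_comp ?W ?N = monotone_map (map sum_list nss)"
    using sorted_eq_monotone_map[OF fin_comp_fin_maps[OF N W] sWN] unfolding F .
  have sI: "sorted (induced ?N ?W i)" if "i < ?l" for i
  proof (rule sorted_iff_nth_mono[THEN iffD2], intro allI impI)
    let ?F = "fibre_elems (fin_comp ?W ?N) i"
    fix x y assume xy: "x \<le> y" "y < length (induced ?N ?W i)"
    then have y: "y < length ?F" by (simp add: length_induced)
    have "?F ! x \<le> ?F ! y" using sorted_nth_mono[OF strict_sorted_imp_sorted[OF sorted_fibre_elems] xy(1) y] .
    moreover have "?F ! y < length ?N" using nth_mem[OF y] by (simp add: set_fibre_elems length_fin_comp)
    ultimately have "?N ! (?F ! x) \<le> ?N ! (?F ! y)" using sorted_nth_mono[OF sorted_monotone_map] by blast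
    then show "induced ?N ?W i ! x \<le> induced ?N ?W i ! y"
      using xy(1) y by (simp add: induced_def rank_mono)
  qed
  have ind: "induced ?N ?W i = monotone_map (nss ! i)" if "i < ?l" for i
    using sorted_eq_monotone_map[OF induced_fin_maps[OF N W] sI[OF that]] by (simp add: Wi[OF that] I[OF that])
  have sp: "sum_perm (map sum_list nss) (map (\<lambda>i. fibre_perm (induced ?N ?W i)) [0..<?l]) = id"
  proof -
    have "map (\<lambda>i. fibre_perm (induced ?N ?W i)) [0..<?l] = map (\<lambda>i. id) [0..<length (map sum_list nss)]"
      using fibre_perm_sorted[OF sI] by simp
    then show ?thesis by (simp only: sum_perm_id)
  qed
  have mm: "map (\<lambda>i. imu c (length (fibre_elems (fin_comp ?W ?N) i), length (fibre_elems ?W i), induced ?N ?W i)) [0..<?l] =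
      map mult nss"
    by (rule nth_equalityI) (simp_all add: L Wi ind mult_def)
  have acn: "acta A ?n id (mult ns) = mult ns" if "sum_list ns = ?n" for ns
    using acta_id[OF HomD(1)[OF mult_Hom[of ns]]] that by simp
  have s': "sum_list (map sum_list nss) = ?n" by (induction nss) simp_all
  have m1: "imu c (?n, ?k, ?N) = mult (concat nss)" "imu c (?k, ?l, ?W) = mult (map length nss)"
    "imu c (?n, ?l, fin_comp ?W ?N) = mult (map sum_list nss)"
    by (simp_all add: mult_def WN s' k)
  show ?thesis
    using mu_associative[OF N W] unfolding Ni FN F sp mm m1
    by (simp add: block_perm_id acn s')
qed

lemma mult_unit_right: "cmp A k (mult (ones k)) (pad k (iob c k)) = idn k"
  using mu_unit_right[of k] monotone_map_ones[of k] by (simp add: mult_def pad_def)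

lemma mult_unit_left: "cmp A k (mult [k]) (mula A [k] (ieps c) [idn k]) = idn k"
  using mu_unit_left[of "monotone_map [k]" k] monotone_map_fin_maps[of "[k]"] by (simp add: mult_def)

text \<open>The associativity law for a bijection followed by an order preserving map, with all inputs of the
  bijection filled by units. Applied to \<open>\<pi> = \<pi>(s)\<close> it computes \<open>\<mu>\<^sub>s\<close>; applied to a permutation that
  preserves the blocks it is naturality of \<open>mult\<close> in the inputs.\<close>

lemma perm_arrow_mult:
  fixes ns :: "nat list" and \<pi> :: "nat \<Rightarrow> nat"
  defines "P \<equiv> map \<pi> [0..<sum_list ns]" and "N \<equiv> monotone_map ns"
  defines "\<tau> \<equiv> map (\<lambda>i. fibre_perm (induced P N i)) [0..<length ns]"
  assumes \<pi>: "\<pi> permutes {..<sum_list ns}"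
  shows "cmp A (sum_list ns) (perm_arrow (sum_list ns) \<pi>) (mult ns) =
    cmp A (sum_list ns) (acta A (sum_list ns) (sum_perm ns \<tau>) (imu c (sum_list ns, length ns, fin_comp N P)))
      (mula A ns (idn (length ns)) (map (\<lambda>i. perm_arrow (ns ! i) (\<tau> ! i)) [0..<length ns]))"
proof -
  let ?n = "sum_list ns" and ?k = "length ns"
  let ?X = "mulo A ns (iob c ?k) (map (iob c) ns)"
  note mp = monotone_after_perm[OF \<pi>, folded P_def N_def]
  have P: "P \<in> fin_maps ?n ?n" unfolding P_def by (rule perm_list_fin_maps[OF \<pi>])
  have N: "N \<in> fin_maps ?n ?k" unfolding N_def by (rule monotone_map_fin_maps)
  have Ni: "fibre_perm N = id" unfolding N_def by (rule fibre_perm_sorted[OF sorted_monotone_map])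
  have FP: "fibre_sizes P ?n = ones ?n" unfolding P_def by (rule fibre_sizes_perm_list[OF \<pi>])
  have Nf: "length (fibre_elems N i) = ns ! i" if "i < ?k" for i
    using fibre_sizes_monotone_map[of ns] fibre_sizes_nth[OF that, of N] unfolding N_def by simp
  have NPf: "length (fibre_elems (fin_comp N P) i) = ns ! i" if "i < ?k" for i
    using mp(1) fibre_sizes_nth[OF that, of "fin_comp N P"] by simp
  have \<tau>: "\<tau> ! i permutes {..<ns ! i}" "induced P N i = map (\<tau> ! i) [0..<ns ! i]" if "i < ?k" for i
    using mp(2,3)[OF that] that by (simp_all add: \<tau>_def)
  have Xo: "?X \<in> obj A ?n" by (rule mulo_Ob[OF ob_Ob obs_ob])
  have PH: "imu c (?n, ?n, P) \<in> hom A ?n (mulo A (ones ?n) (iob c ?n) (replicate ?n (iob c 1))) (acto A ?n \<pi> (iob c ?n))"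
    unfolding P_def by (rule perm_mu_Hom[OF \<pi>])
  have spP: "sum_perm ns \<tau> permutes {..<?n}" by (rule sum_perm_permutes) (rule \<tau>(1))
  let ?ms = "map (\<lambda>i. imu c (ns ! i, ns ! i, induced P N i)) [0..<?k]"
  let ?ps = "map (\<lambda>i. pad (ns ! i) (iob c (ns ! i))) [0..<?k]"
  have ps: "homs A ns ?ps (map (iob c) ns) (map (\<lambda>i. mulo A (ones (ns ! i)) (iob c (ns ! i)) (replicate (ns ! i) (iob c 1))) [0..<?k])"
    using pad_Hom[OF ob_Ob] by (simp add: homs_def)
  have ms: "homs A ns ?ms (map (\<lambda>i. mulo A (ones (ns ! i)) (iob c (ns ! i)) (replicate (ns ! i) (iob c 1))) [0..<?k])
      (map (\<lambda>i. acto A (ns ! i) (\<tau> ! i) (iob c (ns ! i))) [0..<?k])"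
    using perm_mu_Hom[OF \<tau>(1)] \<tau>(2) by (simp add: homs_def)
  have G: "cmp A ?n (imu c (?n, ?n, P)) (mula A (ones ?n) (mult ns) (map idn (ones ?n))) =
      cmp A ?n (acta A ?n (sum_perm ns \<tau>) (imu c (?n, ?k, fin_comp N P))) (mula A ns (idn ?k) ?ms)"
  proof -
    have mm: "map (\<lambda>i. imu c (length (fibre_elems (fin_comp N P) i), length (fibre_elems N i), induced P N i)) [0..<?k] = ?ms"
      by (simp add: Nf NPf)
    have "acta A ?n id (imu c (?n, ?n, P)) = imu c (?n, ?n, P)" by (rule acta_id[OF HomD(1)[OF PH]])
    then show ?thesis
      using mu_associative[OF P N] unfolding Ni FP mp(1) \<tau>_def[symmetric] mm
      by (simp add: block_perm_id mult_def N_def)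
  qed
  \<comment> \<open>The source of both sides is reached from \<open>m(c\<^sub>k; c\<^sub>n\<^sub>1, \<dots>)\<close> by padding all inputs with units,
    either at once or block by block.\<close>
  have E: "pad ?n ?X = mula A ns (idn ?k) ?ps"
  proof -
    have "mula A (concat (map ones ns)) (mula A (map length (map ones ns)) (idn ?k) (map idn ns))
        (concat (map (\<lambda>m. replicate m (ieps c)) ns)) =
      mula A (map sum_list (map ones ns)) (idn ?k)
        (map (\<lambda>i. mula A (map ones ns ! i) (map idn ns ! i) (map (\<lambda>m. replicate m (ieps c)) ns ! i)) [0..<length (map ones ns)])"
      by (rule mula_assoc)
        (use HomD(1)[OF idn_Hom] HomD(1)[OF eps_Hom] in \<open>simp_all add: list_all2_conv_all_nth\<close>)
    moreover have "map length (map ones ns) = ns" "map sum_list (map ones ns) = ns"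
      by (rule nth_equalityI; simp)+
    moreover have "mula A ns (idn ?k) (map idn ns) = idt A ?n ?X"
      using mula_Idn[OF ob_Ob obs_ob, of ns] unfolding idns_ob .
    moreover have "map (\<lambda>i. mula A (map ones ns ! i) (map idn ns ! i) (map (\<lambda>m. replicate m (ieps c)) ns ! i)) [0..<length (map ones ns)] = ?ps"
      by (simp add: pad_def)
    ultimately show ?thesis by (simp only: pad_def concat_map_replicate)
  qed
  have pX: "pad ?n ?X \<in> hom A ?n ?X (mulo A (ones ?n) ?X (replicate ?n (iob c 1)))" by (rule pad_Hom[OF Xo])
  have m1: "mula A (ones ?n) (mult ns) (map idn (ones ?n)) \<in>
      hom A ?n (mulo A (ones ?n) ?X (replicate ?n (iob c 1))) (mulo A (ones ?n) (iob c ?n) (replicate ?n (iob c 1)))"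
    using mula_Hom[of "mult ns" "ones ?n", OF _ homs_idn[of "ones ?n"]] mult_Hom[of ns] by simp
  have m2: "mula A ns (idn ?k) ?ms \<in> hom A ?n (mulo A ns (iob c ?k) (map (\<lambda>i. mulo A (ones (ns ! i)) (iob c (ns ! i)) (replicate (ns ! i) (iob c 1))) [0..<?k]))
      (mulo A ns (iob c ?k) (map (\<lambda>i. acto A (ns ! i) (\<tau> ! i) (iob c (ns ! i))) [0..<?k]))"
    by (rule mula_Hom[OF idn_Hom ms])
  have m3: "mula A ns (idn ?k) ?ps \<in> hom A ?n ?X (mulo A ns (iob c ?k) (map (\<lambda>i. mulo A (ones (ns ! i)) (iob c (ns ! i)) (replicate (ns ! i) (iob c 1))) [0..<?k]))"
    by (rule mula_Hom[OF idn_Hom ps])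
  have NP: "fin_comp N P \<in> fin_maps ?n ?k" by (rule fin_comp_fin_maps[OF P N])
  have tgt: "mulo A ns (iob c ?k) (map (\<lambda>i. acto A (ns ! i) (\<tau> ! i) (iob c (ns ! i))) [0..<?k]) =
      acto A ?n (sum_perm ns \<tau>) ?X"
    by (rule mulo_inputs[OF ob_Ob obs_ob \<tau>(1)]) simp_all
  have aH: "acta A ?n (sum_perm ns \<tau>) (imu c (?n, ?k, fin_comp N P)) \<in>
      hom A ?n (acto A ?n (sum_perm ns \<tau>) ?X) (acto A ?n (sum_perm ns \<tau>) (acto A ?n (fibre_perm (fin_comp N P)) (iob c ?n)))"
    using acta_Hom[OF spP mu_Hom[OF NP]] unfolding mp(1) .
  have "cmp A ?n (perm_arrow ?n \<pi>) (mult ns) =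
      cmp A ?n (imu c (?n, ?n, P)) (cmp A ?n (pad ?n (iob c ?n)) (mult ns))"
    unfolding perm_arrow_def P_def[symmetric] by (rule cmp_assoc[OF mult_Hom pad_Hom[OF ob_Ob] PH])
  also have "cmp A ?n (pad ?n (iob c ?n)) (mult ns) =
      cmp A ?n (mula A (ones ?n) (mult ns) (map idn (ones ?n))) (pad ?n ?X)"
    using pad_natural[OF mult_Hom[of ns]] by simp
  also have "cmp A ?n (imu c (?n, ?n, P)) \<dots> =
      cmp A ?n (cmp A ?n (imu c (?n, ?n, P)) (mula A (ones ?n) (mult ns) (map idn (ones ?n)))) (pad ?n ?X)"
    by (rule cmp_assoc[OF pX m1 PH, symmetric])
  also have "\<dots> = cmp A ?n (acta A ?n (sum_perm ns \<tau>) (imu c (?n, ?k, fin_comp N P)))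
      (cmp A ?n (mula A ns (idn ?k) ?ms) (mula A ns (idn ?k) ?ps))"
    unfolding G E by (rule cmp_assoc[OF m3 m2[unfolded tgt] aH])
  also have "cmp A ?n (mula A ns (idn ?k) ?ms) (mula A ns (idn ?k) ?ps) =
      mula A ns (idn ?k) (map (\<lambda>i. perm_arrow (ns ! i) (\<tau> ! i)) [0..<?k])"
  proof -
    have "cmps A ns ?ms ?ps = map (\<lambda>i. perm_arrow (ns ! i) (\<tau> ! i)) [0..<?k]"
      by (simp add: cmps_def perm_arrow_def \<tau>(2))
    then show ?thesis
      using mula_Cmp[OF idn_Hom ps idn_Hom ms] cmp_idt(1)[OF idn_Hom] by simp
  qed
  finally show ?thesis .
qed

text \<open>The associativity law for \<open>s\<close> followed by a bijection. The maps on its fibres have target \<open>[1]\<close>,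
  and their \<open>\<mu>\<close> cancel against units.\<close>

lemma mu_perm_comp:
  assumes s: "s \<in> fin_maps n k" and p: "p permutes {..<k}"
  defines "f \<equiv> permute_list (inv p) (fibre_sizes s k)"
  shows "imu c (n, k, fin_comp (map p [0..<k]) s) =
    cmp A n (acta A n (inv (block_perm (inv p) (fibre_sizes s k))) (imu c (n, k, s)))
      (mula A f (perm_arrow k p) (map idn f))"
proof -
  define P where "P = map p [0..<k]"
  note pm = perm_after_map[OF s p, folded P_def]
  have P: "P \<in> fin_maps k k" unfolding P_def by (rule perm_list_fin_maps[OF p])
  have Pp: "fibre_perm P = p" unfolding P_def by (rule fibre_perm_of_perm[OF p])
  have Ps: "fin_comp P s \<in> fin_maps n k" by (rule fin_comp_fin_maps[OF s P])
  have lf: "length f = k" by (simp add: f_def)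
  have fi: "f ! i = length (fibre_elems (fin_comp P s) i)" if "i < k" for i
    using pm(1) fibre_sizes_nth[OF that, of "fin_comp P s"] by (simp add: f_def)
  have sf: "sum_list f = n" using sum_fibre_sizes[OF Ps] pm(1) by (simp add: f_def)
  let ?X = "mulo A f (iob c k) (map (iob c) f)" and ?B = "inv (block_perm (inv p) (fibre_sizes s k))"
  have pi: "inv p permutes {..<length (fibre_sizes s k)}" using permutes_inv[OF p] by simp
  have BP: "?B permutes {..<n}"
    using permutes_inv[OF block_perm_permutes[OF pi]] by (simp add: sum_fibre_sizes[OF s])
  let ?ms = "map (\<lambda>i. imu c (f ! i, 1, induced s P i)) [0..<k]"
  let ?es = "map (\<lambda>i. mula A [f ! i] (ieps c) [idn (f ! i)]) [0..<k]"
  let ?ys = "map (\<lambda>i. mulo A [f ! i] (iob c 1) [iob c (f ! i)]) [0..<k]"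
  have ind: "induced s P i \<in> fin_maps (f ! i) 1" if "i < k" for i using pm(3)[OF that] fi[OF that] by simp
  have ms: "homs A f ?ms ?ys (map (iob c) f)"
    unfolding homs_def
  proof (intro conjI allI impI)
    fix i assume "i < length f"
    then have i: "i < k" using lf by simp
    have "fibre_sizes (induced s P i) 1 = [f ! i]" by (rule fibre_sizes_fin_maps_1[OF ind[OF i]])
    moreover have "fibre_perm (induced s P i) = id" using fin_maps_1[THEN iffD1, OF ind[OF i]] by (simp add: fibre_perm_sorted)
    ultimately have "imu c (f ! i, 1, induced s P i) \<in> hom A (f ! i) (mulo A [f ! i] (iob c 1) [iob c (f ! i)]) (iob c (f ! i))"
      using mu_Hom[OF ind[OF i]] by (simp add: acto_id[OF ob_Ob])
    then show "?ms ! i \<in> hom A (f ! i) (?ys ! i) (map (iob c) f ! i)" using i lf by simp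
  qed (simp_all add: lf)
  have es: "homs A f ?es (map (iob c) f) ?ys"
    unfolding homs_def
  proof (intro conjI allI impI)
    fix i assume "i < length f"
    then have i: "i < k" using lf by simp
    have "mula A [f ! i] (ieps c) [idn (f ! i)] \<in>
        hom A (sum_list [f ! i]) (mulo A [f ! i] (unt A) [iob c (f ! i)]) (mulo A [f ! i] (iob c 1) [iob c (f ! i)])"
      by (rule mula_Hom) (use eps_Hom idn_Hom in \<open>simp_all add: homs_def\<close>)
    then show "?es ! i \<in> hom A (f ! i) (map (iob c) f ! i) (?ys ! i)"
      using i lf mulo_unit(1)[OF ob_Ob] by simp
  qed (simp_all add: lf)
  have PsH: "imu c (n, k, fin_comp P s) \<in> hom A n ?X (acto A n (fibre_perm (fin_comp P s)) (iob c n))"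
    using mu_Hom[OF Ps] unfolding pm(1) f_def[symmetric] .
  have G: "cmp A n (acta A n ?B (imu c (n, k, s))) (mula A f (imu c (k, k, P)) (map idn f)) =
      cmp A n (imu c (n, k, fin_comp P s)) (mula A f (idn k) ?ms)"
  proof -
    have mm: "map (\<lambda>i. imu c (length (fibre_elems (fin_comp P s) i), length (fibre_elems P i), induced s P i)) [0..<k] = ?ms"
      using pm(2) fi by simp
    have "sum_perm f (map (\<lambda>i. fibre_perm (induced s P i)) [0..<k]) = id"
    proof -
      have "map (\<lambda>i. fibre_perm (induced s P i)) [0..<k] = map (\<lambda>i. id) [0..<length f]" using pm(4) lf by simp
      then show ?thesis by (simp only: sum_perm_id)
    qed
    moreover have "acta A n id (imu c (n, k, fin_comp P s)) = imu c (n, k, fin_comp P s)"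
      by (rule acta_id[OF HomD(1)[OF PsH]])
    ultimately show ?thesis
      using mu_associative[OF s P] unfolding Pp pm(1) f_def[symmetric] mm by simp
  qed
  have idk: "idn k \<in> hom A (length f) (iob c k) (iob c k)" using idn_Hom lf by simp
  have E: "mula A f (pad k (iob c k)) (map idn f) = mula A f (idn k) ?es"
  proof -
    let ?nss = "map (\<lambda>m. [m]) f" and ?zss = "map (\<lambda>m. [idn m]) f"
    have "mula A (concat ?nss) (mula A (map length ?nss) (idn k) (replicate k (ieps c))) (concat ?zss) =
      mula A (map sum_list ?nss) (idn k) (map (\<lambda>i. mula A (?nss ! i) (replicate k (ieps c) ! i) (?zss ! i)) [0..<length ?nss])"
      by (rule mula_assoc)
        (use HomD(1)[OF idn_Hom] HomD(1)[OF eps_Hom] lf in \<open>simp_all add: list_all2_conv_all_nth\<close>)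
    moreover have "map length ?nss = ones k" "map sum_list ?nss = f"
      by (rule nth_equalityI; simp add: lf)+
    moreover have "map (\<lambda>i. mula A (?nss ! i) (replicate k (ieps c) ! i) (?zss ! i)) [0..<length ?nss] = ?es"
      using lf by simp
    ultimately show ?thesis by (simp only: pad_def concat_map_singleton map_ident)
  qed
  have fa: "mula A f (perm_arrow k p) (map idn f) =
      cmp A n (mula A f (imu c (k, k, P)) (map idn f)) (mula A f (pad k (iob c k)) (map idn f))"
  proof -
    have "pad k (iob c k) \<in> hom A (length f) (iob c k) (mulo A (ones k) (iob c k) (replicate k (iob c 1)))"
      "imu c (k, k, P) \<in> hom A (length f) (mulo A (ones k) (iob c k) (replicate k (iob c 1))) (acto A k p (iob c k))"
      using pad_Hom[OF ob_Ob] perm_mu_Hom[OF p] lf by (simp_all add: P_def)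
    from mula_Cmp[OF this(1) homs_idn this(2) homs_idn] show ?thesis
      using cmps_idns(1)[OF homs_idn[of f]] unfolding idns_ob lf sf perm_arrow_def P_def by simp
  qed
  have H1: "mula A f (pad k (iob c k)) (map idn f) \<in> hom A n ?X
      (mulo A f (mulo A (ones k) (iob c k) (replicate k (iob c 1))) (map (iob c) f))"
    using mula_Hom[of "pad k (iob c k)" f, OF _ homs_idn] pad_Hom[OF ob_Ob[of k]] lf sf by simp
  have H2: "mula A f (imu c (k, k, P)) (map idn f) \<in> hom A n
      (mulo A f (mulo A (ones k) (iob c k) (replicate k (iob c 1))) (map (iob c) f))
      (mulo A f (acto A k p (iob c k)) (map (iob c) f))"
    using mula_Hom[of "imu c (k, k, P)" f, OF _ homs_idn] perm_mu_Hom[OF p] lf sf by (simp add: P_def)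
  have tgt: "mulo A f (acto A k p (iob c k)) (map (iob c) f) =
      acto A n ?B (mulo A (fibre_sizes s k) (iob c k) (map (iob c) (fibre_sizes s k)))"
    using mulo_equivariant_operation[of "iob c k" "fibre_sizes s k", OF _ obs_ob pi] ob_Ob[of k]
      permutes_inv_inv[OF p] permute_list_map[OF pi, of "iob c"]
    by (simp add: f_def sum_fibre_sizes[OF s])
  have H3: "acta A n ?B (imu c (n, k, s)) \<in> hom A n (mulo A f (acto A k p (iob c k)) (map (iob c) f))
      (acto A n ?B (acto A n (fibre_perm s) (iob c n)))"
    unfolding tgt by (rule acta_Hom[OF BP mu_Hom[OF s]])
  have H4: "mula A f (idn k) ?es \<in> hom A n ?X (mulo A f (iob c k) ?ys)"
    using mula_Hom[OF idk es] sf by simp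
  have H5: "mula A f (idn k) ?ms \<in> hom A n (mulo A f (iob c k) ?ys) ?X"
    using mula_Hom[OF idk ms] sf by simp
  have "cmp A n (acta A n ?B (imu c (n, k, s))) (mula A f (perm_arrow k p) (map idn f)) =
      cmp A n (cmp A n (imu c (n, k, fin_comp P s)) (mula A f (idn k) ?ms)) (mula A f (pad k (iob c k)) (map idn f))"
    unfolding fa G[symmetric] by (rule cmp_assoc[OF H1 H2 H3, symmetric])
  also have "\<dots> = cmp A n (imu c (n, k, fin_comp P s)) (cmp A n (mula A f (idn k) ?ms) (mula A f (idn k) ?es))"
    unfolding E by (rule cmp_assoc[OF H4 H5 PsH])
  also have "cmp A n (mula A f (idn k) ?ms) (mula A f (idn k) ?es) = idt A n ?X"
  proof -
    have "cmps A f ?ms ?es = map idn f"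
      unfolding cmps_def using mu_unit_left[OF ind] lf by (auto intro!: nth_equalityI)
    then show ?thesis
      using mula_Cmp[OF idk es idk ms] cmp_idt(1)[OF idn_Hom] lf sf
        mula_Idn[of "iob c k" f, OF _ obs_ob] ob_Ob[of k] unfolding idns_ob by simp
  qed
  also have "cmp A n (imu c (n, k, fin_comp P s)) (idt A n ?X) = imu c (n, k, fin_comp P s)"
    by (rule cmp_idt(1)[OF PsH])
  finally show ?thesis unfolding P_def by simp
qed

end

context internal_symmetric
begin

lemma pad_act:
  assumes p: "p permutes {..<k}" and y: "y \<in> obj A k"
  shows "acta A k p (pad k y) = pad k (acto A k p y)"
proof -
  have pi: "inv p permutes {..<length (ones k)}" using permutes_inv[OF p] by simp
  have "idt A k y \<in> arr A (length (ones k))" "ars A (ones k) (replicate k (ieps c))"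
    using HomD(1)[OF idt_hom[OF y]] HomD(1)[OF eps_Hom] by (simp_all add: list_all2_conv_all_nth)
  from mula_equivariant_operation[OF this pi]
  have "mula A (ones k) (acta A k p (idt A k y)) (replicate k (ieps c)) = acta A k p (pad k y)"
    unfolding block_perm_ones[OF permutes_inv[OF p]] permutes_inv_inv[OF p] sum_list_replicate
      permute_list_replicate[OF permutes_inv[OF p]] by (simp add: pad_def)
  then show ?thesis by (simp add: pad_def acta_Idn[OF p y])
qed

text \<open>A cocycle identity. It makes every \<open>perm_arrow k p\<close> invertible.\<close>

lemma perm_arrow_comp:
  assumes p: "p permutes {..<k}" and q: "q permutes {..<k}"
  shows "perm_arrow k (p \<circ> q) = cmp A k (acta A k p (perm_arrow k q)) (perm_arrow k p)"
proof -
  let ?P = "map p [0..<k]" and ?Q = "map q [0..<k]" and ?c = "iob c k"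
  have pi: "inv p permutes {..<k}" using permutes_inv[OF p] .
  have PQ: "fin_comp ?P ?Q = map (p \<circ> q) [0..<k]"
    using permutes_in_image[OF q] by (auto simp: fin_comp_def)
  have "permute_list (inv p) (ones k) = ones k" by (rule permute_list_replicate[OF pi])
  then have mu: "imu c (k, k, map (p \<circ> q) [0..<k]) =
      cmp A k (acta A k p (imu c (k, k, ?Q))) (mula A (ones k) (perm_arrow k p) (map idn (ones k)))"
    using mu_perm_comp[OF perm_list_fin_maps[OF q] p]
    unfolding fibre_sizes_perm_list[OF q] block_perm_ones[OF pi] permutes_inv_inv[OF p] PQ by simp
  have po: "acto A k p ?c \<in> obj A k" by (rule acto_Ob[OF p ob_Ob])
  have H1: "pad k ?c \<in> hom A k ?c (mulo A (ones k) ?c (replicate k (iob c 1)))" by (rule pad_Hom[OF ob_Ob])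
  have H2: "mula A (ones k) (perm_arrow k p) (map idn (ones k)) \<in>
      hom A k (mulo A (ones k) ?c (replicate k (iob c 1))) (mulo A (ones k) (acto A k p ?c) (replicate k (iob c 1)))"
    using mula_Hom[of "perm_arrow k p" "ones k", OF _ homs_idn] perm_arrow_Hom[OF p] by simp
  have H3: "pad k (acto A k p ?c) \<in> hom A k (acto A k p ?c) (mulo A (ones k) (acto A k p ?c) (replicate k (iob c 1)))"
    by (rule pad_Hom[OF po])
  have eq: "acto A k p (mulo A (ones k) ?c (replicate k (iob c 1))) = mulo A (ones k) (acto A k p ?c) (replicate k (iob c 1))"
    using acta_Hom[OF p H1] H3 unfolding pad_act[OF p ob_Ob] by (auto simp: Hom_def)
  have H4: "acta A k p (imu c (k, k, ?Q)) \<in> hom A k (mulo A (ones k) (acto A k p ?c) (replicate k (iob c 1)))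
      (acto A k p (acto A k q ?c))"
    using acta_Hom[OF p perm_mu_Hom[OF q]] unfolding eq .
  have "perm_arrow k (p \<circ> q) = cmp A k (acta A k p (imu c (k, k, ?Q)))
      (cmp A k (mula A (ones k) (perm_arrow k p) (map idn (ones k))) (pad k ?c))"
    unfolding perm_arrow_def[of k "p \<circ> q"] mu by (rule cmp_assoc[OF H1 H2 H4])
  also have "cmp A k (mula A (ones k) (perm_arrow k p) (map idn (ones k))) (pad k ?c) =
      cmp A k (pad k (acto A k p ?c)) (perm_arrow k p)"
    using pad_natural[OF perm_arrow_Hom[OF p]] by simp
  also have "cmp A k (acta A k p (imu c (k, k, ?Q))) \<dots> =
      cmp A k (cmp A k (acta A k p (imu c (k, k, ?Q))) (pad k (acto A k p ?c))) (perm_arrow k p)"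
    by (rule cmp_assoc[OF perm_arrow_Hom[OF p] H3 H4, symmetric])
  also have "cmp A k (acta A k p (imu c (k, k, ?Q))) (pad k (acto A k p ?c)) = acta A k p (perm_arrow k q)"
    unfolding perm_arrow_def[of k q] pad_act[OF p ob_Ob, symmetric]
    by (rule acta_Cmp[OF p H1 perm_mu_Hom[OF q], symmetric])
  finally show ?thesis .
qed

text \<open>The inverse of \<open>perm_arrow k p\<close>.\<close>

definition perm_back :: "nat \<Rightarrow> (nat \<Rightarrow> nat) \<Rightarrow> 'u" where
  "perm_back k p = acta A k p (perm_arrow k (inv p))"

lemma perm_back_Hom:
  assumes p: "p permutes {..<k}"
  shows "perm_back k p \<in> hom A k (acto A k p (iob c k)) (iob c k)"
  using acta_Hom[OF p perm_arrow_Hom[OF permutes_inv[OF p]]] acto_inv(1)[OF p ob_Ob]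
  by (simp add: perm_back_def)

lemma perm_back_id: "perm_back k id = idn k"
  by (simp add: perm_back_def perm_arrow_id acta_id[OF HomD(1)[OF idn_Hom]])

lemma perm_back_arrow:
  assumes p: "p permutes {..<k}"
  shows "cmp A k (perm_back k p) (perm_arrow k p) = idn k"
  using perm_arrow_comp[OF p permutes_inv[OF p]] unfolding perm_back_def
  by (simp add: permutes_inv_o[OF p] perm_arrow_id)

lemma perm_arrow_back:
  assumes p: "p permutes {..<k}"
  shows "cmp A k (perm_arrow k p) (perm_back k p) = idt A k (acto A k p (iob c k))"
proof -
  have pi: "inv p permutes {..<k}" by (rule permutes_inv[OF p])
  have "acta A k p (cmp A k (acta A k (inv p) (perm_arrow k p)) (perm_arrow k (inv p))) =
      acta A k p (idn k)"
    using perm_arrow_comp[OF pi p] by (simp add: permutes_inv_o[OF p] perm_arrow_id)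
  also have "acta A k p (cmp A k (acta A k (inv p) (perm_arrow k p)) (perm_arrow k (inv p))) =
      cmp A k (acta A k p (acta A k (inv p) (perm_arrow k p))) (perm_back k p)"
    unfolding perm_back_def by (rule acta_Cmp[OF p perm_arrow_Hom[OF pi] acta_Hom[OF pi perm_arrow_Hom[OF p]]])
  finally show ?thesis
    by (simp add: acta_inv(1)[OF p HomD(1)[OF perm_arrow_Hom[OF p]]] acta_Idn[OF p ob_Ob])
qed

lemma perm_back_comp:
  assumes p: "p permutes {..<k}" and q: "q permutes {..<k}"
  shows "perm_back k (p \<circ> q) = cmp A k (perm_back k p) (acta A k p (perm_back k q))"
proof -
  have pi: "inv p permutes {..<k}" and qi: "inv q permutes {..<k}"
    using permutes_inv[OF p] permutes_inv[OF q] .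
  have pq: "p \<circ> q permutes {..<k}" by (rule permutes_compose[OF q p])
  have "inv (p \<circ> q) = inv q \<circ> inv p" by (rule o_inv_distrib[OF permutes_bij[OF p] permutes_bij[OF q]])
  then have "perm_back k (p \<circ> q) =
      acta A k (p \<circ> q) (cmp A k (acta A k (inv q) (perm_arrow k (inv p))) (perm_arrow k (inv q)))"
    unfolding perm_back_def by (simp add: perm_arrow_comp[OF qi pi])
  also have "\<dots> = cmp A k (acta A k (p \<circ> q) (acta A k (inv q) (perm_arrow k (inv p))))
      (acta A k (p \<circ> q) (perm_arrow k (inv q)))"
    by (rule acta_Cmp[OF pq perm_arrow_Hom[OF qi] acta_Hom[OF qi perm_arrow_Hom[OF pi]]])
  also have "acta A k (p \<circ> q) (acta A k (inv q) (perm_arrow k (inv p))) = perm_back k p"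
    using acta_comp[OF pq qi HomD(1)[OF perm_arrow_Hom[OF pi]]]
    by (simp add: comp_assoc permutes_inv_o[OF q] perm_back_def)
  also have "acta A k (p \<circ> q) (perm_arrow k (inv q)) = acta A k p (perm_back k q)"
    using acta_comp[OF p q HomD(1)[OF perm_arrow_Hom[OF qi]]] by (simp add: perm_back_def)
  finally show ?thesis .
qed

text \<open>\<open>s\<close> is an order preserving map after the bijection \<open>\<pi>(s)\<close>, and this bijection induces identities on
  the fibres.\<close>

lemma mu_factor:
  assumes s: "s \<in> fin_maps n k"
  shows "imu c (n, k, s) = cmp A n (perm_arrow n (fibre_perm s)) (mult (fibre_sizes s k))"
proof -
  let ?ns = "fibre_sizes s k" and ?\<pi> = "fibre_perm s"
  let ?P = "map ?\<pi> [0..<n]" and ?N = "monotone_map (fibre_sizes s k)"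
  have sn: "sum_list ?ns = n" by (rule sum_fibre_sizes[OF s])
  have \<pi>: "?\<pi> permutes {..<sum_list ?ns}" unfolding sn by (rule fin_maps_perm[OF s])
  have sP: "fin_comp ?N ?P = s"
  proof (rule nth_equalityI)
    show "length (fin_comp ?N ?P) = length s" using s by (simp add: fin_comp_def fin_maps_length)
    fix x assume "x < length (fin_comp ?N ?P)"
    then have x: "x < n" by (simp add: fin_comp_def)
    have "?N ! ?\<pi> x = s ! x"
      using monotone_map_nth[of "s ! x" ?ns] fibre_perm_offset[OF s x] fin_maps_nth[OF s x] by simp
    then show "fin_comp ?N ?P ! x = s ! x" using x by (simp add: fin_comp_def)
  qed
  define \<tau> where "\<tau> = map (\<lambda>i. fibre_perm (induced ?P ?N i)) [0..<k]"
  note mp = monotone_after_perm[OF \<pi>, unfolded sn sP]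
  have "sum_perm ?ns \<tau> \<circ> ?\<pi> = ?\<pi>" using mp(4) by (simp add: \<tau>_def)
  then have "sum_perm ?ns \<tau> x = x" for x
    using permutes_surj[OF \<pi>] by (metis comp_apply surjD)
  then have sp: "sum_perm ?ns \<tau> = id" by auto
  have \<tau>: "\<tau> ! i = id" if i: "i < k" for i
  proof
    fix j show "(\<tau> ! i) j = id j"
    proof (cases "j < ?ns ! i")
      case True
      then have "offset ?ns i + (\<tau> ! i) j = offset ?ns i + j"
        using sum_perm_apply[of i ?ns j \<tau>] i sp by simp
      then show ?thesis by simp
    next
      case False
      then show ?thesis using permutes_not_in[OF mp(3)[of i], of j] i by (simp add: \<tau>_def)
    qed
  qed
  have m: "map (\<lambda>i. perm_arrow (?ns ! i) (\<tau> ! i)) [0..<k] = map idn ?ns"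
    by (rule nth_equalityI) (simp_all add: \<tau> perm_arrow_id)
  have "cmp A n (perm_arrow n ?\<pi>) (mult ?ns) =
      cmp A n (acta A n (sum_perm ?ns \<tau>) (imu c (n, k, s))) (mula A ?ns (idn k) (map idn ?ns))"
    using perm_arrow_mult[OF \<pi>] unfolding sn sP m[symmetric] \<tau>_def by simp
  also have "\<dots> = imu c (n, k, s)"
    using mula_Idn[of "iob c k" ?ns, OF _ obs_ob] ob_Ob[of k] cmp_idt(1)[OF mu_Hom[OF s]] sn
    unfolding idns_ob sp by (simp add: acta_id[OF HomD(1)[OF mu_Hom[OF s]]])
  finally show ?thesis by simp
qed

text \<open>The following two lemmas are the naturality of \<open>mult\<close> under permutations inside the blocks and of
  the blocks, written with \<open>perm_back\<close>; they give the equivariance of the slice. This lemma replaces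
  the vertical sides of the squares for \<open>perm_arrow\<close> by their inverses.\<close>

lemma invert_square:
  assumes "\<alpha> \<in> hom A n y y'" "\<theta> \<in> hom A n y' y" "cmp A n \<theta> \<alpha> = idt A n y"
    and "\<beta> \<in> hom A n x x'" "\<gamma> \<in> hom A n x' x" "cmp A n \<beta> \<gamma> = idt A n x'"
    and "m \<in> hom A n x y" "m' \<in> hom A n x' y'"
    and "cmp A n \<alpha> m = cmp A n m' \<beta>"
  shows "cmp A n m \<gamma> = cmp A n \<theta> m'"
proof -
  have "cmp A n \<theta> m' = cmp A n \<theta> (cmp A n m' (cmp A n \<beta> \<gamma>))"
    using cmp_idt(1)[OF assms(8)] assms(6) by simp
  also have "\<dots> = cmp A n \<theta> (cmp A n (cmp A n \<alpha> m) \<gamma>)"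
    using cmp_assoc[OF assms(5,4,8)] assms(9) by simp
  also have "\<dots> = cmp A n (cmp A n \<theta> \<alpha>) (cmp A n m \<gamma>)"
    using cmp_assoc[OF assms(5,7,1)] cmp_assoc[OF cmp_hom[OF assms(5,7)] assms(1,2)]
    by simp
  finally show ?thesis
    using cmp_idt(2)[OF cmp_hom[OF assms(5,7)]] assms(3) by simp
qed

lemma mult_inputs:
  assumes ts: "\<And>i. i < length ns \<Longrightarrow> ts ! i permutes {..<ns ! i}" "length ts = length ns"
  shows "cmp A (sum_list ns) (mult ns)
      (mula A ns (idn (length ns)) (map (\<lambda>i. perm_back (ns ! i) (ts ! i)) [0..<length ns])) =
    cmp A (sum_list ns) (perm_back (sum_list ns) (sum_perm ns ts)) (acta A (sum_list ns) (sum_perm ns ts) (mult ns))"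
proof -
  let ?n = "sum_list ns" and ?k = "length ns" and ?q = "sum_perm ns ts"
  let ?P = "map ?q [0..<?n]" and ?N = "monotone_map ns"
  let ?X = "mulo A ns (iob c ?k) (map (iob c) ns)"
  have q: "?q permutes {..<?n}" by (rule sum_perm_permutes) (rule ts(1))
  have NP: "fin_comp ?N ?P = ?N"
  proof (rule nth_equalityI)
    show "length (fin_comp ?N ?P) = length ?N" by (simp add: length_fin_comp length_monotone_map)
    fix x assume "x < length (fin_comp ?N ?P)"
    then have x: "x < ?n" by (simp add: length_fin_comp)
    then obtain i j where ij: "i < ?k" "j < ns ! i" "x = offset ns i + j" using offset_cases by blast
    moreover have "(ts ! i) j < ns ! i" using permutes_in_image[OF ts(1)[OF ij(1)], of j] ij(2) by simp
    ultimately have "?N ! ?q x = ?N ! x" by (simp add: sum_perm_apply monotone_map_nth)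
    then show "fin_comp ?N ?P ! x = ?N ! x" using x by (simp add: fin_comp_def)
  qed
  note mp = monotone_after_perm[OF q]
  define \<tau> where "\<tau> = map (\<lambda>i. fibre_perm (induced ?P ?N i)) [0..<?k]"
  have q\<tau>: "?q = sum_perm ns \<tau>"
    using mp(4) unfolding NP fibre_perm_sorted[OF sorted_monotone_map] by (simp add: \<tau>_def)
  have \<tau>: "\<tau> ! i = ts ! i" if i: "i < ?k" for i
  proof
    fix j show "(\<tau> ! i) j = (ts ! i) j"
    proof (cases "j < ns ! i")
      case True
      then have "offset ns i + (\<tau> ! i) j = offset ns i + (ts ! i) j"
        using sum_perm_apply[of i ns j \<tau>] sum_perm_apply[of i ns j ts] i q\<tau> by simp
      then show ?thesis by simp
    next
      case False
      then show ?thesis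
        using permutes_not_in[OF mp(3)[OF i], of j] permutes_not_in[OF ts(1)[OF i], of j] i by (simp add: \<tau>_def)
    qed
  qed
  let ?as = "map (\<lambda>i. perm_arrow (ns ! i) (ts ! i)) [0..<?k]" and ?bs = "map (\<lambda>i. perm_back (ns ! i) (ts ! i)) [0..<?k]"
  let ?ys = "map (\<lambda>i. acto A (ns ! i) (ts ! i) (iob c (ns ! i))) [0..<?k]"
  have as: "homs A ns ?as (map (iob c) ns) ?ys" using perm_arrow_Hom[OF ts(1)] by (simp add: homs_def)
  have bs: "homs A ns ?bs ?ys (map (iob c) ns)" using perm_back_Hom[OF ts(1)] by (simp add: homs_def)
  have mm: "map (\<lambda>i. perm_arrow (ns ! i) (\<tau> ! i)) [0..<?k] = ?as" using \<tau> by simp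
  have sq: "cmp A ?n (perm_arrow ?n ?q) (mult ns) =
      cmp A ?n (acta A ?n ?q (mult ns)) (mula A ns (idn ?k) ?as)"
    using perm_arrow_mult[OF q] unfolding NP \<tau>_def[symmetric] mm q\<tau>[symmetric] by (simp add: mult_def)
  have qX: "mulo A ns (iob c ?k) ?ys = acto A ?n ?q ?X"
    by (rule mulo_inputs[OF ob_Ob obs_ob ts(1)]) simp_all
  show ?thesis
  proof (rule invert_square[OF perm_arrow_Hom[OF q] perm_back_Hom[OF q] perm_back_arrow[OF q] _ _ _ mult_Hom _ sq])
    show "mula A ns (idn ?k) ?as \<in> hom A ?n ?X (acto A ?n ?q ?X)"
      unfolding qX[symmetric] by (rule mula_Hom[OF idn_Hom as])
    show "mula A ns (idn ?k) ?bs \<in> hom A ?n (acto A ?n ?q ?X) ?X"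
      unfolding qX[symmetric] by (rule mula_Hom[OF idn_Hom bs])
    show "acta A ?n ?q (mult ns) \<in> hom A ?n (acto A ?n ?q ?X) (acto A ?n ?q (iob c ?n))"
      by (rule acta_Hom[OF q mult_Hom])
    have "cmps A ns ?as ?bs = idns A ns ?ys"
      unfolding cmps_def using perm_arrow_back[OF ts(1)] by (auto intro!: nth_equalityI)
    then show "cmp A ?n (mula A ns (idn ?k) ?as) (mula A ns (idn ?k) ?bs) = idt A ?n (acto A ?n ?q ?X)"
      using mula_Cmp[OF idn_Hom bs idn_Hom as] mula_Idn[OF ob_Ob homs_obs(1)[OF bs]] cmp_idt(1)[OF idn_Hom]
      by (simp add: qX)
  qed
qed

lemma mult_operation:
  assumes p: "p permutes {..<length ns}"
  defines "f \<equiv> permute_list (inv p) ns" and "b \<equiv> inv (block_perm (inv p) ns)"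
  shows "cmp A (sum_list ns) (mult f) (mula A f (perm_back (length ns) p) (map idn f)) =
    cmp A (sum_list ns) (perm_back (sum_list ns) b) (acta A (sum_list ns) b (mult ns))"
proof -
  let ?n = "sum_list ns" and ?k = "length ns" and ?N = "monotone_map ns"
  let ?X = "mulo A f (iob c ?k) (map (iob c) f)" and ?Y = "mulo A f (acto A ?k p (iob c ?k)) (map (iob c) f)"
  have pi: "inv p permutes {..<?k}" by (rule permutes_inv[OF p])
  have b: "b permutes {..<?n}" unfolding b_def by (rule permutes_inv[OF block_perm_permutes[OF pi]])
  have N: "?N \<in> fin_maps ?n ?k" by (rule monotone_map_fin_maps)
  have FN: "fibre_sizes ?N ?k = ns" by (rule fibre_sizes_monotone_map)
  have lf: "length f = ?k" and sf: "sum_list f = ?n" unfolding f_def using sum_list_permute_list[OF pi] by simp_all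
  note pm = perm_after_map[OF N p, unfolded FN]
  have fp: "fibre_perm (fin_comp (map p [0..<?k]) ?N) = b"
    using pm(5) unfolding fibre_perm_sorted[OF sorted_monotone_map] by (simp add: b_def)
  have NP: "fin_comp (map p [0..<?k]) ?N \<in> fin_maps ?n ?k"
    by (rule fin_comp_fin_maps[OF N perm_list_fin_maps[OF p]])
  have sq: "cmp A ?n (perm_arrow ?n b) (mult f) =
      cmp A ?n (acta A ?n b (mult ns)) (mula A f (perm_arrow ?k p) (map idn f))"
    using mu_perm_comp[OF N p] mu_factor[OF NP] unfolding FN fp pm(1) f_def[symmetric] b_def[symmetric]
    by (simp add: mult_def)
  have bX: "?Y = acto A ?n b (mulo A ns (iob c ?k) (map (iob c) ns))"
    using mulo_equivariant_operation[OF ob_Ob obs_ob pi] permutes_inv_inv[OF p] permute_list_map[OF pi, of "iob c"]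
    by (simp add: f_def b_def)
  show ?thesis
  proof (rule invert_square[OF perm_arrow_Hom[OF b] perm_back_Hom[OF b] perm_back_arrow[OF b] _ _ _ _ _ sq])
    have aH: "perm_arrow ?k p \<in> hom A (length f) (iob c ?k) (acto A ?k p (iob c ?k))"
      and bH: "perm_back ?k p \<in> hom A (length f) (acto A ?k p (iob c ?k)) (iob c ?k)"
      using perm_arrow_Hom[OF p] perm_back_Hom[OF p] lf by simp_all
    show "mula A f (perm_arrow ?k p) (map idn f) \<in> hom A ?n ?X ?Y"
      using mula_Hom[OF aH homs_idn] sf by simp
    show "mula A f (perm_back ?k p) (map idn f) \<in> hom A ?n ?Y ?X"
      using mula_Hom[OF bH homs_idn] sf by simp
    show "mult f \<in> hom A ?n ?X (iob c ?n)" using mult_Hom[of f] by (simp add: lf sf)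
    show "acta A ?n b (mult ns) \<in> hom A ?n ?Y (acto A ?n b (iob c ?n))"
      unfolding bX by (rule acta_Hom[OF b mult_Hom])
    show "cmp A ?n (mula A f (perm_arrow ?k p) (map idn f)) (mula A f (perm_back ?k p) (map idn f)) = idt A ?n ?Y"
      using mula_Cmp[OF bH homs_idn aH homs_idn] perm_arrow_back[OF p] lf sf
        mula_Idn[of "acto A ?k p (iob c ?k)" f "map (iob c) f"] acto_Ob[OF p ob_Ob] obs_ob[of f]
        cmps_idns(1)[OF homs_idn[of f]] unfolding idns_ob by simp
  qed
qed

end

section \<open>The slice of an operad over an internal symmetric operad\<close>

text \<open>The arrows of an operad lie in the same universe as its objects, so the commutative triangles that
  are the arrows of the slice are coded in it; an infinite universe has room for its pairs.\<close>

definition pair_code :: "'u \<times> 'u \<Rightarrow> 'u" where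
  "pair_code = (SOME f. inj f)"

lemma inj_pair_code:
  assumes "infinite (UNIV :: 'u set)"
  shows "inj (pair_code :: 'u \<times> 'u \<Rightarrow> 'u)"
proof -
  have "\<exists>f :: 'u \<times> 'u \<Rightarrow> 'u. bij_betw f (UNIV \<times> UNIV) UNIV"
    unfolding card_of_ordIso by (rule card_of_Times_same_infinite[OF assms])
  then have "\<exists>f :: 'u \<times> 'u \<Rightarrow> 'u. inj f" by (auto simp: bij_betw_def)
  then show ?thesis unfolding pair_code_def by (rule someI_ex)
qed

definition code_fst :: "'u \<Rightarrow> 'u" where "code_fst z = fst (inv pair_code z)"
definition code_snd :: "'u \<Rightarrow> 'u" where "code_snd z = snd (inv pair_code z)"

lemma code_simps:
  assumes "infinite (UNIV :: 'u set)"
  shows "code_fst (pair_code (x, y :: 'u)) = x" "code_snd (pair_code (x, y)) = y"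
  using inj_pair_code[OF assms] by (simp_all add: code_fst_def code_snd_def)

lemma is_set_operad_pairs:
  assumes inf: "infinite (UNIV :: 'u set)"
    and S: "is_set_operad (C :: nat \<Rightarrow> 'u set) act e mul" and S': "is_set_operad C' act' e' mul'"
  shows "is_set_operad (\<lambda>k. {pair_code (x, y) |x y. x \<in> C k \<and> y \<in> C' k})
    (\<lambda>k p z. pair_code (act k p (code_fst z), act' k p (code_snd z))) (pair_code (e, e'))
    (\<lambda>ns z zs. pair_code (mul ns (code_fst z) (map code_fst zs), mul' ns (code_snd z) (map code_snd zs)))"
    (is "is_set_operad ?C ?act ?e ?mul")
proof -
  note cs [simp] = code_simps[OF inf]
  have C: "code_fst z \<in> C k" "code_snd z \<in> C' k" "pair_code (code_fst z, code_snd z) = z" if "z \<in> ?C k" for z k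
    using that by auto
  have L: "each C ns (map code_fst zs)" "each C' ns (map code_snd zs)"
    if "each ?C ns zs" for ns zs
    using that C by (auto simp: list_all2_conv_all_nth)
  have L1: "list_all2 (\<lambda>ns y. y \<in> C (length ns)) nss (map code_fst zs)"
    "list_all2 (\<lambda>ns y. y \<in> C' (length ns)) nss (map code_snd zs)"
    if "list_all2 (\<lambda>ns y. y \<in> ?C (length ns)) nss zs" for nss :: "nat list list" and zs
    using that C by (auto simp: list_all2_conv_all_nth)
  have LL: "list_all2 (each C) nss (map (map code_fst) zss)"
    "list_all2 (each C') nss (map (map code_snd) zss)"
    if "list_all2 (each ?C) nss zss" for nss zss
    by (subst list_all2_map2, rule list_all2_mono[OF that], erule L)+
  have i: "act k id x = x" if "x \<in> C k" for k x using S that by (simp add: is_set_operad_def)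
  have i': "act' k id x = x" if "x \<in> C' k" for k x using S' that by (simp add: is_set_operad_def)
  show ?thesis
    unfolding is_set_operad_def
  proof (intro conjI allI impI)
    show "?act k p x \<in> ?C k" if "p permutes {..<k}" "x \<in> ?C k" for k p x
    proof -
      have "act k p (code_fst x) \<in> C k" "act' k p (code_snd x) \<in> C' k"
        using that(1) C[OF that(2)] S S' by (simp_all add: is_set_operad_def)
      then show ?thesis by blast
    qed
    show "?act k id x = x" if "x \<in> ?C k" for k x
      using C[OF that] i i' by simp
    show "?act k (p \<circ> q) x = ?act k p (?act k q x)"
      if "p permutes {..<k}" "q permutes {..<k}" "x \<in> ?C k" for k p q x
      using that C[OF that(3)] S S' unfolding is_set_operad_def by simp
    have "e \<in> C 1" "e' \<in> C' 1" using S S' by (simp_all add: is_set_operad_def)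
    then show "?e \<in> ?C 1" by blast
    show "?mul ns x ys \<in> ?C (sum_list ns)" if "x \<in> ?C (length ns)" "each ?C ns ys" for ns x ys
    proof -
      have "mul ns (code_fst x) (map code_fst ys) \<in> C (sum_list ns)"
        "mul' ns (code_snd x) (map code_snd ys) \<in> C' (sum_list ns)"
        using C[OF that(1)] L[OF that(2)] S S' by (simp_all add: is_set_operad_def)
      then show ?thesis by blast
    qed
    show "?mul (concat nss) (?mul (map length nss) x ys) (concat zss) =
        ?mul (map sum_list nss) x (map (\<lambda>i. ?mul (nss ! i) (ys ! i) (zss ! i)) [0..<length nss])"
      if x: "x \<in> ?C (length nss)" and ys: "list_all2 (\<lambda>ns y. y \<in> ?C (length ns)) nss ys"
        and zss: "list_all2 (each ?C) nss zss" for nss x ys zss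
    proof -
      note l = list_all2_lengthD[OF ys] list_all2_lengthD[OF zss]
      have m: "map (\<lambda>i. f (nss ! i) (map g ys ! i) (map (map g) zss ! i)) [0..<length nss] =
          map (\<lambda>i. f (nss ! i) (g (ys ! i)) (map g (zss ! i))) [0..<length nss]"
        for f :: "nat list \<Rightarrow> 'u \<Rightarrow> 'u list \<Rightarrow> 'u" and g using l by simp
      have "mul (concat nss) (mul (map length nss) (code_fst x) (map code_fst ys)) (concat (map (map code_fst) zss)) =
          mul (map sum_list nss) (code_fst x)
            (map (\<lambda>i. mul (nss ! i) (map code_fst ys ! i) (map (map code_fst) zss ! i)) [0..<length nss])"
        using C(1)[OF x] L1(1)[OF ys] LL(1)[OF zss] S unfolding is_set_operad_def by blast
      moreover have "mul' (concat nss) (mul' (map length nss) (code_snd x) (map code_snd ys)) (concat (map (map code_snd) zss)) =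
          mul' (map sum_list nss) (code_snd x)
            (map (\<lambda>i. mul' (nss ! i) (map code_snd ys ! i) (map (map code_snd) zss ! i)) [0..<length nss])"
        using C(2)[OF x] L1(2)[OF ys] LL(2)[OF zss] S' unfolding is_set_operad_def by blast
      ultimately show ?thesis unfolding m by (simp add: map_concat comp_def)
    qed
    show "?mul [k] ?e [x] = x" if "x \<in> ?C k" for k x
    proof -
      have "mul [k] e [code_fst x] = code_fst x" "mul' [k] e' [code_snd x] = code_snd x"
        using C[OF that] S S' by (simp_all add: is_set_operad_def)
      then show ?thesis using C(3)[OF that] by simp
    qed
    show "?mul (replicate k 1) x (replicate k ?e) = x" if "x \<in> ?C k" for k x
    proof -
      have "mul (replicate k 1) (code_fst x) (replicate k e) = code_fst x"
        "mul' (replicate k 1) (code_snd x) (replicate k e') = code_snd x"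
        using C[OF that] S S' by (simp_all add: is_set_operad_def)
      then show ?thesis using C(3)[OF that] by simp
    qed
    show "?mul (permute_list \<rho> ns) (?act (length ns) (inv \<rho>) x) (permute_list \<rho> ys) =
        ?act (sum_list ns) (inv (block_perm \<rho> ns)) (?mul ns x ys)"
      if x: "x \<in> ?C (length ns)" and ys: "each ?C ns ys"
        and \<rho>: "\<rho> permutes {..<length ns}" for ns x ys \<rho>
    proof -
      have p: "permute_list \<rho> (map g ys) = map g (permute_list \<rho> ys)" for g :: "'u \<Rightarrow> 'u"
        using permute_list_map[of \<rho> ys g] \<rho> list_all2_lengthD[OF ys] by simp
      have "mul (permute_list \<rho> ns) (act (length ns) (inv \<rho>) (code_fst x)) (permute_list \<rho> (map code_fst ys)) =
          act (sum_list ns) (inv (block_perm \<rho> ns)) (mul ns (code_fst x) (map code_fst ys))"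
        using C(1)[OF x] L(1)[OF ys] \<rho> S unfolding is_set_operad_def by blast
      moreover have "mul' (permute_list \<rho> ns) (act' (length ns) (inv \<rho>) (code_snd x)) (permute_list \<rho> (map code_snd ys)) =
          act' (sum_list ns) (inv (block_perm \<rho> ns)) (mul' ns (code_snd x) (map code_snd ys))"
        using C(2)[OF x] L(2)[OF ys] \<rho> S' unfolding is_set_operad_def by blast
      ultimately show ?thesis unfolding p by simp
    qed
    show "?mul ns x (map (\<lambda>i. ?act (ns ! i) (inv (ts ! i)) (ys ! i)) [0..<length ns]) =
        ?act (sum_list ns) (inv (sum_perm ns ts)) (?mul ns x ys)"
      if x: "x \<in> ?C (length ns)" and ys: "each ?C ns ys"
        and ts: "list_all2 (\<lambda>n t. t permutes {..<n}) ns ts" for ns x ys ts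
    proof -
      have m: "map (\<lambda>i. f (ns ! i) (inv (ts ! i)) (map g ys ! i)) [0..<length ns] =
          map (\<lambda>i. f (ns ! i) (inv (ts ! i)) (g (ys ! i))) [0..<length ns]"
        for f :: "nat \<Rightarrow> (nat \<Rightarrow> nat) \<Rightarrow> 'u \<Rightarrow> 'u" and g using list_all2_lengthD[OF ys] by simp
      have "mul ns (code_fst x) (map (\<lambda>i. act (ns ! i) (inv (ts ! i)) (map code_fst ys ! i)) [0..<length ns]) =
          act (sum_list ns) (inv (sum_perm ns ts)) (mul ns (code_fst x) (map code_fst ys))"
        using C(1)[OF x] L(1)[OF ys] ts S unfolding is_set_operad_def by blast
      moreover have "mul' ns (code_snd x) (map (\<lambda>i. act' (ns ! i) (inv (ts ! i)) (map code_snd ys ! i)) [0..<length ns]) =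
          act' (sum_list ns) (inv (sum_perm ns ts)) (mul' ns (code_snd x) (map code_snd ys))"
        using C(2)[OF x] L(2)[OF ys] ts S' unfolding is_set_operad_def by blast
      ultimately show ?thesis unfolding m by (simp add: comp_def)
    qed
  qed
qed

context internal_symmetric
begin

text \<open>An object of the slice is an arrow of \<open>A\<close> with target \<open>c\<^sub>k\<close>; the permutations and the
  multiplication carry such arrows to arrows with targets \<open>p c\<^sub>k\<close> and \<open>m(c\<^sub>k; c\<^sub>n\<^sub>1, \<dots>)\<close>, and the
  structure of \<open>c\<close> brings these back. An arrow from \<open>g h\<close> to \<open>g\<close> is coded by the pair \<open>(g, h)\<close>.\<close>

definition slice_ob :: "nat \<Rightarrow> 'u set" where
  "slice_ob k = {f \<in> arr A k. trg A k f = iob c k}"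

definition slice_act :: "nat \<Rightarrow> (nat \<Rightarrow> nat) \<Rightarrow> 'u \<Rightarrow> 'u" where
  "slice_act k p f = cmp A k (perm_back k p) (acta A k p f)"

definition slice_mul :: "nat list \<Rightarrow> 'u \<Rightarrow> 'u list \<Rightarrow> 'u" where
  "slice_mul ns f gs = cmp A (sum_list ns) (mult ns) (mula A ns f gs)"

definition slice :: "'u cat_operad" where
  "slice =
     \<lparr>cat = (\<lambda>k. \<lparr>Ob = slice_ob k,
        Ar = {pair_code (g, h) |g h. g \<in> slice_ob k \<and> h \<in> arr A k \<and> trg A k h = src A k g},
        Src = (\<lambda>z. cmp A k (code_fst z) (code_snd z)),
        Trg = code_fst,
        Idn = (\<lambda>f. pair_code (f, idt A k (src A k f))),
        Cmp = (\<lambda>z' z. pair_code (code_fst z', cmp A k (code_snd z') (code_snd z)))\<rparr>),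
      acto = slice_act,
      acta = (\<lambda>k p z. pair_code (slice_act k p (code_fst z), acta A k p (code_snd z))),
      unt = ieps c,
      mulo = slice_mul,
      mula = (\<lambda>ns z zs. pair_code (slice_mul ns (code_fst z) (map code_fst zs),
                                  mula A ns (code_snd z) (map code_snd zs)))\<rparr>"

lemma slice_simps [simp]:
  "obj slice k = slice_ob k"
  "arr slice k = {pair_code (g, h) |g h. g \<in> slice_ob k \<and> h \<in> arr A k \<and> trg A k h = src A k g}"
  "src slice k z = cmp A k (code_fst z) (code_snd z)"
  "trg slice k z = code_fst z"
  "idt slice k f = pair_code (f, idt A k (src A k f))"
  "cmp slice k z' z = pair_code (code_fst z', cmp A k (code_snd z') (code_snd z))"
  "acto slice = slice_act"
  "acta slice k p z = pair_code (slice_act k p (code_fst z), acta A k p (code_snd z))"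
  "unt slice = ieps c" "mulo slice = slice_mul"
  "mula slice ns z zs = pair_code (slice_mul ns (code_fst z) (map code_fst zs), mula A ns (code_snd z) (map code_snd zs))"
  by (simp_all add: slice_def)

lemma slice_ob_iff: "f \<in> slice_ob k \<longleftrightarrow> f \<in> hom A k (src A k f) (iob c k)"
  by (simp add: slice_ob_def Hom_def)

lemma slice_obI: "f \<in> hom A k x (iob c k) \<Longrightarrow> f \<in> slice_ob k"
  by (simp add: slice_ob_def Hom_def)

lemma slice_homs:
  assumes "each slice_ob ns gs"
  shows "homs A ns gs (map2 (\<lambda>n. src A n) ns gs) (map (iob c) ns)"
  using assms by (auto simp: homs_def list_all2_conv_all_nth slice_ob_iff)

lemma slice_act_Hom:
  assumes "p permutes {..<k}" "f \<in> hom A k x (iob c k)"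
  shows "slice_act k p f \<in> hom A k (acto A k p x) (iob c k)"
  unfolding slice_act_def by (rule cmp_hom[OF acta_Hom[OF assms] perm_back_Hom[OF assms(1)]])

lemma slice_mul_Hom:
  assumes "f \<in> hom A (length ns) x (iob c (length ns))" "homs A ns gs xs (map (iob c) ns)"
  shows "slice_mul ns f gs \<in> hom A (sum_list ns) (mulo A ns x xs) (iob c (sum_list ns))"
  unfolding slice_mul_def by (rule cmp_hom[OF mula_Hom[OF assms] mult_Hom])

lemma slice_act_precompose:
  assumes "p permutes {..<k}" "h \<in> hom A k x y" "f \<in> hom A k y (iob c k)"
  shows "slice_act k p (cmp A k f h) = cmp A k (slice_act k p f) (acta A k p h)"
  unfolding slice_act_def acta_Cmp[OF assms]
  by (rule cmp_assoc[OF acta_Hom[OF assms(1,2)] acta_Hom[OF assms(1,3)] perm_back_Hom[OF assms(1)], symmetric])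

lemma slice_mul_precompose:
  assumes "h \<in> hom A (length ns) x y" "homs A ns hs xs ys"
    and "f \<in> hom A (length ns) y (iob c (length ns))" "homs A ns gs ys (map (iob c) ns)"
  shows "slice_mul ns (cmp A (length ns) f h) (cmps A ns gs hs) =
    cmp A (sum_list ns) (slice_mul ns f gs) (mula A ns h hs)"
  unfolding slice_mul_def mula_Cmp[OF assms, symmetric]
  by (rule cmp_assoc[OF mula_Hom[OF assms(1,2)] mula_Hom[OF assms(3,4)] mult_Hom, symmetric])

lemma slice_mul_assoc:
  assumes x: "x \<in> slice_ob (length nss)" and ys: "list_all2 (\<lambda>ns y. y \<in> slice_ob (length ns)) nss ys"
    and zss: "list_all2 (each slice_ob) nss zss"
  shows "slice_mul (concat nss) (slice_mul (map length nss) x ys) (concat zss) =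
    slice_mul (map sum_list nss) x (map (\<lambda>i. slice_mul (nss ! i) (ys ! i) (zss ! i)) [0..<length nss])"
proof -
  let ?n = "sum_list (concat nss)" and ?l = "length nss" and ?c = "concat nss" and ?ls = "map length nss" and ?ss = "map sum_list nss"
  have sl: "sum_list ?ls = length ?c" by (simp add: length_concat)
  have ss: "sum_list ?ss = ?n" by (induction nss) simp_all
  have xH: "x \<in> hom A (length ?ls) (src A ?l x) (iob c ?l)"
    and xH': "x \<in> hom A (length ?ss) (src A ?l x) (iob c ?l)" using x by (simp_all add: slice_ob_iff)
  have "each slice_ob ?ls ys"
    using ys by (simp add: list_all2_conv_all_nth)
  note ysH = slice_homs[OF this]
  have cz: "each slice_ob ?c (concat zss)"
    using zss by (induction rule: list_all2_induct) (auto intro: list_all2_appendI)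
  note czH = slice_homs[OF cz]
  have yi: "ys ! i \<in> hom A (length (nss ! i)) (src A (length (nss ! i)) (ys ! i)) (iob c (length (nss ! i)))"
    if "i < ?l" for i using ys that by (simp add: list_all2_conv_all_nth slice_ob_iff)
  have zi: "homs A (nss ! i) (zss ! i) (map2 (\<lambda>n. src A n) (nss ! i) (zss ! i)) (map (iob c) (nss ! i))"
    if "i < ?l" for i
  proof -
    have "each slice_ob (nss ! i) (zss ! i)" using list_all2_nthD[OF zss that] .
    then show ?thesis by (rule slice_homs)
  qed
  define ms where "ms = map (\<lambda>i. mula A (nss ! i) (ys ! i) (zss ! i)) [0..<?l]"
  define mx where "mx = map (\<lambda>i. mulo A (nss ! i) (src A (length (nss ! i)) (ys ! i)) (map2 (\<lambda>n. src A n) (nss ! i) (zss ! i))) [0..<?l]"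
  define my where "my = map (\<lambda>i. mulo A (nss ! i) (iob c (length (nss ! i))) (map (iob c) (nss ! i))) [0..<?l]"
  have msH: "homs A ?ss ms mx my"
    unfolding homs_def using mula_Hom[OF yi zi] by (simp add: ms_def mx_def my_def)
  have muH: "homs A ?ss (map mult nss) my (map (iob c) ?ss)"
    unfolding homs_def using mult_Hom by (simp add: my_def)
  have mlH: "mult ?ls \<in> hom A (length ?c) (mulo A ?ls (iob c ?l) (map (iob c) ?ls)) (iob c (length ?c))"
    using mult_Hom[of ?ls] sl by simp
  have xyH: "mula A ?ls x ys \<in> hom A (length ?c) (mulo A ?ls (src A ?l x) (map2 (\<lambda>n. src A n) ?ls ys)) (mulo A ?ls (iob c ?l) (map (iob c) ?ls))"
    using mula_Hom[OF xH] ysH sl by simp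
  have B1: "mula A ?c (mult ?ls) (map idn ?c) \<in> hom A ?n (mulo A ?c (mulo A ?ls (iob c ?l) (map (iob c) ?ls)) (map (iob c) ?c)) (mulo A ?c (iob c (length ?c)) (map (iob c) ?c))"
    by (rule mula_Hom[OF mlH homs_idn])
  have B2: "mula A ?c (mula A ?ls x ys) (concat zss) \<in> hom A ?n (mulo A ?c (mulo A ?ls (src A ?l x) (map2 (\<lambda>n. src A n) ?ls ys)) (map2 (\<lambda>n. src A n) ?c (concat zss))) (mulo A ?c (mulo A ?ls (iob c ?l) (map (iob c) ?ls)) (map (iob c) ?c))"
    by (rule mula_Hom[OF xyH czH])
  have il: "idn ?l \<in> hom A (length ?ss) (iob c ?l) (iob c ?l)" using idn_Hom by simp
  have B3: "mula A ?ss (idn ?l) (map mult nss) \<in> hom A ?n (mulo A ?ss (iob c ?l) my) (mulo A ?ss (iob c ?l) (map (iob c) ?ss))"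
    using mula_Hom[OF il muH] ss by simp
  have B4: "mula A ?ss x ms \<in> hom A ?n (mulo A ?ss (src A ?l x) mx) (mulo A ?ss (iob c ?l) my)"
    using mula_Hom[OF xH' msH] ss by simp
  have as: "mula A ?c (mula A ?ls x ys) (concat zss) = mula A ?ss x ms"
    unfolding ms_def
  proof (rule mula_assoc)
    show "x \<in> arr A ?l" using x by (simp add: slice_ob_def)
    show "list_all2 (\<lambda>ns y. y \<in> arr A (length ns)) nss ys"
      using ys by (rule list_all2_mono) (simp add: slice_ob_def)
    show "list_all2 (ars A) nss zss"
      using zss by (rule list_all2_mono) (erule list_all2_mono, simp add: slice_ob_def)
  qed
  have "slice_mul ?c (slice_mul ?ls x ys) (concat zss) = cmp A ?n (mult ?c)
      (cmp A ?n (mula A ?c (mult ?ls) (map idn ?c)) (mula A ?c (mula A ?ls x ys) (concat zss)))"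
  proof -
    have "cmps A ?c (map idn ?c) (concat zss) = concat zss"
      using cmps_idns(2)[OF czH] unfolding idns_ob .
    then show ?thesis unfolding slice_mul_def mula_Cmp[OF xyH czH mlH homs_idn] by (simp only: sl)
  qed
  also have "\<dots> = cmp A ?n (mult ?c) (cmp A ?n (mula A ?c (mult ?ls) (map idn ?c)) (mula A ?ss x ms))"
    by (simp only: as)
  also have "\<dots> = cmp A ?n (cmp A ?n (mult ?c) (mula A ?c (mult ?ls) (map idn ?c))) (mula A ?ss x ms)"
    by (rule cmp_assoc[OF B2 B1 mult_Hom, unfolded as, symmetric])
  also have "\<dots> = cmp A ?n (cmp A ?n (mult ?ss) (mula A ?ss (idn ?l) (map mult nss))) (mula A ?ss x ms)"
    unfolding mult_associative by (rule refl)
  also have "\<dots> = cmp A ?n (mult ?ss) (cmp A ?n (mula A ?ss (idn ?l) (map mult nss)) (mula A ?ss x ms))"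
    by (rule cmp_assoc[OF B4 B3]) (use mult_Hom[of ?ss] ss in simp)
  also have "cmp A ?n (mula A ?ss (idn ?l) (map mult nss)) (mula A ?ss x ms) =
      mula A ?ss x (map (\<lambda>i. slice_mul (nss ! i) (ys ! i) (zss ! i)) [0..<?l])"
  proof -
    have "cmps A ?ss (map mult nss) ms = map (\<lambda>i. slice_mul (nss ! i) (ys ! i) (zss ! i)) [0..<?l]"
      by (simp add: cmps_def ms_def slice_mul_def)
    then show ?thesis
      using mula_Cmp[OF xH' msH il muH] cmp_idt(2)[OF xH'] ss by simp
  qed
  finally show ?thesis by (simp only: slice_mul_def ss)
qed

text \<open>Every law of the slice is the corresponding law of \<open>A\<close> composed with one for \<open>perm_back\<close> and \<open>mult\<close>:
  the cocycle identity, associativity, the unit laws and the two kinds of naturality.\<close>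

lemma slice_object_operad: "is_set_operad slice_ob slice_act (ieps c) slice_mul"
  unfolding is_set_operad_def
proof (intro conjI allI impI)
  show "slice_act k p x \<in> slice_ob k" if "p permutes {..<k}" "x \<in> slice_ob k" for k p x
    using slice_act_Hom that unfolding slice_ob_iff[of x] by (blast intro: slice_obI)
  show "slice_act k id x = x" if "x \<in> slice_ob k" for k x
    using that cmp_idt(2) unfolding slice_ob_iff
    by (simp add: slice_act_def perm_back_id acta_id[OF HomD(1)])
  show "slice_act k (p \<circ> q) x = slice_act k p (slice_act k q x)"
    if p: "p permutes {..<k}" and q: "q permutes {..<k}" and x: "x \<in> slice_ob k" for k p q x
  proof -
    have xH: "x \<in> hom A k (src A k x) (iob c k)" using x by (simp add: slice_ob_iff)
    have "slice_act k p (slice_act k q x) = cmp A k (perm_back k p)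
        (cmp A k (acta A k p (perm_back k q)) (acta A k p (acta A k q x)))"
      unfolding slice_act_def acta_Cmp[OF p acta_Hom[OF q xH] perm_back_Hom[OF q]] by (rule refl)
    also have "\<dots> = cmp A k (perm_back k (p \<circ> q)) (acta A k (p \<circ> q) x)"
      unfolding perm_back_comp[OF p q] acta_comp[OF p q HomD(1)[OF xH], symmetric]
      by (rule cmp_assoc[OF acta_Hom[OF p acta_Hom[OF q xH]] acta_Hom[OF p perm_back_Hom[OF q]] perm_back_Hom[OF p], symmetric])
    finally show ?thesis by (simp add: slice_act_def)
  qed
  show "ieps c \<in> slice_ob 1" by (rule slice_obI[OF eps_Hom])
  show "slice_mul ns x ys \<in> slice_ob (sum_list ns)"
    if "x \<in> slice_ob (length ns)" "each slice_ob ns ys" for ns x ys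
    using slice_obI[OF slice_mul_Hom[OF _ slice_homs[OF that(2)]]] that(1) by (simp add: slice_ob_iff)
  show "slice_mul (concat nss) (slice_mul (map length nss) x ys) (concat zss) =
      slice_mul (map sum_list nss) x (map (\<lambda>i. slice_mul (nss ! i) (ys ! i) (zss ! i)) [0..<length nss])"
    if "x \<in> slice_ob (length nss)" "list_all2 (\<lambda>ns y. y \<in> slice_ob (length ns)) nss ys"
      "list_all2 (each slice_ob) nss zss" for nss x ys zss
    using slice_mul_assoc[OF that] .
  show "slice_mul [k] (ieps c) [x] = x" if "x \<in> slice_ob k" for k x
  proof -
    have xH: "x \<in> hom A k (src A k x) (iob c k)" using that by (simp add: slice_ob_iff)
    have e: "ieps c \<in> hom A (length [k]) (unt A) (iob c 1)" using eps_Hom by simp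
    have xs: "homs A [k] [x] [src A k x] [iob c k]" using xH by (simp add: homs_def)
    have ik: "homs A [k] [idn k] [iob c k] [iob c k]" using idn_Hom by (simp add: homs_def)
    have H1: "mula A [k] (ieps c) [idn k] \<in> hom A k (mulo A [k] (unt A) [iob c k]) (mulo A [k] (iob c 1) [iob c k])"
      using mula_Hom[OF e ik] by simp
    have H2: "mult [k] \<in> hom A k (mulo A [k] (iob c 1) [iob c k]) (iob c k)"
      using mult_Hom[of "[k]"] by simp
    have xH': "x \<in> hom A k (src A k x) (mulo A [k] (unt A) [iob c k])"
      using xH mulo_unit(1)[OF ob_Ob] by simp
    have "mula A [k] (ieps c) [x] = cmp A k (mula A [k] (ieps c) [idn k]) x"
      using mula_split(1)[OF e xs] mula_unit(1)[OF HomD(1)[OF xH]] by simp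
    then show ?thesis
      using cmp_assoc[OF xH' H1 H2] mult_unit_left[of k] cmp_idt(2)[OF xH]
      by (simp add: slice_mul_def)
  qed
  show "slice_mul (replicate k 1) x (replicate k (ieps c)) = x" if "x \<in> slice_ob k" for k x
  proof -
    have xH: "x \<in> hom A k (src A k x) (iob c k)" using that by (simp add: slice_ob_iff)
    have H2: "mult (ones k) \<in> hom A k (mulo A (ones k) (iob c k) (replicate k (iob c 1))) (iob c k)"
      using mult_Hom[of "ones k"] by simp
    show ?thesis
      using pad_natural(1)[OF xH] cmp_assoc[OF xH pad_Hom[OF ob_Ob] H2] mult_unit_right[of k]
        cmp_idt(2)[OF xH] by (simp add: slice_mul_def)
  qed
  show "slice_mul (permute_list \<rho> ns) (slice_act (length ns) (inv \<rho>) x) (permute_list \<rho> ys) =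
      slice_act (sum_list ns) (inv (block_perm \<rho> ns)) (slice_mul ns x ys)"
    if x: "x \<in> slice_ob (length ns)" and ys: "each slice_ob ns ys"
      and \<rho>: "\<rho> permutes {..<length ns}" for ns x ys \<rho>
  proof -
    let ?n = "sum_list ns" and ?k = "length ns" and ?f = "permute_list \<rho> ns" and ?p = "inv \<rho>"
    let ?b = "inv (block_perm \<rho> ns)"
    have p: "?p permutes {..<?k}" by (rule permutes_inv[OF \<rho>])
    have pi: "inv ?p = \<rho>" by (rule permutes_inv_inv[OF \<rho>])
    have b: "?b permutes {..<?n}" by (rule permutes_inv[OF block_perm_permutes[OF \<rho>]])
    have lf: "length ?f = ?k" and sf: "sum_list ?f = ?n" using sum_list_permute_list[OF \<rho>] by simp_all
    have ly: "length ys = ?k" using list_all2_lengthD[OF ys] by simp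
    have xH: "x \<in> hom A ?k (src A ?k x) (iob c ?k)" using x by (simp add: slice_ob_iff)
    note ysH = slice_homs[OF ys]
    have pys: "each slice_ob ?f (permute_list \<rho> ys)"
      using ys \<rho> permutes_in_image[OF \<rho>] ly by (auto simp: list_all2_conv_all_nth permute_list_nth)
    note pysH = slice_homs[OF pys]
    have pxH: "acta A ?k ?p x \<in> hom A (length ?f) (acto A ?k ?p (src A ?k x)) (acto A ?k ?p (iob c ?k))"
      using acta_Hom[OF p xH] lf by simp
    have bH: "perm_back ?k ?p \<in> hom A (length ?f) (acto A ?k ?p (iob c ?k)) (iob c ?k)"
      using perm_back_Hom[OF p] lf by simp
    have eq: "mula A ?f (acta A ?k ?p x) (permute_list \<rho> ys) = acta A ?n ?b (mula A ns x ys)"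
      using mula_equivariant_operation[OF HomD(1)[OF xH] homs_ars[OF ysH] \<rho>] .
    have L: "mula A ?f (cmp A ?k (perm_back ?k ?p) (acta A ?k ?p x)) (permute_list \<rho> ys) =
        cmp A ?n (mula A ?f (perm_back ?k ?p) (map idn ?f)) (acta A ?n ?b (mula A ns x ys))"
      using mula_Cmp[OF pxH pysH bH homs_idn] cmps_idns(2)[OF pysH] eq unfolding idns_ob lf sf by simp
    have H1: "mula A ?f (perm_back ?k ?p) (map idn ?f) \<in> hom A ?n
        (mulo A ?f (acto A ?k ?p (iob c ?k)) (map (iob c) ?f)) (mulo A ?f (iob c ?k) (map (iob c) ?f))"
      using mula_Hom[OF bH homs_idn] sf by simp
    have H2: "acta A ?n ?b (mula A ns x ys) \<in> hom A ?n
        (mulo A ?f (acto A ?k ?p (src A ?k x)) (map2 (\<lambda>n. src A n) ?f (permute_list \<rho> ys)))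
        (mulo A ?f (acto A ?k ?p (iob c ?k)) (map (iob c) ?f))"
      using mula_Hom[OF pxH pysH] unfolding eq sf .
    have H3: "mult ?f \<in> hom A ?n (mulo A ?f (iob c ?k) (map (iob c) ?f)) (iob c ?n)"
      using mult_Hom[of ?f] unfolding lf sf .
    have "slice_act ?n ?b (slice_mul ns x ys) = cmp A ?n (perm_back ?n ?b)
        (cmp A ?n (acta A ?n ?b (mult ns)) (acta A ?n ?b (mula A ns x ys)))"
      unfolding slice_act_def slice_mul_def acta_Cmp[OF b mula_Hom[OF xH ysH] mult_Hom] by (rule refl)
    also have "\<dots> = cmp A ?n (cmp A ?n (perm_back ?n ?b) (acta A ?n ?b (mult ns))) (acta A ?n ?b (mula A ns x ys))"
      by (rule cmp_assoc[OF acta_Hom[OF b mula_Hom[OF xH ysH]] acta_Hom[OF b mult_Hom] perm_back_Hom[OF b], symmetric])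
    also have "cmp A ?n (perm_back ?n ?b) (acta A ?n ?b (mult ns)) =
        cmp A ?n (mult ?f) (mula A ?f (perm_back ?k ?p) (map idn ?f))"
      using mult_operation[OF p] unfolding pi by simp
    also have "cmp A ?n (cmp A ?n (mult ?f) (mula A ?f (perm_back ?k ?p) (map idn ?f))) (acta A ?n ?b (mula A ns x ys)) =
        cmp A ?n (mult ?f) (cmp A ?n (mula A ?f (perm_back ?k ?p) (map idn ?f)) (acta A ?n ?b (mula A ns x ys)))"
      by (rule cmp_assoc[OF H2 H1 H3])
    finally show ?thesis
      using L by (simp add: slice_mul_def slice_act_def sf)
  qed
  show "slice_mul ns x (map (\<lambda>i. slice_act (ns ! i) (inv (ts ! i)) (ys ! i)) [0..<length ns]) =
      slice_act (sum_list ns) (inv (sum_perm ns ts)) (slice_mul ns x ys)"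
    if x: "x \<in> slice_ob (length ns)" and ys: "each slice_ob ns ys"
      and ts: "list_all2 (\<lambda>n t. t permutes {..<n}) ns ts" for ns x ys ts
  proof -
    let ?n = "sum_list ns" and ?k = "length ns" and ?q = "inv (sum_perm ns ts)"
    let ?ti = "map (\<lambda>i. inv (ts ! i)) [0..<?k]"
    have tp: "ts ! i permutes {..<ns ! i}" if "i < ?k" for i using list_all2_nthD[OF ts that] .
    have ti: "?ti ! i permutes {..<ns ! i}" if "i < ?k" for i using permutes_inv[OF tp[OF that]] that by simp
    have tpi: "inv (ts ! i) permutes {..<ns ! i}" if "i < ?k" for i using permutes_inv[OF tp[OF that]] .
    have q: "?q permutes {..<?n}" by (rule permutes_inv[OF sum_perm_permutes]) (rule tp)
    have q': "sum_perm ns ?ti = ?q" using sum_perm_inv[of ns ts] tp by simp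
    have xH: "x \<in> hom A ?k (src A ?k x) (iob c ?k)" using x by (simp add: slice_ob_iff)
    note ysH = slice_homs[OF ys]
    let ?as = "map (\<lambda>i. acta A (ns ! i) (inv (ts ! i)) (ys ! i)) [0..<?k]"
    let ?bs = "map (\<lambda>i. perm_back (ns ! i) (?ti ! i)) [0..<?k]"
    let ?zs = "map (\<lambda>i. acto A (ns ! i) (inv (ts ! i)) (iob c (ns ! i))) [0..<?k]"
    let ?ws = "map (\<lambda>i. acto A (ns ! i) (inv (ts ! i)) (src A (ns ! i) (ys ! i))) [0..<?k]"
    have yi: "ys ! i \<in> hom A (ns ! i) (src A (ns ! i) (ys ! i)) (iob c (ns ! i))" if "i < ?k" for i
      using list_all2_nthD[OF ys that] by (simp add: slice_ob_iff)
    have asH: "homs A ns ?as ?ws ?zs" using acta_Hom[OF tpi yi] by (simp add: homs_def)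
    have bsH: "homs A ns ?bs ?zs (map (iob c) ns)" using perm_back_Hom[OF tpi] by (simp add: homs_def)
    have eq: "mula A ns x ?as = acta A ?n ?q (mula A ns x ys)"
      using mula_equivariant_inputs[OF HomD(1)[OF xH] homs_ars[OF ysH] ts] .
    have H1: "mula A ns (idn ?k) ?bs \<in> hom A ?n (mulo A ns (iob c ?k) ?zs) (mulo A ns (iob c ?k) (map (iob c) ns))"
      by (rule mula_Hom[OF idn_Hom bsH])
    have H2: "acta A ?n ?q (mula A ns x ys) \<in> hom A ?n (mulo A ns (src A ?k x) ?ws) (mulo A ns (iob c ?k) ?zs)"
      using mula_Hom[OF xH asH] unfolding eq .
    have "cmps A ns ?bs ?as = map (\<lambda>i. slice_act (ns ! i) (inv (ts ! i)) (ys ! i)) [0..<?k]"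
      by (simp add: cmps_def slice_act_def)
    then have "mula A ns x (map (\<lambda>i. slice_act (ns ! i) (inv (ts ! i)) (ys ! i)) [0..<?k]) =
        cmp A ?n (mula A ns (idn ?k) ?bs) (acta A ?n ?q (mula A ns x ys))"
      using mula_Cmp[OF xH asH idn_Hom bsH] cmp_idt(2)[OF xH] eq by simp
    moreover have "slice_act ?n ?q (slice_mul ns x ys) = cmp A ?n (perm_back ?n ?q)
        (cmp A ?n (acta A ?n ?q (mult ns)) (acta A ?n ?q (mula A ns x ys)))"
      unfolding slice_act_def slice_mul_def acta_Cmp[OF q mula_Hom[OF xH ysH] mult_Hom] by (rule refl)
    moreover have "\<dots> = cmp A ?n (cmp A ?n (perm_back ?n ?q) (acta A ?n ?q (mult ns))) (acta A ?n ?q (mula A ns x ys))"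
      by (rule cmp_assoc[OF acta_Hom[OF q mula_Hom[OF xH ysH]] acta_Hom[OF q mult_Hom] perm_back_Hom[OF q], symmetric])
    moreover have "cmp A ?n (perm_back ?n ?q) (acta A ?n ?q (mult ns)) =
        cmp A ?n (mult ns) (mula A ns (idn ?k) ?bs)"
      using mult_inputs[of ns ?ti] ti unfolding q' by simp
    moreover have "cmp A ?n (cmp A ?n (mult ns) (mula A ns (idn ?k) ?bs)) (acta A ?n ?q (mula A ns x ys)) =
        cmp A ?n (mult ns) (cmp A ?n (mula A ns (idn ?k) ?bs) (acta A ?n ?q (mula A ns x ys)))"
      by (rule cmp_assoc[OF H2 H1 mult_Hom])
    ultimately show ?thesis by (simp add: slice_mul_def)
  qed
qed

end

context internal_symmetric
begin

lemma slice_objects: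
  "(\<lambda>k. obj slice k) = slice_ob" "mulo slice = slice_mul" "unt slice = ieps c" "acto slice = slice_act"
  by auto

context
  assumes inf: "infinite (UNIV :: 'u set)"
begin

lemmas codes = code_simps[OF inf]

lemma slice_HomI:
  assumes "g \<in> hom A k y (iob c k)" "h \<in> hom A k x y"
  shows "pair_code (g, h) \<in> hom slice k (cmp A k g h) g"
  using assms by (auto simp: Hom_def codes slice_ob_def)

lemma slice_ArE:
  assumes "z \<in> arr slice k"
  obtains x y where "code_fst z \<in> hom A k y (iob c k)" "code_snd z \<in> hom A k x y"
    "z = pair_code (code_fst z, code_snd z)"
  using assms by (auto simp: Hom_def codes slice_ob_def)

lemma slice_ars:
  assumes "ars slice ns zs"
  shows "each slice_ob ns (map code_fst zs)"
    and "homs A ns (map code_snd zs) (map2 (\<lambda>n. src A n) ns (map code_snd zs))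
      (map2 (\<lambda>n. src A n) ns (map code_fst zs))"
    and "map2 (\<lambda>n. src slice n) ns zs = cmps A ns (map code_fst zs) (map code_snd zs)"
proof -
  have l: "length zs = length ns" using list_all2_lengthD[OF assms] by simp
  have e: "code_fst (zs ! i) \<in> slice_ob (ns ! i)"
    "code_snd (zs ! i) \<in> hom A (ns ! i) (src A (ns ! i) (code_snd (zs ! i))) (src A (ns ! i) (code_fst (zs ! i)))"
    if "i < length ns" for i
  proof -
    have "zs ! i \<in> arr slice (ns ! i)" using list_all2_nthD[OF assms that] .
    then show "code_fst (zs ! i) \<in> slice_ob (ns ! i)"
      "code_snd (zs ! i) \<in> hom A (ns ! i) (src A (ns ! i) (code_snd (zs ! i))) (src A (ns ! i) (code_fst (zs ! i)))"
      by (auto simp: Hom_def codes)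
  qed
  show "each slice_ob ns (map code_fst zs)" using e l by (simp add: list_all2_conv_all_nth)
  show "homs A ns (map code_snd zs) (map2 (\<lambda>n. src A n) ns (map code_snd zs))
      (map2 (\<lambda>n. src A n) ns (map code_fst zs))" using e l by (simp add: homs_def)
  show "map2 (\<lambda>n. src slice n) ns zs = cmps A ns (map code_fst zs) (map code_snd zs)"
    unfolding cmps_def using l by (auto intro!: nth_equalityI simp del: slice_simps) (simp)
qed

lemma slice_mula_Hom:
  assumes z: "z \<in> arr slice (length ns)" and zs: "ars slice ns zs"
  shows "mula slice ns z zs \<in> hom slice (sum_list ns)
    (slice_mul ns (src slice (length ns) z) (map2 (\<lambda>n. src slice n) ns zs))
    (slice_mul ns (code_fst z) (map code_fst zs))"
proof -
  obtain x y where g: "code_fst z \<in> hom A (length ns) y (iob c (length ns))"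
    and h: "code_snd z \<in> hom A (length ns) x y"
    using slice_ArE[OF z] by blast
  note gs = slice_homs[OF slice_ars(1)[OF zs]] and hs = slice_ars(2)[OF zs]
  show ?thesis
    using slice_HomI[OF slice_mul_Hom[OF g gs] mula_Hom[OF h hs]]
      slice_mul_precompose[OF h hs g gs] by (simp only: slice_simps slice_ars(3)[OF zs, simplified slice_simps])
qed

lemma slice_category: "is_category (cat slice k)"
  unfolding is_category_def
proof (intro conjI ballI impI)
  show "src slice k z \<in> obj slice k" "trg slice k z \<in> obj slice k"
    if "z \<in> arr slice k" for z
    using slice_ArE[OF that] slice_obI[OF cmp_hom] slice_obI by (metis slice_simps(1,3,4))+
  show "idt slice k f \<in> hom slice k f f" if "f \<in> obj slice k" for f
  proof -
    have f: "f \<in> hom A k (src A k f) (iob c k)" using that by (simp add: slice_ob_iff)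
    show ?thesis
      using slice_HomI[OF f idt_hom[OF hom_obj(1)[OF f]]] cmp_idt(1)[OF f] by simp
  qed
  show "cmp slice k z' z \<in> hom slice k (src slice k z) (trg slice k z')"
    if z: "z \<in> arr slice k" and z': "z' \<in> arr slice k" and eq: "trg slice k z = src slice k z'"
    for z z'
  proof -
    obtain x y where g: "code_fst z \<in> hom A k y (iob c k)" and h: "code_snd z \<in> hom A k x y"
      using slice_ArE[OF z] by blast
    obtain x' y' where g': "code_fst z' \<in> hom A k y' (iob c k)" and h': "code_snd z' \<in> hom A k x' y'"
      using slice_ArE[OF z'] by blast
    have e: "code_fst z = cmp A k (code_fst z') (code_snd z')" using eq by simp
    have "x' = y" using HomD(2)[OF g] HomD(2)[OF cmp_hom[OF h' g']] e by simp
    then show ?thesis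
      using slice_HomI[OF g' cmp_hom[OF h]] h' cmp_assoc[OF h _ g'] e by simp
  qed
  show "cmp slice k z (idt slice k (src slice k z)) = z"
    "cmp slice k (idt slice k (trg slice k z)) z = z" if z: "z \<in> arr slice k" for z
  proof -
    obtain x y where g: "code_fst z \<in> hom A k y (iob c k)" and h: "code_snd z \<in> hom A k x y"
      and zz: "z = pair_code (code_fst z, code_snd z)" using slice_ArE[OF z] by blast
    show "cmp slice k z (idt slice k (src slice k z)) = z"
      using cmp_idt(1)[OF h] HomD(2)[OF cmp_hom[OF h g]] zz by (simp add: codes)
    show "cmp slice k (idt slice k (trg slice k z)) z = z"
      using cmp_idt(2)[OF h] HomD(2)[OF g] zz by (simp add: codes)
  qed
  show "cmp slice k z'' (cmp slice k z' z) = cmp slice k (cmp slice k z'' z') z"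
    if z: "z \<in> arr slice k" and z': "z' \<in> arr slice k" and z'': "z'' \<in> arr slice k"
      and eq: "trg slice k z = src slice k z'" "trg slice k z' = src slice k z''" for z z' z''
  proof -
    obtain x y where g: "code_fst z \<in> hom A k y (iob c k)" and h: "code_snd z \<in> hom A k x y"
      using slice_ArE[OF z] by blast
    obtain x' y' where g': "code_fst z' \<in> hom A k y' (iob c k)" and h': "code_snd z' \<in> hom A k x' y'"
      using slice_ArE[OF z'] by blast
    obtain x'' y'' where g'': "code_fst z'' \<in> hom A k y'' (iob c k)" and h'': "code_snd z'' \<in> hom A k x'' y''"
      using slice_ArE[OF z''] by blast
    have "x' = y" using HomD(2)[OF g] HomD(2)[OF cmp_hom[OF h' g']] eq(1) by simp
    moreover have "x'' = y'" using HomD(2)[OF g'] HomD(2)[OF cmp_hom[OF h'' g'']] eq(2) by simp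
    ultimately show ?thesis
      using cmp_assoc[OF h, of h' y' h'' y''] cmp_assoc[OF h, of "code_snd z'" y' "code_snd z''" y''] h' h''
      by (simp add: codes)
  qed
qed

lemma slice_act_Hom_slice:
  assumes p: "p permutes {..<k}" and z: "z \<in> arr slice k"
  shows "acta slice k p z \<in> hom slice k (slice_act k p (src slice k z)) (slice_act k p (trg slice k z))"
proof -
  obtain x y where g: "code_fst z \<in> hom A k y (iob c k)" and h: "code_snd z \<in> hom A k x y"
    using slice_ArE[OF z] by blast
  show ?thesis
    using slice_HomI[OF slice_act_Hom[OF p g] acta_Hom[OF p h]] slice_act_precompose[OF p h g] by simp
qed

lemma slice_operad: "is_cat_operad slice"
  unfolding is_cat_operad_def
proof (intro conjI allI impI)
  show "is_category (cat slice k)" for k by (rule slice_category)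
  show "is_set_operad (\<lambda>k. obj slice k) (acto slice) (unt slice) (mulo slice)"
    unfolding slice_objects by (rule slice_object_operad)
  have e: "idt slice 1 (unt slice) = pair_code (ieps c, idt A 1 (unt A))"
    using HomD(2)[OF eps_Hom] by simp
  have act: "acta slice = (\<lambda>k p z. pair_code (slice_act k p (code_fst z), acta A k p (code_snd z)))"
    and mul: "mula slice = (\<lambda>ns z zs. pair_code (slice_mul ns (code_fst z) (map code_fst zs), mula A ns (code_snd z) (map code_snd zs)))"
    by (intro ext; simp)+
  show "is_set_operad (\<lambda>k. arr slice k) (acta slice) (idt slice 1 (unt slice)) (mula slice)"
  proof (rule is_set_operad_subset)
    show "is_set_operad (\<lambda>k. {pair_code (x, y) |x y. x \<in> slice_ob k \<and> y \<in> arr A k})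
        (acta slice) (idt slice 1 (unt slice)) (mula slice)"
      unfolding e act mul by (rule is_set_operad_pairs[OF inf slice_object_operad arrow_operad])
    show "arr slice k \<subseteq> {pair_code (x, y) |x y. x \<in> slice_ob k \<and> y \<in> arr A k}" for k
      by auto
    show "acta slice k p z \<in> arr slice k" if "p permutes {..<k}" "z \<in> arr slice k" for k p z
      by (rule HomD(1)[OF slice_act_Hom_slice[OF that]])
    show "idt slice 1 (unt slice) \<in> arr slice 1"
      by (rule HomD(1)[OF Idn_Hom[OF slice_category]]) (simp add: slice_obI[OF eps_Hom, simplified])
    show "mula slice ns z zs \<in> arr slice (sum_list ns)"
      if "z \<in> arr slice (length ns)" "ars slice ns zs" for ns z zs
      by (rule HomD(1)[OF slice_mula_Hom[OF that]])
  qed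
  show "is_functor (cat slice k) (cat slice k) \<lparr>FOb = acto slice k p, FAr = acta slice k p\<rparr>"
    if p: "p permutes {..<k}" for k p
    unfolding is_functor_def
  proof (intro conjI ballI impI)
    show "is_category (cat slice k)" "is_category (cat slice k)" by (rule slice_category)+
    show "FOb \<lparr>FOb = acto slice k p, FAr = acta slice k p\<rparr> f \<in> obj slice k" if "f \<in> obj slice k" for f
      using slice_obI[OF slice_act_Hom[OF p]] that by (simp add: slice_ob_iff)
    show "FAr \<lparr>FOb = acto slice k p, FAr = acta slice k p\<rparr> z \<in> hom slice k
        (FOb \<lparr>FOb = acto slice k p, FAr = acta slice k p\<rparr> (src slice k z))
        (FOb \<lparr>FOb = acto slice k p, FAr = acta slice k p\<rparr> (trg slice k z))" if "z \<in> arr slice k" for z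
      using slice_act_Hom_slice[OF p that] by (simp only: cat_functor.simps slice_objects)
    show "FAr \<lparr>FOb = acto slice k p, FAr = acta slice k p\<rparr> (idt slice k f) =
        idt slice k (FOb \<lparr>FOb = acto slice k p, FAr = acta slice k p\<rparr> f)" if "f \<in> obj slice k" for f
    proof -
      have f: "f \<in> hom A k (src A k f) (iob c k)" using that by (simp add: slice_ob_iff)
      show ?thesis
        using acta_Idn[OF p hom_obj(1)[OF f]] HomD(2)[OF slice_act_Hom[OF p f]] by (simp add: codes)
    qed
    fix z z' assume z: "z \<in> arr slice k" and z': "z' \<in> arr slice k"
      and eq: "trg slice k z = src slice k z'"
    obtain x y where g: "code_fst z \<in> hom A k y (iob c k)" and h: "code_snd z \<in> hom A k x y"
      using slice_ArE[OF z] by blast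
    obtain x' y' where g': "code_fst z' \<in> hom A k y' (iob c k)" and h': "code_snd z' \<in> hom A k x' y'"
      using slice_ArE[OF z'] by blast
    have "x' = y" using HomD(2)[OF g] HomD(2)[OF cmp_hom[OF h' g']] eq by simp
    then show "FAr \<lparr>FOb = acto slice k p, FAr = acta slice k p\<rparr> (cmp slice k z' z) =
        cmp slice k (FAr \<lparr>FOb = acto slice k p, FAr = acta slice k p\<rparr> z')
          (FAr \<lparr>FOb = acto slice k p, FAr = acta slice k p\<rparr> z)"
      using acta_Cmp[OF p h] h' by (simp add: codes)
  qed
  show "mula slice ns z zs \<in> hom slice (sum_list ns)
      (mulo slice ns (src slice (length ns) z) (map2 (\<lambda>n. src slice n) ns zs))
      (mulo slice ns (trg slice (length ns) z) (map2 (\<lambda>n. trg slice n) ns zs))"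
    if "z \<in> arr slice (length ns)" "ars slice ns zs" for ns z zs
  proof -
    have "map2 (\<lambda>n. trg slice n) ns zs = map code_fst zs"
      using list_all2_lengthD[OF that(2)] by (auto intro!: nth_equalityI)
    then show ?thesis using slice_mula_Hom[OF that] by (simp only: slice_objects slice_simps(4))
  qed
  show "mula slice ns (idt slice (length ns) x) (idns slice ns ys) = idt slice (sum_list ns) (mulo slice ns x ys)"
    if x: "x \<in> obj slice (length ns)" and ys: "obs slice ns ys" for ns x ys
  proof -
    have xH: "x \<in> hom A (length ns) (src A (length ns) x) (iob c (length ns))"
      using x by (simp add: slice_ob_iff)
    have ys': "each slice_ob ns ys" using ys by simp
    note ysH = slice_homs[OF ys']
    have l: "length ys = length ns" using list_all2_lengthD[OF ys] by simp
    have m1: "map code_fst (idns slice ns ys) = ys"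
      by (rule nth_equalityI) (simp_all add: l codes)
    have m2: "map code_snd (idns slice ns ys) = idns A ns (map2 (\<lambda>n. src A n) ns ys)"
      by (rule nth_equalityI) (simp_all add: l codes)
    show ?thesis
      using mula_Idn[OF hom_obj(1)[OF xH] homs_obs(1)[OF ysH]] HomD(2)[OF slice_mul_Hom[OF xH ysH]]
      unfolding slice_simps(11) m1 m2 by (simp add: codes)
  qed
  fix ns z z' zs zs'
  assume z: "z \<in> arr slice (length ns)" and z': "z' \<in> arr slice (length ns)"
    and eq: "trg slice (length ns) z = src slice (length ns) z'"
    and zs: "ars slice ns zs" and zs': "ars slice ns zs'"
    and eqs: "\<forall>i<length ns. trg slice (ns ! i) (zs ! i) = src slice (ns ! i) (zs' ! i)"
  let ?k = "length ns"
  obtain x y where g: "code_fst z \<in> hom A ?k y (iob c ?k)" and h: "code_snd z \<in> hom A ?k x y"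
    using slice_ArE[OF z] by blast
  obtain x' y' where g': "code_fst z' \<in> hom A ?k y' (iob c ?k)" and h': "code_snd z' \<in> hom A ?k x' y'"
    using slice_ArE[OF z'] by blast
  have x': "x' = y" using HomD(2)[OF g] HomD(2)[OF cmp_hom[OF h' g']] eq by simp
  note hs = slice_ars(2)[OF zs] and hs' = slice_ars(2)[OF zs']
  have l: "length zs = ?k" "length zs' = ?k"
    using list_all2_lengthD[OF zs] list_all2_lengthD[OF zs'] by simp_all
  have "map2 (\<lambda>n. src A n) ns (map code_snd zs') = map2 (\<lambda>n. src A n) ns (map code_fst zs)"
  proof (rule nth_equalityI)
    fix i assume "i < length (map2 (\<lambda>n. src A n) ns (map code_snd zs'))"
    then have i: "i < ?k" by simp
    have zi: "zs ! i \<in> arr slice (ns ! i)" and zi': "zs' ! i \<in> arr slice (ns ! i)"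
      using list_all2_nthD[OF zs i] list_all2_nthD[OF zs' i] .
    obtain x y where g: "code_fst (zs ! i) \<in> hom A (ns ! i) y (iob c (ns ! i))"
      using slice_ArE[OF zi] by blast
    obtain x' y' where g': "code_fst (zs' ! i) \<in> hom A (ns ! i) y' (iob c (ns ! i))"
      and h': "code_snd (zs' ! i) \<in> hom A (ns ! i) x' y'" using slice_ArE[OF zi'] by blast
    have "x' = y" using HomD(2)[OF g] HomD(2)[OF cmp_hom[OF h' g']] eqs i by simp
    then show "map2 (\<lambda>n. src A n) ns (map code_snd zs') ! i = map2 (\<lambda>n. src A n) ns (map code_fst zs) ! i"
      using i l HomD(2)[OF g] HomD(2)[OF h'] by simp
  qed (simp add: l)
  then have "cmp A (sum_list ns) (mula A ns (code_snd z') (map code_snd zs')) (mula A ns (code_snd z) (map code_snd zs)) =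
      mula A ns (cmp A ?k (code_snd z') (code_snd z)) (cmps A ns (map code_snd zs') (map code_snd zs))"
    using mula_Cmp[OF h hs] h' hs' x' by simp
  moreover have "map code_snd (map (\<lambda>i. cmp slice (ns ! i) (zs' ! i) (zs ! i)) [0..<?k]) =
      cmps A ns (map code_snd zs') (map code_snd zs)"
    by (rule nth_equalityI) (simp_all add: cmps_def codes l)
  moreover have "map code_fst (map (\<lambda>i. cmp slice (ns ! i) (zs' ! i) (zs ! i)) [0..<?k]) = map code_fst zs'"
    by (rule nth_equalityI) (simp_all add: codes l)
  ultimately show "mula slice ns (cmp slice ?k z' z) (map (\<lambda>i. cmp slice (ns ! i) (zs' ! i) (zs ! i)) [0..<?k]) =
      cmp slice (sum_list ns) (mula slice ns z' zs') (mula slice ns z zs)"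
    by (simp only: slice_simps(6,11) codes)
qed

lemma slice_projection:
  assumes h: "is_cat_operad h" and G: "is_op_functor h slice G"
  defines "F \<equiv> \<lparr>oo = (\<lambda>k. \<lambda>x\<in>obj h k. src A k (oo G k x)),
     oa = (\<lambda>k. \<lambda>f\<in>arr h k. code_snd (oa G k f))\<rparr>"
  shows "is_op_functor h A F"
proof -
  interpret h: cat_operad h by standard (rule h)
  have Gf: "is_functor (cat h k) (cat slice k) (op_component G k)" for k using G by (simp add: is_op_functor_def)
  have Go: "oo G k x \<in> hom A k (src A k (oo G k x)) (iob c k)" if "x \<in> obj h k" for k x
    using functor_Ob[OF Gf that] by (simp add: op_component_def slice_ob_iff)
  have Gs: "cmp A k (code_fst (oa G k f)) (code_snd (oa G k f)) = oo G k x"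
    "code_fst (oa G k f) = oo G k y" "oa G k f \<in> arr slice k" if "f \<in> hom h k x y" for k f x y
    using functor_Hom[OF Gf that] by (auto simp: op_component_def Hom_def codes)
  have Ga: "code_snd (oa G k f) \<in> hom A k (src A k (oo G k x)) (src A k (oo G k y))"
    if f: "f \<in> hom h k x y" for k f x y
  proof -
    obtain x' y' where g: "code_fst (oa G k f) \<in> hom A k y' (iob c k)" "code_snd (oa G k f) \<in> hom A k x' y'"
      using slice_ArE[OF Gs(3)[OF f]] by blast
    then show ?thesis using HomD(2)[OF g(1)] HomD(2)[OF cmp_hom[OF g(2,1)]] Gs[OF f] by simp
  qed
  have lo: "obs h ns ys \<Longrightarrow> map2 (oo F) ns ys = map2 (\<lambda>n y. src A n (oo G n y)) ns ys" for ns ys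
    by (rule nth_equalityI) (auto simp: F_def list_all2_conv_all_nth)
  have la: "ars h ns fs \<Longrightarrow> map2 (oa F) ns fs = map code_snd (map2 (oa G) ns fs)" for ns fs
    by (rule nth_equalityI) (auto simp: F_def list_all2_conv_all_nth)
  have ms: "src A (sum_list ns) (slice_mul ns x ys) = mulo A ns (src A (length ns) x) (map2 (\<lambda>n. src A n) ns ys)"
    if "x \<in> slice_ob (length ns)" "each slice_ob ns ys" for ns x ys
    using HomD(2)[OF slice_mul_Hom[OF _ slice_homs[OF that(2)]]] that(1) by (simp add: slice_ob_iff)
  show ?thesis
    unfolding is_op_functor_def
  proof (intro conjI allI impI ballI)
    show "oo F k \<in> extensional (obj h k)" "oa F k \<in> extensional (arr h k)" for k by (simp_all add: F_def)
    show "is_functor (cat h k) (cat A k) (op_component F k)" for k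
      unfolding is_functor_def
    proof (intro conjI ballI impI)
      show "is_category (cat h k)" "is_category (cat A k)" by (rule h.category, rule category)
      show "FOb (op_component F k) x \<in> obj A k" if "x \<in> obj h k" for x
        using hom_obj(1)[OF Go[OF that]] that by (simp add: op_component_def F_def)
      show "FAr (op_component F k) f \<in> hom A k (FOb (op_component F k) (src h k f)) (FOb (op_component F k) (trg h k f))"
        if "f \<in> arr h k" for f
        using Ga[OF HomI[OF that refl refl]] that h.hom_obj[OF HomI[OF that refl refl]]
        by (simp add: op_component_def F_def)
      show "FAr (op_component F k) (idt h k x) = idt A k (FOb (op_component F k) x)" if x: "x \<in> obj h k" for x
        using functor_Idn[OF Gf x] x HomD(1)[OF h.idt_hom[OF x]] by (simp add: op_component_def F_def codes)
      show "FAr (op_component F k) (cmp h k g f) = cmp A k (FAr (op_component F k) g) (FAr (op_component F k) f)"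
        if fg: "f \<in> arr h k" "g \<in> arr h k" "trg h k f = src h k g" for f g
      proof -
        have f: "f \<in> hom h k (src h k f) (trg h k f)" and g: "g \<in> hom h k (trg h k f) (trg h k g)"
          using fg by (auto simp: Hom_def)
        show ?thesis
          using functor_Cmp[OF Gf f g] HomD(1)[OF h.cmp_hom[OF f g]] fg by (simp add: op_component_def F_def codes)
      qed
    qed
    show "oo F k (acto h k p x) = acto A k p (oo F k x)" if p: "p permutes {..<k}" and x: "x \<in> obj h k" for k p x
    proof -
      have "oo G k (acto h k p x) = slice_act k p (oo G k x)" using G p x by (simp add: is_op_functor_def)
      then show ?thesis using HomD(2)[OF slice_act_Hom[OF p Go[OF x]]] h.acto_Ob[OF p x] x by (simp add: F_def)
    qed
    show "oa F k (acta h k p f) = acta A k p (oa F k f)" if p: "p permutes {..<k}" and f: "f \<in> arr h k" for k p f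
    proof -
      have "oa G k (acta h k p f) = acta slice k p (oa G k f)" using G p f by (simp add: is_op_functor_def)
      then show ?thesis using f HomD(1)[OF h.acta_Hom[OF p HomI[OF f refl refl]]] by (simp add: F_def codes)
    qed
    have "oo G 1 (unt h) = ieps c" using G by (simp add: is_op_functor_def)
    then show "oo F 1 (unt h) = unt A" using h.unt_Ob HomD(2)[OF eps_Hom] by (simp add: F_def)
    show "oo F (sum_list ns) (mulo h ns x ys) = mulo A ns (oo F (length ns) x) (map2 (oo F) ns ys)"
      if x: "x \<in> obj h (length ns)" and ys: "obs h ns ys" for ns x ys
    proof -
      have "oo G (sum_list ns) (mulo h ns x ys) = slice_mul ns (oo G (length ns) x) (map2 (oo G) ns ys)"
        using G x ys by (simp add: is_op_functor_def)
      moreover have "each slice_ob ns (map2 (oo G) ns ys)"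
        using ys Go by (auto simp: list_all2_conv_all_nth slice_ob_iff)
      moreover have "oo G (length ns) x \<in> slice_ob (length ns)" using slice_obI[OF Go[OF x]] .
      moreover have "map2 (\<lambda>n. src A n) ns (map2 (oo G) ns ys) = map2 (oo F) ns ys"
        unfolding lo[OF ys] using list_all2_lengthD[OF ys] by (auto intro!: nth_equalityI)
      ultimately show ?thesis using ms h.mulo_Ob[OF x ys] x by (simp add: F_def)
    qed
    show "oa F (sum_list ns) (mula h ns f gs) = mula A ns (oa F (length ns) f) (map2 (oa F) ns gs)"
      if f: "f \<in> arr h (length ns)" and gs: "ars h ns gs" for ns f gs
    proof -
      have "oa G (sum_list ns) (mula h ns f gs) = mula slice ns (oa G (length ns) f) (map2 (oa G) ns gs)"
        using G f gs by (simp add: is_op_functor_def)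
      moreover have "mula h ns f gs \<in> arr h (sum_list ns)"
        using h.arrow_operad f gs unfolding is_set_operad_def by blast
      ultimately show ?thesis using f unfolding la[OF gs] by (simp add: F_def codes)
    qed
  qed
qed

text \<open>A map \<open>f\<close> from \<open>a\<close> to the desymmetrisation of \<open>c\<close> lifts \<open>a\<close> to the slice: the objects become the
  \<open>f\<^sub>T\<close>, and compatibility of \<open>f\<close> with \<open>\<mu>\<close> says that the \<open>\<mu>\<close> of \<open>a\<close> are arrows over \<open>c\<close> between them.\<close>

lemma slice_internal:
  assumes X: "operadic_index X" and f: "is_internal_map X A a (desymmetrise X c) f"
  shows "is_internal_operad X slice
    \<lparr>iob = f, imu = (\<lambda>(T, S, s)\<in>index_arrows X. pair_code (slice_act (Tips X T) (ipi X s) (f T), imu a (T, S, s))),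
     ieps = pair_code (f (UnitI X), ieps a)\<rparr>"
    (is "is_internal_operad X slice ?w")
proof -
  interpret X: operadic_index X by (rule X)
  have a: "is_internal_operad X A a" using f by (simp add: is_internal_map_def)
  have fH: "f T \<in> hom A (Tips X T) (iob a T) (iob c (Tips X T))" if "T \<in> IOb X" for T
    using f that by (simp add: is_internal_map_def)
  have fsrc: "src A (Tips X T) (f T) = iob a T" if "T \<in> IOb X" for T
    using HomD(2)[OF fH[OF that]] .
  have pp: "ipi X s permutes {..<Tips X T}" if "T \<in> IOb X" "S \<in> IOb X" "s \<in> IHom X T S" for T S s
    unfolding ipi_def by (rule fin_maps_perm[OF X.tip_map[OF that]])
  have wmu: "imu ?w (T, S, s) = pair_code (slice_act (Tips X T) (ipi X s) (f T), imu a (T, S, s))"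
    if "T \<in> IOb X" "S \<in> IOb X" "s \<in> IHom X T S" for T S s
    using that by (simp add: index_arrows_def)
  have sq: "slice_mul (map (Tips X) (fibs X T S s)) (f S) (map f (fibs X T S s)) =
      cmp A (Tips X T) (slice_act (Tips X T) (ipi X s) (f T)) (imu a (T, S, s))"
    if T: "T \<in> IOb X" and S: "S \<in> IOb X" and s: "s \<in> IHom X T S" for T S s
  proof -
    let ?n = "Tips X T" and ?ns = "map (Tips X) (fibs X T S s)" and ?p = "ipi X s"
    note p = pp[OF T S s]
    have ns: "?ns = fibre_sizes (tip_map X s) (Tips X S)" by (rule X.Tips_fibs[OF T S s])
    have sn: "sum_list ?ns = ?n" unfolding ns by (rule sum_fibre_sizes[OF X.tip_map[OF T S s]])
    have ln: "length ?ns = Tips X S" unfolding ns by simp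
    have fs: "homs A ?ns (map f (fibs X T S s)) (map (iob a) (fibs X T S s)) (map (iob c) ?ns)"
      using fH subsetD[OF X.fibs_IOb[OF T S s] nth_mem] by (simp add: homs_def)
    have fS: "f S \<in> hom A (length ?ns) (iob a S) (iob c (length ?ns))" using fH[OF S] ln by simp
    have m: "mula A ?ns (f S) (map f (fibs X T S s)) \<in> hom A ?n
        (mulo A ?ns (iob a S) (map (iob a) (fibs X T S s))) (mulo A ?ns (iob c (length ?ns)) (map (iob c) ?ns))"
      using mula_Hom[OF fS fs] sn by simp
    have mH: "mult ?ns \<in> hom A ?n (mulo A ?ns (iob c (length ?ns)) (map (iob c) ?ns)) (iob c ?n)"
      using mult_Hom[of ?ns] sn by simp
    have aH: "imu a (T, S, s) \<in> hom A ?n (mulo A ?ns (iob a S) (map (iob a) (fibs X T S s))) (acto A ?n ?p (iob a T))"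
      by (rule internal_mu[OF a T S s])
    have "cmp A ?n (imu c (?n, Tips X S, tip_map X s)) (mula A ?ns (f S) (map f (fibs X T S s))) =
        cmp A ?n (acta A ?n ?p (f T)) (imu a (T, S, s))"
      using f T S s by (simp add: is_internal_map_def)
    then have e: "cmp A ?n (perm_arrow ?n ?p) (cmp A ?n (mult ?ns) (mula A ?ns (f S) (map f (fibs X T S s)))) =
        cmp A ?n (acta A ?n ?p (f T)) (imu a (T, S, s))"
      using mu_factor[OF X.tip_map[OF T S s]] cmp_assoc[OF m mH perm_arrow_Hom[OF p]]
      by (simp add: ns ipi_def)
    note h = cmp_hom[OF m mH]
    have "cmp A ?n (mult ?ns) (mula A ?ns (f S) (map f (fibs X T S s))) =
        cmp A ?n (cmp A ?n (perm_back ?n ?p) (perm_arrow ?n ?p))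
          (cmp A ?n (mult ?ns) (mula A ?ns (f S) (map f (fibs X T S s))))"
      unfolding perm_back_arrow[OF p] using cmp_idt(2)[OF h] by simp
    also have "\<dots> = cmp A ?n (perm_back ?n ?p) (cmp A ?n (acta A ?n ?p (f T)) (imu a (T, S, s)))"
      unfolding cmp_assoc[OF h perm_arrow_Hom[OF p] perm_back_Hom[OF p]] e by (rule refl)
    also have "\<dots> = cmp A ?n (slice_act ?n ?p (f T)) (imu a (T, S, s))"
      unfolding slice_act_def
      by (rule cmp_assoc[OF aH acta_Hom[OF p fH[OF T]] perm_back_Hom[OF p], symmetric])
    finally show ?thesis by (simp add: slice_mul_def sn)
  qed
  have sa_id: "slice_act k id x = x" if "x \<in> slice_ob k" for k x
    using slice_object_operad that by (simp add: is_set_operad_def)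
  have sa_comp: "slice_act k p (slice_act k q x) = slice_act k (p \<circ> q) x"
    if "p permutes {..<k}" "q permutes {..<k}" "x \<in> slice_ob k" for k p q x
    using slice_object_operad that by (simp add: is_set_operad_def)
  show ?thesis
    unfolding is_internal_operad_def
  proof (intro conjI ballI)
    show "iob ?w \<in> extensional (IOb X)" using f by (simp add: is_internal_map_def)
    show "imu ?w \<in> extensional (index_arrows X)" by simp
    show "iob ?w T \<in> obj slice (Tips X T)" if "T \<in> IOb X" for T
      using slice_obI[OF fH[OF that]] by simp
    show "imu ?w (T, S, s) \<in> hom slice (Tips X T)
        (mulo slice (map (Tips X) (fibs X T S s)) (iob ?w S) (map (iob ?w) (fibs X T S s)))
        (acto slice (Tips X T) (ipi X s) (iob ?w T))"
      if p: "T \<in> IOb X" "S \<in> IOb X" "s \<in> IHom X T S" for T S s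
      using slice_HomI[OF slice_act_Hom[OF pp[OF p] fH[OF p(1)]] internal_mu[OF a p]] sq[OF p]
      unfolding wmu[OF p] by (simp only: slice_objects internal_operad.simps)
    show "ieps ?w \<in> hom slice 1 (unt slice) (iob ?w (UnitI X))"
    proof -
      have "f (UnitI X) \<in> hom A 1 (iob a (UnitI X)) (iob c 1)"
        using fH[OF X.UnitI_IOb] by (simp add: X.Tips_UnitI)
      moreover have "cmp A 1 (f (UnitI X)) (ieps a) = ieps c" using f by (simp add: is_internal_map_def)
      ultimately show ?thesis using slice_HomI[OF _ internal_eps[OF a], of "f (UnitI X)"] by simp
    qed
    show "internal_assoc X slice ?w T S R s w"
      if T: "T \<in> IOb X" and S: "S \<in> IOb X" and R: "R \<in> IOb X" and s: "s \<in> IHom X T S" and w: "w \<in> IHom X S R"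
      for T S R s w
    proof -
      let ?n = "Tips X T"
      let ?ws = "IComp X w s"
      note ws = X.IComp_IHom[OF T S R s w]
      let ?b = "inv (block_perm (inv (ipi X w)) (map (Tips X) (fibs X T S s)))"
      let ?q = "sum_perm (map (Tips X) (fibs X T R ?ws)) (map (\<lambda>i. ipi X (Ind X T S R s w i)) [0..<Tips X R])"
      have d: "concat (map (\<lambda>i. fibs X (Fib X T R ?ws i) (Fib X S R w i) (Ind X T S R s w i)) [0..<Tips X R]) =
          X.double_fibs T S R s w" by (simp add: X.double_fibs_def)
      have m1: "map code_snd (map (\<lambda>T. idt slice (Tips X T) (iob ?w T)) (X.double_fibs T S R s w)) =
          map (\<lambda>T. idt A (Tips X T) (iob a T)) (X.double_fibs T S R s w)"
        using X.double_fibs_IOb[OF T S R s w] fsrc by (auto simp: codes)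
      have m2: "map code_snd (map (\<lambda>i. imu ?w (Fib X T R ?ws i, Fib X S R w i, Ind X T S R s w i)) [0..<Tips X R]) =
          map (\<lambda>i. imu a (Fib X T R ?ws i, Fib X S R w i, Ind X T S R s w i)) [0..<Tips X R]"
        using wmu[OF X.Fib_IOb[OF T R ws] X.Fib_IOb[OF S R w] X.Ind_IHom[OF T S R s w]]
        by (auto simp: codes simp del: internal_operad.simps)
      have tw: "tip_map X w \<in> fin_maps (Tips X S) (Tips X R)" and ts: "tip_map X s \<in> fin_maps ?n (Tips X S)"
        using X.tip_map T S R s w by auto
      have sp: "map (\<lambda>i. ipi X (Ind X T S R s w i)) [0..<Tips X R] =
          map (\<lambda>i. fibre_perm (induced (tip_map X s) (tip_map X w) i)) [0..<Tips X R]"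
        by (auto simp: ipi_def X.tip_map_Ind[OF T S R s w])
      have PQ: "?b \<circ> ipi X s = ?q \<circ> ipi X ?ws"
        using fibre_perm_comp[OF ts tw] unfolding sp X.Tips_fibs[OF T S s] X.Tips_fibs[OF T R ws]
        by (simp add: ipi_def X.tip_map_IComp[OF T S R s w])
      have bp: "?b permutes {..<?n}"
      proof -
        have "inv (ipi X w) permutes {..<length (fibre_sizes (tip_map X s) (Tips X S))}"
          using permutes_inv[OF pp[OF S R w]] by simp
        from permutes_inv[OF block_perm_permutes[OF this]] show ?thesis
          unfolding X.Tips_fibs[OF T S s] sum_fibre_sizes[OF ts] .
      qed
      have qp: "?q permutes {..<?n}"
      proof -
        have "sum_perm (fibre_sizes (tip_map X ?ws) (Tips X R)) (map (\<lambda>i. fibre_perm (induced (tip_map X s) (tip_map X w) i)) [0..<Tips X R])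
            permutes {..<sum_list (fibre_sizes (tip_map X ?ws) (Tips X R))}"
          by (rule sum_perm_permutes)
            (use fin_maps_perm[OF induced_fin_maps[OF ts tw]] in
              \<open>simp add: X.tip_map_IComp[OF T S R s w]\<close>)
        then show ?thesis
          unfolding sp X.Tips_fibs[OF T R ws] sum_fibre_sizes[OF X.tip_map[OF T R ws]] .
      qed
      have fT: "f T \<in> slice_ob ?n" using slice_obI[OF fH[OF T]] .
      have "slice_act ?n ?b (slice_act ?n (ipi X s) (f T)) = slice_act ?n ?q (slice_act ?n (ipi X ?ws) (f T))"
        unfolding sa_comp[OF bp pp[OF T S s] fT] sa_comp[OF qp pp[OF T R ws] fT] PQ by (rule refl)
      then show ?thesis
        using internal_associative[OF a T S R s w]
        unfolding internal_assoc_def Let_def d slice_simps(6,8,11) m1 m2 wmu[OF T S s] wmu[OF T R ws] wmu[OF S R w]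
        by (simp add: codes fsrc[OF R])
    qed
    show "cmp slice (Tips X T) (imu ?w (T, T, IId X T))
        (mula slice (replicate (Tips X T) 1) (idt slice (Tips X T) (iob ?w T)) (replicate (Tips X T) (ieps ?w))) =
        idt slice (Tips X T) (iob ?w T)" if T: "T \<in> IOb X" for T
    proof -
      have "ipi X (IId X T) = id" by (simp add: ipi_def X.tip_map_IId[OF T] fibre_perm_sorted)
      then show ?thesis
        unfolding wmu[OF T T X.IId_IHom[OF T]]
        using internal_unit_right[OF a T] sa_id[OF slice_obI[OF fH[OF T]]] by (simp add: codes fsrc[OF T])
    qed
    show "cmp slice (Tips X T) (imu ?w (T, UnitI X, s))
        (mula slice [Tips X T] (ieps ?w) [idt slice (Tips X T) (iob ?w T)]) =
        idt slice (Tips X T) (iob ?w T)" if T: "T \<in> IOb X" and s: "s \<in> IHom X T (UnitI X)" for T s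
    proof -
      have "tip_map X s \<in> fin_maps (Tips X T) 1" using X.tip_map[OF T X.UnitI_IOb s] by (simp add: X.Tips_UnitI)
      then have "tip_map X s = replicate (Tips X T) 0" by (rule fin_maps_1[THEN iffD1])
      then have "ipi X s = id" by (simp add: ipi_def fibre_perm_sorted)
      then show ?thesis
        unfolding wmu[OF T X.UnitI_IOb s]
        using internal_unit_left[OF a T s] sa_id[OF slice_obI[OF fH[OF T]]] by (simp add: codes fsrc[OF T])
    qed
  qed
qed

text \<open>The operadic functor into the slice that classifies such a lift is a family of cocones which
  respects the operad structures.\<close>

lemma slice_cocone:
  assumes X: "operadic_index X" and rep: "represents X h u" and F: "is_op_functor h A F"
    and f: "is_internal_map X A (image_operad X u F) (desymmetrise X c) f"
  obtains G where "\<And>k x. x \<in> obj h k \<Longrightarrow> G k x \<in> hom A k (oo F k x) (iob c k)"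
    "\<And>k x y g. g \<in> hom h k x y \<Longrightarrow> cmp A k (G k y) (oa F k g) = G k x"
    "\<And>k p x. p permutes {..<k} \<Longrightarrow> x \<in> obj h k \<Longrightarrow> G k (acto h k p x) = slice_act k p (G k x)"
    "G 1 (unt h) = ieps c"
    "\<And>ns x ys. x \<in> obj h (length ns) \<Longrightarrow> obs h ns ys \<Longrightarrow>
       G (sum_list ns) (mulo h ns x ys) = slice_mul ns (G (length ns) x) (map2 G ns ys)"
    "\<And>T. T \<in> IOb X \<Longrightarrow> G (Tips X T) (iob u T) = f T"
proof -
  interpret X: operadic_index X by (rule X)
  let ?a = "image_operad X u F"
  have h: "is_cat_operad h" and uh: "is_internal_operad X h u" using represents_operad[OF rep] .
  have A: "is_cat_operad A" by (rule operad)
  have fH: "f T \<in> hom A (Tips X T) (iob ?a T) (iob c (Tips X T))" if "T \<in> IOb X" for T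
    using f that by (simp add: is_internal_map_def)
  obtain G where G: "is_op_functor h slice G"
    "image_operad X u G = \<lparr>iob = f, imu = (\<lambda>(T, S, s)\<in>index_arrows X. pair_code (slice_act (Tips X T) (ipi X s) (f T), imu ?a (T, S, s))),
     ieps = pair_code (f (UnitI X), ieps ?a)\<rparr>"
    using represents_functor[OF rep slice_operad slice_internal[OF X f]] by blast
  let ?P = "\<lparr>oo = (\<lambda>k. \<lambda>x\<in>obj h k. src A k (oo G k x)),
     oa = (\<lambda>k. \<lambda>f\<in>arr h k. code_snd (oa G k f))\<rparr>"
  have GT: "oo G (Tips X T) (iob u T) = f T" if "T \<in> IOb X" for T
    using image_operad_simps(1)[OF that, of u G] by (simp add: G(2))
  have Gm: "oa G (Tips X T) (imu u (T, S, s)) = pair_code (slice_act (Tips X T) (ipi X s) (f T), imu ?a (T, S, s))"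
    if "T \<in> IOb X" "S \<in> IOb X" "s \<in> IHom X T S" for T S s
    using image_operad_simps(2)[OF that, of u G] that by (simp add: G(2) index_arrows_def)
  have Ge: "oa G 1 (ieps u) = pair_code (f (UnitI X), ieps ?a)"
    using image_operad_simps(3)[of X u G] by (simp add: G(2))
  have "image_operad X u ?P = ?a"
  proof (rule internal_operad.equality)
    show "iob (image_operad X u ?P) = iob ?a"
    proof (rule extensionalityI)
      show "iob (image_operad X u ?P) T = iob ?a T" if "T \<in> IOb X" for T
        using that internal_ob[OF uh that] GT[OF that] HomD(2)[OF fH[OF that]] by (simp add: image_operad_simps)
    qed (simp_all add: image_operad_def)
    show "imu (image_operad X u ?P) = imu ?a"
    proof (rule extensionalityI)
      show "imu (image_operad X u ?P) p = imu ?a p" if "p \<in> index_arrows X" for p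
      proof -
        obtain T S s where p: "p = (T, S, s)" by (cases p)
        then have q: "T \<in> IOb X" "S \<in> IOb X" "s \<in> IHom X T S" using that by (auto simp: index_arrows_def)
        have "imu (image_operad X u ?P) p = code_snd (oa G (Tips X T) (imu u (T, S, s)))"
          unfolding p image_operad_simps(2)[OF q] using HomD(1)[OF internal_mu[OF uh q]] by simp
        then show ?thesis unfolding Gm[OF q] p by (simp add: codes)
      qed
    qed (simp_all add: image_operad_def)
    show "ieps (image_operad X u ?P) = ieps ?a"
      using HomD(1)[OF internal_eps[OF uh]] Ge unfolding image_operad_simps(3)[of X u ?P] by (simp add: codes)
  qed simp
  then have PF: "?P = F"
    using represents_functor_unique[OF rep A slice_projection[OF h G(1)] F] by simp
  have Fo: "oo F k x = src A k (oo G k x)" if "x \<in> obj h k" for k x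
    unfolding PF[symmetric] using that by simp
  have Fa: "oa F k g = code_snd (oa G k g)" if "g \<in> arr h k" for k g
    unfolding PF[symmetric] using that by simp
  have Gf: "is_functor (cat h k) (cat slice k) (op_component G k)" for k using G(1) by (simp add: is_op_functor_def)
  show thesis
  proof (rule that[of "oo G"])
    show "oo G k x \<in> hom A k (oo F k x) (iob c k)" if "x \<in> obj h k" for k x
      using functor_Ob[OF Gf that] Fo[OF that] by (simp add: op_component_def slice_ob_iff)
    show "cmp A k (oo G k y) (oa F k g) = oo G k x" if g: "g \<in> hom h k x y" for k x y g
      using functor_Hom[OF Gf g] Fa[OF HomD(1)[OF g]] by (auto simp: op_component_def Hom_def codes)
    show "oo G k (acto h k p x) = slice_act k p (oo G k x)" if "p permutes {..<k}" "x \<in> obj h k" for k p x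
      using G(1) that by (simp add: is_op_functor_def)
    show "oo G 1 (unt h) = ieps c" using G(1) by (simp add: is_op_functor_def)
    show "oo G (sum_list ns) (mulo h ns x ys) = slice_mul ns (oo G (length ns) x) (map2 (oo G) ns ys)"
      if "x \<in> obj h (length ns)" "obs h ns ys" for ns x ys
      using G(1) that by (simp add: is_op_functor_def)
    show "oo G (Tips X T) (iob u T) = f T" if "T \<in> IOb X" for T by (rule GT[OF that])
  qed
qed

end

end

section \<open>The colimit as an internal symmetric operad\<close>

locale colimit_operad = cocomplete_operad A V + h: cat_operad h
  for A h :: "'u cat_operad" and V :: "'v itself" +
  fixes F :: "'u op_functor" and b :: "nat \<Rightarrow> 'u" and i :: "nat \<Rightarrow> 'u \<Rightarrow> 'u"
  assumes F: "is_op_functor h A F"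
    and countable_h: "countable (obj h k)" "countable (arr h k)"
    and colimit: "is_colimit (cat h k) (cat A k) (op_component F k) (b k) (i k)"
begin

lemma F_functor: "is_functor (cat h k) (cat A k) (op_component F k)"
  using F by (simp add: is_op_functor_def)

lemma F_Ob: "x \<in> obj h k \<Longrightarrow> oo F k x \<in> obj A k"
  using functor_Ob[OF F_functor[of k]] by (simp add: op_component_def)

lemma F_Hom: "f \<in> hom h k x y \<Longrightarrow> oa F k f \<in> hom A k (oo F k x) (oo F k y)"
  using functor_Hom[OF F_functor[of k]] by (simp add: op_component_def)

lemma F_acto: "p permutes {..<k} \<Longrightarrow> x \<in> obj h k \<Longrightarrow> oo F k (acto h k p x) = acto A k p (oo F k x)"
  using F by (simp add: is_op_functor_def)

lemma F_acta: "p permutes {..<k} \<Longrightarrow> f \<in> arr h k \<Longrightarrow> oa F k (acta h k p f) = acta A k p (oa F k f)"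
  using F by (simp add: is_op_functor_def)

lemma F_unt: "oo F 1 (unt h) = unt A"
  using F by (simp add: is_op_functor_def)

lemma F_mulo: "x \<in> obj h (length ns) \<Longrightarrow> obs h ns ys \<Longrightarrow>
    oo F (sum_list ns) (mulo h ns x ys) = mulo A ns (oo F (length ns) x) (map2 (oo F) ns ys)"
  using F by (simp add: is_op_functor_def)

lemma F_mula: "f \<in> arr h (length ns) \<Longrightarrow> ars h ns gs \<Longrightarrow>
    oa F (sum_list ns) (mula h ns f gs) = mula A ns (oa F (length ns) f) (map2 (oa F) ns gs)"
  using F by (simp add: is_op_functor_def)

lemma i_Hom: "x \<in> obj h k \<Longrightarrow> i k x \<in> hom A k (oo F k x) (b k)"
  using cocone_Hom[OF colimit_cocone[OF colimit[of k]]] by (simp add: op_component_def)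

lemma i_natural: "f \<in> hom h k x y \<Longrightarrow> cmp A k (i k y) (oa F k f) = i k x"
  using cocone_natural[OF colimit_cocone[OF colimit[of k]]] by (simp add: op_component_def)

lemma b_Ob: "b k \<in> obj A k"
  using colimit_cocone[OF colimit[of k]] by (simp add: is_cocone_def)

lemma obs_b: "obs A ns (map b ns)"
  using b_Ob by (simp add: list_all2_conv_all_nth)

lemma idn_b_Hom: "idt A k (b k) \<in> hom A k (b k) (b k)"
  by (rule idt_hom[OF b_Ob])

lemma homs_i: "obs h ns ys \<Longrightarrow> homs A ns (map2 i ns ys) (map2 (oo F) ns ys) (map b ns)"
  using i_Hom by (auto simp: homs_def list_all2_conv_all_nth)

lemma i_epic:
  assumes "f \<in> hom A k (b k) z" "g \<in> hom A k (b k) z"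
    and "\<And>x. x \<in> obj h k \<Longrightarrow> cmp A k f (i k x) = cmp A k g (i k x)"
  shows "f = g"
  by (rule colimit_unique[OF colimit assms])

text \<open>The translate by \<open>p\<close> of the colimit cocone, reindexed so that its source is \<open>F x\<close>.\<close>

definition leg :: "nat \<Rightarrow> (nat \<Rightarrow> nat) \<Rightarrow> 'u \<Rightarrow> 'u" where
  "leg k p x = acta A k p (i k (acto h k (inv p) x))"

lemma leg_Hom:
  assumes p: "p permutes {..<k}" and x: "x \<in> obj h k"
  shows "leg k p x \<in> hom A k (oo F k x) (acto A k p (b k))"
proof -
  have pi: "inv p permutes {..<k}" by (rule permutes_inv[OF p])
  have "acto A k p (oo F k (acto h k (inv p) x)) = oo F k x"
    using F_acto[OF pi x] acto_inv(1)[OF p F_Ob[OF x]] by simp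
  then show ?thesis
    using acta_Hom[OF p i_Hom[OF h.acto_Ob[OF pi x]]] by (simp add: leg_def)
qed

lemma leg_id: "x \<in> obj h k \<Longrightarrow> leg k id x = i k x"
  using HomD(1)[OF i_Hom] by (simp add: leg_def h.acto_id acta_id)

lemma leg_act:
  assumes p: "p permutes {..<k}" and q: "q permutes {..<k}" and x: "x \<in> obj h k"
  shows "acta A k q (leg k p x) = leg k (q \<circ> p) (acto h k q x)"
proof -
  have pi: "inv p permutes {..<k}" and qi: "inv q permutes {..<k}"
    using permutes_inv[OF p] permutes_inv[OF q] .
  have "inv (q \<circ> p) = inv p \<circ> inv q" by (rule o_inv_distrib[OF permutes_bij[OF q] permutes_bij[OF p]])
  then have "acto h k (inv (q \<circ> p)) (acto h k q x) = acto h k (inv p) x"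
    using h.acto_comp[OF pi qi h.acto_Ob[OF q x]] h.acto_inv(2)[OF q x] by simp
  then show ?thesis
    using acta_comp[OF q p HomD(1)[OF i_Hom[OF h.acto_Ob[OF pi x]]]] by (simp add: leg_def)
qed

lemma leg_natural:
  assumes p: "p permutes {..<k}" and f: "f \<in> hom h k x y"
  shows "cmp A k (leg k p y) (oa F k f) = leg k p x"
proof -
  have pi: "inv p permutes {..<k}" by (rule permutes_inv[OF p])
  let ?g = "acta h k (inv p) f"
  have g: "?g \<in> hom h k (acto h k (inv p) x) (acto h k (inv p) y)" by (rule h.acta_Hom[OF pi f])
  have "oa F k f = acta A k p (oa F k ?g)"
    using F_acta[OF pi HomD(1)[OF f]] acta_inv(1)[OF p HomD(1)[OF F_Hom[OF f]]] by simp
  then have "cmp A k (leg k p y) (oa F k f) =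
      acta A k p (cmp A k (i k (acto h k (inv p) y)) (oa F k ?g))"
    using acta_Cmp[OF p F_Hom[OF g] i_Hom] h.hom_obj(2)[OF g] by (simp add: leg_def)
  then show ?thesis using i_natural[OF g] by (simp add: leg_def)
qed

lemma leg_action:
  assumes p: "p permutes {..<k}" and x: "x \<in> obj h k"
  shows "leg k p (acto h k p x) = acta A k p (i k x)"
  using h.acto_inv(2)[OF p x] by (simp add: leg_def)

lemma obs_map2: "obs h ns ys \<Longrightarrow> map2 f ns ys = map (\<lambda>l. f (ns ! l) (ys ! l)) [0..<length ns]"
  using list_all2_lengthD[of _ ns ys] by (auto intro!: nth_equalityI)

lemma mul_i_epic:
  assumes f: "f \<in> hom A (sum_list ns) (mulo A ns (b (length ns)) (map b ns)) z"
    and g: "g \<in> hom A (sum_list ns) (mulo A ns (b (length ns)) (map b ns)) z"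
    and eq: "\<And>x ys. x \<in> obj h (length ns) \<Longrightarrow> obs h ns ys \<Longrightarrow>
      cmp A (sum_list ns) f (mula A ns (i (length ns) x) (map2 i ns ys)) =
      cmp A (sum_list ns) g (mula A ns (i (length ns) x) (map2 i ns ys))"
  shows "f = g"
proof (rule epic_jointly[where J = "\<lambda>l. cat h (ns ! l)" and D = "\<lambda>l. op_component F (ns ! l)"
      and c = "\<lambda>l. b (ns ! l)" and t = "\<lambda>l. i (ns ! l)" and ns = ns and ?c0.0 = "b (length ns)"])
  have m: "map (\<lambda>l. b (ns ! l)) [0..<length ns] = map b ns" by (rule nth_equalityI) simp_all
  show "f \<in> hom A (sum_list ns) (mulo A ns (b (length ns)) (map (\<lambda>l. b (ns ! l)) [0..<length ns])) z"
    "g \<in> hom A (sum_list ns) (mulo A ns (b (length ns)) (map (\<lambda>l. b (ns ! l)) [0..<length ns])) z"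
    unfolding m by (rule f, rule g)
  show "is_colimit (cat h (length ns)) (cat A (length ns)) (op_component F (length ns)) (b (length ns)) (i (length ns))"
    by (rule colimit)
  fix p j assume p: "p \<in> obj h (length ns)" and j: "\<And>l. l < length ns \<Longrightarrow> j l \<in> obj h (ns ! l)"
  have o: "obs h ns (map j [0..<length ns])" using j by (rule h.homs_obs(1)[OF h.homs_idns] | simp add: list_all2_conv_all_nth)+
  have "map2 i ns (map j [0..<length ns]) = map (\<lambda>l. i (ns ! l) (j l)) [0..<length ns]"
    by (rule nth_equalityI) simp_all
  then show "cmp A (sum_list ns) f (mula A ns (i (length ns) p) (map (\<lambda>l. i (ns ! l) (j l)) [0..<length ns])) =
    cmp A (sum_list ns) g (mula A ns (i (length ns) p) (map (\<lambda>l. i (ns ! l) (j l)) [0..<length ns]))"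
    using eq[OF p o] by simp
qed (use countable_h colimit in auto)

text \<open>For a twofold composite of the \<open>b\<^sub>k\<close> the legs are still jointly epic: the inner composites
  are themselves colimits, because the multiplication preserves colimits in the operation.\<close>

lemma nested_mul_i_epic:
  fixes nss :: "nat list list"
  defines "c \<equiv> concat nss" and "ls \<equiv> map length nss" and "ss \<equiv> map sum_list nss" and "l \<equiv> length nss"
  assumes f: "f \<in> hom A (sum_list c) (mulo A c (mulo A ls (b l) (map b ls)) (map b c)) z"
    and g: "g \<in> hom A (sum_list c) (mulo A c (mulo A ls (b l) (map b ls)) (map b c)) z"
    and eq: "\<And>x ys zs. x \<in> obj h l \<Longrightarrow> obs h ls ys \<Longrightarrow> obs h c zs \<Longrightarrow>
      cmp A (sum_list c) f (mula A c (mula A ls (i l x) (map2 i ls ys)) (map2 i c zs)) =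
      cmp A (sum_list c) g (mula A c (mula A ls (i l x) (map2 i ls ys)) (map2 i c zs))"
  shows "f = g"
proof -
  let ?n = "sum_list c"
  have sl: "sum_list ls = length c" by (simp add: ls_def c_def length_concat)
  have ss: "sum_list ss = ?n" unfolding ss_def c_def by (induction nss) simp_all
  have ll: "length ls = l" "length ss = l" by (simp_all add: ls_def ss_def l_def)
  let ?B = "\<lambda>m. mulo A (nss ! m) (b (length (nss ! m))) (map b (nss ! m))"
  let ?t = "\<lambda>m y. mula A (nss ! m) (i (length (nss ! m)) y) (idns A (nss ! m) (map b (nss ! m)))"
  have src: "mulo A c (mulo A ls (b l) (map b ls)) (map b c) = mulo A ss (b l) (map ?B [0..<l])"
  proof -
    have "mulo A (concat nss) (mulo A (map length nss) (b l) (map b ls)) (concat (map (map b) nss)) =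
        mulo A (map sum_list nss) (b l) (map (\<lambda>m. mulo A (nss ! m) (map b ls ! m) (map (map b) nss ! m)) [0..<length nss])"
      by (rule mulo_assoc) (use b_Ob in \<open>simp_all add: l_def ls_def list_all2_conv_all_nth\<close>)
    moreover have "map (\<lambda>m. mulo A (nss ! m) (map b ls ! m) (map (map b) nss ! m)) [0..<length nss] = map ?B [0..<l]"
      by (simp add: l_def ls_def)
    ultimately show ?thesis by (simp add: c_def ls_def ss_def map_concat)
  qed
  have colB: "\<exists>D. is_colimit (cat h (length (nss ! m))) (cat A (ss ! m)) D (?B m) (?t m)" if "m < l" for m
  proof -
    obtain D' where "is_colimit (cat h (length (nss ! m))) (cat A (sum_list (nss ! m))) D' (?B m) (?t m)"
      by (rule operation_colimit[OF countable_h colimit obs_b])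
    then show ?thesis using that by (auto simp: ss_def l_def)
  qed
  then obtain D where D: "\<And>m. m < l \<Longrightarrow> is_colimit (cat h (length (nss ! m))) (cat A (ss ! m)) (D m) (?B m) (?t m)"
    by metis
  have Bo: "obs A ss (map ?B [0..<l])"
    using mulo_Ob[OF b_Ob obs_b] by (simp add: list_all2_conv_all_nth ss_def l_def)
  show ?thesis
  proof (rule epic_in_operation[where ns = ss and c = "b l" and ys = "map ?B [0..<l]" and J = "cat h l" and t = "i l" and z = z])
    show "countable (obj h l)" "countable (arr h l)" by (rule countable_h)+
    show "is_colimit (cat h l) (cat A (length ss)) (op_component F l) (b l) (i l)"
      using colimit ll by simp
    show "obs A ss (map ?B [0..<l])" by (rule Bo)
    show "f \<in> hom A (sum_list ss) (mulo A ss (b l) (map ?B [0..<l])) z"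
      "g \<in> hom A (sum_list ss) (mulo A ss (b l) (map ?B [0..<l])) z"
      using f g unfolding src ss by auto
    fix x assume x: "x \<in> obj h l"
    let ?ix = "mula A ss (i l x) (idns A ss (map ?B [0..<l]))"
    have ixl: "i l x \<in> hom A (length ss) (oo F l x) (b l)" using i_Hom[OF x] ll by simp
    have ixH: "?ix \<in> hom A ?n (mulo A ss (oo F l x) (map ?B [0..<l])) (mulo A ss (b l) (map ?B [0..<l]))"
      using mula_Hom[OF ixl homs_idns[OF Bo]] ss by simp
    show "cmp A (sum_list ss) f ?ix = cmp A (sum_list ss) g ?ix"
      unfolding ss
    proof (rule epic_in_inputs[where ns = ss and c = ?B and J = "\<lambda>m. cat h (length (nss ! m))" and D = D and t = ?t
          and x = "oo F l x" and z = z, unfolded ss ll])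
      show "countable (obj h (length (nss ! m)))" "countable (arr h (length (nss ! m)))" for m
        by (rule countable_h)+
      show "is_colimit (cat h (length (nss ! m))) (cat A (ss ! m)) (D m) (?B m) (?t m)" if "m < l" for m
        by (rule D[OF that])
      show "oo F l x \<in> obj A l" by (rule F_Ob[OF x])
      show "cmp A ?n f ?ix \<in> hom A ?n (mulo A ss (oo F l x) (map ?B [0..<l])) z"
        "cmp A ?n g ?ix \<in> hom A ?n (mulo A ss (oo F l x) (map ?B [0..<l])) z"
        using cmp_hom[OF ixH] f g unfolding src by auto
      fix j assume j: "\<And>m. m < l \<Longrightarrow> j m \<in> obj h (length (nss ! m))"
      define ys where "ys = map j [0..<l]"
      have ys: "obs h ls ys" using j by (simp add: list_all2_conv_all_nth ys_def ls_def l_def)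
      let ?ts = "map (\<lambda>m. ?t m (j m)) [0..<l]"
      let ?xs = "map (\<lambda>m. mulo A (nss ! m) (oo F (length (nss ! m)) (j m)) (map b (nss ! m))) [0..<l]"
      have ts: "homs A ss ?ts ?xs (map ?B [0..<l])"
        using mula_Hom[OF i_Hom[OF j] homs_idns[OF obs_b]] by (simp add: homs_def ss_def l_def)
      let ?u = "mula A ls (i l x) (map2 i ls ys)"
      have ilx: "i l x \<in> hom A (length ls) (oo F l x) (b l)" using i_Hom[OF x] ll by simp
      have uH: "?u \<in> hom A (length c) (mulo A ls (oo F l x) (map2 (oo F) ls ys)) (mulo A ls (b l) (map b ls))"
        using mula_Hom[OF ilx homs_i[OF ys]] sl by simp
      have as: "mula A c ?u (idns A c (map b c)) = mula A ss (i l x) ?ts"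
      proof -
        let ?zss = "map (\<lambda>ns. idns A ns (map b ns)) nss"
        have "mula A (concat nss) (mula A (map length nss) (i l x) (map2 i ls ys)) (concat ?zss) =
            mula A (map sum_list nss) (i l x) (map (\<lambda>m. mula A (nss ! m) (map2 i ls ys ! m) (?zss ! m)) [0..<length nss])"
        proof (rule mula_assoc)
          show "i l x \<in> arr A (length nss)" using HomD(1)[OF i_Hom[OF x]] by (simp add: l_def)
          show "list_all2 (\<lambda>ns y. y \<in> arr A (length ns)) nss (map2 i ls ys)"
            using HomD(1)[OF i_Hom[OF j]] by (simp add: list_all2_conv_all_nth ls_def ys_def l_def)
          show "list_all2 (ars A) nss ?zss"
            using homs_ars[OF homs_idns[OF obs_b]] by (simp add: list_all2_conv_all_nth[of "ars A"])
        qed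
        moreover have "concat ?zss = idns A c (map b c)"
        proof -
          have e: "idns A ns (map b ns) = map (\<lambda>m. idt A m (b m)) ns" for ns
            by (rule nth_equalityI) simp_all
          show ?thesis unfolding e by (simp only: c_def map_concat)
        qed
        moreover have "map (\<lambda>m. mula A (nss ! m) (map2 i ls ys ! m) (?zss ! m)) [0..<length nss] = ?ts"
          by (simp add: ls_def ys_def l_def)
        ultimately show ?thesis by (simp add: c_def ls_def ss_def)
      qed
      have key: "cmp A ?n f (mula A c ?u (idns A c (map b c))) = cmp A ?n g (mula A c ?u (idns A c (map b c)))"
      proof -
        let ?v = "mula A c ?u (idns A c (map b c))" and ?y = "mulo A ls (oo F l x) (map2 (oo F) ls ys)"
        have yo: "?y \<in> obj A (length c)" using hom_obj(1)[OF uH] .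
        have vH: "?v \<in> hom A ?n (mulo A c ?y (map b c)) (mulo A c (mulo A ls (b l) (map b ls)) (map b c))"
          by (rule mula_Hom[OF uH homs_idns[OF obs_b]])
        show ?thesis
        proof (rule epic_in_inputs[where ns = c and c = "\<lambda>m. b (c ! m)" and J = "\<lambda>m. cat h (c ! m)"
              and D = "\<lambda>m. op_component F (c ! m)" and t = "\<lambda>m. i (c ! m)" and x = ?y and z = z])
          have m: "map (\<lambda>m. b (c ! m)) [0..<length c] = map b c" by (rule nth_equalityI) simp_all
          show "cmp A ?n f ?v \<in> hom A ?n (mulo A c ?y (map (\<lambda>m. b (c ! m)) [0..<length c])) z"
            "cmp A ?n g ?v \<in> hom A ?n (mulo A c ?y (map (\<lambda>m. b (c ! m)) [0..<length c])) z"
            unfolding m by (rule cmp_hom[OF vH f], rule cmp_hom[OF vH g])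
          show "?y \<in> obj A (length c)" by (rule yo)
          fix j' assume j': "\<And>m. m < length c \<Longrightarrow> j' m \<in> obj h (c ! m)"
          define zs where "zs = map j' [0..<length c]"
          have zs: "obs h c zs" using j' by (simp add: list_all2_conv_all_nth zs_def)
          have mz: "map (\<lambda>m. i (c ! m) (j' m)) [0..<length c] = map2 i c zs"
            by (rule nth_equalityI) (simp_all add: zs_def)
          have wH: "mula A c (idt A (length c) ?y) (map2 i c zs) \<in>
              hom A ?n (mulo A c ?y (map2 (oo F) c zs)) (mulo A c ?y (map b c))"
            by (rule mula_Hom[OF idt_hom[OF yo] homs_i[OF zs]])
          show "cmp A ?n (cmp A ?n f ?v) (mula A c (idt A (length c) ?y) (map (\<lambda>m. i (c ! m) (j' m)) [0..<length c])) =
            cmp A ?n (cmp A ?n g ?v) (mula A c (idt A (length c) ?y) (map (\<lambda>m. i (c ! m) (j' m)) [0..<length c]))"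
            unfolding mz cmp_assoc[OF wH vH f] cmp_assoc[OF wH vH g]
              mula_split(1)[OF uH homs_i[OF zs], symmetric]
            by (rule eq[OF x ys zs])
        qed (use countable_h colimit in auto)
      qed
      have tH: "mula A ss (idt A l (oo F l x)) ?ts \<in> hom A ?n (mulo A ss (oo F l x) ?xs) (mulo A ss (oo F l x) (map ?B [0..<l]))"
        using mula_Hom[OF idt_hom[OF hom_obj(1)[OF ixl]] ts] unfolding ll ss .
      have fs: "f \<in> hom A ?n (mulo A ss (b l) (map ?B [0..<l])) z" "g \<in> hom A ?n (mulo A ss (b l) (map ?B [0..<l])) z"
        using f g unfolding src by auto
      have "mula A ss (i l x) ?ts = cmp A ?n ?ix (mula A ss (idt A l (oo F l x)) ?ts)"
        using mula_split(1)[OF ixl ts] unfolding ll ss .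
      then show "cmp A ?n (cmp A ?n f ?ix) (mula A ss (idt A l (oo F l x)) ?ts) =
          cmp A ?n (cmp A ?n g ?ix) (mula A ss (idt A l (oo F l x)) ?ts)"
        using key unfolding as cmp_assoc[OF tH ixH fs(1)] cmp_assoc[OF tH ixH fs(2)] by simp
    qed
  qed
qed

text \<open>The translated legs at \<open>m(x; y\<^sub>1, \<dots>)\<close> are natural in \<open>x\<close> and the \<open>y\<^sub>i\<close>, because \<open>F\<close> takes the
  multiplication of \<open>h\<close> to that of \<open>A\<close>.\<close>

lemma mu_exists:
  assumes s: "s \<in> fin_maps n k"
  shows "\<exists>m. m \<in> hom A n (mulo A (fibre_sizes s k) (b k) (map b (fibre_sizes s k))) (acto A n (fibre_perm s) (b n)) \<and>
    (\<forall>x ys. x \<in> obj h k \<longrightarrow> obs h (fibre_sizes s k) ys \<longrightarrow>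
      cmp A n m (mula A (fibre_sizes s k) (i k x) (map2 i (fibre_sizes s k) ys)) =
      leg n (fibre_perm s) (mulo h (fibre_sizes s k) x ys))"
proof -
  let ?ns = "fibre_sizes s k" and ?p = "fibre_perm s"
  have sn: "sum_list ?ns = n" by (rule sum_fibre_sizes[OF s])
  have p: "?p permutes {..<n}" by (rule fin_maps_perm[OF s])
  have m: "map (\<lambda>l. b (?ns ! l)) [0..<length ?ns] = map b ?ns" by (rule nth_equalityI) simp_all
  have col: "is_colimit (cat h k) (cat A (length ?ns)) (op_component F k) (b k) (i k)" using colimit by simp
  obtain \<psi> where \<psi>: "\<psi> \<in> hom A (sum_list ?ns) (mulo A ?ns (b k) (map (\<lambda>l. b (?ns ! l)) [0..<length ?ns])) (acto A n ?p (b n))"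
    "\<And>q j. q \<in> obj h k \<Longrightarrow> (\<And>l. l < length ?ns \<Longrightarrow> j l \<in> obj h (?ns ! l)) \<Longrightarrow>
      cmp A (sum_list ?ns) \<psi> (mula A ?ns (i k q) (map (\<lambda>l. i (?ns ! l) (j l)) [0..<length ?ns])) =
      leg n ?p (mulo h ?ns q (map j [0..<length ?ns]))"
  proof (rule factor_jointly[where ns = ?ns and J = "\<lambda>l. cat h (?ns ! l)" and D = "\<lambda>l. op_component F (?ns ! l)"
        and c = "\<lambda>l. b (?ns ! l)" and t = "\<lambda>l. i (?ns ! l)" and ?J0.0 = "cat h k" and ?D0.0 = "op_component F k"
        and ?c0.0 = "b k" and ?t0.0 = "i k" and \<phi> = "\<lambda>q qs. leg n ?p (mulo h ?ns q qs)" and z = "acto A n ?p (b n)"])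
    show "is_colimit (cat h k) (cat A (length ?ns)) (op_component F k) (b k) (i k)" by (rule col)
    show "acto A n ?p (b n) \<in> obj A (sum_list ?ns)" unfolding sn by (rule acto_Ob[OF p b_Ob])
    show "leg n ?p (mulo h ?ns q qs) \<in> hom A (sum_list ?ns)
        (mulo A ?ns (FOb (op_component F k) q) (map (\<lambda>l. FOb (op_component F (?ns ! l)) (qs ! l)) [0..<length ?ns])) (acto A n ?p (b n))"
      if q: "q \<in> obj h k" and qs: "length qs = length ?ns" "\<And>l. l < length ?ns \<Longrightarrow> qs ! l \<in> obj h (?ns ! l)" for q qs
    proof -
      have q': "q \<in> obj h (length ?ns)" using q by simp
      have o: "obs h ?ns qs" using qs by (simp add: list_all2_conv_all_nth)
      have "mulo h ?ns q qs \<in> obj h n" using h.mulo_Ob[OF q' o] unfolding sn .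
      moreover have "oo F n (mulo h ?ns q qs) = mulo A ?ns (oo F k q) (map2 (oo F) ?ns qs)"
        using F_mulo[OF q' o] unfolding sn by simp
      ultimately show ?thesis
        using leg_Hom[OF p, of "mulo h ?ns q qs"] unfolding sn obs_map2[OF o] by (simp add: op_component_def)
    qed
    show "cmp A (sum_list ?ns) (leg n ?p (mulo h ?ns q' qs'))
        (mula A ?ns (FAr (op_component F k) a) (map (\<lambda>l. FAr (op_component F (?ns ! l)) (bs ! l)) [0..<length ?ns])) =
        leg n ?p (mulo h ?ns q qs)"
      if a: "a \<in> hom h k q q'" and l: "length bs = length ?ns" "length qs = length ?ns" "length qs' = length ?ns"
        and bs: "\<And>l. l < length ?ns \<Longrightarrow> bs ! l \<in> hom h (?ns ! l) (qs ! l) (qs' ! l)" for a q q' bs qs qs'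
    proof -
      have a': "a \<in> hom h (length ?ns) q q'" using a by simp
      have b': "homs h ?ns bs qs qs'" using bs l by (simp add: homs_def)
      have "oa F n (mula h ?ns a bs) = mula A ?ns (oa F k a) (map2 (oa F) ?ns bs)"
        using F_mula[OF HomD(1)[OF a'] h.homs_ars[OF b']] unfolding sn by simp
      moreover have "map2 (oa F) ?ns bs = map (\<lambda>l. oa F (?ns ! l) (bs ! l)) [0..<length ?ns]"
        using l by (auto intro!: nth_equalityI)
      moreover have H: "mula h ?ns a bs \<in> hom h n (mulo h ?ns q qs) (mulo h ?ns q' qs')"
        using h.mula_Hom[OF a' b'] unfolding sn .
      ultimately show ?thesis using leg_natural[OF p H] unfolding sn by (simp add: op_component_def)
    qed
  qed (use countable_h colimit in auto)
  have "cmp A n \<psi> (mula A ?ns (i k x) (map2 i ?ns ys)) = leg n ?p (mulo h ?ns x ys)"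
    if x: "x \<in> obj h k" and ys: "obs h ?ns ys" for x ys
  proof -
    have "map ((!) ys) [0..<length ?ns] = ys" using list_all2_lengthD[OF ys] by (metis map_nth)
    then show ?thesis
      using \<psi>(2)[OF x, of "(!) ys"] list_all2_nthD[OF ys] unfolding sn obs_map2[OF ys] by simp
  qed
  then show ?thesis using \<psi>(1) unfolding sn m by blast
qed

definition mu :: "nat \<Rightarrow> nat \<Rightarrow> nat list \<Rightarrow> 'u" where
  "mu n k s = (SOME m. m \<in> hom A n (mulo A (fibre_sizes s k) (b k) (map b (fibre_sizes s k))) (acto A n (fibre_perm s) (b n)) \<and>
    (\<forall>x ys. x \<in> obj h k \<longrightarrow> obs h (fibre_sizes s k) ys \<longrightarrow>
      cmp A n m (mula A (fibre_sizes s k) (i k x) (map2 i (fibre_sizes s k) ys)) =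
      leg n (fibre_perm s) (mulo h (fibre_sizes s k) x ys)))"

lemma mu_Hom: "s \<in> fin_maps n k \<Longrightarrow> mu n k s \<in> hom A n
    (mulo A (fibre_sizes s k) (b k) (map b (fibre_sizes s k))) (acto A n (fibre_perm s) (b n))"
  unfolding mu_def by (rule someI2_ex[OF mu_exists]) auto

lemma mu_leg: "s \<in> fin_maps n k \<Longrightarrow> x \<in> obj h k \<Longrightarrow> obs h (fibre_sizes s k) ys \<Longrightarrow>
    cmp A n (mu n k s) (mula A (fibre_sizes s k) (i k x) (map2 i (fibre_sizes s k) ys)) =
    leg n (fibre_perm s) (mulo h (fibre_sizes s k) x ys)"
  unfolding mu_def by (rule someI2_ex[OF mu_exists]) auto

definition sym_operad :: "(nat, nat list, 'u) internal_operad" where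
  "sym_operad = \<lparr>iob = b, imu = (\<lambda>(n, k, s)\<in>index_arrows Omega_sym. mu n k s), ieps = i 1 (unt h)\<rparr>"

lemma sym_operad_simps [simp]:
  "iob sym_operad = b" "s \<in> fin_maps n k \<Longrightarrow> imu sym_operad (n, k, s) = mu n k s"
  "ieps sym_operad = i 1 (unt h)"
  by (simp_all add: sym_operad_def index_arrows_def)

end

lemma list_all2_concat_split:
  "list_all2 P (concat nss) zs \<Longrightarrow> \<exists>zss. concat zss = zs \<and> list_all2 (list_all2 P) nss zss"
proof (induction nss arbitrary: zs)
  case (Cons ns nss)
  then obtain us vs where "zs = us @ vs" "list_all2 P ns us" "list_all2 P (concat nss) vs"
    by (auto simp: list_all2_append1)
  then show ?case using Cons.IH[of vs] by (metis concat.simps(2) list_all2_Cons)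
qed simp

lemma map2_concat:
  "list_all2 (\<lambda>ns zs. length ns = length zs) nss zss \<Longrightarrow>
     map2 f (concat nss) (concat zss) = concat (map2 (map2 f) nss zss)"
  by (induction rule: list_all2_induct) simp_all

lemma permute_list_inverse:
  assumes "p permutes {..<length xs}"
  shows "permute_list (inv p) (permute_list p xs) = xs"
  using permute_list_compose[OF permutes_inv[OF assms], of p] permutes_inv_o[OF assms] by simp

context colimit_operad
begin

text \<open>After the legs at \<open>x\<close>, the \<open>y\<^sub>i\<close> and the \<open>z\<^sub>j\<close>, both sides become a translate of the leg at the iterated
  product of these objects. Equivariance of \<open>h\<close> identifies the products in question, and
  \<open>fibre_perm_comp\<close> the two translations.\<close>

lemma sym_operad_assoc:
  assumes s: "s \<in> fin_maps n k" and w: "w \<in> fin_maps k l"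
  shows "internal_assoc Omega_sym A sym_operad n k l s w"
proof -
  let ?ws = "fin_comp w s" and ?ind = "induced s w"
  define nss where "nss = map (\<lambda>m. fibre_sizes (?ind m) (length (fibre_elems w m))) [0..<l]"
  define f where "f = permute_list (inv (fibre_perm w)) (fibre_sizes s k)"
  let ?F = "fibre_sizes s k" and ?pw = "fibre_perm w" and ?ps = "fibre_perm s"
  let ?fw = "fibre_sizes w l" and ?fws = "fibre_sizes ?ws l"
  let ?B = "inv (block_perm (inv ?pw) ?F)"
  let ?\<tau> = "map (\<lambda>m. fibre_perm (?ind m)) [0..<l]"
  let ?Q = "sum_perm ?fws ?\<tau>"
  note ws = fin_comp_fin_maps[OF s w]
  have cf: "concat nss = f" unfolding nss_def f_def by (rule concat_induced_sizes[OF s w])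
  have lf: "map length nss = ?fw" by (rule nth_equalityI) (simp_all add: nss_def)
  have sf: "map sum_list nss = ?fws"
    by (rule nth_equalityI) (simp_all add: nss_def sum_induced_sizes[OF s w])
  have ln: "length nss = l" by (simp add: nss_def)
  have nth: "nss ! m = fibre_sizes (?ind m) (?fw ! m)" if "m < l" for m using that by (simp add: nss_def)
  have lenf: "length f = k" by (simp add: f_def)
  have pw: "?pw permutes {..<k}" and ps: "?ps permutes {..<n}"
    using fin_maps_perm[OF w] fin_maps_perm[OF s] .
  have pwi: "inv ?pw permutes {..<length ?F}" using permutes_inv[OF pw] by simp
  have pws: "fibre_perm ?ws permutes {..<n}" by (rule fin_maps_perm[OF ws])
  have B: "?B permutes {..<n}"
    using permutes_inv[OF block_perm_permutes[OF pwi]] unfolding sum_fibre_sizes[OF s] .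
  have \<tau>: "fibre_perm (?ind m) permutes {..<?fws ! m}" if "m < l" for m
    using fibre_perm_permutes[OF fin_maps_length[OF induced_fin_maps[OF s w]], of m] that by simp
  have \<tau>': "?\<tau> ! m permutes {..<?fws ! m}" if "m < length ?fws" for m using \<tau>[of m] that by simp
  have Q: "?Q permutes {..<n}"
    using sum_perm_permutes[of ?fws ?\<tau>] \<tau>' unfolding sum_fibre_sizes[OF ws] by blast
  have sumf: "sum_list f = n"
    using sum_list_permute_list[OF pwi] sum_fibre_sizes[OF s] by (simp add: f_def)
  have ind: "?ind m \<in> fin_maps (?fws ! m) (?fw ! m)" if "m < l" for m
    using induced_fin_maps[OF s w, of m] that by simp
  have PQ: "?B \<circ> ?ps = ?Q \<circ> fibre_perm ?ws" by (rule fibre_perm_comp[OF s w])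
  let ?ms = "map (\<lambda>m. mu (?fws ! m) (?fw ! m) (?ind m)) [0..<l]"
  let ?S = "mulo A f (mulo A ?fw (b l) (map b ?fw)) (map b f)"
  have muwH: "mu k l w \<in> hom A (length f) (mulo A ?fw (b l) (map b ?fw)) (acto A k ?pw (b k))"
    using mu_Hom[OF w] lenf by simp
  have LH: "mula A f (mu k l w) (idns A f (map b f)) \<in> hom A n ?S (mulo A f (acto A k ?pw (b k)) (map b f))"
    using mula_Hom[OF muwH homs_idns[OF obs_b]] unfolding sumf .
  have BF: "mulo A f (acto A k ?pw (b k)) (map b f) = acto A n ?B (mulo A ?F (b k) (map b ?F))"
    using mulo_equivariant_operation[of "b k" ?F, OF _ obs_b pwi] b_Ob[of k] permutes_inv_inv[OF pw]
      permute_list_map[OF pwi, of b] unfolding sum_fibre_sizes[OF s] by (simp add: f_def)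
  have BmuH: "acta A n ?B (mu n k s) \<in> hom A n (mulo A f (acto A k ?pw (b k)) (map b f)) (acto A n ?B (acto A n ?ps (b n)))"
    unfolding BF by (rule acta_Hom[OF B mu_Hom[OF s]])
  let ?Bs = "map (\<lambda>m. mulo A (nss ! m) (b (length (nss ! m))) (map b (nss ! m))) [0..<l]"
  let ?Ts = "map (\<lambda>m. acto A (?fws ! m) (fibre_perm (?ind m)) (b (?fws ! m))) [0..<l]"
  have msH: "homs A ?fws ?ms ?Bs ?Ts"
    unfolding homs_def
  proof (intro conjI allI impI)
    fix m assume "m < length ?fws"
    then have m: "m < l" by simp
    have "?fw ! m = length (nss ! m)" using nth[OF m] by simp
    then show "?ms ! m \<in> hom A (?fws ! m) (?Bs ! m) (?Ts ! m)"
      using mu_Hom[OF ind[OF m]] m unfolding nth[OF m, symmetric] by simp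
  qed simp_all
  have Ssrc: "?S = mulo A ?fws (b l) ?Bs"
  proof -
    have "mulo A (concat nss) (mulo A (map length nss) (b l) (map b ?fw)) (concat (map (map b) nss)) =
        mulo A (map sum_list nss) (b l) (map (\<lambda>m. mulo A (nss ! m) (map b ?fw ! m) (map (map b) nss ! m)) [0..<length nss])"
      by (rule mulo_assoc) (use b_Ob ln lf[symmetric] in \<open>simp_all add: list_all2_conv_all_nth\<close>)
    moreover have "map (\<lambda>m. mulo A (nss ! m) (map b ?fw ! m) (map (map b) nss ! m)) [0..<length nss] = ?Bs"
      using ln lf[symmetric] by simp
    ultimately show ?thesis unfolding cf lf sf by (simp only: map_concat[symmetric] cf)
  qed
  have idl: "idt A l (b l) \<in> hom A (length ?fws) (b l) (b l)" using idn_b_Hom by simp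
  have RH: "mula A ?fws (idt A l (b l)) ?ms \<in> hom A n ?S (mulo A ?fws (b l) ?Ts)"
    using mula_Hom[OF idl msH] unfolding sum_fibre_sizes[OF ws] Ssrc[symmetric] .
  have QT: "mulo A ?fws (b l) ?Ts = acto A n ?Q (mulo A ?fws (b l) (map b ?fws))"
    using mulo_inputs[of "b l" ?fws, OF _ obs_b \<tau>', of ?Ts] b_Ob[of l] unfolding sum_fibre_sizes[OF ws] by simp
  have QmuH: "acta A n ?Q (mu n l ?ws) \<in> hom A n (mulo A ?fws (b l) ?Ts) (acto A n ?Q (acto A n (fibre_perm ?ws) (b n)))"
    unfolding QT by (rule acta_Hom[OF Q mu_Hom[OF ws]])
  have tgt: "acto A n ?Q (acto A n (fibre_perm ?ws) (b n)) = acto A n ?B (acto A n ?ps (b n))"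
    unfolding acto_comp[OF Q pws b_Ob] acto_comp[OF B ps b_Ob] PQ by (rule refl)
  let ?L = "cmp A n (acta A n ?B (mu n k s)) (mula A f (mu k l w) (idns A f (map b f)))"
  let ?R = "cmp A n (acta A n ?Q (mu n l ?ws)) (mula A ?fws (idt A l (b l)) ?ms)"
  have LR: "?L = ?R"
  proof (rule nested_mul_i_epic[of ?L nss _ ?R, unfolded cf lf ln sumf])
    show "?L \<in> hom A n ?S (acto A n ?B (acto A n ?ps (b n)))" by (rule cmp_hom[OF LH BmuH])
    show "?R \<in> hom A n ?S (acto A n ?B (acto A n ?ps (b n)))"
      using cmp_hom[OF RH QmuH] unfolding tgt .
    fix x ys zs assume x: "x \<in> obj h l" and ys: "obs h ?fw ys" and zs: "obs h f zs"
    let ?gen = "mula A f (mula A ?fw (i l x) (map2 i ?fw ys)) (map2 i f zs)"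
    let ?y0 = "mulo h ?fw x ys"
    let ?X = "mulo h f ?y0 zs"
    have lz: "length zs = k" using list_all2_lengthD[OF zs] lenf by simp
    have ly: "length ys = l" using list_all2_lengthD[OF ys] by simp
    have xw: "x \<in> obj h (length ?fw)" and xws: "x \<in> obj h (length ?fws)" using x by simp_all
    have y0: "?y0 \<in> obj h k" using h.mulo_Ob[OF xw ys] unfolding sum_fibre_sizes[OF w] .
    have iw: "i l x \<in> hom A (length ?fw) (oo F l x) (b l)" using i_Hom[OF x] by simp
    have gen1: "mula A ?fw (i l x) (map2 i ?fw ys) \<in> hom A (length f) (mulo A ?fw (oo F l x) (map2 (oo F) ?fw ys)) (mulo A ?fw (b l) (map b ?fw))"
      using mula_Hom[OF iw homs_i[OF ys]] unfolding sum_fibre_sizes[OF w] lenf .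
    have genH: "?gen \<in> hom A n (mulo A f (mulo A ?fw (oo F l x) (map2 (oo F) ?fw ys)) (map2 (oo F) f zs)) ?S"
      using mula_Hom[OF gen1 homs_i[OF zs]] unfolding sumf .
    \<comment> \<open>Along \<open>\<mu>\<^sub>w\<close> the operation becomes \<open>\<pi>(w)\<close> times a leg at \<open>y\<close>; moving \<open>\<pi>(w)\<close> out of \<open>m\<close> permutes
      the inputs into the order of the fibres of \<open>s\<close>.\<close>
    have "cmp A n ?L ?gen = leg n (?B \<circ> ?ps) ?X"
    proof -
      define y where "y = acto h k (inv ?pw) ?y0"
      define zs' where "zs' = permute_list ?pw zs"
      have y: "y \<in> obj h k" unfolding y_def by (rule h.acto_Ob[OF permutes_inv[OF pw] y0])
      have pz: "permute_list (inv ?pw) zs' = zs"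
        unfolding zs'_def by (rule permute_list_inverse) (use pw lz in simp)
      have lz': "length zs' = k" by (simp add: zs'_def lz)
      have fF: "f ! ?pw m = ?F ! m" "?pw m < k" if "m < k" for m
      proof -
        show mk: "?pw m < k" using permutes_in_image[OF pw, of m] that by simp
        have "f ! ?pw m = ?F ! (inv ?pw (?pw m))"
          unfolding f_def by (rule permute_list_nth[OF pwi]) (use mk in simp)
        then show "f ! ?pw m = ?F ! m" using permutes_inverses[OF pw] by simp
      qed
      have zs': "obs h ?F zs'"
        unfolding list_all2_conv_all_nth
      proof (intro conjI allI impI)
        fix m assume "m < length ?F"
        then have m: "m < k" by simp
        have "zs' ! m = zs ! ?pw m"
          unfolding zs'_def using permute_list_nth[of ?pw zs m] pw lz m by simp
        then show "zs' ! m \<in> obj h (?F ! m)"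
          using list_all2_nthD[OF zs, of "?pw m"] fF[OF m] lenf by simp
      qed (simp add: lz')
      have pm: "permute_list (inv ?pw) (map2 i ?F zs') = map2 i f zs"
      proof (rule nth_equalityI)
        fix m assume "m < length (permute_list (inv ?pw) (map2 i ?F zs'))"
        then have m: "m < k" by (simp add: lz')
        have im: "inv ?pw m < k" using permutes_in_image[OF permutes_inv[OF pw], of m] m by simp
        have "zs' ! inv ?pw m = zs ! m"
          using pz permute_list_nth[of "inv ?pw" zs' m] permutes_inv[OF pw] lz' m by simp
        moreover have "?F ! inv ?pw m = f ! m"
          unfolding f_def using permute_list_nth[OF pwi, of m] m by simp
        ultimately show "permute_list (inv ?pw) (map2 i ?F zs') ! m = map2 i f zs ! m"
          using permute_list_nth[of "inv ?pw" "map2 i ?F zs'" m] permutes_inv[OF pw] m im lz lz' lenf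
          by simp
      qed (simp add: lz lz' lenf)
      have "cmp A n (mula A f (mu k l w) (idns A f (map b f))) ?gen =
          mula A f (leg k ?pw ?y0) (map2 i f zs)"
        using mula_Cmp[OF gen1 homs_i[OF zs] muwH homs_idns[OF obs_b]] cmps_idns(2)[OF homs_i[OF zs]]
          mu_leg[OF w x ys] unfolding sumf lenf by simp
      also have "leg k ?pw ?y0 = acta A k ?pw (i k y)" by (simp add: leg_def y_def)
      also have "mula A f (acta A k ?pw (i k y)) (map2 i f zs) = acta A n ?B (mula A ?F (i k y) (map2 i ?F zs'))"
        using mula_equivariant_operation[of "i k y" ?F, OF _ homs_ars[OF homs_i[OF zs']] pwi]
          HomD(1)[OF i_Hom[OF y]] permutes_inv_inv[OF pw]
        unfolding pm sum_fibre_sizes[OF s] by (simp add: f_def)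
      finally have e: "cmp A n (mula A f (mu k l w) (idns A f (map b f))) ?gen =
          acta A n ?B (mula A ?F (i k y) (map2 i ?F zs'))" .
      have yF: "y \<in> obj h (length ?F)" using y by simp
      have iy: "i k y \<in> hom A (length ?F) (oo F k y) (b k)" using i_Hom[OF y] by simp
      have mF: "mula A ?F (i k y) (map2 i ?F zs') \<in> hom A n (mulo A ?F (oo F k y) (map2 (oo F) ?F zs')) (mulo A ?F (b k) (map b ?F))"
        using mula_Hom[OF iy homs_i[OF zs']] unfolding sum_fibre_sizes[OF s] .
      have "cmp A n ?L ?gen = cmp A n (acta A n ?B (mu n k s)) (acta A n ?B (mula A ?F (i k y) (map2 i ?F zs')))"
        unfolding cmp_assoc[OF genH LH BmuH] e by (rule refl)
      also have "\<dots> = acta A n ?B (leg n ?ps (mulo h ?F y zs'))"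
        unfolding acta_Cmp[OF B mF mu_Hom[OF s], symmetric] mu_leg[OF s y zs'] by (rule refl)
      also have "\<dots> = leg n (?B \<circ> ?ps) (acto h n ?B (mulo h ?F y zs'))"
        by (rule leg_act[OF ps B]) (use h.mulo_Ob[OF yF zs'] in \<open>simp add: sum_fibre_sizes[OF s]\<close>)
      also have "acto h n ?B (mulo h ?F y zs') = ?X"
        using h.mulo_equivariant_operation[OF yF zs' pwi] permutes_inv_inv[OF pw] h.acto_inv(1)[OF pw y0]
        unfolding sum_fibre_sizes[OF s] pz by (simp add: f_def y_def)
      finally show ?thesis .
    qed
    \<comment> \<open>Along the \<open>\<mu>\<close> of the induced maps the inputs become translates of legs at \<open>z m\<close>.\<close>
    moreover have "cmp A n ?R ?gen = leg n (?Q \<circ> fibre_perm ?ws) ?X"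
    proof -
      obtain zss where zss: "concat zss = zs" "list_all2 (obs h) nss zss"
        using list_all2_concat_split[of "\<lambda>n y. y \<in> obj h n" nss zs] zs unfolding cf by blast
      have lzz: "length zss = l" using list_all2_lengthD[OF zss(2)] ln by simp
      define M where "M m = mulo h (nss ! m) (ys ! m) (zss ! m)" for m
      define z where "z m = acto h (?fws ! m) (inv (fibre_perm (?ind m))) (M m)" for m
      have ym: "ys ! m \<in> obj h (length (nss ! m))" if "m < l" for m
        using list_all2_nthD[OF ys, of m] that nth[OF that] by simp
      have zm: "obs h (nss ! m) (zss ! m)" if "m < l" for m
        using list_all2_nthD[OF zss(2), of m] that ln by simp
      have sm: "sum_list (nss ! m) = ?fws ! m" if "m < l" for m
        using arg_cong[OF sf, of "\<lambda>xs. xs ! m"] that ln by simp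
      have Mo: "M m \<in> obj h (?fws ! m)" if "m < l" for m
        unfolding M_def sm[OF that, symmetric] by (rule h.mulo_Ob[OF ym[OF that] zm[OF that]])
      have zo: "z m \<in> obj h (?fws ! m)" if "m < l" for m
        unfolding z_def by (rule h.acto_Ob[OF permutes_inv[OF \<tau>[OF that]] Mo[OF that]])
      let ?gs = "map (\<lambda>m. mula A (nss ! m) (i (length (nss ! m)) (ys ! m)) (map2 i (nss ! m) (zss ! m))) [0..<l]"
      let ?os = "map (\<lambda>m. mulo A (nss ! m) (oo F (length (nss ! m)) (ys ! m)) (map2 (oo F) (nss ! m) (zss ! m))) [0..<l]"
      have gsH: "homs A ?fws ?gs ?os ?Bs"
        unfolding homs_def
      proof (intro conjI allI impI)
        fix m assume "m < length ?fws"
        then have m: "m < l" by simp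
        show "?gs ! m \<in> hom A (?fws ! m) (?os ! m) (?Bs ! m)"
          using mula_Hom[OF i_Hom[OF ym[OF m]] homs_i[OF zm[OF m]]] m unfolding sm[OF m] by simp
      qed simp_all
      have gen: "?gen = mula A ?fws (i l x) ?gs"
      proof -
        have "mula A (concat nss) (mula A (map length nss) (i l x) (map2 i ?fw ys)) (concat (map2 (map2 i) nss zss)) =
          mula A (map sum_list nss) (i l x) (map (\<lambda>m. mula A (nss ! m) (map2 i ?fw ys ! m) (map2 (map2 i) nss zss ! m)) [0..<length nss])"
        proof (rule mula_assoc)
          show "i l x \<in> arr A (length nss)" using HomD(1)[OF i_Hom[OF x]] ln by simp
          show "list_all2 (\<lambda>ns y. y \<in> arr A (length ns)) nss (map2 i ?fw ys)"
            unfolding list_all2_conv_all_nth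
          proof (intro conjI allI impI)
            fix m assume "m < length nss"
            then have m: "m < l" by (simp add: ln)
            show "map2 i ?fw ys ! m \<in> arr A (length (nss ! m))"
              using HomD(1)[OF i_Hom[OF ym[OF m]]] m ly nth[OF m] by simp
          qed (simp add: ln ly)
          show "list_all2 (ars A) nss (map2 (map2 i) nss zss)"
            unfolding list_all2_conv_all_nth[of "ars A"]
            using homs_ars[OF homs_i[OF zm]] by (simp add: ln lzz)
        qed
        moreover have "concat (map2 (map2 i) nss zss) = map2 i f zs"
        proof -
          have "list_all2 (\<lambda>ns zs. length ns = length zs) nss zss"
            using zss(2) by (rule list_all2_mono) (rule list_all2_lengthD)
          from map2_concat[OF this, of i] show ?thesis by (simp add: cf zss(1))
        qed
        moreover have "map (\<lambda>m. mula A (nss ! m) (map2 i ?fw ys ! m) (map2 (map2 i) nss zss ! m)) [0..<length nss] = ?gs"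
          using ln ly lzz nth by simp
        ultimately show ?thesis unfolding cf lf sf by simp
      qed
      have ix: "i l x \<in> hom A (length ?fws) (oo F l x) (b l)" using i_Hom[OF x] by simp
      have zsO: "obs h ?fws (map z [0..<l])" using zo by (simp add: list_all2_conv_all_nth)
      have cm: "cmps A ?fws ?ms ?gs = map (\<lambda>m. acta A (?fws ! m) (fibre_perm (?ind m)) (i (?fws ! m) (z m))) [0..<l]"
      proof (rule nth_equalityI)
        fix m assume "m < length (cmps A ?fws ?ms ?gs)"
        then have m: "m < l" by (simp add: cmps_def)
        have "cmp A (?fws ! m) (mu (?fws ! m) (?fw ! m) (?ind m)) (mula A (nss ! m) (i (?fw ! m) (ys ! m)) (map2 i (nss ! m) (zss ! m))) =
            leg (?fws ! m) (fibre_perm (?ind m)) (M m)"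
          using mu_leg[OF ind[OF m], of "ys ! m" "zss ! m"] ym[OF m] zm[OF m] nth[OF m] unfolding M_def by simp
        then show "cmps A ?fws ?ms ?gs ! m = map (\<lambda>m. acta A (?fws ! m) (fibre_perm (?ind m)) (i (?fws ! m) (z m))) [0..<l] ! m"
          using m nth[OF m] by (simp add: cmps_def leg_def z_def)
      qed (simp add: cmps_def)
      have "cmp A n (mula A ?fws (idt A l (b l)) ?ms) ?gen = mula A ?fws (i l x) (cmps A ?fws ?ms ?gs)"
        unfolding gen using mula_Cmp[OF ix gsH idl msH] cmp_idt(2)[OF i_Hom[OF x]]
        unfolding sum_fibre_sizes[OF ws] by simp
      also have "\<dots> = acta A n ?Q (mula A ?fws (i l x) (map2 i ?fws (map z [0..<l])))"
        by (rule mula_inputs[of "i l x" ?fws, OF _ homs_ars[OF homs_i[OF zsO]] \<tau>', unfolded sum_fibre_sizes[OF ws]])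
          (use HomD(1)[OF ix] in \<open>simp_all add: cm\<close>)
      finally have e: "cmp A n (mula A ?fws (idt A l (b l)) ?ms) ?gen =
          acta A n ?Q (mula A ?fws (i l x) (map2 i ?fws (map z [0..<l])))" .
      have mF: "mula A ?fws (i l x) (map2 i ?fws (map z [0..<l])) \<in>
          hom A n (mulo A ?fws (oo F l x) (map2 (oo F) ?fws (map z [0..<l]))) (mulo A ?fws (b l) (map b ?fws))"
        using mula_Hom[OF ix homs_i[OF zsO]] unfolding sum_fibre_sizes[OF ws] .
      have Zo: "mulo h ?fws x (map z [0..<l]) \<in> obj h n"
        using h.mulo_Ob[OF xws zsO] unfolding sum_fibre_sizes[OF ws] .
      have MO: "obs h ?fws (map M [0..<l])" using Mo by (simp add: list_all2_conv_all_nth)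
      have "cmp A n ?R ?gen = cmp A n (acta A n ?Q (mu n l ?ws)) (acta A n ?Q (mula A ?fws (i l x) (map2 i ?fws (map z [0..<l]))))"
        unfolding cmp_assoc[OF genH RH QmuH] e by (rule refl)
      also have "\<dots> = acta A n ?Q (leg n (fibre_perm ?ws) (mulo h ?fws x (map z [0..<l])))"
        unfolding acta_Cmp[OF Q mF mu_Hom[OF ws], symmetric] mu_leg[OF ws x zsO] by (rule refl)
      also have "\<dots> = leg n (?Q \<circ> fibre_perm ?ws) (acto h n ?Q (mulo h ?fws x (map z [0..<l])))"
        by (rule leg_act[OF pws Q Zo])
      also have "mulo h ?fws x (map z [0..<l]) = acto h n (inv ?Q) (mulo h ?fws x (map M [0..<l]))"
      proof -
        have "list_all2 (\<lambda>n t. t permutes {..<n}) ?fws ?\<tau>" using \<tau>' by (simp add: list_all2_conv_all_nth)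
        note h.mulo_equivariant_inputs[OF xws MO this]
        moreover have "map (\<lambda>m. acto h (?fws ! m) (inv (?\<tau> ! m)) (map M [0..<l] ! m)) [0..<length ?fws] = map z [0..<l]"
          by (simp add: z_def)
        ultimately show ?thesis unfolding sum_fibre_sizes[OF ws] by (simp only:)
      qed
      also have "acto h n ?Q (acto h n (inv ?Q) (mulo h ?fws x (map M [0..<l]))) = mulo h ?fws x (map M [0..<l])"
        by (rule h.acto_inv(1)[OF Q]) (use h.mulo_Ob[OF xws MO] in \<open>simp add: sum_fibre_sizes[OF ws]\<close>)
      also have "\<dots> = ?X"
      proof -
        have "mulo h (concat nss) (mulo h (map length nss) x ys) (concat zss) =
            mulo h (map sum_list nss) x (map (\<lambda>m. mulo h (nss ! m) (ys ! m) (zss ! m)) [0..<length nss])"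
          by (rule h.mulo_assoc) (use x ln ly ym zss(2) in \<open>simp_all add: list_all2_conv_all_nth\<close>)
        then show ?thesis unfolding cf lf sf zss(1) ln by (simp add: M_def[abs_def])
      qed
      finally show ?thesis .
    qed
    ultimately show "cmp A n ?L ?gen = cmp A n ?R ?gen" by (simp add: PQ)
  qed
  have q1: "idns A f (map b f) = map (\<lambda>T. idt A T (b T)) f" by (rule nth_equalityI) simp_all
  have q2: "?ms = map (\<lambda>m. imu sym_operad (length (fibre_elems ?ws m), length (fibre_elems w m), ?ind m)) [0..<l]"
    using ind by simp
  show ?thesis
    using LR[unfolded q1 q2] s w ws concat_induced_sizes[OF s w]
    by (simp add: internal_assoc_def Let_def fibs_Omega_sym f_def)
qed

end


context colimit_operad
begin

lemma sym_operad_unit_right: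
  "cmp A k (mu k k [0..<k]) (mula A (replicate k 1) (idt A k (b k)) (replicate k (i 1 (unt h)))) =
    idt A k (b k)"
proof -
  let ?e = "replicate k (i 1 (unt h))" and ?o = "replicate k (1 :: nat)" and ?I = "idt A k (b k)"
  have u: "[0..<k] \<in> fin_maps k k" by (rule upt_fin_maps)
  have fs: "fibre_sizes [0..<k] k = ?o" using fibre_sizes_perm_list[OF permutes_id, of k] by (simp add: id_def)
  have e: "homs A ?o ?e (replicate k (unt A)) (map b ?o)"
    using i_Hom[OF h.unt_Ob] F_unt by (simp add: homs_def)
  have ho: "obs h ?o (replicate k (unt h))" using h.unt_Ob by (simp add: list_all2_conv_all_nth)
  have m: "mu k k [0..<k] \<in> hom A k (mulo A ?o (b k) (map b ?o)) (b k)"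
    using mu_Hom[OF u] unfolding fs by (simp add: fibre_perm_sorted acto_id[OF b_Ob])
  have bo: "?I \<in> hom A (length ?o) (b k) (b k)" using idn_b_Hom by simp
  have d: "mula A ?o ?I ?e \<in> hom A k (b k) (mulo A ?o (b k) (map b ?o))"
    using mula_Hom[OF bo e] mulo_unit(2)[OF b_Ob[of k]] by (simp add: sum_list_replicate)
  show ?thesis
  proof (rule i_epic[OF cmp_hom[OF d m] idn_b_Hom])
    fix x assume x: "x \<in> obj h k"
    have ix: "i k x \<in> hom A (length ?o) (oo F k x) (b k)" using i_Hom[OF x] by simp
    have ui: "idns A ?o (replicate k (unt A)) = replicate k (idt A 1 (unt A))"
      by (rule nth_equalityI) simp_all
    have "cmp A k (mula A ?o ?I ?e) (i k x) = mula A ?o (i k x) ?e"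
      using mula_split(2)[OF ix e] mula_unit(2)[OF HomD(1)[OF i_Hom[OF x]]] unfolding ui
      by (simp add: sum_list_replicate)
    also have "?e = map2 i ?o (replicate k (unt h))" by (rule nth_equalityI) simp_all
    finally have "cmp A k (cmp A k (mu k k [0..<k]) (mula A ?o ?I ?e)) (i k x) =
        leg k (fibre_perm [0..<k]) (mulo h ?o x (replicate k (unt h)))"
      using mu_leg[OF u x, unfolded fs, OF ho] cmp_assoc[OF i_Hom[OF x] d m] by simp
    also have "\<dots> = cmp A k ?I (i k x)"
      using cmp_idt(2)[OF i_Hom[OF x]] h.mulo_unit(2)[OF x] leg_id[OF x] by (simp add: fibre_perm_sorted)
    finally show "cmp A k (cmp A k (mu k k [0..<k]) (mula A ?o ?I ?e)) (i k x) =
        cmp A k ?I (i k x)" .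
  qed
qed

lemma sym_operad_unit_left:
  assumes s: "s \<in> fin_maps k 1"
  shows "cmp A k (mu k 1 s) (mula A [k] (i 1 (unt h)) [idt A k (b k)]) = idt A k (b k)"
proof -
  let ?I = "idt A k (b k)" and ?e = "i 1 (unt h)"
  have fs: "fibre_sizes s 1 = [k]" by (rule fibre_sizes_fin_maps_1[OF s])
  have "sorted s" using fin_maps_1[THEN iffD1, OF s] by simp
  then have fp: "fibre_perm s = id" by (rule fibre_perm_sorted)
  have e: "?e \<in> hom A (length [k]) (unt A) (b 1)" using i_Hom[OF h.unt_Ob] F_unt by simp
  have hI: "homs A [k] [?I] [b k] [b k]" using idn_b_Hom by (simp add: homs_def)
  have m: "mu k 1 s \<in> hom A k (mulo A [k] (b 1) [b k]) (b k)"
    using mu_Hom[OF s] unfolding fs fp by (simp add: acto_id[OF b_Ob])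
  have d: "mula A [k] ?e [?I] \<in> hom A k (b k) (mulo A [k] (b 1) [b k])"
    using mula_Hom[OF e hI] mulo_unit(1)[OF b_Ob[of k]] by simp
  show ?thesis
  proof (rule i_epic[OF cmp_hom[OF d m] idn_b_Hom])
    fix x assume x: "x \<in> obj h k"
    have hx: "homs A [k] [i k x] [oo F k x] [b k]" using i_Hom[OF x] by (simp add: homs_def)
    have ho: "obs h [k] [x]" using x by simp
    have "cmp A k (mula A [k] ?e [?I]) (i k x) = mula A [k] ?e (map2 i [k] [x])"
      using mula_split(1)[OF e hx] mula_unit(1)[OF HomD(1)[OF i_Hom[OF x]]] by simp
    then have "cmp A k (cmp A k (mu k 1 s) (mula A [k] ?e [?I])) (i k x) =
        leg k id (mulo h [k] (unt h) [x])"
      using mu_leg[OF s h.unt_Ob, unfolded fs, OF ho] cmp_assoc[OF i_Hom[OF x] d m] fp by simp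
    then show "cmp A k (cmp A k (mu k 1 s) (mula A [k] ?e [?I])) (i k x) = cmp A k ?I (i k x)"
      using cmp_idt(2)[OF i_Hom[OF x]] h.mulo_unit(1)[OF x] leg_id[OF x] by simp
  qed
qed

lemma sym_operad_internal: "is_internal_operad Omega_sym A sym_operad"
  unfolding is_internal_operad_def
proof (intro conjI ballI)
  show "iob sym_operad \<in> extensional (IOb Omega_sym)" "imu sym_operad \<in> extensional (index_arrows Omega_sym)"
    by (simp_all add: sym_operad_def)
  show "iob sym_operad k \<in> obj A (Tips Omega_sym k)" for k by (simp add: b_Ob)
  show "ieps sym_operad \<in> hom A 1 (unt A) (iob sym_operad (UnitI Omega_sym))"
    using i_Hom[OF h.unt_Ob] F_unt by simp
  fix n k l s assume s: "s \<in> IHom Omega_sym n k"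
  show "imu sym_operad (n, k, s) \<in> hom A (Tips Omega_sym n)
      (mulo A (map (Tips Omega_sym) (fibs Omega_sym n k s)) (iob sym_operad k) (map (iob sym_operad) (fibs Omega_sym n k s)))
      (acto A (Tips Omega_sym n) (ipi Omega_sym s) (iob sym_operad n))"
    using s mu_Hom[of s n k] by (simp add: fibs_Omega_sym)
  show "internal_assoc Omega_sym A sym_operad n k l s w" if "w \<in> IHom Omega_sym k l" for w
    using sym_operad_assoc s that by simp
next
  fix k
  show "cmp A (Tips Omega_sym k) (imu sym_operad (k, k, IId Omega_sym k))
      (mula A (replicate (Tips Omega_sym k) 1) (idt A (Tips Omega_sym k) (iob sym_operad k))
        (replicate (Tips Omega_sym k) (ieps sym_operad))) =
      idt A (Tips Omega_sym k) (iob sym_operad k)"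
    using sym_operad_unit_right[of k] upt_fin_maps[of k] by simp
  show "cmp A (Tips Omega_sym k) (imu sym_operad (k, UnitI Omega_sym, s))
      (mula A [Tips Omega_sym k] (ieps sym_operad) [idt A (Tips Omega_sym k) (iob sym_operad k)]) =
      idt A (Tips Omega_sym k) (iob sym_operad k)" if "s \<in> IHom Omega_sym k (UnitI Omega_sym)" for s
    using sym_operad_unit_left[of s k] that by simp
qed

end

lemma (in internal_symmetric) slice_act_inverse:
  assumes p: "p permutes {..<k}" and g: "g \<in> hom A k x (iob c k)"
  shows "acta A k p (slice_act k (inv p) g) = cmp A k (perm_arrow k p) g"
proof -
  have pi: "inv p permutes {..<k}" by (rule permutes_inv[OF p])
  have "slice_act k (inv p) g = acta A k (inv p) (cmp A k (perm_arrow k p) g)"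
    unfolding slice_act_def perm_back_def permutes_inv_inv[OF p]
    by (rule acta_Cmp[OF pi g perm_arrow_Hom[OF p], symmetric])
  then show ?thesis
    using acta_inv(1)[OF p HomD(1)[OF cmp_hom[OF g perm_arrow_Hom[OF p]]]] by simp
qed

context colimit_operad
begin

lemma cocone_factor:
  assumes z: "z \<in> obj A k"
    and G: "\<And>x. x \<in> obj h k \<Longrightarrow> G x \<in> hom A k (oo F k x) z"
      "\<And>x y f. f \<in> hom h k x y \<Longrightarrow> cmp A k (G y) (oa F k f) = G x"
  obtains g where "g \<in> hom A k (b k) z" "\<And>x. x \<in> obj h k \<Longrightarrow> cmp A k g (i k x) = G x"
proof -
  have "is_cocone (cat h k) (cat A k) (op_component F k) z G"
    using z G by (auto simp: is_cocone_def op_component_def Hom_def)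
  then show thesis using colimit_factor[OF colimit] that by blast
qed

lemma homs_factor:
  assumes "\<And>k. f k \<in> hom A k (b k) (z k)"
  shows "homs A ns (map f ns) (map b ns) (map z ns)"
  using assms by (simp add: homs_def)

text \<open>The two sides of the condition on a map of internal operads out of \<open>sym_operad\<close>, evaluated on the
  legs: both depend only on the composites of the map with legs.\<close>

lemma precompose_legs:
  assumes s: "s \<in> fin_maps n k" and x: "x \<in> obj h k" and ys: "obs h (fibre_sizes s k) ys"
    and f: "\<And>k. f k \<in> hom A k (b k) (z k)"
    and m: "m \<in> hom A n (mulo A (fibre_sizes s k) (z k) (map z (fibre_sizes s k))) z'"
  shows "cmp A n (cmp A n m (mula A (fibre_sizes s k) (f k) (map f (fibre_sizes s k))))
        (mula A (fibre_sizes s k) (i k x) (map2 i (fibre_sizes s k) ys)) =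
      cmp A n m (mula A (fibre_sizes s k) (cmp A k (f k) (i k x))
        (map2 (\<lambda>k x. cmp A k (f k) (i k x)) (fibre_sizes s k) ys))"
    and "cmp A n (cmp A n (acta A n (fibre_perm s) (f n)) (mu n k s))
        (mula A (fibre_sizes s k) (i k x) (map2 i (fibre_sizes s k) ys)) =
      acta A n (fibre_perm s) (cmp A n (f n)
        (i n (acto h n (inv (fibre_perm s)) (mulo h (fibre_sizes s k) x ys))))"
proof -
  let ?ns = "fibre_sizes s k" and ?p = "fibre_perm s"
  have sn: "sum_list ?ns = n" by (rule sum_fibre_sizes[OF s])
  have p: "?p permutes {..<n}" by (rule fin_maps_perm[OF s])
  have ix: "i k x \<in> hom A (length ?ns) (oo F k x) (b k)" and fk: "f k \<in> hom A (length ?ns) (b k) (z k)"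
    using i_Hom[OF x] f by simp_all
  note iss = homs_i[OF ys] and fs = homs_factor[of f z ?ns, OF f]
  have gH: "mula A ?ns (i k x) (map2 i ?ns ys) \<in> hom A n (mulo A ?ns (oo F k x) (map2 (oo F) ?ns ys)) (mulo A ?ns (b k) (map b ?ns))"
    using mula_Hom[OF ix iss] unfolding sn .
  have fH: "mula A ?ns (f k) (map f ?ns) \<in> hom A n (mulo A ?ns (b k) (map b ?ns)) (mulo A ?ns (z k) (map z ?ns))"
    using mula_Hom[OF fk fs] unfolding sn .
  have "cmps A ?ns (map f ?ns) (map2 i ?ns ys) = map2 (\<lambda>k x. cmp A k (f k) (i k x)) ?ns ys"
    using list_all2_lengthD[OF ys] by (auto simp: cmps_def intro!: nth_equalityI)
  then show "cmp A n (cmp A n m (mula A ?ns (f k) (map f ?ns))) (mula A ?ns (i k x) (map2 i ?ns ys)) =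
      cmp A n m (mula A ?ns (cmp A k (f k) (i k x)) (map2 (\<lambda>k x. cmp A k (f k) (i k x)) ?ns ys))"
    using cmp_assoc[OF gH fH m] mula_Cmp[OF ix iss fk fs] sn by simp
  have X: "mulo h ?ns x ys \<in> obj h n" using h.mulo_Ob[of x ?ns ys] x ys sn by simp
  have Y: "acto h n (inv ?p) (mulo h ?ns x ys) \<in> obj h n" by (rule h.acto_Ob[OF permutes_inv[OF p] X])
  have "cmp A n (cmp A n (acta A n ?p (f n)) (mu n k s)) (mula A ?ns (i k x) (map2 i ?ns ys)) =
      cmp A n (acta A n ?p (f n)) (leg n ?p (mulo h ?ns x ys))"
    unfolding cmp_assoc[OF gH mu_Hom[OF s] acta_Hom[OF p f]] mu_leg[OF s x ys] by (rule refl)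
  then show "cmp A n (cmp A n (acta A n ?p (f n)) (mu n k s)) (mula A ?ns (i k x) (map2 i ?ns ys)) =
      acta A n ?p (cmp A n (f n) (i n (acto h n (inv ?p) (mulo h ?ns x ys))))"
    unfolding leg_def by (simp add: acta_Cmp[OF p i_Hom[OF Y] f])
qed

end

locale universal_colimit = colimit_operad A h V F b i + operadic_index X
  for A h :: "'u cat_operad" and V :: "'v itself" and F b i and X :: "('i, 'f) index_category" +
  fixes u :: "('i, 'f, 'u) internal_operad"
  assumes rep: "represents X h u" and universe: "infinite (UNIV :: 'u set)"
begin

definition unit_map :: "'i \<Rightarrow> 'u" where
  "unit_map = (\<lambda>T\<in>IOb X. i (Tips X T) (iob u T))"

lemma u_internal: "is_internal_operad X h u"
  by (rule represents_operad(2)[OF rep])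

lemma unit_map_internal: "is_internal_map X A (image_operad X u F) (desymmetrise X sym_operad) unit_map"
  unfolding is_internal_map_def
proof (intro conjI ballI)
  show "is_internal_operad X A (image_operad X u F)" by (rule image_operad_internal[OF rep operad F])
  show "is_internal_operad X A (desymmetrise X sym_operad)" by (rule desymmetrise_internal[OF sym_operad_internal])
  show "unit_map \<in> extensional (IOb X)" by (simp add: unit_map_def)
  show "unit_map T \<in> hom A (Tips X T) (iob (image_operad X u F) T) (iob (desymmetrise X sym_operad) T)"
    if "T \<in> IOb X" for T
    using that i_Hom[OF internal_ob[OF u_internal that]] by (simp add: unit_map_def image_operad_simps)
  show "cmp A 1 (unit_map (UnitI X)) (ieps (image_operad X u F)) = ieps (desymmetrise X sym_operad)"
    using i_natural[OF internal_eps[OF u_internal]] by (simp add: unit_map_def UnitI_IOb Tips_UnitI image_operad_simps)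
  fix T S s assume q: "T \<in> IOb X" "S \<in> IOb X" "s \<in> IHom X T S"
  let ?n = "Tips X T" and ?k = "Tips X S" and ?s = "tip_map X s" and ?fs = "fibs X T S s"
  have s: "?s \<in> fin_maps ?n ?k" by (rule tip_map[OF q])
  have p: "fibre_perm ?s permutes {..<?n}" by (rule fin_maps_perm[OF s])
  have ns: "map (Tips X) ?fs = fibre_sizes ?s ?k" by (rule Tips_fibs[OF q])
  note fo = fibs_IOb[OF q]
  have um: "map unit_map ?fs = map2 i (fibre_sizes ?s ?k) (map (iob u) ?fs)"
    unfolding ns[symmetric] by (rule nth_equalityI) (use fo in \<open>auto simp: unit_map_def subset_iff\<close>)
  have uo: "obs h (fibre_sizes ?s ?k) (map (iob u) ?fs)"
    unfolding ns[symmetric] using fo internal_ob[OF u_internal] by (auto simp: list_all2_conv_all_nth subset_iff)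
  have uH: "imu u (T, S, s) \<in> hom h ?n (mulo h (fibre_sizes ?s ?k) (iob u S) (map (iob u) ?fs)) (acto h ?n (fibre_perm ?s) (iob u T))"
    using internal_mu[OF u_internal q] unfolding ns ipi_def .
  have uS: "iob u S \<in> obj h ?k" and uT: "iob u T \<in> obj h ?n" using internal_ob[OF u_internal] q by auto
  show "cmp A ?n (imu (desymmetrise X sym_operad) (T, S, s)) (mula A (map (Tips X) ?fs) (unit_map S) (map unit_map ?fs)) =
      cmp A ?n (acta A ?n (ipi X s) (unit_map T)) (imu (image_operad X u F) (T, S, s))"
    unfolding ns um desymmetrise_simps(2)[OF q] image_operad_simps(2)[OF q] sym_operad_simps(2)[OF s] ipi_def
    using mu_leg[OF s uS uo] leg_natural[OF p uH] leg_action[OF p uT] q by (simp add: unit_map_def)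
qed

text \<open>On the legs, compatibility with \<open>\<mu>\<close> is compatibility of the cocones with multiplication and
  permutations, by \<open>mu_factor\<close>.\<close>

lemma map_exists:
  assumes c: "is_internal_operad Omega_sym A c"
    and f: "is_internal_map X A (image_operad X u F) (desymmetrise X c) f"
  obtains g where "is_internal_map Omega_sym A sym_operad c g"
    "\<And>T. T \<in> IOb X \<Longrightarrow> cmp A (Tips X T) (g (Tips X T)) (unit_map T) = f T"
proof -
  interpret c: internal_symmetric A c by unfold_locales (rule c)
  obtain G where G: "\<And>k x. x \<in> obj h k \<Longrightarrow> G k x \<in> hom A k (oo F k x) (iob c k)"
    "\<And>k x y g. g \<in> hom h k x y \<Longrightarrow> cmp A k (G k y) (oa F k g) = G k x"
    "\<And>k p x. p permutes {..<k} \<Longrightarrow> x \<in> obj h k \<Longrightarrow> G k (acto h k p x) = c.slice_act k p (G k x)"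
    "G 1 (unt h) = ieps c"
    "\<And>ns x ys. x \<in> obj h (length ns) \<Longrightarrow> obs h ns ys \<Longrightarrow>
       G (sum_list ns) (mulo h ns x ys) = c.slice_mul ns (G (length ns) x) (map2 G ns ys)"
    "\<And>T. T \<in> IOb X \<Longrightarrow> G (Tips X T) (iob u T) = f T"
    by (rule c.slice_cocone[OF universe operadic_index_axioms rep F f]) (rule that)
  have "\<exists>g. g \<in> hom A k (b k) (iob c k) \<and> (\<forall>x\<in>obj h k. cmp A k g (i k x) = G k x)" for k
    using cocone_factor[OF c.ob_Ob[of k] G(1,2)] by metis
  then obtain g where gH: "\<And>k. g k \<in> hom A k (b k) (iob c k)"
    and gi: "\<And>k x. x \<in> obj h k \<Longrightarrow> cmp A k (g k) (i k x) = G k x" by metis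
  have "is_internal_map Omega_sym A sym_operad c g"
    unfolding is_internal_map_def
  proof (intro conjI ballI)
    show "is_internal_operad Omega_sym A sym_operad" "is_internal_operad Omega_sym A c"
      by (rule sym_operad_internal, rule c)
    show "g \<in> extensional (IOb Omega_sym)" by simp
    show "g k \<in> hom A (Tips Omega_sym k) (iob sym_operad k) (iob c k)" for k using gH by simp
    show "cmp A 1 (g (UnitI Omega_sym)) (ieps sym_operad) = ieps c" using gi[OF h.unt_Ob] G(4) by simp
    fix n k s assume "s \<in> IHom Omega_sym n k"
    then have s: "s \<in> fin_maps n k" by simp
    let ?ns = "fibre_sizes s k" and ?p = "fibre_perm s"
    have sn: "sum_list ?ns = n" by (rule sum_fibre_sizes[OF s])
    have p: "?p permutes {..<n}" by (rule fin_maps_perm[OF s])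
    have gk: "g k \<in> hom A (length ?ns) (b k) (iob c k)" using gH by simp
    have mH: "mula A ?ns (g k) (map g ?ns) \<in> hom A n (mulo A ?ns (b k) (map b ?ns)) (mulo A ?ns (iob c k) (map (iob c) ?ns))"
      using mula_Hom[OF gk homs_factor[of g "iob c" ?ns, OF gH]] unfolding sn .
    have "cmp A n (imu c (n, k, s)) (mula A ?ns (g k) (map g ?ns)) = cmp A n (acta A n ?p (g n)) (mu n k s)"
    proof (rule mul_i_epic[of _ ?ns, unfolded sn length_fibre_sizes])
      show "cmp A n (imu c (n, k, s)) (mula A ?ns (g k) (map g ?ns)) \<in> hom A n (mulo A ?ns (b k) (map b ?ns)) (acto A n ?p (iob c n))"
        by (rule cmp_hom[OF mH c.mu_Hom[OF s]])
      show "cmp A n (acta A n ?p (g n)) (mu n k s) \<in> hom A n (mulo A ?ns (b k) (map b ?ns)) (acto A n ?p (iob c n))"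
        by (rule cmp_hom[OF mu_Hom[OF s] acta_Hom[OF p gH]])
      fix x ys assume x: "x \<in> obj h k" and ys: "obs h ?ns ys"
      have x': "x \<in> obj h (length ?ns)" using x by simp
      have X: "mulo h ?ns x ys \<in> obj h n" using h.mulo_Ob[OF x' ys] unfolding sn .
      have "map2 (\<lambda>k x. cmp A k (g k) (i k x)) ?ns ys = map2 G ?ns ys"
        by (rule nth_equalityI) (use ys gi in \<open>auto simp: list_all2_conv_all_nth\<close>)
      note l = precompose_legs(1)[OF s x ys gH c.mu_Hom[OF s], unfolded this gi[OF x]]
      have Gx: "G k x \<in> hom A (length ?ns) (oo F k x) (iob c k)" using G(1)[OF x] by simp
      have Gs: "homs A ?ns (map2 G ?ns ys) (map2 (oo F) ?ns ys) (map (iob c) ?ns)"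
        using ys G(1) by (auto simp: homs_def list_all2_conv_all_nth)
      have MH: "mula A ?ns (G k x) (map2 G ?ns ys) \<in> hom A n (mulo A ?ns (oo F k x) (map2 (oo F) ?ns ys)) (mulo A ?ns (iob c k) (map (iob c) ?ns))"
        using mula_Hom[OF Gx Gs] unfolding sn .
      have "cmp A n (imu c (n, k, s)) (mula A ?ns (G k x) (map2 G ?ns ys)) =
          cmp A n (c.perm_arrow n ?p) (G n (mulo h ?ns x ys))"
        unfolding c.mu_factor[OF s]
        using cmp_assoc[OF MH _ c.perm_arrow_Hom[OF p]] c.mult_Hom[of ?ns] G(5)[OF x' ys] sn
        by (simp add: c.slice_mul_def)
      also have "\<dots> = acta A n ?p (G n (acto h n (inv ?p) (mulo h ?ns x ys)))"
        using c.slice_act_inverse[OF p G(1)[OF X]] G(3)[OF permutes_inv[OF p] X] by simp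
      finally show "cmp A n (cmp A n (imu c (n, k, s)) (mula A ?ns (g k) (map g ?ns))) (mula A ?ns (i k x) (map2 i ?ns ys)) =
          cmp A n (cmp A n (acta A n ?p (g n)) (mu n k s)) (mula A ?ns (i k x) (map2 i ?ns ys))"
        unfolding l precompose_legs(2)[OF s x ys gH c.mu_Hom[OF s]] gi[OF h.acto_Ob[OF permutes_inv[OF p] X]] .
    qed
    then show "cmp A (Tips Omega_sym n) (imu c (n, k, s))
          (mula A (map (Tips Omega_sym) (fibs Omega_sym n k s)) (g k) (map g (fibs Omega_sym n k s))) =
        cmp A (Tips Omega_sym n) (acta A (Tips Omega_sym n) (ipi Omega_sym s) (g n)) (imu sym_operad (n, k, s))"
      using s by (simp add: fibs_Omega_sym)
  qed
  moreover have "cmp A (Tips X T) (g (Tips X T)) (unit_map T) = f T" if "T \<in> IOb X" for T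
    using gi[OF internal_ob[OF u_internal that]] G(6)[OF that] that by (simp add: unit_map_def)
  ultimately show thesis by (rule that)
qed

text \<open>The objects on which two maps agree are closed under the operad structure of \<open>h\<close> and contain the
  universal internal operad, and \<open>h\<close> is generated by the latter.\<close>

lemma map_unique:
  assumes f: "is_internal_map Omega_sym A sym_operad c f" and g: "is_internal_map Omega_sym A sym_operad c g"
    and eq: "\<And>T. T \<in> IOb X \<Longrightarrow> cmp A (Tips X T) (f (Tips X T)) (unit_map T) = cmp A (Tips X T) (g (Tips X T)) (unit_map T)"
  shows "f = g"
proof -
  have c: "is_internal_operad Omega_sym A c" using f by (simp add: is_internal_map_def)
  interpret c: internal_symmetric A c by unfold_locales (rule c)
  have fH: "f k \<in> hom A k (b k) (iob c k)" and gH: "g k \<in> hom A k (b k) (iob c k)" for k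
    using f g by (auto simp: is_internal_map_def)
  define P where "P k = {x \<in> obj h k. cmp A k (f k) (i k x) = cmp A k (g k) (i k x)}" for k
  define M where "M k = {a \<in> arr h k. src h k a \<in> P k \<and> trg h k a \<in> P k}" for k
  have legs: "acto h n (inv (fibre_perm s)) (mulo h (fibre_sizes s k) x ys) \<in> P n"
    if s: "s \<in> fin_maps n k" and x: "x \<in> P k" and ys: "each P (fibre_sizes s k) ys" for n k s x ys
  proof -
    let ?ns = "fibre_sizes s k" and ?p = "fibre_perm s"
    let ?y = "acto h n (inv ?p) (mulo h ?ns x ys)"
    have p: "?p permutes {..<n}" by (rule fin_maps_perm[OF s])
    have xo: "x \<in> obj h k" and yo: "obs h ?ns ys"
      using x ys by (auto simp: P_def list_all2_conv_all_nth)
    have X: "mulo h ?ns x ys \<in> obj h n"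
      using h.mulo_Ob[of x ?ns ys] xo yo sum_fibre_sizes[OF s] by simp
    have y: "?y \<in> obj h n" by (rule h.acto_Ob[OF permutes_inv[OF p] X])
    have m: "cmp A n (imu c (n, k, s)) (mula A ?ns (r k) (map r ?ns)) = cmp A n (acta A n ?p (r n)) (mu n k s)"
      if "is_internal_map Omega_sym A sym_operad c r" for r
      using that s unfolding is_internal_map_def by (simp add: fibs_Omega_sym)
    have l: "cmp A n (imu c (n, k, s)) (mula A ?ns (cmp A k (r k) (i k x))
        (map2 (\<lambda>k x. cmp A k (r k) (i k x)) ?ns ys)) = acta A n ?p (cmp A n (r n) (i n ?y))"
      if r: "is_internal_map Omega_sym A sym_operad c r" and rH: "\<And>k. r k \<in> hom A k (b k) (iob c k)" for r
      using precompose_legs[OF s xo yo rH c.mu_Hom[OF s]] m[OF r] by simp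
    have e: "map2 (\<lambda>k x. cmp A k (f k) (i k x)) ?ns ys = map2 (\<lambda>k x. cmp A k (g k) (i k x)) ?ns ys"
      by (rule nth_equalityI) (use ys in \<open>auto simp: P_def list_all2_conv_all_nth\<close>)
    have ex: "cmp A k (f k) (i k x) = cmp A k (g k) (i k x)" using x by (simp add: P_def)
    have "acta A n ?p (cmp A n (f n) (i n ?y)) = acta A n ?p (cmp A n (g n) (i n ?y))"
      by (rule trans[OF l[OF f fH, unfolded e ex, symmetric] l[OF g gH]])
    then have "cmp A n (f n) (i n ?y) = cmp A n (g n) (i n ?y)"
      using acta_inv(2)[OF p HomD(1)[OF cmp_hom[OF i_Hom[OF y] fH]]]
        acta_inv(2)[OF p HomD(1)[OF cmp_hom[OF i_Hom[OF y] gH]]] by metis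
    then show ?thesis using y by (simp add: P_def)
  qed
  have unit: "unt h \<in> P 1"
    using f g h.unt_Ob by (simp add: P_def is_internal_map_def)
  have mul: "mulo h ns x ys \<in> P (sum_list ns)"
    if "x \<in> P (length ns)" "each P ns ys" for ns x ys
  proof -
    have "x \<in> obj h (length ns)" "obs h ns ys"
      using that by (auto simp: P_def list_all2_conv_all_nth)
    then show ?thesis
      using legs[OF monotone_map_fin_maps, of x ns ys] that h.acto_id[OF h.mulo_Ob]
      by (simp add: fibre_sizes_monotone_map fibre_perm_sorted[OF sorted_monotone_map])
  qed
  have act: "acto h k p x \<in> P k" if p: "p permutes {..<k}" and x: "x \<in> P k" for k p x
  proof -
    have pi: "inv p permutes {..<k}" by (rule permutes_inv[OF p])
    have "each P (replicate k 1) (replicate k (unt h))"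
      using unit by (simp add: list_all2_conv_all_nth)
    moreover have "mulo h (replicate k 1) x (replicate k (unt h)) = x"
      by (rule h.mulo_unit(2)) (use x in \<open>simp add: P_def\<close>)
    ultimately show ?thesis
      using legs[OF perm_list_fin_maps[OF pi] x, unfolded fibre_sizes_perm_list[OF pi], of "replicate k (unt h)"]
      by (simp add: fibre_perm_of_perm[OF pi] permutes_inv_inv[OF p])
  qed
  have Ml: "obs h ns (map2 (\<lambda>n. src h n) ns as)" "obs h ns (map2 (\<lambda>n. trg h n) ns as)"
    "each P ns (map2 (\<lambda>n. src h n) ns as)"
    "each P ns (map2 (\<lambda>n. trg h n) ns as)"
    "homs h ns as (map2 (\<lambda>n. src h n) ns as) (map2 (\<lambda>n. trg h n) ns as)"
    if "each M ns as" for ns as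
    using that by (auto simp: M_def P_def homs_def Hom_def list_all2_conv_all_nth)
  have "operad_closed h P M"
    unfolding operad_closed_def
  proof (intro conjI allI ballI impI)
    show "P k \<subseteq> obj h k" "M k \<subseteq> arr h k" for k by (auto simp: P_def M_def)
    show "src h k a \<in> P k" "trg h k a \<in> P k" if "a \<in> M k" for k a using that by (auto simp: M_def)
    show "idt h k x \<in> M k" if "x \<in> P k" for k x
      using that Idn_Hom[OF h.category[of k], of x] by (auto simp: M_def P_def Hom_def)
    show "cmp h k a' a \<in> M k" if "a \<in> M k" "a' \<in> M k" "trg h k a = src h k a'" for k a a'
      using that Cmp_Hom[OF h.category[of k], of a "src h k a" "trg h k a" a' "trg h k a'"]
      by (auto simp: M_def Hom_def)
    show "acto h k p x \<in> P k" if "p permutes {..<k}" "x \<in> P k" for k p x by (rule act[OF that])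
    show "acta h k p a \<in> M k" if "p permutes {..<k}" "a \<in> M k" for k p a
      using that act[OF that(1)] h.acta_Hom[OF that(1), of a "src h k a" "trg h k a"]
      by (auto simp: M_def Hom_def)
    show "unt h \<in> P 1" by (rule unit)
    show "mulo h ns x ys \<in> P (sum_list ns)" if "x \<in> P (length ns)" "each P ns ys" for ns x ys
      by (rule mul[OF that])
    show "mula h ns a as \<in> M (sum_list ns)" if a: "a \<in> M (length ns)" and as: "each M ns as" for ns a as
    proof -
      have "a \<in> hom h (length ns) (src h (length ns) a) (trg h (length ns) a)"
        using a by (simp add: M_def Hom_def)
      from h.mula_Hom[OF this Ml(5)[OF as]] show ?thesis
        using mul[OF _ Ml(3)[OF as]] mul[OF _ Ml(4)[OF as]] a by (simp add: M_def Hom_def)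
    qed
  qed
  moreover have uP: "iob u T \<in> P (Tips X T)" if "T \<in> IOb X" for T
    using eq[OF that] internal_ob[OF u_internal that] that by (simp add: P_def unit_map_def)
  moreover have uM: "imu u (T, S, s) \<in> M (Tips X T)" if q: "T \<in> IOb X" "S \<in> IOb X" "s \<in> IHom X T S" for T S s
  proof -
    have "each P (map (Tips X) (fibs X T S s)) (map (iob u) (fibs X T S s))"
      using fibs_IOb[OF q] uP by (auto simp: list_all2_conv_all_nth subset_iff)
    moreover have "sum_list (map (Tips X) (fibs X T S s)) = Tips X T" "length (fibs X T S s) = Tips X S"
      using Tips_fibs[OF q] sum_fibre_sizes[OF tip_map[OF q]] by (simp_all add: fibs_def)
    ultimately have "mulo h (map (Tips X) (fibs X T S s)) (iob u S) (map (iob u) (fibs X T S s)) \<in> P (Tips X T)"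
      using mul[of "iob u S" "map (Tips X) (fibs X T S s)"] uP[OF q(2)] by simp
    moreover have "acto h (Tips X T) (ipi X s) (iob u T) \<in> P (Tips X T)"
      unfolding ipi_def by (rule act[OF fin_maps_perm[OF tip_map[OF q]] uP[OF q(1)]])
    ultimately show ?thesis using internal_mu[OF u_internal q] by (simp add: M_def Hom_def)
  qed
  moreover have "ieps u \<in> M 1"
    using internal_eps[OF u_internal] unit uP[OF UnitI_IOb] by (simp add: M_def Hom_def Tips_UnitI)
  ultimately have "P k = obj h k" for k using represents_minimal(1)[OF rep] by blast
  then have "f k = g k" for k by (intro i_epic[OF fH gH]) (auto simp: P_def)
  then show ?thesis by blast
qed

end

lemma colimit_universal_arrow:
  fixes A h H :: "'u cat_operad" and u :: "(tree, tree_map, 'u) internal_operad"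
    and v :: "(nat, nat list, 'u) internal_operad"
  assumes n: "1 \<le> n" and inf: "infinite (UNIV :: 'u set)" "infinite (UNIV :: 'v set)"
    and A: "is_cocomplete_cat_operad TYPE('v) A" and h: "represents (Omega n) h u"
    and H: "represents Omega_sym H v" and a: "is_internal_operad (Omega n) A a"
  obtains b i \<eta> where
    "\<And>k. is_colimit (cat h k) (cat A k) (op_component (FOb (classify (Omega n) h u A) a) k) (iob b k) (i k)"
    "universal_arrow (IO (Omega n) A) (IO Omega_sym A) (zeta_star n h u H v A) a b \<eta>"
proof -
  define F where "F = FOb (classify (Omega n) h u A) a"
  have A': "is_cat_operad A" using A by (simp add: is_cocomplete_cat_operad_def)
  have clF: "is_op_functor h A F" "image_operad (Omega n) u F = a"
    unfolding F_def by (rule classify_functor[OF h A' a])+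
  interpret A: cocomplete_operad A "TYPE('v)"
    by unfold_locales (use A A' inf in auto)
  have "\<exists>c t. is_colimit (cat h k) (cat A k) (op_component F k) c t" for k
    using A.colimit_exists[OF represents_countable[OF h]] clF(1) unfolding is_op_functor_def by metis
  then obtain b i where col: "\<And>k. is_colimit (cat h k) (cat A k) (op_component F k) (b k) (i k)" by metis
  interpret h: cat_operad h by unfold_locales (rule represents_operad(1)[OF h])
  interpret X: operadic_index "Omega n" by (rule operadic_index_Omega[OF n])
  interpret universal_colimit A h "TYPE('v)" F b i "Omega n" u
    by unfold_locales (use clF(1) represents_countable[OF h] col h inf in auto)
  have R: "FOb (zeta_star n h u H v A) c = desymmetrise (Omega n) c" if "is_internal_operad Omega_sym A c" for c
    using zeta_star_Ob[OF n A' h H that] by (simp add: delta_desymmetrise)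
  have comp: "Cmp (IO (Omega n) A) (FAr (zeta_star n h u H v A) (sym_operad, g, c)) (a, unit_map, desymmetrise (Omega n) sym_operad) =
      (a, \<lambda>T\<in>IOb (Omega n). cmp A (Tips (Omega n) T) (g (Tips (Omega n) T)) (unit_map T), desymmetrise (Omega n) c)"
    if "is_internal_map Omega_sym A sym_operad c g" for g c
    unfolding zeta_star_Ar[OF n A' h H that]
    by (auto simp: IO_def delta_desymmetrise intro!: restrict_ext)
  have "universal_arrow (IO (Omega n) A) (IO Omega_sym A) (zeta_star n h u H v A) a sym_operad
      (a, unit_map, desymmetrise (Omega n) sym_operad)"
    unfolding universal_arrow_def
  proof (intro conjI ballI)
    show "sym_operad \<in> Ob (IO Omega_sym A)" using sym_operad_internal by (simp add: IO_def)
    show "(a, unit_map, desymmetrise (Omega n) sym_operad) \<in>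
        Hom (IO (Omega n) A) a (FOb (zeta_star n h u H v A) sym_operad)"
      using unit_map_internal unfolding R[OF sym_operad_internal] clF(2) by (simp add: IO_def Hom_def)
    fix c g assume "c \<in> Ob (IO Omega_sym A)" and g: "g \<in> Hom (IO (Omega n) A) a (FOb (zeta_star n h u H v A) c)"
    then have c: "is_internal_operad Omega_sym A c" by (simp add: IO_def)
    obtain f where f: "g = (a, f, desymmetrise (Omega n) c)" "is_internal_map (Omega n) A a (desymmetrise (Omega n) c) f"
      using g unfolding R[OF c] by (auto simp: IO_def Hom_def)
    obtain g' where g': "is_internal_map Omega_sym A sym_operad c g'"
      "\<And>T. T \<in> IOb (Omega n) \<Longrightarrow> cmp A (Tips (Omega n) T) (g' (Tips (Omega n) T)) (unit_map T) = f T"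
      by (rule map_exists[OF c f(2)[folded clF(2)]]) (rule that)
    have fe: "f \<in> extensional (IOb (Omega n))" using f(2) by (simp add: is_internal_map_def)
    show "\<exists>!f'. f' \<in> Hom (IO Omega_sym A) sym_operad c \<and>
        Cmp (IO (Omega n) A) (FAr (zeta_star n h u H v A) f') (a, unit_map, desymmetrise (Omega n) sym_operad) = g"
    proof (intro ex1I conjI)
      show "(sym_operad, g', c) \<in> Hom (IO Omega_sym A) sym_operad c" using g'(1) by (simp add: IO_def Hom_def)
      have "(\<lambda>T\<in>IOb (Omega n). cmp A (Tips (Omega n) T) (g' (Tips (Omega n) T)) (unit_map T)) = f"
        using g'(2) fe by (intro extensionalityI[of _ "IOb (Omega n)"]) auto
      then show "Cmp (IO (Omega n) A) (FAr (zeta_star n h u H v A) (sym_operad, g', c))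
          (a, unit_map, desymmetrise (Omega n) sym_operad) = g"
        unfolding comp[OF g'(1)] f(1) by simp
      fix f' assume f': "f' \<in> Hom (IO Omega_sym A) sym_operad c \<and>
        Cmp (IO (Omega n) A) (FAr (zeta_star n h u H v A) f') (a, unit_map, desymmetrise (Omega n) sym_operad) = g"
      then obtain g'' where g'': "f' = (sym_operad, g'', c)" "is_internal_map Omega_sym A sym_operad c g''"
        by (auto simp: IO_def Hom_def)
      have e: "(\<lambda>T\<in>IOb (Omega n). cmp A (Tips (Omega n) T) (g'' (Tips (Omega n) T)) (unit_map T)) = f"
        using conjunct2[OF f'] unfolding g''(1) comp[OF g''(2)] f(1) by simp
      have "cmp A (Tips (Omega n) T) (g'' (Tips (Omega n) T)) (unit_map T) = f T" if "T \<in> IOb (Omega n)" for T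
        using fun_cong[OF e, of T] that by (simp del: Omega_simps)
      then have "g'' = g'" by (intro map_unique[OF g''(2) g'(1)]) (simp only: g'(2))
      then show "f' = (sym_operad, g', c)" by (simp add: g''(1))
    qed
  qed
  then show thesis by (rule that[rotated]) (use col in \<open>simp add: F_def\<close>)
qed

theorem theorem13p1:
  fixes n :: nat
    and A h H :: "'u cat_operad"
    and u :: "(tree, tree_map, 'u) internal_operad"
    and v :: "(nat, nat list, 'u) internal_operad"
  assumes "1 \<le> n"
    and "infinite (UNIV :: 'u set)"
    and "infinite (UNIV :: 'v set)"
    and "is_cocomplete_cat_operad TYPE('v) A"
    and "represents (Omega n) h u"
    and "represents Omega_sym H v"
  shows "(\<exists>sym. is_left_adjoint (IO (Omega n) A) (IO Omega_sym A) sym (zeta_star n h u H v A)) \<and>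
    (\<forall>sym. is_left_adjoint (IO (Omega n) A) (IO Omega_sym A) sym (zeta_star n h u H v A) \<longrightarrow>
      (\<forall>a\<in>Ob (IO (Omega n) A). \<forall>k.
        \<exists>t. is_colimit (cat h k) (cat A k)
              (op_component (FOb (classify (Omega n) h u A) a) k)
              (iob (FOb sym a) k) t))"
proof (intro conjI allI ballI impI)
  let ?C = "IO (Omega n) A" and ?D = "IO Omega_sym A" and ?R = "zeta_star n h u H v A"
  have A: "is_cat_operad A" using assms(4) by (simp add: is_cocomplete_cat_operad_def)
  have R: "is_functor ?D ?C ?R" by (rule zeta_star_is_functor[OF assms(1) A assms(5,6)])
  have "\<exists>b \<eta>. universal_arrow ?C ?D ?R a b \<eta>" if "a \<in> Ob ?C" for a
  proof -
    have "is_internal_operad (Omega n) A a" using that by (simp add: IO_def)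
    from colimit_universal_arrow[OF assms this] show ?thesis by blast
  qed
  then show "\<exists>sym. is_left_adjoint ?C ?D sym ?R"
    by (rule left_adjoint_from_universal_arrows[OF represents_IO_category[OF assms(5) A] R])
  fix sym a k assume sym: "is_left_adjoint ?C ?D sym ?R" and a: "a \<in> Ob ?C"
  have "is_internal_operad (Omega n) A a" using a by (simp add: IO_def)
  then obtain b i \<eta> where
    col: "\<And>k. is_colimit (cat h k) (cat A k) (op_component (FOb (classify (Omega n) h u A) a) k) (iob b k) (i k)"
    and b: "universal_arrow ?C ?D ?R a b \<eta>"
    using colimit_universal_arrow[OF assms] by metis
  obtain \<eta>' where "universal_arrow ?C ?D ?R a (FOb sym a) \<eta>'"
    using left_adjoint_universal_arrow[OF sym a] by blast
  from universal_arrow_unique[OF R b this] obtain j j' where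
    j: "j \<in> Hom ?D b (FOb sym a)" "j' \<in> Hom ?D (FOb sym a) b" "Cmp ?D j' j = Idn ?D b" "Cmp ?D j j' = Idn ?D (FOb sym a)"
    by metis
  obtain f f' where f: "j = (b, f, FOb sym a)" "is_internal_map Omega_sym A b (FOb sym a) f"
    and f': "j' = (FOb sym a, f', b)" "is_internal_map Omega_sym A (FOb sym a) b f'"
    using j(1,2) by (auto simp: IO_def Hom_def)
  have fk: "f k \<in> hom A k (iob b k) (iob (FOb sym a) k)" "f' k \<in> hom A k (iob (FOb sym a) k) (iob b k)"
    using f(2) f'(2) by (auto simp: is_internal_map_def)
  have "cmp A k (f' k) (f k) = idt A k (iob b k)"
    "cmp A k (f k) (f' k) = idt A k (iob (FOb sym a) k)"
    using j(3,4) unfolding f(1) f'(1) by (simp_all add: IO_def fun_eq_iff)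
  then show "\<exists>t. is_colimit (cat h k) (cat A k) (op_component (FOb (classify (Omega n) h u A) a) k) (iob (FOb sym a) k) t"
    using colimit_iso[OF col fk] by blast
qed

end
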